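(* Let $K$ be a field and $\mathcal{G}=(G^0,\mathcal{G}^1,r,s)$ an ultragraph. Let $\mathcal{E}_c(\mathcal{G})$ be the set of all exclusive cycles in $\mathcal{G}$, where cycles obtained from each other by (cyclically) permuting the vertices are considered equal. For a non-graded prime ideal $P$ of $L_K(\mathcal{G})$ with $\mathcal{H}=\{A\in\mathcal{G}^0\mid p_A\in P\}$, let $(c,f(x))$ consist of an exclusive cycle $c$ in $\mathcal{G}$ based at a vertex $v$ with $G^0\setminus\bigcup\mathcal{H}=M(v)$, and an irreducible polynomial $f(x)\in K[x,x^{-1}]$ such that $P$ is generated by $\{p_A\mid A\in\mathcal{H}\}\cup\{p_w^{\mathcal{H}}\mid w\in B_{\mathcal{H}}\}\cup\{f(s_c)\}$. Then the map $P\longmapsto(c,f(x))$ defines a bijection between the non-graded prime ideals of $L_K(\mathcal{G})$ and the set $\mathcal{E}_c(\mathcal{G})\times(\mathrm{Spec}(K[x,x^{-1}])\setminus\{0\})$, where $f(x)$ is identified with the nonzero prime ideal $(f(x))$ of $K[x,x^{-1}]$ that it generates.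
   Context: An ultragraph $\mathcal{G}=(G^0,\mathcal{G}^1,r,s)$ consists of a countable set $G^0$ of vertices, a countable set $\mathcal{G}^1$ of edges, and maps $s:\mathcal{G}^1\to G^0$, $r:\mathcal{G}^1\to\mathcal{P}(G^0)\setminus\{\varnothing\}$. A vertex $v$ is regular if $0<|s^{-1}(v)|<\infty$. $\mathcal{G}^0$ denotes the smallest subset of $\mathcal{P}(G^0)$ that contains $\{v\}$ for all $v\in G^0$, contains $r(e)$ for all $e\in\mathcal{G}^1$, and is closed under relative complements, finite unions and finite intersections. A finite path is either an element $A\in\mathcal{G}^0$ (of length $0$, with $s(A)=r(A)=A$) or a sequence $\alpha=\alpha_1\cdots\alpha_n$ of edges with $s(\alpha_{i+1})\in r(\alpha_i)$ for $1\le i\le n-1$ (of length $|\alpha|=n$, with $s(\alpha)=s(\alpha_1)$, $r(\alpha)=r(\alpha_n)$). $\mathcal{G}^*$ is the set of finite paths. A closed path (based at $v=s(\alpha)$) is a path $\alpha$ with $|\alpha|\ge1$ and $s(\alpha)\in r(\alpha)$; a cycle is a closed path with $s(\alpha_i)\ne s(\alpha_j)$ for all $i\ne j$. The vertices on $\alpha=\alpha_1\cdots\alpha_n$ are the $s(\alpha_i)$. A cycle $c$ is exclusive if no vertex on $c$ is the base of a cycle other than the cyclic permutations of $c$. For vertices $v,w$ write $v\ge w$ if there is a finite path $p$ with $s(p)=v$ and $w\in r(p)$ (length $0$ allowed, so $v\ge v$); $M(v):=\{w\in G^0\mid w\ge v\}$. For a field $K$, $L_K(\mathcal{G})$ is the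 (associative, not necessarily unital) $K$-algebra generated by $\{s_e,s_e^*\mid e\in\mathcal{G}^1\}\cup\{p_A\mid A\in\mathcal{G}^0\}$ subject to the relations, for all $A,B\in\mathcal{G}^0$, $e,f\in\mathcal{G}^1$: (1) $p_\varnothing=0$, $p_Ap_B=p_{A\cap B}$, $p_{A\cup B}=p_A+p_B-p_{A\cap B}$; (2) $p_{s(e)}s_e=s_e=s_ep_{r(e)}$ and $p_{r(e)}s_e^*=s_e^*=s_e^*p_{s(e)}$; (3) $s_e^*s_f=\delta_{e,f}p_{r(e)}$; (4) $p_v=\sum_{s(e)=v}s_es_e^*$ for every regular vertex $v$. Here $p_v:=p_{\{v\}}$; $s_A:=p_A=:s_A^*$ for $A\in\mathcal{G}^0$, and $s_\alpha:=s_{\alpha_1}\cdots s_{\alpha_n}$, $s_\alpha^*:=s_{\alpha_n}^*\cdots s_{\alpha_1}^*$. $L_K(\mathcal{G})$ is $\mathbb{Z}$-graded with degree-$n$ component $\mathrm{Span}_K\{s_\alpha p_As_\beta^*\mid\alpha,\beta\in\mathcal{G}^*,A\in\mathcal{G}^0,|\alpha|-|\beta|=n\}$; (non-)graded ideals are with respect to this grading. $\bigcup\mathcal{H}:=\bigcup_{A\in\mathcal{H}}A$. $B_{\mathcal{H}}:=\{v\in G^0\mid|s^{-1}(v)|=\infty\text{ and }0<|s^{-1}(v)\cap\{e\mid r(e)\notin\mathcal{H}\}|<\infty\}$, and for $v\in B_{\mathcal{H}}$, $p_v^{\mathcal{H}}:=p_v-\sum_{e\in s^{-1}(v),\,r(e)\notin\mathcal{H}}s_es_e^*$.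 For a cycle $c$ based at $v$ and $f(x)\in K[x,x^{-1}]$, $f(s_c)$ is obtained by substituting $x^0\mapsto p_v$, $x\mapsto s_c$, $x^{-1}\mapsto s_c^*$. $\mathrm{Spec}$ is the prime spectrum. *)

theory Defs
  imports
    "HOL-Library.Countable_Set"
    "HOL-Library.Poly_Mapping"
    "HOL-Algebra.QuotRing"
    "HOL-Algebra.Module"
    "HOL-Algebra.Algebraic_Closure_Type"
begin

section \<open>Ultragraphs\<close>

record ('v, 'e) ultragraph =
  verts :: "'v set"
  edges :: "'e set"
  src :: "'e \<Rightarrow> 'v"
  rng :: "'e \<Rightarrow> 'v set"

locale ultragraph =
  fixes G :: "('v, 'e) ultragraph"
  assumes countable_verts: "countable (verts G)"
    and countable_edges: "countable (edges G)"
    and src_in: "e \<in> edges G \<Longrightarrow> src G e \<in> verts G"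
    and rng_sub: "e \<in> edges G \<Longrightarrow> rng G e \<subseteq> verts G"
    and rng_nonempty: "e \<in> edges G \<Longrightarrow> rng G e \<noteq> {}"

definition out_edges :: "('v, 'e) ultragraph \<Rightarrow> 'v \<Rightarrow> 'e set" where
  "out_edges G v = {e \<in> edges G. src G e = v}"

definition regular :: "('v, 'e) ultragraph \<Rightarrow> 'v \<Rightarrow> bool" where
  "regular G v \<longleftrightarrow> v \<in> verts G \<and> finite (out_edges G v) \<and> out_edges G v \<noteq> {}"

text \<open>The family \<open>\<G>\<^sup>0\<close>. The rule \<open>empty\<close> is the empty finite union; it is redundant as soon as
  there is a vertex, since then the empty set is a relative complement.\<close>

inductive_set gsets :: "('v, 'e) ultragraph \<Rightarrow> 'v set set" for G where
  vertex: "v \<in> verts G \<Longrightarrow> {v} \<in> gsets G"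
| range: "e \<in> edges G \<Longrightarrow> rng G e \<in> gsets G"
| empty: "{} \<in> gsets G"
| diff: "A \<in> gsets G \<Longrightarrow> B \<in> gsets G \<Longrightarrow> A - B \<in> gsets G"
| union: "A \<in> gsets G \<Longrightarrow> B \<in> gsets G \<Longrightarrow> A \<union> B \<in> gsets G"
| inter: "A \<in> gsets G \<Longrightarrow> B \<in> gsets G \<Longrightarrow> A \<inter> B \<in> gsets G"

definition edge_path :: "('v, 'e) ultragraph \<Rightarrow> 'e list \<Rightarrow> bool" where
  "edge_path G es \<longleftrightarrow> es \<noteq> [] \<and> set es \<subseteq> edges G \<and>
     (\<forall>i. Suc i < length es \<longrightarrow> src G (es ! Suc i) \<in> rng G (es ! i))"

datatype ('v, 'e) upath = PSet "'v set" | PEdges "'e list"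

fun is_path :: "('v, 'e) ultragraph \<Rightarrow> ('v, 'e) upath \<Rightarrow> bool" where
  "is_path G (PSet A) \<longleftrightarrow> A \<in> gsets G"
| "is_path G (PEdges es) \<longleftrightarrow> edge_path G es"

fun plength :: "('v, 'e) upath \<Rightarrow> nat" where
  "plength (PSet A) = 0"
| "plength (PEdges es) = length es"

text \<open>The source of a path of length \<open>0\<close> is a set; a vertex \<open>v\<close> is identified with \<open>{v}\<close>, so that
  sources of all paths live in one type.\<close>

fun psrc :: "('v, 'e) ultragraph \<Rightarrow> ('v, 'e) upath \<Rightarrow> 'v set" where
  "psrc G (PSet A) = A"
| "psrc G (PEdges es) = {src G (hd es)}"

fun prng :: "('v, 'e) ultragraph \<Rightarrow> ('v, 'e) upath \<Rightarrow> 'v set" where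
  "prng G (PSet A) = A"
| "prng G (PEdges es) = rng G (last es)"

definition reaches :: "('v, 'e) ultragraph \<Rightarrow> 'v \<Rightarrow> 'v \<Rightarrow> bool" where
  "reaches G v w \<longleftrightarrow> (\<exists>p. is_path G p \<and> psrc G p = {v} \<and> w \<in> prng G p)"

definition M_set :: "('v, 'e) ultragraph \<Rightarrow> 'v \<Rightarrow> 'v set" where
  "M_set G v = {w \<in> verts G. reaches G w v}"

definition closed_path :: "('v, 'e) ultragraph \<Rightarrow> 'e list \<Rightarrow> bool" where
  "closed_path G es \<longleftrightarrow> edge_path G es \<and> src G (hd es) \<in> rng G (last es)"

definition cycle :: "('v, 'e) ultragraph \<Rightarrow> 'e list \<Rightarrow> bool" where
  "cycle G c \<longleftrightarrow> closed_path G c \<and> distinct (map (src G) c)"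

definition base :: "('v, 'e) ultragraph \<Rightarrow> 'e list \<Rightarrow> 'v" where
  "base G c = src G (hd c)"

definition exclusive_cycle :: "('v, 'e) ultragraph \<Rightarrow> 'e list \<Rightarrow> bool" where
  "exclusive_cycle G c \<longleftrightarrow> cycle G c \<and>
     (\<forall>d. cycle G d \<and> base G d \<in> src G ` set c \<longrightarrow> (\<exists>k. d = rotate k c))"

definition cycle_class :: "'e list \<Rightarrow> 'e list set" where
  "cycle_class c = {rotate k c | k. True}"

definition exclusive_cycle_classes :: "('v, 'e) ultragraph \<Rightarrow> 'e list set set" where
  "exclusive_cycle_classes G = {cycle_class c | c. exclusive_cycle G c}"


section \<open>Not necessarily unital algebras and their ideals\<close>

text \<open>A \<open>'k\<close>-algebra is a record of type \<open>('k, 'a) module\<close>. The algebras considered here need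
  not have a unit: the record field \<open>one\<close> carries no meaning and is not referred to below. The
  locale \<open>ideal\<close> presupposes a unital ring and is therefore not used for them. Ideals are required
  to be subspaces; in an algebra with local units, such as a Leavitt path algebra, this holds for
  every ring ideal.\<close>

definition alg_ideal :: "('k::field, 'a) module \<Rightarrow> 'a set \<Rightarrow> bool" where
  "alg_ideal A I \<longleftrightarrow> submodule I (ring_of_type_algebra :: 'k ring) A \<and>
     (\<forall>x\<in>carrier A. \<forall>a\<in>I. x \<otimes>\<^bsub>A\<^esub> a \<in> I \<and> a \<otimes>\<^bsub>A\<^esub> x \<in> I)"

definition alg_ideal_gen :: "('k::field, 'a) module \<Rightarrow> 'a set \<Rightarrow> 'a set" where
  "alg_ideal_gen A S = \<Inter>{I. alg_ideal A I \<and> S \<subseteq> I}"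

definition alg_prime_ideal :: "('k::field, 'a) module \<Rightarrow> 'a set \<Rightarrow> bool" where
  "alg_prime_ideal A P \<longleftrightarrow> alg_ideal A P \<and> P \<noteq> carrier A \<and>
     (\<forall>I J. alg_ideal A I \<and> alg_ideal A J \<and> (\<forall>a\<in>I. \<forall>b\<in>J. a \<otimes>\<^bsub>A\<^esub> b \<in> P)
        \<longrightarrow> I \<subseteq> P \<or> J \<subseteq> P)"

inductive_set alg_span :: "('k::field, 'a) module \<Rightarrow> 'a set \<Rightarrow> 'a set" for A S where
  zero: "\<zero>\<^bsub>A\<^esub> \<in> alg_span A S"
| add_smult: "x \<in> alg_span A S \<Longrightarrow> y \<in> S \<Longrightarrow> x \<oplus>\<^bsub>A\<^esub> (k \<odot>\<^bsub>A\<^esub> y) \<in> alg_span A S"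

definition alg_quotient :: "('k::field, 'a) module \<Rightarrow> 'a set \<Rightarrow> ('k, 'a set) module" where
  "alg_quotient A I =
     ring.extend (A Quot I) (module.fields (\<lambda>k B. \<Union>x\<in>B. I +>\<^bsub>A\<^esub> (k \<odot>\<^bsub>A\<^esub> x)))"

fun nprod :: "('a, 'b) ring_scheme \<Rightarrow> 'a list \<Rightarrow> 'a" where
  "nprod A [] = undefined"
| "nprod A [x] = x"
| "nprod A (x # y # xs) = x \<otimes>\<^bsub>A\<^esub> nprod A (y # xs)"


section \<open>The Leavitt path algebra of an ultragraph\<close>

datatype ('v, 'e) gen = GenP "'v set" | GenS 'e | GenStar 'e

definition gens :: "('v, 'e) ultragraph \<Rightarrow> ('v, 'e) gen set" where
  "gens G = GenP ` gsets G \<union> GenS ` edges G \<union> GenStar ` edges G"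

text \<open>Words under concatenation, written additively so that \<open>'g fword \<Rightarrow>\<^sub>0 'k\<close> is the free unital
  algebra. The free non-unital algebra consists of the combinations of nonempty words.\<close>

datatype 'g fword = FWord (letters: "'g list")

instantiation fword :: (type) monoid_add
begin

definition "0 = FWord []"

definition "u + w = FWord (letters u @ letters w)"

instance
  by standard (simp_all add: zero_fword_def plus_fword_def)

end

definition free_algebra :: "'g set \<Rightarrow> ('k::field, 'g fword \<Rightarrow>\<^sub>0 'k) module" where
  "free_algebra T =
     \<lparr>carrier = {f. \<forall>w\<in>Poly_Mapping.keys f. letters w \<noteq> [] \<and> set (letters w) \<subseteq> T},
      monoid.mult = (*), one = 1, ring.zero = 0, add = (+),
      module.smult = (\<lambda>k f. Poly_Mapping.single 0 k * f)\<rparr>"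

definition letter :: "'g \<Rightarrow> ('g fword \<Rightarrow>\<^sub>0 'k::field)" where
  "letter g = Poly_Mapping.single (FWord [g]) 1"

abbreviation "fp A \<equiv> letter (GenP A)"
abbreviation "fs e \<equiv> letter (GenS e)"
abbreviation "fstar e \<equiv> letter (GenStar e)"

text \<open>The element \<open>a - b\<close> stands for the defining relation \<open>a = b\<close>.\<close>

inductive_set relators :: "('v, 'e) ultragraph \<Rightarrow> (('v, 'e) gen fword \<Rightarrow>\<^sub>0 'k::field) set" for G where
  p_empty: "fp {} \<in> relators G"
| p_inter: "A \<in> gsets G \<Longrightarrow> B \<in> gsets G \<Longrightarrow> fp A * fp B - fp (A \<inter> B) \<in> relators G"
| p_union: "A \<in> gsets G \<Longrightarrow> B \<in> gsets G \<Longrightarrow>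
    fp (A \<union> B) - (fp A + fp B - fp (A \<inter> B)) \<in> relators G"
| src_s: "e \<in> edges G \<Longrightarrow> fp {src G e} * fs e - fs e \<in> relators G"
| s_rng: "e \<in> edges G \<Longrightarrow> fs e * fp (rng G e) - fs e \<in> relators G"
| rng_star: "e \<in> edges G \<Longrightarrow> fp (rng G e) * fstar e - fstar e \<in> relators G"
| star_src: "e \<in> edges G \<Longrightarrow> fstar e * fp {src G e} - fstar e \<in> relators G"
| star_s: "e \<in> edges G \<Longrightarrow> f \<in> edges G \<Longrightarrow>
    fstar e * fs f - (if e = f then fp (rng G e) else 0) \<in> relators G"
| cuntz_krieger: "regular G v \<Longrightarrow>
    fp {v} - (\<Sum>e\<in>out_edges G v. fs e * fstar e) \<in> relators G"

definition rel_ideal :: "('v, 'e) ultragraph \<Rightarrow> (('v, 'e) gen fword \<Rightarrow>\<^sub>0 'k::field) set" where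
  "rel_ideal G = alg_ideal_gen (free_algebra (gens G)) (relators G)"

type_synonym ('v, 'e, 'k) lpa = "(('v, 'e) gen fword \<Rightarrow>\<^sub>0 'k) set"

definition leavitt :: "('v, 'e) ultragraph \<Rightarrow> ('k::field, ('v, 'e, 'k) lpa) module" where
  "leavitt G = alg_quotient (free_algebra (gens G)) (rel_ideal G)"

definition lgen :: "('v, 'e) ultragraph \<Rightarrow> ('v, 'e) gen \<Rightarrow> ('v, 'e, 'k::field) lpa" where
  "lgen G g = rel_ideal G +>\<^bsub>(free_algebra (gens G) :: ('k, _) module)\<^esub> letter g"

abbreviation "lp G A \<equiv> lgen G (GenP A)"
abbreviation "ls G e \<equiv> lgen G (GenS e)"
abbreviation "lstar G e \<equiv> lgen G (GenStar e)"

fun s_path :: "('v, 'e) ultragraph \<Rightarrow> ('v, 'e) upath \<Rightarrow> ('v, 'e, 'k::field) lpa" where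
  "s_path G (PSet A) = lp G A"
| "s_path G (PEdges es) = nprod (leavitt G) (map (ls G) es)"

fun s_path_star :: "('v, 'e) ultragraph \<Rightarrow> ('v, 'e) upath \<Rightarrow> ('v, 'e, 'k::field) lpa" where
  "s_path_star G (PSet A) = lp G A"
| "s_path_star G (PEdges es) = nprod (leavitt G) (map (lstar G) (rev es))"

definition homogeneous :: "('v, 'e) ultragraph \<Rightarrow> int \<Rightarrow> ('v, 'e, 'k::field) lpa set" where
  "homogeneous G n = alg_span (leavitt G)
     {s_path G \<alpha> \<otimes>\<^bsub>leavitt G\<^esub> lp G A \<otimes>\<^bsub>leavitt G\<^esub> s_path_star G \<beta> | \<alpha> A \<beta>.
        is_path G \<alpha> \<and> is_path G \<beta> \<and> A \<in> gsets G \<and> int (plength \<alpha>) - int (plength \<beta>) = n}"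

text \<open>\<open>I\<close> is graded if it is the sum of the subspaces \<open>I \<inter> L\<^sub>n\<close>.\<close>

definition graded_ideal :: "('v, 'e) ultragraph \<Rightarrow> ('v, 'e, 'k::field) lpa set \<Rightarrow> bool" where
  "graded_ideal G I \<longleftrightarrow> alg_ideal (leavitt G) I \<and>
     (\<forall>x\<in>I. \<exists>N y. finite N \<and> (\<forall>n\<in>N. y n \<in> I \<inter> homogeneous G n) \<and>
        x = (\<Oplus>\<^bsub>leavitt G\<^esub>n\<in>N. y n))"

definition nongraded_primes :: "('v, 'e) ultragraph \<Rightarrow> ('v, 'e, 'k::field) lpa set set" where
  "nongraded_primes G = {P. alg_prime_ideal (leavitt G) P \<and> \<not> graded_ideal G P}"

definition H_of :: "('v, 'e) ultragraph \<Rightarrow> ('v, 'e, 'k::field) lpa set \<Rightarrow> 'v set set" where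
  "H_of G P = {A \<in> gsets G. lp G A \<in> P}"

definition breaking :: "('v, 'e) ultragraph \<Rightarrow> 'v set set \<Rightarrow> 'v set" where
  "breaking G H = {v \<in> verts G. infinite (out_edges G v) \<and>
     finite {e \<in> out_edges G v. rng G e \<notin> H} \<and> {e \<in> out_edges G v. rng G e \<notin> H} \<noteq> {}}"

definition lp_breaking ::
    "('v, 'e) ultragraph \<Rightarrow> 'v set set \<Rightarrow> 'v \<Rightarrow> ('v, 'e, 'k::field) lpa" where
  "lp_breaking G H v = lp G {v} \<ominus>\<^bsub>leavitt G\<^esub>
     (\<Oplus>\<^bsub>leavitt G\<^esub>e\<in>{e \<in> out_edges G v. rng G e \<notin> H}. ls G e \<otimes>\<^bsub>leavitt G\<^esub> lstar G e)"


section \<open>Laurent polynomials\<close>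

text \<open>\<open>K[x, x\<^sup>-\<^sup>1]\<close> is the group algebra of the integers: \<open>Poly_Mapping.lookup f i\<close> is the coefficient of \<open>x\<^sup>i\<close>.\<close>

type_synonym 'k laurent = "int \<Rightarrow>\<^sub>0 'k"

definition laurent_ring :: "'k::field laurent ring" where
  "laurent_ring = ring_of_type_algebra"

definition Spec :: "('a, 'b) ring_scheme \<Rightarrow> 'a set set" where
  "Spec R = {Q. primeideal Q R}"

text \<open>There is no unit to serve as an empty product, and \<open>p\<^sub>v\<close> is not a two-sided unit for \<open>s\<^sub>c\<close> and
  \<open>s\<^sub>c\<^sup>*\<close> when \<open>r(c) \<noteq> {v}\<close>; hence \<open>x\<^sup>0\<close> is treated separately.\<close>

definition cycle_power :: "('v, 'e) ultragraph \<Rightarrow> 'e list \<Rightarrow> int \<Rightarrow> ('v, 'e, 'k::field) lpa" where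
  "cycle_power G c i =
     (if i = 0 then lp G {base G c}
      else if i > 0 then nprod (leavitt G) (replicate (nat i) (s_path G (PEdges c)))
      else nprod (leavitt G) (replicate (nat (- i)) (s_path_star G (PEdges c))))"

definition laurent_at_cycle ::
    "('v, 'e) ultragraph \<Rightarrow> 'k::field laurent \<Rightarrow> 'e list \<Rightarrow> ('v, 'e, 'k) lpa" where
  "laurent_at_cycle G f c =
     (\<Oplus>\<^bsub>leavitt G\<^esub>i\<in>Poly_Mapping.keys f. Poly_Mapping.lookup f i \<odot>\<^bsub>leavitt G\<^esub> cycle_power G c i)"


section \<open>The data attached to a non-graded prime ideal\<close>

definition cycle_polynomial_of ::
    "('v, 'e) ultragraph \<Rightarrow> ('v, 'e, 'k::field) lpa set \<Rightarrow> 'e list \<Rightarrow> 'k laurent \<Rightarrow> bool" where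
  "cycle_polynomial_of G P c f \<longleftrightarrow>
     exclusive_cycle G c \<and>
     verts G - \<Union>(H_of G P) = M_set G (base G c) \<and>
     Factorial_Ring.irreducible f \<and>
     P = alg_ideal_gen (leavitt G)
           (lp G ` H_of G P \<union> lp_breaking G (H_of G P) ` breaking G (H_of G P)
            \<union> {laurent_at_cycle G f c})"

text \<open>The pair \<open>(c, f)\<close> with \<open>c\<close> up to cyclic permutation and \<open>f\<close> replaced by the ideal \<open>(f)\<close>.\<close>

definition pair_of ::
    "('v, 'e) ultragraph \<Rightarrow> ('v, 'e, 'k::field) lpa set \<Rightarrow> 'e list set \<times> 'k laurent set \<Rightarrow> bool" where
  "pair_of G P y \<longleftrightarrow>
     (\<exists>c f. cycle_polynomial_of G P c f \<and> y = (cycle_class c, PIdl\<^bsub>laurent_ring\<^esub> f))"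

end

theory Submission
  imports Defs "HOL-Computational_Algebra.Polynomial"
begin

text \<open>A non-graded ideal \<open>P\<close> contains a sum of homogeneous elements that are not all in \<open>P\<close>. The
  components of a shortest such sum behave alike under multiplication by homogeneous elements, and
  the Leavitt relations compress one of them to a projection \<open>p\<^sub>A\<close>, with another component of
  nonzero degree. Compressing further by a path surviving modulo \<open>P\<close> shows that the path is
  eventually periodic, which yields a cycle \<open>c\<close> whose only exits die in the quotient. If \<open>P\<close> is
  prime, \<open>c\<close> is exclusive and \<open>p\<^sub>A \<in> P\<close> exactly if \<open>A\<close> is disjoint from \<open>M(v)\<close>.

  The corner of the quotient at the base \<open>v\<close> of \<open>c\<close> consists of Laurent polynomials in \<open>s\<^sub>c\<close>, and
  an ideal with these data is determined by its intersection with the corner, the prime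
  ideal \<open>(f)\<close>. This intersection does not change under rotation of \<open>c\<close>, and the cycle is
  recovered from \<open>M(v)\<close> up to rotation.

  Conversely, for an exclusive cycle \<open>c\<close> and a prime ideal \<open>Q\<close> of Laurent polynomials, the algebra acts
  on functions on the infinite paths with tail \<open>c\<^sup>\<infinity>\<close>, where \<open>c\<close> acts as multiplication by \<open>x\<close>;
  the elements all of whose matrix entries lie in \<open>Q\<close> form the required prime ideal. Since \<open>c\<^sup>\<infinity>\<close> is the only
  such path from \<open>v\<close>, the elements \<open>s\<^sub>\<alpha> p\<^sub>v s\<^sub>\<beta>\<^sup>*\<close> isolate matrix entries, which gives primeness.\<close>

text \<open>Two obstacles shape the calculus. The algebra has no unit, so computations take place in
  a unital ring modulo the preimage of the ideal; there \<open>gap E\<close>, the complement of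
  finitely many range projections, makes sense. And \<open>p A\<close> for infinite \<open>A\<close>
  is no sum of vertex projections, so sets are cut into pieces on which finitely many given sets are
  constant (\<open>gset_refine\<close>).

  Compression to a projection can also stop at an idempotent that is annihilated by all edges. Such
  an idempotent kills every component of nonzero degree, hence, for components that live and die
  together, every component. The same argument provides the live exits of a set and the
  Cuntz-Krieger relation on the cycle, even at infinite emitters.

  That the corner determines the ideal is proved without grading and without primeness, from the
  dead sets and the Cuntz-Krieger relations in \<open>M\<close> alone; so it applies to the ideal
  spanned by the expected generators.

  In the representation only the first edge of \<open>c\<close> carries the variable, so every full
  turn contributes one factor \<open>x\<close> wherever it starts.\<close>

fun walk :: "('v, 'e) ultragraph \<Rightarrow> 'v \<Rightarrow> 'e list \<Rightarrow> 'v \<Rightarrow> bool" where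
  "walk G u [] w \<longleftrightarrow> u = w"
| "walk G u (e # es) w \<longleftrightarrow> e \<in> edges G \<and> src G e = u \<and> (\<exists>x\<in>rng G e. walk G x es w)"

lemma walk_append: "walk G u (xs @ ys) w \<longleftrightarrow> (\<exists>x. walk G u xs x \<and> walk G x ys w)"
  by (induction xs arbitrary: u) auto

lemma edge_path_Cons:
  "edge_path G (e # es) \<longleftrightarrow>
     e \<in> edges G \<and> (es = [] \<or> src G (hd es) \<in> rng G e \<and> edge_path G es)"
proof (cases es)
  case (Cons f fs)
  have "(\<forall>i. Suc i < length (e # es) \<longrightarrow> src G ((e # es) ! Suc i) \<in> rng G ((e # es) ! i)) \<longleftrightarrow>
    src G f \<in> rng G e \<and> (\<forall>i. Suc i < length es \<longrightarrow> src G (es ! Suc i) \<in> rng G (es ! i))"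
    unfolding Cons by (auto simp: nth_Cons less_Suc_eq_0_disj split: nat.splits)
  then show ?thesis
    unfolding edge_path_def using Cons by auto
qed (auto simp: edge_path_def)

text \<open>A path ends in a whole set of vertices, a walk at one chosen vertex of that set; this
  choice is what makes walks compose.\<close>

lemma walk_iff_edge_path:
  "es \<noteq> [] \<Longrightarrow> walk G u es w \<longleftrightarrow> edge_path G es \<and> src G (hd es) = u \<and> w \<in> rng G (last es)"
proof (induction es arbitrary: u)
  case (Cons e es)
  then show ?case
    by (cases "es = []") (auto simp: edge_path_Cons)
qed simp

lemma walk_edges: "walk G u es w \<Longrightarrow> set es \<subseteq> edges G"
  by (induction es arbitrary: u) auto

lemma walk_nthD: "walk G u es w \<Longrightarrow> i < length es \<Longrightarrow> walk G u (take i es) (src G (es ! i))"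
proof (induction es arbitrary: u i)
  case (Cons e es)
  show ?case
  proof (cases i)
    case (Suc j)
    then show ?thesis using Cons by auto
  qed (use Cons in auto)
qed simp

lemma walk_drop: "walk G u es w \<Longrightarrow> i < length es \<Longrightarrow> walk G (src G (es ! i)) (drop i es) w"
proof (induction es arbitrary: u i)
  case (Cons e es)
  show ?case
  proof (cases i)
    case (Suc j)
    then show ?thesis using Cons by auto
  qed (use Cons in auto)
qed simp

text \<open>The empty walk at \<open>v\<close> corresponds to the path \<open>{v}\<close> of length
  \<open>0\<close>; the hypothesis makes \<open>{v}\<close> a member of
  \<open>gsets G\<close>.\<close>

lemma reaches_iff_walk:
  assumes "v \<in> verts G"
  shows "reaches G v w \<longleftrightarrow> (\<exists>es. walk G v es w)"
proof
  assume "reaches G v w"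
  then obtain q where q: "is_path G q" "psrc G q = {v}" "w \<in> prng G q"
    unfolding reaches_def by blast
  show "\<exists>es. walk G v es w"
  proof (cases q)
    case (PSet A)
    then have "walk G v [] w" using q by simp
    then show ?thesis by blast
  next
    case (PEdges es)
    then have "walk G v es w"
      using q by (subst walk_iff_edge_path) (auto simp: edge_path_def)
    then show ?thesis by blast
  qed
next
  assume "\<exists>es. walk G v es w"
  then obtain es where es: "walk G v es w" by blast
  show "reaches G v w"
  proof (cases "es = []")
    case True
    then have "is_path G (PSet {v})" "psrc G (PSet {v}) = {v}" "w \<in> prng G (PSet {v})"
      using es assms by (auto intro: gsets.vertex)
    then show ?thesis unfolding reaches_def by blast
  next
    case False
    then have "is_path G (PEdges es)" "psrc G (PEdges es) = {v}" "w \<in> prng G (PEdges es)"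
      using es by (auto simp: walk_iff_edge_path)
    then show ?thesis unfolding reaches_def by blast
  qed
qed

lemma M_set_iff_walk: "w \<in> M_set G v \<longleftrightarrow> w \<in> verts G \<and> (\<exists>es. walk G w es v)"
  unfolding M_set_def using reaches_iff_walk[of w G v] by auto

section \<open>Cycles\<close>

locale cycle_graph = ultragraph G for G :: "('v, 'e) ultragraph" +
  fixes c :: "'e list"
  assumes is_cycle: "cycle G c"
begin

abbreviation "m \<equiv> length c"

text \<open>Indices are read modulo the length, so that inductions along the cycle never have to
  treat the passage from the last edge to the first.\<close>

definition edg :: "nat \<Rightarrow> 'e" where "edg t = c ! (t mod m)"

definition vx :: "nat \<Rightarrow> 'v" where "vx t = src G (edg t)"

definition seg :: "nat \<Rightarrow> nat \<Rightarrow> 'e list" where "seg t n = map edg [t..<t + n]"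

definition M :: "'v set" where "M = M_set G (base G c)"

lemma c_nonempty: "c \<noteq> []" and m_pos: "m > 0"
  using is_cycle by (auto simp: cycle_def closed_path_def edge_path_def)

lemma edg_in: "edg t \<in> edges G"
proof -
  have "set c \<subseteq> edges G" using is_cycle by (auto simp: cycle_def closed_path_def edge_path_def)
  then show ?thesis unfolding edg_def using m_pos by (meson mod_less_divisor nth_mem subsetD)
qed

lemma src_edg: "src G (edg t) = vx t"
  by (simp add: vx_def)

lemma vx_in: "vx t \<in> verts G"
  using edg_in src_in by (simp add: vx_def)

lemma edg_mod [simp]: "edg (t mod m) = edg t" and vx_mod [simp]: "vx (t mod m) = vx t"
  by (simp_all add: edg_def vx_def)

lemma edg_period [simp]: "edg (t + m) = edg t" "edg (m + t) = edg t"
  and vx_period [simp]: "vx (t + m) = vx t" "vx (m + t) = vx t"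
  by (simp_all add: edg_def vx_def)

lemma vx_eq_iff: "vx t = vx t' \<longleftrightarrow> t mod m = t' mod m"
proof
  assume "vx t = vx t'"
  then have "map (src G) c ! (t mod m) = map (src G) c ! (t' mod m)"
    using m_pos by (simp add: vx_def edg_def)
  then show "t mod m = t' mod m"
    using is_cycle m_pos nth_eq_iff_index_eq[of "map (src G) c" "t mod m" "t' mod m"]
    by (simp add: cycle_def)
qed (metis vx_mod)

lemma edg_eq: "vx t = vx t' \<Longrightarrow> edg t = edg t'"
  by (metis vx_eq_iff edg_mod)

lemma vx_Suc_eq: "vx t = vx t' \<Longrightarrow> vx (Suc t) = vx (Suc t')"
  by (metis vx_eq_iff mod_Suc_eq)

lemma vx_add_eq: "vx t = vx t' \<Longrightarrow> vx (t + k) = vx (t' + k)"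
  by (metis vx_eq_iff mod_add_left_eq)

lemma base_eq: "base G c = vx 0"
  using c_nonempty by (simp add: base_def vx_def edg_def hd_conv_nth)

lemma vx_Suc_in_rng: "vx (Suc t) \<in> rng G (edg t)"
proof (cases "Suc (t mod m) < m")
  case True
  then have "src G (c ! Suc (t mod m)) \<in> rng G (c ! (t mod m))"
    using is_cycle by (auto simp: cycle_def closed_path_def edge_path_def)
  then show ?thesis using True by (simp add: vx_def edg_def mod_Suc)
next
  case False
  then have t: "Suc (t mod m) = m" using m_pos by (meson mod_less_divisor not_less_eq less_antisym)
  then have "t mod m = m - 1" by simp
  then have "vx (Suc t) = src G (hd c)" "edg t = last c"
    using c_nonempty by (simp_all add: vx_def edg_def mod_Suc hd_conv_nth last_conv_nth)
  then show ?thesis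
    using is_cycle by (auto simp: cycle_def closed_path_def)
qed

lemma seg_0 [simp]: "seg t 0 = []" by (simp add: seg_def)

lemma seg_Suc: "seg t (Suc n) = edg t # seg (Suc t) n"
  unfolding seg_def by (simp add: upt_conv_Cons del: upt_Suc)

lemma seg_Suc_right: "seg t (Suc n) = seg t n @ [edg (t + n)]"
  unfolding seg_def by simp

lemma length_seg [simp]: "length (seg t n) = n" by (simp add: seg_def)

lemma seg_nth: "i < n \<Longrightarrow> seg t n ! i = edg (t + i)" by (simp add: seg_def)

lemma seg_append: "seg t (n + k) = seg t n @ seg (t + n) k"
  by (induction k) (simp_all add: seg_Suc_right add.assoc)

lemma set_seg: "set (seg t n) \<subseteq> edges G"
  using edg_in by (auto simp: seg_def)

lemma seg_mod: "seg (t mod m) n = seg t n"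
  by (rule nth_equalityI) (auto simp: seg_nth edg_def mod_add_left_eq)

lemma seg_c: "seg 0 m = c"
  by (rule nth_equalityI) (auto simp: seg_nth edg_def)

lemma seg_m: "seg t m = rotate t c"
  by (rule nth_equalityI) (auto simp: seg_nth edg_def nth_rotate)

lemma walk_seg: "walk G (vx t) (seg t n) (vx (t + n))"
proof (induction n arbitrary: t)
  case (Suc n)
  then show ?case
    using edg_in vx_Suc_in_rng[of t] Suc[of "Suc t"] by (auto simp: seg_Suc src_edg)
qed simp

lemma vx_range: "src G ` set c = range vx"
proof
  show "src G ` set c \<subseteq> range vx"
  proof
    fix x assume "x \<in> src G ` set c"
    then obtain i where "i < m" "x = src G (c ! i)" by (auto simp: in_set_conv_nth)
    then have "x = vx i" by (simp add: vx_def edg_def)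
    then show "x \<in> range vx" by blast
  qed
  show "range vx \<subseteq> src G ` set c"
    using m_pos by (auto simp: vx_def edg_def)
qed

lemma reach_vx: "\<exists>k. vx (t + k) = vx t'"
proof
  \<comment> \<open>The multiple \<open>m * t\<close> keeps the subtraction of \<open>t\<close> from
    truncating and changes nothing modulo \<open>m\<close>.\<close>
  have "t \<le> m * t" using m_pos by (cases m) auto
  then have "t + (t' + m * t - t) = t' + m * t" by linarith
  then have "(t + (t' + m * t - t)) mod m = t' mod m" by simp
  then show "vx (t + (t' + m * t - t)) = vx t'" by (simp add: vx_eq_iff)
qed

lemma vx_in_M: "vx t \<in> M"
proof -
  obtain k where "vx (t + k) = vx 0" using reach_vx by blast
  then have w: "walk G (vx t) (seg t k) (vx 0)" using walk_seg[of t k] by simp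
  show ?thesis
    unfolding M_def M_set_iff_walk base_eq by (intro conjI exI) (rule vx_in, rule w)
qed

lemma M_verts: "M \<subseteq> verts G"
  by (auto simp: M_def M_set_iff_walk)

text \<open>The vertices of the cycle reach each other, so any of them can replace the base.\<close>

lemma M_iff: "w \<in> M \<longleftrightarrow> w \<in> verts G \<and> (\<exists>es. walk G w es (vx t))"
proof -
  obtain k where k: "vx (t + k) = vx 0" using reach_vx by blast
  have w1: "walk G (vx t) (seg t k) (vx 0)" using walk_seg[of t k] k by simp
  obtain l where l: "vx (0 + l) = vx t" using reach_vx by blast
  have w2: "walk G (vx 0) (seg 0 l) (vx t)" using walk_seg[of 0 l] l by simp
  show ?thesis
    unfolding M_def M_set_iff_walk base_eq using w1 w2 by (meson walk_append)
qed

lemma walk_into_M: "walk G w es x \<Longrightarrow> x \<in> M \<Longrightarrow> w \<in> verts G \<Longrightarrow> w \<in> M"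
  by (meson M_iff[of _ 0] walk_append)

lemma src_in_M: "e \<in> edges G \<Longrightarrow> x \<in> rng G e \<Longrightarrow> x \<in> M \<Longrightarrow> src G e \<in> M"
  by (rule walk_into_M[of _ "[e]"]) (auto intro: src_in)

lemma M_edge: "w \<in> M \<Longrightarrow> \<exists>e\<in>edges G. src G e = w \<and> (\<exists>x\<in>rng G e. x \<in> M)"
proof -
  assume w: "w \<in> M"
  obtain es where es: "walk G w es (vx 0)" using w M_iff by blast
  show ?thesis
  proof (cases es)
    case Nil
    then show ?thesis using es edg_in vx_Suc_in_rng vx_in_M by (metis walk.simps(1) src_edg)
  next
    case (Cons e fs)
    then obtain x where x: "e \<in> edges G" "src G e = w" "x \<in> rng G e" "walk G x fs (vx 0)"
      using es by auto
    then have "x \<in> M" using M_iff rng_sub by blast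
    then show ?thesis using x by blast
  qed
qed

text \<open>Cut the walk at its first visit to the cycle. That no source lies on the cycle will
  distinguish such a path from a segment of the cycle.\<close>

lemma walk_to_cycle:
  assumes "walk G w es x" "x \<in> range vx" "w \<notin> range vx"
  shows "\<exists>\<mu> t. \<mu> \<noteq> [] \<and> walk G w \<mu> (vx t) \<and> src G ` set \<mu> \<inter> range vx = {}"
  using assms
proof (induction es arbitrary: w)
  case (Cons e es)
  then obtain y where y: "e \<in> edges G" "src G e = w" "y \<in> rng G e" "walk G y es x" by auto
  show ?case
  proof (cases "y \<in> range vx")
    case True
    then obtain t where "y = vx t" by blast
    then have "walk G w [e] (vx t)" using y by auto
    then show ?thesis using y Cons.prems by (intro exI[of _ "[e]"]) auto
  next
    case False
    then obtain \<mu> t where "\<mu> \<noteq> []" "walk G y \<mu> (vx t)" "src G ` set \<mu> \<inter> range vx = {}"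
      using Cons.IH y Cons.prems by blast
    then show ?thesis
      using y Cons.prems by (intro exI[of _ "e # \<mu>"] exI[of _ t]) auto
  qed
qed auto

lemma edge_to_cycle:
  assumes "e \<in> edges G" "x \<in> rng G e" "x \<in> M" "src G e \<notin> range vx"
  shows "\<exists>\<mu> t. walk G (src G e) (e # \<mu>) (vx t) \<and> src G ` set (e # \<mu>) \<inter> range vx = {}"
proof (cases "x \<in> range vx")
  case True
  then obtain t where "x = vx t" by blast
  then have "walk G (src G e) (e # []) (vx t)" using assms by auto
  then show ?thesis using assms by (intro exI[of _ "[]"]) auto
next
  case False
  obtain es where "walk G x es (vx 0)" using assms M_iff by blast
  then obtain \<mu> t where "\<mu> \<noteq> []" "walk G x \<mu> (vx t)" "src G ` set \<mu> \<inter> range vx = {}"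
    using walk_to_cycle False by blast
  then show ?thesis
    using assms by (intro exI[of _ \<mu>] exI[of _ t]) auto
qed

end

text \<open>In a walk of minimal length a repeated source, or a source equal to the target, would
  allow a shortcut.\<close>

lemma shortest_walk:
  assumes "walk G w es u"
  obtains \<pi> where "walk G w \<pi> u" "distinct (map (src G) \<pi>)" "u \<notin> src G ` set \<pi>"
proof -
  define \<pi> where "\<pi> = arg_min length (\<lambda>es. walk G w es u)"
  have w: "walk G w \<pi> u" unfolding \<pi>_def by (rule arg_min_natI[of _ es]) (rule assms)
  have min: "length \<pi> \<le> length fs" if "walk G w fs u" for fs
    unfolding \<pi>_def using that by (rule arg_min_nat_le)
  have "u \<notin> src G ` set \<pi>"
  proof
    assume "u \<in> src G ` set \<pi>"
    then obtain i where i: "i < length \<pi>" "src G (\<pi> ! i) = u" by (auto simp: in_set_conv_nth)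
    then have "walk G w (take i \<pi>) u" using walk_nthD[OF w] by auto
    then show False using min i by fastforce
  qed
  moreover have "src G (\<pi> ! i) \<noteq> src G (\<pi> ! j)" if "i < j" "j < length \<pi>" for i j
  proof
    assume eq: "src G (\<pi> ! i) = src G (\<pi> ! j)"
    have "walk G w (take i \<pi> @ drop j \<pi>) u"
      unfolding walk_append using walk_nthD[OF w, of i] walk_drop[OF w, of j] that eq by auto
    then show False using min that by fastforce
  qed
  then have "distinct (map (src G) \<pi>)"
    by (auto simp: distinct_conv_nth) (metis linorder_neqE_nat)
  ultimately show thesis using w that by blast
qed

locale exclusive_cycle_graph = cycle_graph +
  assumes exclusive: "exclusive_cycle G c"
begin

text \<open>A shortest walk from \<open>x\<close> back to \<open>vx t\<close> closes
  \<open>e\<close> up to a cycle based on a vertex of \<open>c\<close>, which by exclusivity is a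
  rotation of \<open>c\<close>. This pins down the vertex \<open>x\<close> as well as the
  edge.\<close>

lemma unique_return:
  assumes e: "e \<in> edges G" "src G e = vx t" and x: "x \<in> rng G e" "x \<in> M"
  shows "e = edg t \<and> x = vx (Suc t)"
proof -
  obtain es where "walk G x es (vx t)" using x M_iff by blast
  then obtain \<pi> where \<pi>: "walk G x \<pi> (vx t)" "distinct (map (src G) \<pi>)" "vx t \<notin> src G ` set \<pi>"
    using shortest_walk by metis
  let ?d = "e # \<pi>"
  have "walk G (vx t) ?d (vx t)" using e x \<pi> by auto
  then have "cycle G ?d"
    using \<pi> e unfolding cycle_def closed_path_def by (auto simp: walk_iff_edge_path edge_path_Cons)
  moreover have "base G ?d = vx t" using e by (simp add: base_def)
  ultimately obtain k where k: "?d = rotate k c"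
    using exclusive vx_range unfolding exclusive_cycle_def by (metis rangeI)
  then have d: "?d = seg k m" by (simp add: seg_m)
  then have ek: "e = edg k" "\<pi> = seg (Suc k) (m - 1)"
    using m_pos by (cases m; auto simp: seg_Suc)+
  then have tk: "vx t = vx k" using e by (simp add: src_edg)
  \<comment> \<open>If \<open>c\<close> is a loop, \<open>\<pi>\<close> is empty and
    \<open>x\<close> is read off from its endpoint; otherwise \<open>x\<close> is the source of the
    first edge of \<open>\<pi>\<close>.\<close>
  have "x = vx (Suc k)"
  proof (cases "m = 1")
    case True
    then have "x = vx t" using \<pi> ek by simp
    then show ?thesis using True by (simp add: vx_eq_iff)
  next
    case False
    then have "m - 1 \<noteq> 0" using m_pos by linarith
    then obtain l where "m - 1 = Suc l" using not0_implies_Suc by blast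
    then show ?thesis using \<pi> ek by (auto simp: seg_Suc src_edg)
  qed
  then show ?thesis using ek tk edg_eq vx_Suc_eq by metis
qed

lemma walk_on_cycle:
  assumes "walk G (vx t) es x" "x \<in> M"
  shows "es = seg t (length es) \<and> x = vx (t + length es)"
  using assms
proof (induction es arbitrary: t)
  case (Cons e es)
  then obtain y where y: "e \<in> edges G" "src G e = vx t" "y \<in> rng G e" "walk G y es x" by auto
  then have "y \<in> M" using Cons.prems walk_into_M rng_sub by blast
  then have "e = edg t" "y = vx (Suc t)" using unique_return y by auto
  then have es: "es = seg (Suc t) (length es)" and x: "x = vx (Suc t + length es)"
    using Cons.IH[of "Suc t"] y Cons.prems by blast+
  have e_es: "e # es = seg t (length (e # es))"
    unfolding length_Cons seg_Suc by (rule arg_cong2[where f = Cons, OF \<open>e = edg t\<close> es])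
  have "x = vx (t + length (e # es))" using x by simp
  with e_es show ?case by (rule conjI)
qed simp

text \<open>Inside \<open>M\<close> the cycle behaves as in an ordinary graph:
  \<open>rng G (edg t)\<close> may be infinite, but only the next vertex of the cycle leads
  back.\<close>

lemma rng_Int_M: "rng G (edg t) \<inter> M = {vx (Suc t)}"
  using unique_return[OF edg_in src_edg] vx_in_M vx_Suc_in_rng by auto

end

section \<open>Cycles up to rotation\<close>

lemma cycle_class_rotate: "cycle_class (rotate k c) = cycle_class c"
proof (cases "c = []")
  case False
  \<comment> \<open>Rotating further by \<open>length c * k - k\<close> undoes the rotation by
    \<open>k\<close>.\<close>
  have *: "rotate j c = rotate (j + length c * k - k) (rotate k c)" for j
  proof -
    have "k \<le> length c * k" using False by (cases "length c") auto
    then have "j + length c * k - k + k = j + length c * k" by linarith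
    moreover have "rotate (j + length c * k) c = rotate j c"
      by (metis rotate_conv_mod mod_mult_self2)
    ultimately show ?thesis by (simp add: rotate_rotate)
  qed
  show ?thesis
  proof
    show "cycle_class c \<subseteq> cycle_class (rotate k c)"
      unfolding cycle_class_def using * by blast
    show "cycle_class (rotate k c) \<subseteq> cycle_class c"
      unfolding cycle_class_def by (auto simp: rotate_rotate)
  qed
qed (simp add: cycle_class_def)

text \<open>The base of \<open>c\<close> reaches the base of \<open>d\<close>, and the latter lies
  in \<open>M\<close> of \<open>c\<close>. Such a walk cannot leave \<open>c\<close>, so
  \<open>d\<close> starts on \<open>c\<close> and exclusivity applies.\<close>

lemma exclusive_same_M_set:
  assumes G: "ultragraph G" and c: "exclusive_cycle G c" and d: "exclusive_cycle G d"
    and M: "M_set G (base G c) = M_set G (base G d)"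
  obtains k where "d = rotate k c"
proof -
  interpret C: exclusive_cycle_graph G c
    using G c by unfold_locales (auto simp: exclusive_cycle_def ultragraph_def)
  interpret D: exclusive_cycle_graph G d
    using G d by unfold_locales (auto simp: exclusive_cycle_def ultragraph_def)
  have "D.vx 0 \<in> C.M" using D.vx_in_M M by (simp add: C.M_def D.M_def)
  moreover have "C.vx 0 \<in> D.M" using C.vx_in_M M by (simp add: C.M_def D.M_def)
  then obtain es where "walk G (C.vx 0) es (D.vx 0)" using D.M_iff by blast
  ultimately have "D.vx 0 \<in> range C.vx" using C.walk_on_cycle by blast
  then have "\<exists>k. d = rotate k c"
    using c D.is_cycle D.base_eq C.vx_range by (metis exclusive_cycle_def)
  then show thesis using that by blast
qed

text \<open>Absorbs one more term into a sum grouped by an index, whether or not the index already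
  occurs. Outside \<open>E\<close> the old value counts as \<open>0\<close>, because
  \<open>y\<close> is arbitrary there.\<close>

lemma sum_fun_upd_add:
  fixes h :: "'b \<Rightarrow> 'c::ab_group_add \<Rightarrow> 'd::ab_group_add"
  assumes "finite E" "\<And>e x y. h e (x + y) = h e x + h e y"
  shows "\<exists>y'. (\<forall>f. y' f = (if f = e then (if e \<in> E then y e else 0) + z else y f)) \<and>
    (\<Sum>f\<in>insert e E. h f (y' f)) = (\<Sum>f\<in>E. h f (y f)) + h e z"
proof -
  let ?y = "\<lambda>f. if f = e then (if e \<in> E then y e else 0) + z else y f"
  have h0: "h e 0 = 0" using assms(2)[of e 0 0] by simp
  have *: "(\<Sum>f\<in>E - {e}. h f (?y f)) = (\<Sum>f\<in>E - {e}. h f (y f))"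
    by (rule sum.cong) auto
  have "(\<Sum>f\<in>insert e E. h f (?y f)) = h e (?y e) + (\<Sum>f\<in>E - {e}. h f (?y f))"
    using assms(1) by (rule sum.insert_remove)
  also have "\<dots> = h e (if e \<in> E then y e else 0) + (\<Sum>f\<in>E - {e}. h f (y f)) + h e z"
    unfolding * using assms(2) by (simp add: algebra_simps)
  also have "h e (if e \<in> E then y e else 0) + (\<Sum>f\<in>E - {e}. h f (y f)) = (\<Sum>f\<in>E. h f (y f))"
    using assms(1) h0 by (cases "e \<in> E") (simp_all add: sum.remove)
  finally show ?thesis by (intro exI[of _ ?y]) simp
qed

section \<open>Ideals containing the Leavitt relations\<close>

text \<open>All computations take place in a unital ring \<open>'a\<close>, in the application the free unital
  algebra, modulo an ideal \<open>P\<close> containing the defining relations.\<close>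

locale leavitt_ideal = ultragraph G for G :: "('v, 'e) ultragraph" +
  fixes K :: "'k::field \<Rightarrow> 'a::ring_1" and p :: "'v set \<Rightarrow> 'a" and s t :: "'e \<Rightarrow> 'a"
    and P :: "'a set"
  assumes P_zero: "0 \<in> P"
    and P_add: "x \<in> P \<Longrightarrow> y \<in> P \<Longrightarrow> x + y \<in> P"
    and P_left: "x \<in> P \<Longrightarrow> a * x \<in> P"
    and P_right: "x \<in> P \<Longrightarrow> x * a \<in> P"
    and K_add: "K (k + l) = K k + K l"
    and K_mult: "K (k * l) = K k * K l"
    and K_one: "K 1 = 1"
    and K_commute: "K k * x = x * K k"
    and rel_empty: "p {} \<in> P"
    and rel_inter: "A \<in> gsets G \<Longrightarrow> B \<in> gsets G \<Longrightarrow> p A * p B - p (A \<inter> B) \<in> P"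
    and rel_union: "A \<in> gsets G \<Longrightarrow> B \<in> gsets G \<Longrightarrow>
      p (A \<union> B) - (p A + p B - p (A \<inter> B)) \<in> P"
    and rel_src_s: "e \<in> edges G \<Longrightarrow> p {src G e} * s e - s e \<in> P"
    and rel_s_rng: "e \<in> edges G \<Longrightarrow> s e * p (rng G e) - s e \<in> P"
    and rel_rng_t: "e \<in> edges G \<Longrightarrow> p (rng G e) * t e - t e \<in> P"
    and rel_t_src: "e \<in> edges G \<Longrightarrow> t e * p {src G e} - t e \<in> P"
    and rel_t_s: "e \<in> edges G \<Longrightarrow> f \<in> edges G \<Longrightarrow>
      t e * s f - (if e = f then p (rng G e) else 0) \<in> P"
    and rel_ck: "regular G v \<Longrightarrow> p {v} - (\<Sum>e\<in>out_edges G v. s e * t e) \<in> P"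
begin

definition cg :: "'a \<Rightarrow> 'a \<Rightarrow> bool" (infix \<open>\<approx>\<close> 50) where "x \<approx> y \<longleftrightarrow> x - y \<in> P"

lemma P_uminus: "x \<in> P \<Longrightarrow> - x \<in> P"
  using P_left[of x "-1"] by simp

lemma P_diff: "x \<in> P \<Longrightarrow> y \<in> P \<Longrightarrow> x - y \<in> P"
  using P_add[of x "- y"] P_uminus by simp

lemma P_sum: "(\<And>i. i \<in> I \<Longrightarrow> f i \<in> P) \<Longrightarrow> sum f I \<in> P"
  by (induction I rule: infinite_finite_induct) (auto intro: P_zero P_add)

lemma cg_refl [simp, intro!]: "x \<approx> x"
  by (simp add: cg_def P_zero)

lemma cg_sym: "x \<approx> y \<Longrightarrow> y \<approx> x"
  unfolding cg_def using P_uminus[of "x - y"] by simp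

lemma cg_trans [trans]: "x \<approx> y \<Longrightarrow> y \<approx> z \<Longrightarrow> x \<approx> z"
  unfolding cg_def using P_add[of "x - y" "y - z"] by simp

lemma cg_eq_trans [trans]: "x \<approx> y \<Longrightarrow> y = z \<Longrightarrow> x \<approx> z"
  and eq_cg_trans [trans]: "x = y \<Longrightarrow> y \<approx> z \<Longrightarrow> x \<approx> z"
  by simp_all

lemma cg_add: "x \<approx> y \<Longrightarrow> x' \<approx> y' \<Longrightarrow> x + x' \<approx> y + y'"
  unfolding cg_def using P_add[of "x - y" "x' - y'"] by (simp add: algebra_simps)

lemma cg_diff: "x \<approx> y \<Longrightarrow> x' \<approx> y' \<Longrightarrow> x - x' \<approx> y - y'"
  unfolding cg_def using P_diff[of "x - y" "x' - y'"] by (simp add: algebra_simps)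

lemma cg_left: "x \<approx> y \<Longrightarrow> a * x \<approx> a * y"
  unfolding cg_def using P_left[of "x - y" a] by (simp add: algebra_simps)

lemma cg_right: "x \<approx> y \<Longrightarrow> x * a \<approx> y * a"
  unfolding cg_def using P_right[of "x - y" a] by (simp add: algebra_simps)

lemma cg_mult: "x \<approx> y \<Longrightarrow> x' \<approx> y' \<Longrightarrow> x * x' \<approx> y * y'"
  using cg_left cg_right cg_trans by meson

lemma cg_sum: "(\<And>i. i \<in> I \<Longrightarrow> f i \<approx> g i) \<Longrightarrow> sum f I \<approx> sum g I"
  unfolding cg_def sum_subtractf[symmetric] by (rule P_sum)

lemma P_iff_cg: "x \<in> P \<longleftrightarrow> x \<approx> 0"
  by (simp add: cg_def)

lemma cg_P: "x \<approx> y \<Longrightarrow> x \<in> P \<longleftrightarrow> y \<in> P"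
  unfolding P_iff_cg using cg_sym cg_trans by blast

lemma K_zero: "K 0 = 0"
  using K_add[of 0 0] by simp

lemma K_uminus: "K (- k) = - K k"
  using K_add[of k "- k"] K_zero by (simp add: add_eq_0_iff)

lemma K_cancel: "k \<noteq> 0 \<Longrightarrow> K k * x \<in> P \<Longrightarrow> x \<in> P"
proof -
  assume k: "k \<noteq> 0" and x: "K k * x \<in> P"
  have "K (inverse k) * (K k * x) = x"
    using k K_mult[of "inverse k" k] K_one by (simp flip: mult.assoc)
  then show "x \<in> P" using P_left[OF x] by metis
qed

lemma K_left_commute: "a * (K k * x) = K k * (a * x)"
  by (metis K_commute mult.assoc)


subsection \<open>The generators\<close>

lemma p_p: "A \<in> gsets G \<Longrightarrow> B \<in> gsets G \<Longrightarrow> p A * p B \<approx> p (A \<inter> B)"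
  unfolding cg_def by (rule rel_inter)

lemma p_empty: "p {} \<approx> 0"
  using rel_empty by (simp add: P_iff_cg)

lemma p_Un_disjoint:
  assumes "A \<in> gsets G" "B \<in> gsets G" "A \<inter> B = {}"
  shows "p (A \<union> B) \<approx> p A + p B"
proof -
  have "p (A \<union> B) \<approx> p A + p B - p (A \<inter> B)"
    unfolding cg_def using assms by (intro rel_union)
  also have "\<dots> \<approx> p A + p B - 0"
    unfolding assms(3) by (intro cg_diff cg_refl p_empty)
  finally show ?thesis by simp
qed

lemma p_split:
  assumes "A \<in> gsets G" "B \<in> gsets G"
  shows "p A \<approx> p (A \<inter> B) + p (A - B)"
proof -
  have "p ((A \<inter> B) \<union> (A - B)) \<approx> p (A \<inter> B) + p (A - B)"
    using assms by (intro p_Un_disjoint gsets.inter gsets.diff) auto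
  moreover have "(A \<inter> B) \<union> (A - B) = A" by auto
  ultimately show ?thesis by simp
qed

lemma vertex_gset: "e \<in> edges G \<Longrightarrow> {src G e} \<in> gsets G"
  by (intro gsets.vertex src_in)

lemma p_s_in: "A \<in> gsets G \<Longrightarrow> e \<in> edges G \<Longrightarrow> src G e \<in> A \<Longrightarrow> p A * s e \<approx> s e"
proof -
  assume e: "A \<in> gsets G" "e \<in> edges G" "src G e \<in> A"
  have s: "s e \<approx> p {src G e} * s e" using rel_src_s[of e] e by - (rule cg_sym, simp add: cg_def)
  have "p A * s e \<approx> p A * (p {src G e} * s e)" by (rule cg_left[OF s])
  also have "\<dots> = p A * p {src G e} * s e" by (simp add: mult.assoc)
  also have "\<dots> \<approx> p (A \<inter> {src G e}) * s e" using e by (intro cg_right p_p vertex_gset)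
  also have "\<dots> = p {src G e} * s e" using e by (simp add: Int_insert_right)
  also have "\<dots> \<approx> s e" by (rule cg_sym[OF s])
  finally show ?thesis .
qed

lemma p_s_notin: "A \<in> gsets G \<Longrightarrow> e \<in> edges G \<Longrightarrow> src G e \<notin> A \<Longrightarrow> p A * s e \<approx> 0"
proof -
  assume e: "A \<in> gsets G" "e \<in> edges G" "src G e \<notin> A"
  have s: "s e \<approx> p {src G e} * s e" using rel_src_s[of e] e by - (rule cg_sym, simp add: cg_def)
  have "p A * s e \<approx> p A * (p {src G e} * s e)" by (rule cg_left[OF s])
  also have "\<dots> = p A * p {src G e} * s e" by (simp add: mult.assoc)
  also have "\<dots> \<approx> p (A \<inter> {src G e}) * s e" using e by (intro cg_right p_p vertex_gset)
  also have "\<dots> = p {} * s e" using e by simp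
  also have "\<dots> \<approx> 0 * s e" by (intro cg_right p_empty)
  finally show ?thesis by simp
qed

lemma t_p_in: "A \<in> gsets G \<Longrightarrow> e \<in> edges G \<Longrightarrow> src G e \<in> A \<Longrightarrow> t e * p A \<approx> t e"
proof -
  assume e: "A \<in> gsets G" "e \<in> edges G" "src G e \<in> A"
  have s: "t e \<approx> t e * p {src G e}" using rel_t_src[of e] e by - (rule cg_sym, simp add: cg_def)
  have "t e * p A \<approx> t e * p {src G e} * p A" by (rule cg_right[OF s])
  also have "\<dots> = t e * (p {src G e} * p A)" by (simp add: mult.assoc)
  also have "\<dots> \<approx> t e * p ({src G e} \<inter> A)" using e by (intro cg_left p_p vertex_gset)
  also have "\<dots> = t e * p {src G e}" using e by (simp add: Int_insert_left)
  also have "\<dots> \<approx> t e" by (rule cg_sym[OF s])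
  finally show ?thesis .
qed

lemma t_p_notin: "A \<in> gsets G \<Longrightarrow> e \<in> edges G \<Longrightarrow> src G e \<notin> A \<Longrightarrow> t e * p A \<approx> 0"
proof -
  assume e: "A \<in> gsets G" "e \<in> edges G" "src G e \<notin> A"
  have s: "t e \<approx> t e * p {src G e}" using rel_t_src[of e] e by - (rule cg_sym, simp add: cg_def)
  have "t e * p A \<approx> t e * p {src G e} * p A" by (rule cg_right[OF s])
  also have "\<dots> = t e * (p {src G e} * p A)" by (simp add: mult.assoc)
  also have "\<dots> \<approx> t e * p ({src G e} \<inter> A)" using e by (intro cg_left p_p vertex_gset)
  also have "\<dots> = t e * p {}" using e by simp
  also have "\<dots> \<approx> t e * 0" by (intro cg_left p_empty)
  finally show ?thesis by simp
qed

lemma s_rng: "e \<in> edges G \<Longrightarrow> s e * p (rng G e) \<approx> s e"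
  and rng_t: "e \<in> edges G \<Longrightarrow> p (rng G e) * t e \<approx> t e"
  unfolding cg_def by (fact rel_s_rng, fact rel_rng_t)

lemma t_s_same: "e \<in> edges G \<Longrightarrow> t e * s e \<approx> p (rng G e)"
  using rel_t_s[of e e] by (simp add: cg_def)

lemma t_s_diff: "e \<in> edges G \<Longrightarrow> f \<in> edges G \<Longrightarrow> e \<noteq> f \<Longrightarrow> t e * s f \<approx> 0"
  using rel_t_s[of e f] by (simp add: cg_def)

lemma p_Int_singleton_notP: "p (A \<inter> {w}) \<notin> P \<Longrightarrow> w \<in> A"
proof (rule ccontr)
  assume "p (A \<inter> {w}) \<notin> P" "w \<notin> A"
  moreover from \<open>w \<notin> A\<close> have "A \<inter> {w} = {}" by blast
  ultimately show False using rel_empty by metis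
qed

lemma p_P_subset: "p A \<in> P \<Longrightarrow> A \<in> gsets G \<Longrightarrow> B \<in> gsets G \<Longrightarrow> B \<subseteq> A \<Longrightarrow> p B \<in> P"
  using P_right[of "p A" "p B"] cg_P[OF p_p[of A B]] by (simp add: Int_absorb1)

lemma s_P_iff: "e \<in> edges G \<Longrightarrow> s e \<in> P \<longleftrightarrow> p (rng G e) \<in> P"
  using P_left[of "s e" "t e"] cg_P[OF t_s_same] P_left[of "p (rng G e)" "s e"] cg_P[OF s_rng]
  by blast

lemma t_P_iff: "e \<in> edges G \<Longrightarrow> t e \<in> P \<longleftrightarrow> p (rng G e) \<in> P"
  using P_right[of "t e" "s e"] cg_P[OF t_s_same] P_right[of "p (rng G e)" "t e"] cg_P[OF rng_t]
  by blast

lemma p_src_P: "e \<in> edges G \<Longrightarrow> A \<in> gsets G \<Longrightarrow> src G e \<in> A \<Longrightarrow> p A \<in> P \<Longrightarrow> p (rng G e) \<in> P"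
  using P_right[of "p A" "s e"] cg_P[OF p_s_in] s_P_iff by blast

text \<open>Stands in for the choice of a vertex: a surviving \<open>p C\<close> splits along each
  set \<open>D\<close> into \<open>p (C \<inter> D)\<close> and \<open>p (C - D)\<close>, and at
  least one half survives between \<open>a\<close> and \<open>b\<close>.\<close>

lemma gset_refine:
  assumes "finite F" "F \<subseteq> gsets G" "B \<in> gsets G" "a * p B * b \<notin> P"
  obtains C where "C \<in> gsets G" "C \<subseteq> B" "a * p C * b \<notin> P" "\<And>A. A \<in> F \<Longrightarrow> C \<subseteq> A \<or> C \<inter> A = {}"
proof -
  have "\<exists>C. C \<in> gsets G \<and> C \<subseteq> B \<and> a * p C * b \<notin> P \<and> (\<forall>A\<in>F. C \<subseteq> A \<or> C \<inter> A = {})"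
    using assms
  proof (induction F rule: finite_induct)
    case (insert D F)
    then obtain C where C: "C \<in> gsets G" "C \<subseteq> B" "a * p C * b \<notin> P"
      "\<forall>A\<in>F. C \<subseteq> A \<or> C \<inter> A = {}" by auto
    have D: "D \<in> gsets G" using insert by auto
    have "a * p C * b \<approx> a * (p (C \<inter> D) + p (C - D)) * b"
      by (intro cg_right cg_left p_split C D)
    then have "a * p (C \<inter> D) * b \<notin> P \<or> a * p (C - D) * b \<notin> P"
      using cg_P C(3) P_add by (fastforce simp: algebra_simps)
    then show ?case
    proof
      assume "a * p (C \<inter> D) * b \<notin> P"
      then show ?thesis using C D by (intro exI[of _ "C \<inter> D"]) (auto intro: gsets.inter)
    next
      assume "a * p (C - D) * b \<notin> P"
      then show ?thesis using C D by (intro exI[of _ "C - D"]) (auto intro: gsets.diff)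
    qed
  qed auto
  then show thesis using that by blast
qed


subsection \<open>Monomials\<close>

definition sp :: "'e list \<Rightarrow> 'a" where "sp \<alpha> = prod_list (map s \<alpha>)"

definition st :: "'e list \<Rightarrow> 'a" where "st \<alpha> = prod_list (map t (rev \<alpha>))"

lemma sp_simps [simp]: "sp [] = 1" "sp (e # \<alpha>) = s e * sp \<alpha>"
  and st_simps [simp]: "st [] = 1" "st (e # \<alpha>) = st \<alpha> * t e"
  by (simp_all add: sp_def st_def)

lemma sp_append: "sp (\<alpha> @ \<beta>) = sp \<alpha> * sp \<beta>"
  and st_append: "st (\<alpha> @ \<beta>) = st \<beta> * st \<alpha>"
  by (simp_all add: sp_def st_def)

lemma p_sp_in: "A \<in> gsets G \<Longrightarrow> e \<in> edges G \<Longrightarrow> src G e \<in> A \<Longrightarrow> p A * sp (e # \<alpha>) \<approx> sp (e # \<alpha>)"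
  using cg_right[OF p_s_in] by (simp add: mult.assoc)

lemma p_sp_notin: "A \<in> gsets G \<Longrightarrow> e \<in> edges G \<Longrightarrow> src G e \<notin> A \<Longrightarrow> p A * sp (e # \<alpha>) \<approx> 0"
  using cg_right[OF p_s_notin, of A e "sp \<alpha>"] by (simp add: mult.assoc)

lemma st_p_in: "A \<in> gsets G \<Longrightarrow> e \<in> edges G \<Longrightarrow> src G e \<in> A \<Longrightarrow> st (e # \<alpha>) * p A \<approx> st (e # \<alpha>)"
  using cg_left[OF t_p_in] by (simp add: mult.assoc)

lemma st_p_notin: "A \<in> gsets G \<Longrightarrow> e \<in> edges G \<Longrightarrow> src G e \<notin> A \<Longrightarrow> st (e # \<alpha>) * p A \<approx> 0"
  using cg_left[OF t_p_notin, of A e "st \<alpha>"] by (simp add: mult.assoc)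

lemma sp_rng: "\<alpha> \<noteq> [] \<Longrightarrow> set \<alpha> \<subseteq> edges G \<Longrightarrow> sp \<alpha> * p (rng G (last \<alpha>)) \<approx> sp \<alpha>"
proof (induction \<alpha> rule: rev_induct)
  case (snoc e \<alpha>)
  then show ?case using cg_left[OF s_rng, of e "sp \<alpha>"] by (simp add: sp_append mult.assoc)
qed simp

text \<open>Between consecutive edges stands a hidden factor \<open>p (rng G e)\<close>, which
  annihilates \<open>s f\<close> unless the source of \<open>f\<close> lies in that range.\<close>

lemma sp_edge_path: "sp \<alpha> \<notin> P \<Longrightarrow> \<alpha> \<noteq> [] \<Longrightarrow> set \<alpha> \<subseteq> edges G \<Longrightarrow> edge_path G \<alpha>"
proof (induction \<alpha>)
  case (Cons e \<alpha>)
  show ?case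
  proof (cases \<alpha>)
    case (Cons f \<beta>)
    have e: "e \<in> edges G" "f \<in> edges G" using Cons.prems Cons by auto
    have "sp \<alpha> \<notin> P" using Cons.prems P_left by auto
    then have 1: "edge_path G \<alpha>" using Cons.IH Cons.prems Cons by auto
    have "s e * p (rng G e) * sp \<alpha> \<approx> s e * sp \<alpha>" by (intro cg_right s_rng e)
    then have "s e * (p (rng G e) * sp \<alpha>) \<notin> P" using Cons.prems cg_P by (simp add: mult.assoc)
    then have "\<not> p (rng G e) * sp \<alpha> \<approx> 0" using P_left P_iff_cg by blast
    then have "src G f \<in> rng G e" using p_sp_notin[of "rng G e" f \<beta>] e Cons gsets.range[of e G] by blast
    then show ?thesis using 1 e Cons by (auto simp: edge_path_Cons)
  qed (use Cons.prems in \<open>auto simp: edge_path_Cons\<close>)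
qed simp

lemma sp_p_walk:
  assumes "sp \<alpha> * p {w} \<notin> P" "set \<alpha> \<subseteq> edges G" "w \<in> verts G"
  shows "\<exists>u. walk G u \<alpha> w"
proof (cases "\<alpha> = []")
  case False
  have "sp \<alpha> \<notin> P" using assms P_right by blast
  then have 1: "edge_path G \<alpha>" using sp_edge_path assms False by blast
  have r: "rng G (last \<alpha>) \<in> gsets G" using assms False by (intro gsets.range) auto
  have "sp \<alpha> * p (rng G (last \<alpha>)) * p {w} \<approx> sp \<alpha> * p {w}"
    by (intro cg_right sp_rng assms False)
  then have "sp \<alpha> * (p (rng G (last \<alpha>)) * p {w}) \<notin> P"
    using assms cg_P by (simp add: mult.assoc)
  then have "\<not> p (rng G (last \<alpha>)) * p {w} \<approx> 0" using P_left P_iff_cg by blast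
  then have "p (rng G (last \<alpha>) \<inter> {w}) \<notin> P"
    using cg_P[OF p_p[OF r gsets.vertex]] assms P_iff_cg by blast
  then have "w \<in> rng G (last \<alpha>)" by (rule p_Int_singleton_notP)
  then have "walk G (src G (hd \<alpha>)) \<alpha> w"
    unfolding walk_iff_edge_path[OF False] using 1 by simp
  then show ?thesis by blast
qed auto

lemma st_sp: "edge_path G \<alpha> \<Longrightarrow> st \<alpha> * sp \<alpha> \<approx> p (rng G (last \<alpha>))"
proof (induction \<alpha>)
  case (Cons e \<alpha>)
  have e: "e \<in> edges G" using Cons.prems by (simp add: edge_path_Cons)
  have "st (e # \<alpha>) * sp (e # \<alpha>) = st \<alpha> * (t e * s e) * sp \<alpha>" by (simp add: mult.assoc)
  also have "\<dots> \<approx> st \<alpha> * p (rng G e) * sp \<alpha>" by (intro cg_right cg_left t_s_same e)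
  also have "\<dots> \<approx> p (rng G (last (e # \<alpha>)))"
  proof (cases \<alpha>)
    case (Cons f \<beta>)
    then have f: "f \<in> edges G" "src G f \<in> rng G e" "edge_path G \<alpha>"
      using Cons.prems by (auto simp: edge_path_Cons)
    have "st \<alpha> * p (rng G e) * sp \<alpha> \<approx> st \<alpha> * sp \<alpha>"
      unfolding Cons mult.assoc[of "st (f # \<beta>)"]
      by (intro cg_left p_sp_in gsets.range e f)
    also have "\<dots> \<approx> p (rng G (last \<alpha>))" using Cons.IH f by blast
    finally show ?thesis using Cons by simp
  qed simp
  finally show ?case .
qed (simp add: edge_path_def)

text \<open>Edges cancel in pairs from the middle outwards: equal ones leave a projection, different
  ones give \<open>0\<close>. Survival means that one list runs out before a mismatch
  occurs.\<close>

lemma st_p_sp_comparable: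
  assumes "st \<alpha> * p B * sp \<beta> \<notin> P" "set \<alpha> \<subseteq> edges G" "set \<beta> \<subseteq> edges G" "B \<in> gsets G"
  shows "\<exists>\<gamma>. \<beta> = \<alpha> @ \<gamma> \<or> \<alpha> = \<beta> @ \<gamma>"
  using assms
proof (induction \<alpha> arbitrary: \<beta> B)
  case (Cons e \<alpha>)
  show ?case
  proof (cases \<beta>)
    case (Cons f \<beta>')
    have ef: "e \<in> edges G" "f \<in> edges G" using Cons.prems Cons by auto
    have eq: "st (e # \<alpha>) * p B * sp \<beta> = st \<alpha> * (t e * p B * s f) * sp \<beta>'"
      using Cons by (simp add: mult.assoc)
    have B: "src G e \<in> B"
    proof (rule ccontr)
      assume "src G e \<notin> B"
      then have "st \<alpha> * (t e * p B * s f) * sp \<beta>' \<approx> st \<alpha> * (0 * s f) * sp \<beta>'"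
        by (intro cg_right cg_left t_p_notin Cons.prems ef)
      then show False using Cons.prems eq P_iff_cg by auto
    qed
    have "st \<alpha> * (t e * p B * s f) * sp \<beta>' \<approx> st \<alpha> * (t e * s f) * sp \<beta>'"
      by (intro cg_right cg_left t_p_in Cons.prems ef B)
    then have 1: "st \<alpha> * (t e * s f) * sp \<beta>' \<notin> P" using Cons.prems eq cg_P by metis
    have "e = f"
    proof (rule ccontr)
      assume "e \<noteq> f"
      then have "st \<alpha> * (t e * s f) * sp \<beta>' \<approx> st \<alpha> * 0 * sp \<beta>'"
        by (intro cg_right cg_left t_s_diff ef)
      then show False using 1 P_iff_cg by simp
    qed
    then have "st \<alpha> * (t e * s f) * sp \<beta>' \<approx> st \<alpha> * p (rng G e) * sp \<beta>'"
      using ef by (auto intro!: cg_right cg_left t_s_same)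
    then have "st \<alpha> * p (rng G e) * sp \<beta>' \<notin> P" using 1 cg_P by blast
    then show ?thesis
      using Cons.IH[of "rng G e" \<beta>'] Cons.prems Cons \<open>e = f\<close> gsets.range[OF ef(1)] by auto
  qed simp
qed auto

lemma st_sp_comparable:
  assumes "st \<alpha> * sp \<beta> \<notin> P" "set \<alpha> \<subseteq> edges G" "set \<beta> \<subseteq> edges G"
  shows "\<exists>\<gamma>. \<beta> = \<alpha> @ \<gamma> \<or> \<alpha> = \<beta> @ \<gamma>"
proof (cases \<beta>)
  case (Cons f \<beta>')
  have f: "f \<in> edges G" using assms Cons by auto
  have "st \<alpha> * p {src G f} * sp \<beta> \<approx> st \<alpha> * sp \<beta>"
    unfolding Cons mult.assoc[of "st \<alpha>"] by (intro cg_left p_sp_in vertex_gset f) auto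
  then show ?thesis using st_p_sp_comparable assms vertex_gset[OF f] cg_P by blast
qed auto

definition mono :: "'e list \<Rightarrow> 'v set \<Rightarrow> 'e list \<Rightarrow> 'a" where
  "mono \<alpha> A \<beta> = sp \<alpha> * p A * st \<beta>"

text \<open>The span of \<open>P\<close> and the monomials whose two words satisfy
  \<open>\<Phi>\<close>; one predicate covers degrees, length bounds and one-sided words. The words
  are arbitrary lists of edges, because monomials of lists that are not paths lie in
  \<open>P\<close> anyway.\<close>

inductive_set Sp :: "('e list \<Rightarrow> 'e list \<Rightarrow> bool) \<Rightarrow> 'a set" for \<Phi> where
  Sp_P: "x \<in> P \<Longrightarrow> x \<in> Sp \<Phi>"
| Sp_mono: "x \<in> Sp \<Phi> \<Longrightarrow> A \<in> gsets G \<Longrightarrow> set \<alpha> \<subseteq> edges G \<Longrightarrow> set \<beta> \<subseteq> edges G \<Longrightarrow> \<Phi> \<alpha> \<beta> \<Longrightarrow>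
    x + K k * mono \<alpha> A \<beta> \<in> Sp \<Phi>"

lemma Sp_add:
  assumes "x \<in> Sp \<Phi>" "y \<in> Sp \<Phi>"
  shows "x + y \<in> Sp \<Phi>"
  using assms(2)
proof (induction y rule: Sp.induct)
  case (Sp_P y)
  show ?case using assms(1)
  proof (induction x rule: Sp.induct)
    case (Sp_mono x A \<alpha> \<beta> k)
    then show ?case using Sp.Sp_mono[of "x + y" \<Phi> A \<alpha> \<beta> k] by (simp add: algebra_simps)
  qed (use Sp_P in \<open>auto intro: P_add Sp.Sp_P\<close>)
next
  case (Sp_mono y A \<alpha> \<beta> k)
  then show ?case using Sp.Sp_mono[of "x + y" \<Phi> A \<alpha> \<beta> k] by (simp add: algebra_simps)
qed

lemma Sp_cg: "x \<in> Sp \<Phi> \<Longrightarrow> x \<approx> y \<Longrightarrow> y \<in> Sp \<Phi>"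
  using Sp_add[of x \<Phi> "y - x"] Sp_P[of "y - x"] cg_sym by (simp add: cg_def)

lemma Sp_zero: "0 \<in> Sp \<Phi>"
  by (intro Sp_P P_zero)

lemma mono_in_Sp: "A \<in> gsets G \<Longrightarrow> set \<alpha> \<subseteq> edges G \<Longrightarrow> set \<beta> \<subseteq> edges G \<Longrightarrow> \<Phi> \<alpha> \<beta> \<Longrightarrow>
    mono \<alpha> A \<beta> \<in> Sp \<Phi>"
  using Sp_mono[OF Sp_zero, of A \<alpha> \<beta> \<Phi> 1] by (simp add: K_one)

lemma Sp_K: "x \<in> Sp \<Phi> \<Longrightarrow> K k * x \<in> Sp \<Phi>"
proof (induction x rule: Sp.induct)
  case (Sp_mono x A \<alpha> \<beta> k')
  then show ?case
    using Sp.Sp_mono[of "K k * x" \<Phi> A \<alpha> \<beta> "k * k'"] by (simp add: algebra_simps K_mult)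
qed (auto intro: P_left Sp.Sp_P)

lemma Sp_uminus: "x \<in> Sp \<Phi> \<Longrightarrow> - x \<in> Sp \<Phi>"
  using Sp_K[of x \<Phi> "-1"] by (simp add: K_uminus K_one)

lemma Sp_diff: "x \<in> Sp \<Phi> \<Longrightarrow> y \<in> Sp \<Phi> \<Longrightarrow> x - y \<in> Sp \<Phi>"
  using Sp_add[of x \<Phi> "- y"] Sp_uminus by simp

lemma Sp_sum: "(\<And>i. i \<in> I \<Longrightarrow> f i \<in> Sp \<Phi>) \<Longrightarrow> sum f I \<in> Sp \<Phi>"
  by (induction I rule: infinite_finite_induct) (auto intro: Sp_zero Sp_add)

text \<open>Sandwiching is linear and preserves \<open>P\<close>, so monomials suffice.\<close>

lemma Sp_image:
  assumes "x \<in> Sp \<Phi>"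
    and "\<And>A \<alpha> \<beta>. A \<in> gsets G \<Longrightarrow> set \<alpha> \<subseteq> edges G \<Longrightarrow> set \<beta> \<subseteq> edges G \<Longrightarrow> \<Phi> \<alpha> \<beta> \<Longrightarrow>
      a * mono \<alpha> A \<beta> * b \<in> Sp \<Psi>"
  shows "a * x * b \<in> Sp \<Psi>"
  using assms(1)
proof (induction x rule: Sp.induct)
  case (Sp_mono x A \<alpha> \<beta> k)
  have "a * x * b + K k * (a * mono \<alpha> A \<beta> * b) \<in> Sp \<Psi>"
    using Sp_mono assms(2) by (intro Sp_add Sp_K) auto
  then show ?case by (simp add: algebra_simps K_left_commute)
qed (auto intro: P_left P_right Sp.Sp_P)

lemma Sp_image_P:
  assumes "x \<in> Sp \<Phi>"
    and "\<And>A \<alpha> \<beta>. A \<in> gsets G \<Longrightarrow> set \<alpha> \<subseteq> edges G \<Longrightarrow> set \<beta> \<subseteq> edges G \<Longrightarrow> \<Phi> \<alpha> \<beta> \<Longrightarrow>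
      a * mono \<alpha> A \<beta> * b \<in> P"
  shows "a * x * b \<in> P"
  using assms(1)
proof (induction x rule: Sp.induct)
  case (Sp_mono x A \<alpha> \<beta> k)
  have "a * x * b + K k * (a * mono \<alpha> A \<beta> * b) \<in> P"
    using Sp_mono by (intro P_add P_left[of "a * mono \<alpha> A \<beta> * b"] assms(2))
  then show ?case by (simp add: algebra_simps K_left_commute)
qed (auto intro: P_left P_right Sp.Sp_P)

lemma Sp_image_mono_notP:
  assumes "x \<in> Sp \<Phi>" "a * x * b \<notin> P"
  obtains A \<alpha> \<beta> where "A \<in> gsets G" "set \<alpha> \<subseteq> edges G" "set \<beta> \<subseteq> edges G" "\<Phi> \<alpha> \<beta>"
    "a * mono \<alpha> A \<beta> * b \<notin> P"
  using Sp_image_P[OF assms(1)] assms(2) by blast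

lemma Sp_weaken: "x \<in> Sp \<Phi> \<Longrightarrow> (\<And>\<alpha> \<beta>. \<Phi> \<alpha> \<beta> \<Longrightarrow> \<Psi> \<alpha> \<beta>) \<Longrightarrow> x \<in> Sp \<Psi>"
  using Sp_image[of x \<Phi> 1 1 \<Psi>] mono_in_Sp by simp

lemma p_Sp: "x \<in> Sp \<Phi> \<Longrightarrow> A \<in> gsets G \<Longrightarrow> p A * x \<in> Sp \<Phi>"
proof -
  assume x: "x \<in> Sp \<Phi>" and A: "A \<in> gsets G"
  have "p A * x * 1 \<in> Sp \<Phi>" using x
  proof (rule Sp_image)
    fix B \<alpha> \<beta> assume B: "B \<in> gsets G" "set \<alpha> \<subseteq> edges G" "set \<beta> \<subseteq> edges G" "\<Phi> \<alpha> \<beta>"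
    show "p A * mono \<alpha> B \<beta> * 1 \<in> Sp \<Phi>"
    proof (cases \<alpha>)
      case Nil
      have "p A * p B * st \<beta> \<approx> p (A \<inter> B) * st \<beta>" by (intro cg_right p_p A B)
      moreover have "mono [] (A \<inter> B) \<beta> \<in> Sp \<Phi>" using A B Nil by (intro mono_in_Sp gsets.inter) auto
      ultimately show ?thesis using Nil Sp_cg cg_sym by (fastforce simp: mono_def mult.assoc)
    next
      case (Cons e \<gamma>)
      show ?thesis
      proof (cases "src G e \<in> A")
        case True
        then have "p A * sp \<alpha> * (p B * st \<beta>) \<approx> sp \<alpha> * (p B * st \<beta>)"
          using Cons A B unfolding Cons by (intro cg_right p_sp_in) auto
        then show ?thesis using mono_in_Sp[of B \<alpha> \<beta> \<Phi>] B Sp_cg cg_sym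
          by (fastforce simp: mono_def mult.assoc)
      next
        case False
        then have "p A * sp \<alpha> * (p B * st \<beta>) \<approx> 0 * (p B * st \<beta>)"
          using Cons A B unfolding Cons by (intro cg_right p_sp_notin) auto
        then have "p A * mono \<alpha> B \<beta> \<in> P" by (simp add: P_iff_cg mono_def mult.assoc)
        then show ?thesis using Sp_P by simp
      qed
    qed
  qed
  then show ?thesis by simp
qed

lemma Sp_p: "x \<in> Sp \<Phi> \<Longrightarrow> A \<in> gsets G \<Longrightarrow> x * p A \<in> Sp \<Phi>"
proof -
  assume x: "x \<in> Sp \<Phi>" and A: "A \<in> gsets G"
  have "1 * x * p A \<in> Sp \<Phi>" using x
  proof (rule Sp_image)
    fix B \<alpha> \<beta> assume B: "B \<in> gsets G" "set \<alpha> \<subseteq> edges G" "set \<beta> \<subseteq> edges G" "\<Phi> \<alpha> \<beta>"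
    show "1 * mono \<alpha> B \<beta> * p A \<in> Sp \<Phi>"
    proof (cases \<beta>)
      case Nil
      have "sp \<alpha> * (p B * p A) \<approx> sp \<alpha> * p (B \<inter> A)" by (intro cg_left p_p A B)
      moreover have "mono \<alpha> (B \<inter> A) [] \<in> Sp \<Phi>" using A B Nil by (intro mono_in_Sp gsets.inter) auto
      ultimately show ?thesis using Nil Sp_cg cg_sym by (fastforce simp: mono_def mult.assoc)
    next
      case (Cons e \<gamma>)
      show ?thesis
      proof (cases "src G e \<in> A")
        case True
        then have "sp \<alpha> * p B * (st \<beta> * p A) \<approx> sp \<alpha> * p B * st \<beta>"
          using Cons A B unfolding Cons by (intro cg_left st_p_in) auto
        then show ?thesis using mono_in_Sp[of B \<alpha> \<beta> \<Phi>] B Sp_cg cg_sym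
          by (fastforce simp: mono_def mult.assoc)
      next
        case False
        then have "sp \<alpha> * p B * (st \<beta> * p A) \<approx> sp \<alpha> * p B * 0"
          using Cons A B unfolding Cons by (intro cg_left st_p_notin) auto
        then have "mono \<alpha> B \<beta> * p A \<in> P" by (simp add: P_iff_cg mono_def mult.assoc)
        then show ?thesis using Sp_P by simp
      qed
    qed
  qed
  then show ?thesis by simp
qed

lemma s_Sp:
  assumes "x \<in> Sp \<Phi>" "e \<in> edges G" "\<And>\<alpha> \<beta>. \<Phi> \<alpha> \<beta> \<Longrightarrow> \<Psi> (e # \<alpha>) \<beta>"
  shows "s e * x \<in> Sp \<Psi>"
proof -
  have "s e * x * 1 \<in> Sp \<Psi>" using assms(1)
  proof (rule Sp_image)
    fix B \<alpha> \<beta> assume "B \<in> gsets G" "set \<alpha> \<subseteq> edges G" "set \<beta> \<subseteq> edges G" "\<Phi> \<alpha> \<beta>"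
    then have "mono (e # \<alpha>) B \<beta> \<in> Sp \<Psi>" using assms by (intro mono_in_Sp) auto
    then show "s e * mono \<alpha> B \<beta> * 1 \<in> Sp \<Psi>" by (simp add: mono_def mult.assoc)
  qed
  then show ?thesis by simp
qed

lemma Sp_t:
  assumes "x \<in> Sp \<Phi>" "e \<in> edges G" "\<And>\<alpha> \<beta>. \<Phi> \<alpha> \<beta> \<Longrightarrow> \<Psi> \<alpha> (e # \<beta>)"
  shows "x * t e \<in> Sp \<Psi>"
proof -
  have "1 * x * t e \<in> Sp \<Psi>" using assms(1)
  proof (rule Sp_image)
    fix B \<alpha> \<beta> assume "B \<in> gsets G" "set \<alpha> \<subseteq> edges G" "set \<beta> \<subseteq> edges G" "\<Phi> \<alpha> \<beta>"
    then have "mono \<alpha> B (e # \<beta>) \<in> Sp \<Psi>" using assms by (intro mono_in_Sp) auto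
    then show "1 * mono \<alpha> B \<beta> * t e \<in> Sp \<Psi>" by (simp add: mono_def mult.assoc)
  qed
  then show ?thesis by simp
qed

text \<open>If the left word is empty, \<open>t e\<close> passes the projection and joins the right
  word, at its end because \<open>st\<close> reverses. Otherwise it cancels the first letter of the
  left word or gives \<open>0\<close>.\<close>

lemma t_Sp:
  assumes x: "x \<in> Sp \<Phi>" and e: "e \<in> edges G" and 1: "\<And>\<alpha> \<beta>. \<Phi> (e # \<alpha>) \<beta> \<Longrightarrow> \<Psi> \<alpha> \<beta>"
    and 2: "\<And>\<beta>. \<Phi> [] \<beta> \<Longrightarrow> \<Psi> [] (\<beta> @ [e])"
  shows "t e * x \<in> Sp \<Psi>"
proof -
  have "t e * x * 1 \<in> Sp \<Psi>" using x
  proof (rule Sp_image)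
    fix B \<alpha> \<beta> assume B: "B \<in> gsets G" "set \<alpha> \<subseteq> edges G" "set \<beta> \<subseteq> edges G" "\<Phi> \<alpha> \<beta>"
    show "t e * mono \<alpha> B \<beta> * 1 \<in> Sp \<Psi>"
    proof (cases \<alpha>)
      case Nil
      show ?thesis
      proof (cases "src G e \<in> B")
        case True
        have "t e * p B * st \<beta> \<approx> t e * st \<beta>" by (intro cg_right t_p_in B e True)
        also have "\<dots> \<approx> p (rng G e) * t e * st \<beta>" by (intro cg_right cg_sym[OF rng_t] e)
        finally have "t e * mono \<alpha> B \<beta> \<approx> mono [] (rng G e) (\<beta> @ [e])"
          using Nil by (simp add: mono_def st_append mult.assoc)
        moreover have "mono [] (rng G e) (\<beta> @ [e]) \<in> Sp \<Psi>"
          using B e 2 Nil by (intro mono_in_Sp gsets.range) auto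
        ultimately show ?thesis using Sp_cg cg_sym by fastforce
      next
        case False
        have "t e * p B * st \<beta> \<approx> 0 * st \<beta>" by (intro cg_right t_p_notin B e False)
        then have "t e * mono \<alpha> B \<beta> \<in> P" using Nil by (simp add: P_iff_cg mono_def mult.assoc)
        then show ?thesis using Sp_P by simp
      qed
    next
      case (Cons f \<gamma>)
      show ?thesis
      proof (cases "e = f")
        case True
        have "t e * s e * (sp \<gamma> * p B * st \<beta>) \<approx> p (rng G e) * (sp \<gamma> * p B * st \<beta>)"
          by (intro cg_right t_s_same e)
        moreover have "p (rng G e) * mono \<gamma> B \<beta> \<in> Sp \<Psi>"
          using B e 1 Cons True by (intro p_Sp mono_in_Sp gsets.range) auto
        ultimately show ?thesis using Cons True Sp_cg cg_sym by (fastforce simp: mono_def mult.assoc)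
      next
        case False
        have "t e * s f * (sp \<gamma> * p B * st \<beta>) \<approx> 0 * (sp \<gamma> * p B * st \<beta>)"
          using B Cons e False by (intro cg_right t_s_diff) auto
        then have "t e * mono \<alpha> B \<beta> \<in> P" using Cons by (simp add: P_iff_cg mono_def mult.assoc)
        then show ?thesis using Sp_P by simp
      qed
    qed
  qed
  then show ?thesis by simp
qed

lemma Sp_s:
  assumes x: "x \<in> Sp \<Phi>" and e: "e \<in> edges G" and 1: "\<And>\<alpha> \<beta>. \<Phi> \<alpha> (e # \<beta>) \<Longrightarrow> \<Psi> \<alpha> \<beta>"
    and 2: "\<And>\<alpha>. \<Phi> \<alpha> [] \<Longrightarrow> \<Psi> (\<alpha> @ [e]) []"
  shows "x * s e \<in> Sp \<Psi>"
proof -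
  have "1 * x * s e \<in> Sp \<Psi>" using x
  proof (rule Sp_image)
    fix B \<alpha> \<beta> assume B: "B \<in> gsets G" "set \<alpha> \<subseteq> edges G" "set \<beta> \<subseteq> edges G" "\<Phi> \<alpha> \<beta>"
    show "1 * mono \<alpha> B \<beta> * s e \<in> Sp \<Psi>"
    proof (cases \<beta>)
      case Nil
      show ?thesis
      proof (cases "src G e \<in> B")
        case True
        have "sp \<alpha> * (p B * s e) \<approx> sp \<alpha> * s e" by (intro cg_left p_s_in B e True)
        also have "\<dots> \<approx> sp \<alpha> * (s e * p (rng G e))" by (intro cg_left cg_sym[OF s_rng] e)
        finally have "mono \<alpha> B \<beta> * s e \<approx> mono (\<alpha> @ [e]) (rng G e) []"
          using Nil by (simp add: mono_def sp_append mult.assoc)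
        moreover have "mono (\<alpha> @ [e]) (rng G e) [] \<in> Sp \<Psi>"
          using B e 2 Nil by (intro mono_in_Sp gsets.range) auto
        ultimately show ?thesis using Sp_cg cg_sym by fastforce
      next
        case False
        have "sp \<alpha> * (p B * s e) \<approx> sp \<alpha> * 0" by (intro cg_left p_s_notin B e False)
        then have "mono \<alpha> B \<beta> * s e \<in> P" using Nil by (simp add: P_iff_cg mono_def mult.assoc)
        then show ?thesis using Sp_P by simp
      qed
    next
      case (Cons f \<gamma>)
      show ?thesis
      proof (cases "e = f")
        case True
        have "sp \<alpha> * p B * st \<gamma> * (t e * s e) \<approx> sp \<alpha> * p B * st \<gamma> * p (rng G e)"
          by (intro cg_left t_s_same e)
        moreover have "mono \<alpha> B \<gamma> * p (rng G e) \<in> Sp \<Psi>"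
          using B e 1 Cons True by (intro Sp_p mono_in_Sp gsets.range) auto
        ultimately show ?thesis using Cons True Sp_cg cg_sym by (fastforce simp: mono_def mult.assoc)
      next
        case False
        have "sp \<alpha> * p B * st \<gamma> * (t f * s e) \<approx> sp \<alpha> * p B * st \<gamma> * 0"
          using B Cons e False by (intro cg_left t_s_diff) auto
        then have "mono \<alpha> B \<beta> * s e \<in> P" using Cons by (simp add: P_iff_cg mono_def mult.assoc)
        then show ?thesis using Sp_P by simp
      qed
    qed
  qed
  then show ?thesis by simp
qed

text \<open>Groups the monomials by the first edge of the right word, which is the rightmost factor
  of the product since \<open>st\<close> reverses.\<close>

lemma Sp_decompose_right:
  assumes "x \<in> Sp \<Phi>"
  obtains x0 E y where "finite E" "E \<subseteq> edges G" "x0 \<in> Sp (\<lambda>\<alpha> \<beta>. \<beta> = [] \<and> \<Phi> \<alpha> [])"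
    "\<And>e. e \<in> E \<Longrightarrow> y e \<in> Sp (\<lambda>\<alpha> \<beta>. \<Phi> \<alpha> (e # \<beta>))" "x \<approx> x0 + (\<Sum>e\<in>E. y e * t e)"
proof -
  have "\<exists>x0 E y. finite E \<and> E \<subseteq> edges G \<and> x0 \<in> Sp (\<lambda>\<alpha> \<beta>. \<beta> = [] \<and> \<Phi> \<alpha> []) \<and>
    (\<forall>e\<in>E. y e \<in> Sp (\<lambda>\<alpha> \<beta>. \<Phi> \<alpha> (e # \<beta>))) \<and> x \<approx> x0 + (\<Sum>e\<in>E. y e * t e)"
    using assms
  proof (induction x rule: Sp.induct)
    case (Sp_P x)
    then show ?case
      by (intro exI[of _ x] exI[of _ "{}"]) (auto intro: Sp.Sp_P)
  next
    case (Sp_mono x A \<alpha> \<beta> k)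
    then obtain x0 E y where *: "finite E" "E \<subseteq> edges G" "x0 \<in> Sp (\<lambda>\<alpha> \<beta>. \<beta> = [] \<and> \<Phi> \<alpha> [])"
      "\<And>e. e \<in> E \<Longrightarrow> y e \<in> Sp (\<lambda>\<alpha> \<beta>. \<Phi> \<alpha> (e # \<beta>))" "x \<approx> x0 + (\<Sum>e\<in>E. y e * t e)"
      by blast
    show ?case
    proof (cases \<beta>)
      case Nil
      have "x0 + K k * mono \<alpha> A \<beta> \<in> Sp (\<lambda>\<alpha> \<beta>. \<beta> = [] \<and> \<Phi> \<alpha> [])"
        using * Sp_mono Nil by (intro Sp.Sp_mono) auto
      moreover have "x + K k * mono \<alpha> A \<beta> \<approx> x0 + K k * mono \<alpha> A \<beta> + (\<Sum>e\<in>E. y e * t e)"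
        using cg_add[OF *(5) cg_refl, of "K k * mono \<alpha> A \<beta>"] by (simp add: algebra_simps)
      ultimately show ?thesis using * by blast
    next
      case (Cons f \<gamma>)
      let ?z = "K k * mono \<alpha> A \<gamma>"
      obtain y' where y': "\<And>e. y' e = (if e = f then (if f \<in> E then y f else 0) + ?z else y e)"
        "(\<Sum>e\<in>insert f E. y' e * t e) = (\<Sum>e\<in>E. y e * t e) + ?z * t f"
        using sum_fun_upd_add[OF *(1), of "\<lambda>e x. x * t e" f y ?z] by (auto simp: algebra_simps)
      have "?z \<in> Sp (\<lambda>\<alpha> \<beta>. \<Phi> \<alpha> (f # \<beta>))"
        using Sp_mono Cons by (intro Sp_K mono_in_Sp) auto
      then have "y' e \<in> Sp (\<lambda>\<alpha> \<beta>. \<Phi> \<alpha> (e # \<beta>))" if "e \<in> insert f E" for e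
        using that *(4) y'(1) by (auto intro: Sp_add)
      moreover have "x + K k * mono \<alpha> A \<beta> \<approx> x0 + (\<Sum>e\<in>insert f E. y' e * t e)"
        unfolding y'(2) using cg_add[OF *(5) cg_refl, of "K k * mono \<alpha> A \<beta>"] Cons
        by (simp add: algebra_simps mono_def)
      moreover have "insert f E \<subseteq> edges G" using * Sp_mono Cons by auto
      ultimately show ?thesis using *(1,3) by blast
    qed
  qed
  then show thesis using that by blast
qed

lemma Sp_decompose_left:
  assumes "x \<in> Sp \<Phi>"
  obtains x0 E y where "finite E" "E \<subseteq> edges G" "x0 \<in> Sp (\<lambda>\<alpha> \<beta>. \<alpha> = [] \<and> \<Phi> [] \<beta>)"
    "\<And>e. e \<in> E \<Longrightarrow> y e \<in> Sp (\<lambda>\<alpha> \<beta>. \<Phi> (e # \<alpha>) \<beta>)" "x \<approx> x0 + (\<Sum>e\<in>E. s e * y e)"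
proof -
  have "\<exists>x0 E y. finite E \<and> E \<subseteq> edges G \<and> x0 \<in> Sp (\<lambda>\<alpha> \<beta>. \<alpha> = [] \<and> \<Phi> [] \<beta>) \<and>
    (\<forall>e\<in>E. y e \<in> Sp (\<lambda>\<alpha> \<beta>. \<Phi> (e # \<alpha>) \<beta>)) \<and> x \<approx> x0 + (\<Sum>e\<in>E. s e * y e)"
    using assms
  proof (induction x rule: Sp.induct)
    case (Sp_P x)
    then show ?case
      by (intro exI[of _ x] exI[of _ "{}"]) (auto intro: Sp.Sp_P)
  next
    case (Sp_mono x A \<alpha> \<beta> k)
    then obtain x0 E y where *: "finite E" "E \<subseteq> edges G" "x0 \<in> Sp (\<lambda>\<alpha> \<beta>. \<alpha> = [] \<and> \<Phi> [] \<beta>)"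
      "\<And>e. e \<in> E \<Longrightarrow> y e \<in> Sp (\<lambda>\<alpha> \<beta>. \<Phi> (e # \<alpha>) \<beta>)" "x \<approx> x0 + (\<Sum>e\<in>E. s e * y e)"
      by blast
    show ?case
    proof (cases \<alpha>)
      case Nil
      have "x0 + K k * mono \<alpha> A \<beta> \<in> Sp (\<lambda>\<alpha> \<beta>. \<alpha> = [] \<and> \<Phi> [] \<beta>)"
        using * Sp_mono Nil by (intro Sp.Sp_mono) auto
      moreover have "x + K k * mono \<alpha> A \<beta> \<approx> x0 + K k * mono \<alpha> A \<beta> + (\<Sum>e\<in>E. s e * y e)"
        using cg_add[OF *(5) cg_refl, of "K k * mono \<alpha> A \<beta>"] by (simp add: algebra_simps)
      ultimately show ?thesis using * by blast
    next
      case (Cons f \<gamma>)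
      let ?z = "K k * mono \<gamma> A \<beta>"
      obtain y' where y': "\<And>e. y' e = (if e = f then (if f \<in> E then y f else 0) + ?z else y e)"
        "(\<Sum>e\<in>insert f E. s e * y' e) = (\<Sum>e\<in>E. s e * y e) + s f * ?z"
        using sum_fun_upd_add[OF *(1), of "\<lambda>e x. s e * x" f y ?z] by (auto simp: algebra_simps)
      have "?z \<in> Sp (\<lambda>\<alpha> \<beta>. \<Phi> (f # \<alpha>) \<beta>)"
        using Sp_mono Cons by (intro Sp_K mono_in_Sp) auto
      then have "y' e \<in> Sp (\<lambda>\<alpha> \<beta>. \<Phi> (e # \<alpha>) \<beta>)" if "e \<in> insert f E" for e
        using that *(4) y'(1) by (auto intro: Sp_add)
      moreover have "x + K k * mono \<alpha> A \<beta> \<approx> x0 + (\<Sum>e\<in>insert f E. s e * y' e)"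
        unfolding y'(2) using cg_add[OF *(5) cg_refl, of "K k * mono \<alpha> A \<beta>"] Cons
        by (simp add: algebra_simps mono_def K_left_commute)
      moreover have "insert f E \<subseteq> edges G" using * Sp_mono Cons by auto
      ultimately show ?thesis using *(1,3) by blast
    qed
  qed
  then show thesis using that by blast
qed

end

section \<open>Homogeneous elements\<close>

context leavitt_ideal
begin

definition Hom :: "int \<Rightarrow> 'a set" where
  "Hom n = Sp (\<lambda>\<alpha> \<beta>. int (length \<alpha>) - int (length \<beta>) = n)"

text \<open>Multipliers of degree \<open>d\<close>. They replace \<open>Hom d\<close> on the outside
  of products because \<open>1\<close> and \<open>gap E\<close> act with degree \<open>0\<close> but
  need not belong to \<open>Hom 0\<close>.\<close>

definition LM :: "int \<Rightarrow> 'a set" where "LM d = {a. \<forall>n. \<forall>y\<in>Hom n. a * y \<in> Hom (n + d)}"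

definition RM :: "int \<Rightarrow> 'a set" where "RM d = {b. \<forall>n. \<forall>y\<in>Hom n. y * b \<in> Hom (n + d)}"

lemma LM_one: "1 \<in> LM 0" and RM_one: "1 \<in> RM 0"
  by (simp_all add: LM_def RM_def)

lemma LM_mult: "a \<in> LM i \<Longrightarrow> b \<in> LM j \<Longrightarrow> a * b \<in> LM (i + j)"
  unfolding LM_def by (auto simp: mult.assoc) (metis add.assoc add.commute)

lemma RM_mult: "a \<in> RM i \<Longrightarrow> b \<in> RM j \<Longrightarrow> a * b \<in> RM (i + j)"
  unfolding RM_def by (auto simp flip: mult.assoc) (metis add.assoc)

lemma LM_diff: "a \<in> LM i \<Longrightarrow> b \<in> LM i \<Longrightarrow> a - b \<in> LM i"
  and RM_diff: "a \<in> RM i \<Longrightarrow> b \<in> RM i \<Longrightarrow> a - b \<in> RM i"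
  unfolding LM_def RM_def Hom_def by (auto simp: algebra_simps intro: Sp_diff)

lemma LM_sum: "(\<And>e. e \<in> E \<Longrightarrow> f e \<in> LM i) \<Longrightarrow> sum f E \<in> LM i"
  and RM_sum: "(\<And>e. e \<in> E \<Longrightarrow> f e \<in> RM i) \<Longrightarrow> sum f E \<in> RM i"
  unfolding LM_def RM_def Hom_def by (auto simp: sum_distrib_left sum_distrib_right intro!: Sp_sum)

lemma LM_K: "K k \<in> LM 0"
  unfolding LM_def Hom_def by (auto intro: Sp_K)

lemma LM_p: "A \<in> gsets G \<Longrightarrow> p A \<in> LM 0" and RM_p: "A \<in> gsets G \<Longrightarrow> p A \<in> RM 0"
  unfolding LM_def RM_def Hom_def by (auto intro: p_Sp Sp_p)

lemma LM_s: "e \<in> edges G \<Longrightarrow> s e \<in> LM 1"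
  unfolding LM_def Hom_def by (auto intro: s_Sp)

lemma RM_t: "e \<in> edges G \<Longrightarrow> t e \<in> RM (-1)"
  unfolding RM_def Hom_def by (auto intro: Sp_t)

lemma LM_t: "e \<in> edges G \<Longrightarrow> t e \<in> LM (-1)"
  unfolding LM_def Hom_def by (auto intro: t_Sp)

lemma RM_s: "e \<in> edges G \<Longrightarrow> s e \<in> RM 1"
  unfolding RM_def Hom_def by (auto intro: Sp_s)

lemma RM_sp: "set \<alpha> \<subseteq> edges G \<Longrightarrow> sp \<alpha> \<in> RM (int (length \<alpha>))"
proof (induction \<alpha>)
  case (Cons e \<alpha>)
  then show ?case using RM_mult[OF RM_s, of e "sp \<alpha>" "int (length \<alpha>)"] by (simp add: add.commute)
qed (simp add: RM_one)

lemma LM_st: "set \<alpha> \<subseteq> edges G \<Longrightarrow> st \<alpha> \<in> LM (- int (length \<alpha>))"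
proof (induction \<alpha>)
  case (Cons e \<alpha>)
  then show ?case using LM_mult[OF _ LM_t, of "st \<alpha>" "- int (length \<alpha>)" e]
    by (simp add: algebra_simps)
qed (simp add: LM_one)

lemma HomLD: "a \<in> LM i \<Longrightarrow> y \<in> Hom n \<Longrightarrow> a * y \<in> Hom (n + i)"
  and HomRD: "b \<in> RM i \<Longrightarrow> y \<in> Hom n \<Longrightarrow> y * b \<in> Hom (n + i)"
  by (auto simp: LM_def RM_def)

lemma p_in_Hom: "A \<in> gsets G \<Longrightarrow> p A \<in> Hom 0"
  using mono_in_Sp[of A "[]" "[]"] by (simp add: mono_def Hom_def)

lemma Sp_False: "x \<in> Sp \<Phi> \<Longrightarrow> (\<And>\<alpha> \<beta>. \<not> \<Phi> \<alpha> \<beta>) \<Longrightarrow> x \<in> P"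
  using Sp_image_P[of x \<Phi> 1 1] by simp

lemma Sp_bounded:
  "x \<in> Sp \<Phi> \<Longrightarrow> \<exists>N. x \<in> Sp (\<lambda>\<alpha> \<beta>. \<Phi> \<alpha> \<beta> \<and> length \<alpha> \<le> N \<and> length \<beta> \<le> N)"
proof (induction x rule: Sp.induct)
  case (Sp_mono x A \<alpha> \<beta> k)
  then obtain N where N: "x \<in> Sp (\<lambda>\<alpha> \<beta>. \<Phi> \<alpha> \<beta> \<and> length \<alpha> \<le> N \<and> length \<beta> \<le> N)" by blast
  let ?N = "max N (max (length \<alpha>) (length \<beta>))"
  have "x \<in> Sp (\<lambda>\<alpha> \<beta>. \<Phi> \<alpha> \<beta> \<and> length \<alpha> \<le> ?N \<and> length \<beta> \<le> ?N)"
    using N by (rule Sp_weaken) auto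
  then have "x + K k * mono \<alpha> A \<beta> \<in> Sp (\<lambda>\<alpha> \<beta>. \<Phi> \<alpha> \<beta> \<and> length \<alpha> \<le> ?N \<and> length \<beta> \<le> ?N)"
    using Sp_mono by (intro Sp.Sp_mono) auto
  then show ?case by blast
qed (auto intro: Sp.Sp_P)

lemma t_sum_s:
  assumes "finite E" "E \<subseteq> edges G" "e \<in> edges G"
  shows "t e * (\<Sum>f\<in>E. s f * y f) \<approx> (if e \<in> E then p (rng G e) * y e else 0)"
proof -
  have "t e * (\<Sum>f\<in>E. s f * y f) = (\<Sum>f\<in>E. t e * s f * y f)"
    by (simp add: sum_distrib_left mult.assoc)
  also have "\<dots> \<approx> (\<Sum>f\<in>E. if f = e then p (rng G e) * y e else 0)"
  proof (rule cg_sum)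
    fix f assume "f \<in> E"
    then have f: "f \<in> edges G" using assms by blast
    show "t e * s f * y f \<approx> (if f = e then p (rng G e) * y e else 0)"
      using cg_right[OF t_s_same, of e "y e"] cg_right[OF t_s_diff, of e f "y f"] f assms by auto
  qed
  also have "\<dots> = (if e \<in> E then p (rng G e) * y e else 0)" using assms by simp
  finally show ?thesis .
qed

lemma sum_t_s:
  assumes "finite E" "E \<subseteq> edges G" "e \<in> edges G"
  shows "(\<Sum>f\<in>E. y f * t f) * s e \<approx> (if e \<in> E then y e * p (rng G e) else 0)"
proof -
  have "(\<Sum>f\<in>E. y f * t f) * s e = (\<Sum>f\<in>E. y f * (t f * s e))"
    by (simp add: sum_distrib_right mult.assoc)
  also have "\<dots> \<approx> (\<Sum>f\<in>E. if f = e then y e * p (rng G e) else 0)"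
  proof (rule cg_sum)
    fix f assume "f \<in> E"
    then have f: "f \<in> edges G" using assms by blast
    show "y f * (t f * s e) \<approx> (if f = e then y e * p (rng G e) else 0)"
      using cg_left[OF t_s_same, of e "y e"] cg_left[OF t_s_diff, of f e "y f"] f assms by auto
  qed
  also have "\<dots> = (if e \<in> E then y e * p (rng G e) else 0)" using assms by simp
  finally show ?thesis .
qed

text \<open>The complement of finitely many range projections. If \<open>E\<close> consists of edges
  with source \<open>v\<close>, its product with \<open>p {v}\<close> is the Cuntz-Krieger defect at
  \<open>v\<close>, and for a breaking vertex with its surviving edges the generator
  \<open>p_v^H\<close>.\<close>

definition gap :: "'e set \<Rightarrow> 'a" where "gap E = 1 - (\<Sum>e\<in>E. s e * t e)"

lemma gap_s:
  assumes "finite E" "E \<subseteq> edges G" "e \<in> edges G"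
  shows "gap E * s e \<approx> (if e \<in> E then 0 else s e)"
proof -
  have "gap E * s e \<approx> s e - (if e \<in> E then s e * p (rng G e) else 0)"
    unfolding gap_def left_diff_distrib mult_1_left
    using assms by (intro cg_diff cg_refl sum_t_s)
  also have "\<dots> \<approx> s e - (if e \<in> E then s e else 0)"
    using s_rng assms by (intro cg_diff cg_refl) auto
  finally show ?thesis by (simp split: if_splits)
qed

lemma t_gap:
  assumes "finite E" "E \<subseteq> edges G" "e \<in> edges G"
  shows "t e * gap E \<approx> (if e \<in> E then 0 else t e)"
proof -
  have "t e * gap E \<approx> t e - (if e \<in> E then p (rng G e) * t e else 0)"
    unfolding gap_def right_diff_distrib mult_1_right
    using assms by (intro cg_diff cg_refl t_sum_s)
  also have "\<dots> \<approx> t e - (if e \<in> E then t e else 0)"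
    using rng_t assms by (intro cg_diff cg_refl) auto
  finally show ?thesis by (simp split: if_splits)
qed

lemma LM_st_prod: "e \<in> edges G \<Longrightarrow> s e * t e \<in> LM 0" and RM_st_prod: "e \<in> edges G \<Longrightarrow> s e * t e \<in> RM 0"
  using LM_mult[OF LM_s LM_t, of e e] RM_mult[OF RM_s RM_t, of e e] by auto

lemma LM_gap: "E \<subseteq> edges G \<Longrightarrow> gap E \<in> LM 0" and RM_gap: "E \<subseteq> edges G \<Longrightarrow> gap E \<in> RM 0"
  unfolding gap_def
  by (intro LM_diff LM_one LM_sum LM_st_prod; blast)
    (intro RM_diff RM_one RM_sum RM_st_prod; blast)


subsection \<open>Reduction of homogeneous elements\<close>

text \<open>Models a sink modulo \<open>P\<close>, or what remains of a vertex once its finitely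
  many surviving edges are split off. It is the only alternative to \<open>p A\<close> at the end of
  a reduction.\<close>

definition terminal :: "'a \<Rightarrow> bool" where
  "terminal q \<longleftrightarrow> (\<forall>e\<in>edges G. q * s e \<in> P \<and> t e * q \<in> P) \<and> q * q \<approx> q"

text \<open>A monomial of nonzero degree has a nonempty word on one side, whose outermost edge dies
  against \<open>q\<close>.\<close>

lemma terminal_kills:
  assumes "terminal q" "z \<in> Hom n" "n \<noteq> 0"
  shows "q * z * q \<in> P"
  using assms(2) unfolding Hom_def
proof (rule Sp_image_P)
  fix A \<alpha> \<beta> assume *: "A \<in> gsets G" "set \<alpha> \<subseteq> edges G" "set \<beta> \<subseteq> edges G"
    "int (length \<alpha>) - int (length \<beta>) = n"
  show "q * mono \<alpha> A \<beta> * q \<in> P"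
  proof (cases \<alpha>)
    case (Cons e \<gamma>)
    then have "q * s e * (sp \<gamma> * p A * st \<beta> * q) \<in> P"
      using * assms(1) by (intro P_right[of "q * s e"]) (auto simp: terminal_def)
    then show ?thesis using Cons by (simp add: mono_def mult.assoc)
  next
    case Nil
    then obtain e \<gamma> where \<beta>: "\<beta> = e # \<gamma>" using * assms(3) by (cases \<beta>) auto
    then have "q * sp \<alpha> * p A * st \<gamma> * (t e * q) \<in> P"
      using * assms(1) by (intro P_left[of "t e * q"]) (auto simp: terminal_def)
    then show ?thesis using \<beta> by (simp add: mono_def mult.assoc)
  qed
qed

text \<open>A combination of projections \<open>p A\<close> is a step function: it is a scalar on
  every piece that none of the finitely many sets cuts, and the union of these sets provides the
  left unit \<open>p B\<close>.\<close>

lemma degree_zero_diagonal: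
  "x \<in> Sp (\<lambda>\<alpha> \<beta>. \<alpha> = [] \<and> \<beta> = []) \<Longrightarrow> \<exists>F B. finite F \<and> F \<subseteq> gsets G \<and> B \<in> gsets G \<and> p B * x \<approx> x \<and>
    (\<forall>C\<in>gsets G. (\<forall>A\<in>F. C \<subseteq> A \<or> C \<inter> A = {}) \<longrightarrow> (\<exists>k. p C * x \<approx> K k * p C))"
proof (induction x rule: Sp.induct)
  case (Sp_P x)
  have 1: "p {} * x \<approx> x" unfolding cg_def by (intro P_diff P_left Sp_P)
  have 2: "p C * x \<approx> K 0 * p C" for C using P_left[OF Sp_P, of "p C"] by (simp add: cg_def K_zero)
  have 3: "\<forall>C\<in>gsets G. (\<forall>A\<in>{}. C \<subseteq> A \<or> C \<inter> A = {}) \<longrightarrow> (\<exists>k. p C * x \<approx> K k * p C)"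
  proof (intro ballI impI)
    fix C show "\<exists>k. p C * x \<approx> K k * p C" by (rule exI[of _ 0], rule 2)
  qed
  show ?case
    by (rule exI[of _ "{}"], rule exI[of _ "{}"], intro conjI)
      (rule finite.emptyI, rule empty_subsetI, rule gsets.empty, rule 1, rule 3)
next
  case (Sp_mono x A \<alpha> \<beta> k)
  from Sp_mono.IH obtain F B where *: "finite F" "F \<subseteq> gsets G" "B \<in> gsets G" "p B * x \<approx> x"
    and Cx: "\<forall>C\<in>gsets G. (\<forall>A\<in>F. C \<subseteq> A \<or> C \<inter> A = {}) \<longrightarrow> (\<exists>k. p C * x \<approx> K k * p C)"
    by (elim exE conjE) (rule that)
  have A: "A \<in> gsets G" and BA: "B \<union> A \<in> gsets G" using Sp_mono * gsets.union by auto
  have m: "mono \<alpha> A \<beta> = p A" using Sp_mono by (simp add: mono_def)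
  have "p (B \<union> A) * x \<approx> p (B \<union> A) * (p B * x)" by (intro cg_left cg_sym[OF *(4)])
  also have "\<dots> = p (B \<union> A) * p B * x" by (simp add: mult.assoc)
  also have "\<dots> \<approx> p ((B \<union> A) \<inter> B) * x" by (intro cg_right p_p BA *)
  also have "(B \<union> A) \<inter> B = B" by blast
  also have "p B * x \<approx> x" by fact
  finally have 1: "p (B \<union> A) * x \<approx> x" .
  have "p (B \<union> A) * p A \<approx> p ((B \<union> A) \<inter> A)" by (intro p_p BA A)
  also have "(B \<union> A) \<inter> A = A" by blast
  finally have 2: "p (B \<union> A) * p A \<approx> p A" .
  have "p (B \<union> A) * (x + K k * mono \<alpha> A \<beta>) \<approx> x + K k * mono \<alpha> A \<beta>"
    unfolding m distrib_left K_left_commute[of "p (B \<union> A)"] using 1 2 by (intro cg_add cg_left)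
  moreover have "\<exists>k'. p C * (x + K k * mono \<alpha> A \<beta>) \<approx> K k' * p C"
    if C: "C \<in> gsets G" "\<forall>D\<in>insert A F. C \<subseteq> D \<or> C \<inter> D = {}" for C
  proof -
    have "\<forall>A\<in>F. C \<subseteq> A \<or> C \<inter> A = {}" using C(2) by simp
    then obtain l where l: "p C * x \<approx> K l * p C" using Cx C(1) by blast
    have "p C * p A \<approx> p (C \<inter> A)" by (intro p_p C A)
    moreover have "C \<inter> A = C \<or> C \<inter> A = {}" using C by auto
    ultimately have "p C * p A \<approx> K 1 * p C \<or> p C * p A \<approx> K 0 * p C"
      using cg_trans[OF _ p_empty] by (auto simp: K_one K_zero)
    then obtain l' where l': "p C * p A \<approx> K l' * p C" by blast
    have "p C * (x + K k * mono \<alpha> A \<beta>) \<approx> K l * p C + K k * (K l' * p C)"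
      unfolding m distrib_left K_left_commute[of "p C"] using l l' by (intro cg_add cg_left)
    also have "\<dots> = K (l + k * l') * p C" by (simp add: K_add K_mult algebra_simps)
    finally show ?thesis by blast
  qed
  then have "\<forall>C\<in>gsets G. (\<forall>D\<in>insert A F. C \<subseteq> D \<or> C \<inter> D = {}) \<longrightarrow>
      (\<exists>k'. p C * (x + K k * mono \<alpha> A \<beta>) \<approx> K k' * p C)"
    by blast
  moreover have "finite (insert A F)" "insert A F \<subseteq> gsets G" using *(1,2) A by auto
  ultimately show ?case using BA
    by (rule_tac exI[of _ "insert A F"], rule_tac exI[of _ "B \<union> A"]) (intro conjI)
qed

text \<open>The factor \<open>z\<close> is a test element that has to survive next to the chosen
  piece; it will be \<open>1\<close> or some \<open>gap E\<close>.\<close>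

lemma reduce_degree_zero:
  assumes "x \<in> Sp (\<lambda>\<alpha> \<beta>. \<alpha> = [] \<and> \<beta> = [])" "x * z \<notin> P"
  obtains A k where "A \<in> gsets G" "k \<noteq> 0" "p A * x \<approx> K k * p A" "p A * z \<notin> P"
proof -
  from degree_zero_diagonal[OF assms(1)]
  obtain F B where *: "finite F" "F \<subseteq> gsets G" "B \<in> gsets G" "p B * x \<approx> x"
    and diag: "\<forall>C\<in>gsets G. (\<forall>A\<in>F. C \<subseteq> A \<or> C \<inter> A = {}) \<longrightarrow> (\<exists>k. p C * x \<approx> K k * p C)"
    by (elim exE conjE) (rule that)
  have "p B * x * z \<approx> x * z" by (intro cg_right *)
  then have "1 * p B * (x * z) \<notin> P" using assms(2) cg_P by (simp add: mult.assoc)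
  then obtain C where C: "C \<in> gsets G" "1 * p C * (x * z) \<notin> P" "\<And>A. A \<in> F \<Longrightarrow> C \<subseteq> A \<or> C \<inter> A = {}"
    by (rule gset_refine[OF *(1,2,3)]) (rule that)
  have "\<forall>A\<in>F. C \<subseteq> A \<or> C \<inter> A = {}" using C(3) by simp
  then obtain k where k: "p C * x \<approx> K k * p C" using diag C(1) by blast
  have "p C * x * z \<approx> K k * p C * z" by (intro cg_right k)
  then have kz: "K k * (p C * z) \<notin> P" using C(2) cg_P by (simp add: mult.assoc)
  then have "k \<noteq> 0" using K_zero P_zero by auto
  moreover have "p C * z \<notin> P" using kz P_left by blast
  ultimately show thesis using that C(1) k by blast
qed

text \<open>A suitable \<open>t e\<close> on the left strips one edge. If no \<open>t e\<close> kept
  \<open>x * z\<close> alive, neither would the sum of all \<open>s e * t e * x * z\<close>, which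
  is congruent to \<open>x * z\<close>.\<close>

lemma reduce_paths:
  assumes "x \<in> Sp (\<lambda>\<alpha> \<beta>. \<beta> = [] \<and> length \<alpha> = n)" "x * z \<notin> P"
  shows "\<exists>a A. a \<in> LM (- int n) \<and> A \<in> gsets G \<and> a * x \<approx> p A \<and> p A * z \<notin> P"
  using assms
proof (induction n arbitrary: x)
  case 0
  have "x \<in> Sp (\<lambda>\<alpha> \<beta>. \<alpha> = [] \<and> \<beta> = [])" using 0(1) by (rule Sp_weaken) auto
  then obtain A k where A: "A \<in> gsets G" "k \<noteq> 0" "p A * x \<approx> K k * p A" "p A * z \<notin> P"
    by (rule reduce_degree_zero[OF _ 0(2)]) (rule that)
  have "K (inverse k) * p A * x \<approx> K (inverse k) * (K k * p A)"
    unfolding mult.assoc by (intro cg_left A)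
  also have "\<dots> = p A" using A(2) K_mult[of "inverse k" k] by (simp add: K_one flip: mult.assoc)
  finally have "K (inverse k) * p A * x \<approx> p A" .
  moreover have "K (inverse k) * p A \<in> LM 0" using LM_mult[OF LM_K LM_p[OF A(1)]] by simp
  ultimately show ?case using A by auto
next
  case (Suc n)
  obtain x0 E y where E: "finite E" "E \<subseteq> edges G"
    and x0: "x0 \<in> Sp (\<lambda>\<alpha> \<beta>. \<alpha> = [] \<and> \<beta> = [] \<and> length ([]::'e list) = Suc n)"
    and x: "x \<approx> x0 + (\<Sum>e\<in>E. s e * y e)"
    by (rule Sp_decompose_left[OF Suc.prems(1)]) (rule that)
  have "x0 \<in> P" using x0 by (rule Sp_False) auto
  then have x': "x \<approx> (\<Sum>e\<in>E. s e * y e)"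
    using cg_trans[OF x] P_uminus by (force simp: cg_def)
  have t: "t e * x \<approx> p (rng G e) * y e" if "e \<in> E" for e
    using cg_trans[OF cg_left[OF x'] t_sum_s[OF E, of e y]] that E by auto
  have "\<exists>e\<in>E. t e * x * z \<notin> P"
  proof (rule ccontr)
    assume *: "\<not> (\<exists>e\<in>E. t e * x * z \<notin> P)"
    have "s e * y e * z \<in> P" if e: "e \<in> E" for e
    proof -
      have "s e * y e * z \<approx> s e * p (rng G e) * y e * z"
        using e E by (intro cg_right cg_sym[OF s_rng]) auto
      also have "\<dots> = s e * (p (rng G e) * y e * z)" by (simp add: mult.assoc)
      also have "\<dots> \<approx> s e * (t e * x * z)" using e by (intro cg_left cg_right cg_sym[OF t])
      finally show ?thesis using * e cg_P P_left by blast
    qed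
    then have "(\<Sum>e\<in>E. s e * y e) * z \<in> P"
      unfolding sum_distrib_right by (rule P_sum)
    then show False using cg_P[OF cg_right[OF x']] Suc.prems(2) by blast
  qed
  then obtain e where e: "e \<in> edges G" "t e * x * z \<notin> P" using E by blast
  have "t e * x \<in> Sp (\<lambda>\<alpha> \<beta>. \<beta> = [] \<and> length \<alpha> = n)"
    using Suc.prems(1) e(1) by (rule t_Sp) auto
  then obtain a A where a: "a \<in> LM (- int n)" "A \<in> gsets G" "a * (t e * x) \<approx> p A" "p A * z \<notin> P"
    using Suc.IH e(2) by blast
  then show ?case using LM_mult[OF a(1) LM_t[OF e(1)]]
    by (intro exI[of _ "a * t e"]) (auto simp: mult.assoc algebra_simps)
qed

text \<open>The condition \<open>y * s e \<in> P\<close> determines the part of \<open>y\<close>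
  ending in \<open>t e\<close>: it must be \<open>- x0 * s e * t e\<close>. Summing over
  \<open>e\<close> turns \<open>x0\<close> into \<open>x0 * gap E\<close>.\<close>

lemma Sp_stuck_right:
  assumes y: "y \<in> Sp \<Phi>" and stuck: "\<And>e. e \<in> edges G \<Longrightarrow> y * s e \<in> P"
  obtains x0 E where "finite E" "E \<subseteq> edges G" "x0 \<in> Sp (\<lambda>\<alpha> \<beta>. \<beta> = [] \<and> \<Phi> \<alpha> [])" "y \<approx> x0 * gap E"
proof -
  obtain x0 E z where E: "finite E" "E \<subseteq> edges G"
    and x0: "x0 \<in> Sp (\<lambda>\<alpha> \<beta>. \<beta> = [] \<and> \<Phi> \<alpha> [])"
    and yz: "y \<approx> x0 + (\<Sum>e\<in>E. z e * t e)"
    by (rule Sp_decompose_right[OF y]) (rule that)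
  have ze: "z e * t e \<approx> - (x0 * s e * t e)" if e: "e \<in> E" for e
  proof -
    have "y * s e \<approx> x0 * s e + (\<Sum>e\<in>E. z e * t e) * s e"
      using cg_right[OF yz] by (simp add: distrib_right)
    also have "\<dots> \<approx> x0 * s e + z e * p (rng G e)"
      using cg_add[OF cg_refl sum_t_s[OF E, of e z]] e E by auto
    finally have "x0 * s e + z e * p (rng G e) \<in> P" using stuck e E cg_P by blast
    then have "(x0 * s e + z e * p (rng G e)) * t e \<in> P" by (rule P_right)
    then have "z e * (p (rng G e) * t e) \<approx> - (x0 * s e * t e)"
      by (simp add: cg_def algebra_simps)
    moreover have "z e * t e \<approx> z e * (p (rng G e) * t e)"
      using e E by (intro cg_left cg_sym[OF rng_t]) auto
    ultimately show ?thesis using cg_trans by blast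
  qed
  have "y \<approx> x0 + (\<Sum>e\<in>E. - (x0 * s e * t e))"
    using cg_trans[OF yz cg_add[OF cg_refl cg_sum[OF ze]]] by blast
  also have "\<dots> = x0 * gap E"
    by (simp add: gap_def right_diff_distrib sum_distrib_left sum_negf mult.assoc)
  finally have "y \<approx> x0 * gap E" .
  then show thesis by (rule that[OF E x0])
qed

text \<open>Stripping the left words of \<open>x0\<close> against the test element
  \<open>gap E\<close> leaves \<open>p A * gap E\<close>, which is terminal because \<open>y\<close>
  was stuck.\<close>

lemma reduce_stuck:
  assumes y: "y \<in> Sp (\<lambda>\<alpha> \<beta>. length \<beta> \<le> Suc N \<and> int (length \<alpha>) - int (length \<beta>) = n)" "y \<notin> P"
    and stuck: "\<And>e. e \<in> edges G \<Longrightarrow> y * s e \<in> P"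
  obtains a q where "a \<in> LM (- n)" "a * y \<approx> q" "q \<notin> P" "q \<in> LM 0" "q \<in> RM 0" "terminal q"
proof -
  obtain x0 E where E: "finite E" "E \<subseteq> edges G"
    and x0: "x0 \<in> Sp (\<lambda>\<alpha> \<beta>. \<beta> = [] \<and> length ([]::'e list) \<le> Suc N \<and>
      int (length \<alpha>) - int (length ([]::'e list)) = n)"
    and yx: "y \<approx> x0 * gap E"
    by (rule Sp_stuck_right[OF y(1) stuck]) (assumption, rule that)
  then have nP: "x0 * gap E \<notin> P" using y(2) cg_P by blast
  have "n \<ge> 0"
  proof (rule ccontr)
    assume "\<not> n \<ge> 0"
    then have "x0 \<in> P" using Sp_False[OF x0] by auto
    then show False using nP P_right by blast
  qed
  have "x0 \<in> Sp (\<lambda>\<alpha> \<beta>. \<beta> = [] \<and> length \<alpha> = nat n)"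
    using x0 by (rule Sp_weaken) auto
  from reduce_paths[OF this nP]
  obtain a A where a: "a \<in> LM (- n)" "A \<in> gsets G" "a * x0 \<approx> p A" "p A * gap E \<notin> P"
    using \<open>n \<ge> 0\<close> by auto
  let ?q = "p A * gap E"
  have ay: "a * y \<approx> ?q"
    using cg_trans[OF cg_left[OF yx, of a] cg_right[OF a(3), of "gap E", unfolded mult.assoc]]
    by simp
  have qs: "?q * s e \<in> P" if e: "e \<in> edges G" for e
    using cg_P[OF cg_right[OF ay]] P_left[OF stuck[OF e], of a] by (simp add: mult.assoc)
  have tq: "t e * ?q \<in> P" if e: "e \<in> edges G" for e
  proof (cases "src G e \<in> A")
    case False
    have "t e * p A * gap E \<approx> 0 * gap E" by (intro cg_right t_p_notin a e False)
    then show ?thesis by (simp add: P_iff_cg mult.assoc)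
  next
    case True
    have 1: "t e * ?q \<approx> t e * gap E"
      using cg_right[OF t_p_in[OF a(2) e True], of "gap E"] by (simp add: mult.assoc)
    \<comment> \<open>For an edge outside \<open>E\<close> one has
      \<open>?q * s e \<approx> s e\<close>, while \<open>?q * s e \<in> P\<close> is inherited from
      \<open>y\<close>. So \<open>s e\<close>, and with it \<open>t e\<close>, is in
      \<open>P\<close>.\<close>
    have "t e * gap E \<in> P"
    proof (cases "e \<in> E")
      case True
      then show ?thesis using t_gap[OF E e] by (simp add: P_iff_cg)
    next
      case False
      have "?q * s e \<approx> p A * s e"
        using cg_left[OF gap_s[OF E e], of "p A"] False by (simp add: mult.assoc)
      also have "\<dots> \<approx> s e" by (intro p_s_in a e True)
      finally have "s e \<in> P" using qs e cg_P by blast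
      then have "t e \<in> P" using s_P_iff t_P_iff e by blast
      then show ?thesis by (rule P_right)
    qed
    then show ?thesis using cg_P[OF 1] by blast
  qed
  have "gap E * ?q = ?q - (\<Sum>e\<in>E. s e * (t e * ?q))"
    by (simp add: gap_def left_diff_distrib sum_distrib_right mult.assoc)
  also have "\<dots> \<approx> ?q - 0"
  proof (intro cg_diff cg_refl)
    have "(\<Sum>e\<in>E. s e * (t e * ?q)) \<in> P" using E by (intro P_sum P_left tq) auto
    then show "(\<Sum>e\<in>E. s e * (t e * ?q)) \<approx> 0" by (simp add: P_iff_cg)
  qed
  finally have "?q * ?q \<approx> p A * ?q"
    using cg_left[of "gap E * ?q" ?q "p A"] by (simp add: mult.assoc)
  also have "\<dots> = p A * p A * gap E" by (simp add: mult.assoc)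
  also have "\<dots> \<approx> p (A \<inter> A) * gap E" by (intro cg_right p_p a)
  finally have "?q * ?q \<approx> ?q" by simp
  then have "terminal ?q" unfolding terminal_def using qs tq by blast
  moreover have "?q \<in> LM 0" "?q \<in> RM 0"
    using LM_mult[OF LM_p[OF a(2)] LM_gap[OF E(2)]] RM_mult[OF RM_p[OF a(2)] RM_gap[OF E(2)]]
    by simp_all
  ultimately show thesis using that a ay by blast
qed

text \<open>Some \<open>s e\<close> on the right shortens the right words as long as one keeps
  \<open>y\<close> alive; when none does, \<open>y\<close> is stuck. Only multipliers of known
  degree occur, so the same compression can be applied to the other components of a sum.\<close>

lemma reduce_homogeneous_bounded:
  assumes "y \<in> Sp (\<lambda>\<alpha> \<beta>. length \<beta> \<le> N \<and> int (length \<alpha>) - int (length \<beta>) = n)" "y \<notin> P"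
  shows "\<exists>i j a b q. a \<in> LM i \<and> b \<in> RM j \<and> i + j + n = 0 \<and> a * y * b \<approx> q \<and> q \<notin> P \<and>
    ((\<exists>A\<in>gsets G. q = p A) \<or> q \<in> LM 0 \<and> q \<in> RM 0 \<and> terminal q)"
  using assms
proof (induction N arbitrary: y n)
  case 0
  have "n \<ge> 0"
  proof (rule ccontr)
    assume "\<not> n \<ge> 0"
    then show False using Sp_False[OF 0(1)] 0(2) by auto
  qed
  have "y \<in> Sp (\<lambda>\<alpha> \<beta>. \<beta> = [] \<and> length \<alpha> = nat n)"
    using 0(1) by (rule Sp_weaken) auto
  moreover have "y * 1 \<notin> P" using 0 by simp
  ultimately have "\<exists>a A. a \<in> LM (- int (nat n)) \<and> A \<in> gsets G \<and> a * y \<approx> p A \<and> p A * 1 \<notin> P"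
    by (rule reduce_paths)
  then obtain a A where "a \<in> LM (- n)" "A \<in> gsets G" "a * y \<approx> p A" "p A * 1 \<notin> P"
    using \<open>n \<ge> 0\<close> by auto
  then show ?case using RM_one
    by (intro exI[of _ "- n"] exI[of _ 0] exI[of _ a] exI[of _ 1] exI[of _ "p A"] conjI)
      (simp_all, blast)
next
  case (Suc N)
  show ?case
  proof (cases "\<exists>e\<in>edges G. y * s e \<notin> P")
    case True
    then obtain e where e: "e \<in> edges G" "y * s e \<notin> P" by blast
    have "y * s e \<in> Sp (\<lambda>\<alpha> \<beta>. length \<beta> \<le> N \<and> int (length \<alpha>) - int (length \<beta>) = n + 1)"
      using Suc.prems(1) e(1) by (rule Sp_s) auto
    from Suc.IH[OF this e(2)] obtain i j a b q where *: "a \<in> LM i" "b \<in> RM j" "i + j + (n + 1) = 0"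
      "a * (y * s e) * b \<approx> q" "q \<notin> P"
      "(\<exists>A\<in>gsets G. q = p A) \<or> q \<in> LM 0 \<and> q \<in> RM 0 \<and> terminal q" by blast
    have "s e * b \<in> RM (1 + j)" by (intro RM_mult RM_s e *)
    then show ?thesis using *
      by (intro exI[of _ i] exI[of _ "1 + j"] exI[of _ a] exI[of _ "s e * b"] exI[of _ q] conjI)
        (simp_all add: mult.assoc)
  next
    case False
    then have stuck: "\<And>e. e \<in> edges G \<Longrightarrow> y * s e \<in> P" by blast
    obtain a q where "a \<in> LM (- n)" "a * y \<approx> q" "q \<notin> P" "q \<in> LM 0" "q \<in> RM 0" "terminal q"
      by (rule reduce_stuck[OF Suc.prems stuck]) (assumption, rule that)
    then show ?thesis using RM_one
      by (intro exI[of _ "- n"] exI[of _ 0] exI[of _ a] exI[of _ 1] exI[of _ q] conjI) simp_all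
  qed
qed

lemma reduce_homogeneous:
  assumes "y \<in> Hom n" "y \<notin> P"
  shows "\<exists>i j a b q. a \<in> LM i \<and> b \<in> RM j \<and> i + j + n = 0 \<and> a * y * b \<approx> q \<and> q \<notin> P \<and>
    ((\<exists>A\<in>gsets G. q = p A) \<or> q \<in> LM 0 \<and> q \<in> RM 0 \<and> terminal q)"
proof -
  obtain N where "y \<in> Sp (\<lambda>\<alpha> \<beta>. int (length \<alpha>) - int (length \<beta>) = n \<and> length \<alpha> \<le> N \<and> length \<beta> \<le> N)"
    using Sp_bounded[OF assms(1)[unfolded Hom_def]] by blast
  then have "y \<in> Sp (\<lambda>\<alpha> \<beta>. length \<beta> \<le> N \<and> int (length \<alpha>) - int (length \<beta>) = n)"
    by (rule Sp_weaken) auto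
  then show ?thesis using reduce_homogeneous_bounded assms(2) by blast
qed


subsection \<open>Minimal inhomogeneous elements\<close>

definition homogeneous_sum :: "int set \<Rightarrow> (int \<Rightarrow> 'a) \<Rightarrow> bool" where
  "homogeneous_sum S y \<longleftrightarrow> finite S \<and> (\<forall>n\<in>S. y n \<in> Hom n) \<and> sum y S \<in> P"

text \<open>The components of a minimal inhomogeneous element of \<open>P\<close> behave alike under
  multiplication by homogeneous elements.\<close>

definition linked :: "int set \<Rightarrow> (int \<Rightarrow> 'a) \<Rightarrow> bool" where
  "linked S y \<longleftrightarrow> (\<forall>i j a b. \<forall>n\<in>S. \<forall>n'\<in>S. a \<in> LM i \<longrightarrow> b \<in> RM j \<longrightarrow> a * y n * b \<in> P \<longrightarrow> a * y n' * b \<in> P)"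

text \<open>A second index in \<open>S\<close> witnesses inhomogeneity. Its component is not in
  \<open>P\<close> either, since linkedness with \<open>a = b = 1\<close> would then put
  \<open>q\<close> into \<open>P\<close>.\<close>

definition linked_to :: "'a \<Rightarrow> bool" where
  "linked_to q \<longleftrightarrow> q \<notin> P \<and>
    (\<exists>S y. homogeneous_sum S y \<and> 0 \<in> S \<and> S \<noteq> {0} \<and> y 0 = q \<and> linked S y)"

text \<open>Linkedness survives compression by multipliers; all degrees are shifted by
  \<open>n\<close> so that the distinguished component lands in degree \<open>0\<close>.\<close>

lemma linked_to_transform:
  assumes "homogeneous_sum S y" "linked S y" "n \<in> S" "S \<noteq> {n}"
    and ab: "a \<in> LM i" "b \<in> RM j" "i + j + n = 0" and q: "a * y n * b \<approx> q" "q \<notin> P"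
    and q0: "q \<in> Hom 0"
  shows "linked_to q"
proof -
  define S' where "S' = (\<lambda>m. m - n) ` S"
  \<comment> \<open>At \<open>0\<close> the value is \<open>q\<close> itself, which agrees with the
    compressed component only modulo \<open>P\<close>.\<close>
  define y' where "y' m = (if m = 0 then q else a * y (m + n) * b)" for m
  have cg: "y' (m - n) \<approx> a * y m * b" for m
    using q(1) cg_sym by (simp add: y'_def)
  have "y' (m - n) \<in> Hom (m - n)" if "m \<in> S" for m
  proof (cases "m = n")
    case False
    have "y m \<in> Hom m" using assms(1) that by (simp add: homogeneous_sum_def)
    then have "a * y m * b \<in> Hom (m + i + j)" using ab by (intro HomLD HomRD)
    moreover have "m + i + j = m - n" using ab(3) by linarith
    ultimately show ?thesis using False by (simp add: y'_def)
  qed (use q0 in \<open>simp add: y'_def\<close>)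
  moreover have "sum y' S' \<in> P"
  proof -
    have "sum y' S' = (\<Sum>m\<in>S. y' (m - n))"
      unfolding S'_def by (subst sum.reindex) (auto simp: inj_on_def)
    also have "\<dots> \<approx> (\<Sum>m\<in>S. a * y m * b)" by (intro cg_sum cg)
    also have "\<dots> = a * sum y S * b" by (simp add: sum_distrib_left sum_distrib_right)
    finally have *: "sum y' S' \<approx> a * sum y S * b" .
    have "a * sum y S * b \<in> P" using assms(1) by (intro P_right P_left) (simp add: homogeneous_sum_def)
    then show ?thesis using cg_P[OF *] by blast
  qed
  ultimately have 1: "homogeneous_sum S' y'"
    using assms(1) by (auto simp: homogeneous_sum_def S'_def)
  have "linked S' y'"
    unfolding linked_def S'_def
  proof (intro allI ballI impI)
    fix i' j' a' b' k k'
    assume k: "k \<in> (\<lambda>m. m - n) ` S" "k' \<in> (\<lambda>m. m - n) ` S" and ab': "a' \<in> LM i'" "b' \<in> RM j'"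
      and *: "a' * y' k * b' \<in> P"
    obtain m m' where m: "m \<in> S" "k = m - n" "m' \<in> S" "k' = m' - n" using k by blast
    have eq: "a' * y' (l - n) * b' \<in> P \<longleftrightarrow> a' * a * y l * (b * b') \<in> P" for l
      using cg_P[OF cg_right[OF cg_left[OF cg[of l], of a'], of b']] by (simp add: mult.assoc)
    have "a' * a \<in> LM (i' + i)" "b * b' \<in> RM (j + j')" using ab ab' LM_mult RM_mult by auto
    then show "a' * y' k' * b' \<in> P"
      using assms(2) m * eq unfolding linked_def by blast
  qed
  moreover have "0 \<in> S'" using assms(3) by (auto simp: S'_def)
  moreover have "S' \<noteq> {0}"
  proof -
    obtain m where "m \<in> S" "m \<noteq> n" using assms(3,4) by blast
    then have "m - n \<in> S'" "m - n \<noteq> 0" by (auto simp: S'_def)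
    then show ?thesis by blast
  qed
  moreover have "y' 0 = q" by (simp add: y'_def)
  ultimately show ?thesis unfolding linked_to_def using 1 q(2) by blast
qed

lemma linked_to_corner:
  assumes "linked_to q" "a \<in> LM i" "b \<in> RM (- i)" "a * q * b \<approx> q'" "q' \<notin> P" "q' \<in> Hom 0"
  shows "linked_to q'"
proof -
  obtain S y where "homogeneous_sum S y" "0 \<in> S" "S \<noteq> {0}" "y 0 = q" "linked S y"
    using assms(1) unfolding linked_to_def by blast
  then show ?thesis using linked_to_transform[of S y 0 a i b "- i" q'] assms by simp
qed

text \<open>The terminal element kills a component of nonzero degree, and linkedness passes this on
  to \<open>q\<close>.\<close>

lemma linked_to_terminal:
  assumes "linked_to q" "r \<in> LM 0" "r \<in> RM 0" "terminal r"
  shows "r * q * r \<in> P"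
proof -
  obtain S y where S: "homogeneous_sum S y" "0 \<in> S" "S \<noteq> {0}" "y 0 = q" "linked S y"
    using assms(1) unfolding linked_to_def by blast
  then obtain n where n: "n \<in> S" "n \<noteq> 0" by blast
  then have "r * y n * r \<in> P"
    using S terminal_kills[OF assms(4)] by (auto simp: homogeneous_sum_def)
  then show ?thesis using S n assms unfolding linked_def by blast
qed

text \<open>Take a family with the fewest components, none of them in \<open>P\<close>. If a
  compression killed one component but not another, the survivors would form a smaller such
  family.\<close>

lemma minimal_linked:
  assumes "homogeneous_sum S y" "n \<in> S" "y n \<notin> P"
  obtains S' y' where "homogeneous_sum S' y'" "S' \<noteq> {}" "\<And>n. n \<in> S' \<Longrightarrow> y' n \<notin> P" "linked S' y'"
proof -
  define Q where "Q = (\<lambda>(S, y). homogeneous_sum S y \<and> S \<noteq> {} \<and> (\<forall>n\<in>S. y n \<notin> P))"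
  have restrict: "sum y {n\<in>S. y n \<notin> P} \<in> P" if "finite S" "sum y S \<in> P" for S and y :: "int \<Rightarrow> 'a"
  proof -
    have "sum y S = sum y {n\<in>S. y n \<notin> P} + sum y {n\<in>S. y n \<in> P}"
      using that(1) by (subst sum.union_disjoint[symmetric]) (auto intro: sum.cong)
    moreover have "sum y {n\<in>S. y n \<in> P} \<in> P" by (rule P_sum) auto
    ultimately show ?thesis using P_diff[OF that(2)] by (metis add_diff_cancel_right')
  qed
  have Q0: "Q ({n\<in>S. y n \<notin> P}, y)"
    unfolding Q_def using assms restrict by (auto simp: homogeneous_sum_def)
  define T where "T = arg_min (\<lambda>T. card (fst T)) Q"
  have T: "Q T" "\<And>T'. Q T' \<Longrightarrow> card (fst T) \<le> card (fst T')"
    unfolding T_def by (rule arg_min_natI[where P = Q, OF Q0]) (rule arg_min_nat_le)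
  obtain S' y' where Teq: "T = (S', y')" by force
  have S': "homogeneous_sum S' y'" "S' \<noteq> {}" "\<And>n. n \<in> S' \<Longrightarrow> y' n \<notin> P"
    and fin: "finite S'"
    using T(1) unfolding Q_def Teq by (auto simp: homogeneous_sum_def)
  have "linked S' y'"
    unfolding linked_def
  proof (intro allI ballI impI, rule ccontr)
    fix i j a b n n'
    assume n: "n \<in> S'" "n' \<in> S'" and ab: "a \<in> LM i" "b \<in> RM j"
      and *: "a * y' n * b \<in> P" "a * y' n' * b \<notin> P"
    define R where "R = {m\<in>S'. a * y' m * b \<notin> P}"
    define y'' where "y'' m = a * y' (m - (i + j)) * b" for m
    let ?R = "(\<lambda>m. m + (i + j)) ` R"
    have "y'' (m + (i + j)) \<in> Hom (m + (i + j))" if "m \<in> R" for m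
    proof -
      have "y' m \<in> Hom m" using that S'(1) by (auto simp: R_def homogeneous_sum_def)
      then have "a * y' m * b \<in> Hom (m + i + j)" using ab by (intro HomLD HomRD)
      then show ?thesis by (simp add: y''_def add.assoc)
    qed
    moreover have "sum y'' ?R \<in> P"
    proof -
      have "sum y'' ?R = (\<Sum>m\<in>R. a * y' m * b)"
        by (subst sum.reindex) (auto simp: inj_on_def y''_def)
      moreover have "a * sum y' S' * b \<in> P"
        using S'(1) by (intro P_right P_left) (simp add: homogeneous_sum_def)
      then have "(\<Sum>m\<in>S'. a * y' m * b) \<in> P" by (simp add: sum_distrib_left sum_distrib_right)
      ultimately show ?thesis using restrict[OF fin] unfolding R_def by simp
    qed
    moreover have "n' \<in> R" using n * by (simp add: R_def)
    ultimately have "Q (?R, y'')"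
      unfolding Q_def using fin by (auto simp: homogeneous_sum_def R_def y''_def)
    then have "card S' \<le> card ?R" using T(2) Teq by fastforce
    also have "\<dots> \<le> card R" by (rule card_image_le) (use fin R_def in auto)
    also have "\<dots> < card S'"
      using n(1) * fin by (intro psubset_card_mono) (auto simp: R_def)
    finally show False by simp
  qed
  then show thesis using that S' by blast
qed

lemma linked_to_gset_exists:
  assumes "homogeneous_sum S y" "n \<in> S" "y n \<notin> P"
  obtains A where "A \<in> gsets G" "linked_to (p A)"
proof -
  obtain S' y' where S': "homogeneous_sum S' y'" "S' \<noteq> {}" "\<And>n. n \<in> S' \<Longrightarrow> y' n \<notin> P" "linked S' y'"
    using minimal_linked[OF assms] by metis
  obtain m where m: "m \<in> S'" using S'(2) by blast
  \<comment> \<open>A single component would equal the whole sum and lie in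
    \<open>P\<close>.\<close>
  have ne: "S' \<noteq> {m}" using S'(1,3) by (auto simp: homogeneous_sum_def)
  have "y' m \<in> Hom m" "y' m \<notin> P" using S' m by (auto simp: homogeneous_sum_def)
  from reduce_homogeneous[OF this] obtain i j a b q where *: "a \<in> LM i" "b \<in> RM j" "i + j + m = 0"
    "a * y' m * b \<approx> q" "q \<notin> P" "(\<exists>A\<in>gsets G. q = p A) \<or> q \<in> LM 0 \<and> q \<in> RM 0 \<and> terminal q"
    by blast
  have "a * y' m * b \<in> Hom (m + i + j)"
    using * \<open>y' m \<in> Hom m\<close> by (intro HomLD HomRD)
  moreover have "m + i + j = 0" using * by simp
  ultimately have "q \<in> Hom 0" using Sp_cg *(4) by (simp add: Hom_def)
  then have l: "linked_to q" using linked_to_transform[OF S'(1,4) m ne *(1,2,3,4,5)] by blast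
  \<comment> \<open>Otherwise \<open>q\<close> could be used against itself:
    \<open>q * q * q\<close> would be in \<open>P\<close>, yet it is congruent to
    \<open>q\<close>.\<close>
  have "\<not> terminal q \<or> q \<notin> LM 0 \<or> q \<notin> RM 0"
  proof (rule ccontr)
    assume "\<not> ?thesis"
    then have t: "terminal q" "q \<in> LM 0" "q \<in> RM 0" by auto
    have "q * q * q \<approx> q * q" using t(1) by (intro cg_right) (auto simp: terminal_def)
    also have "q * q \<approx> q" using t(1) by (auto simp: terminal_def)
    finally show False using linked_to_terminal[OF l t(2,3,1)] *(5) cg_P by blast
  qed
  then show thesis using that l *(6) by blast
qed

lemma p_idem3: "A \<in> gsets G \<Longrightarrow> B \<in> gsets G \<Longrightarrow> B \<subseteq> A \<Longrightarrow> p B * p A * p B \<approx> p B"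
proof -
  assume *: "A \<in> gsets G" "B \<in> gsets G" "B \<subseteq> A"
  have "p B * p A * p B \<approx> p (B \<inter> A) * p B" by (intro cg_right p_p *)
  also have "B \<inter> A = B" using * by blast
  also have "p B * p B \<approx> p (B \<inter> B)" by (intro p_p *)
  finally show ?thesis by simp
qed

lemma linked_subset:
  assumes "linked_to (p A)" "A \<in> gsets G" "B \<in> gsets G" "B \<subseteq> A" "p B \<notin> P"
  shows "linked_to (p B)"
  using linked_to_corner[OF assms(1), of "p B" 0 "p B" "p B"] assms
  by (simp add: LM_p RM_p p_idem3 p_in_Hom)

lemma linked_edge:
  assumes "linked_to (p A)" "A \<in> gsets G" "e \<in> edges G" "src G e \<in> A" "p (rng G e) \<notin> P"
  shows "linked_to (p (rng G e))"
proof -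
  have "t e * p A * s e \<approx> t e * s e" using assms by (intro cg_right t_p_in)
  also have "\<dots> \<approx> p (rng G e)" using assms by (intro t_s_same)
  finally have "t e * p A * s e \<approx> p (rng G e)" .
  then show ?thesis
    using linked_to_corner[OF assms(1), of "t e" "-1" "s e" "p (rng G e)"] assms
    by (simp add: LM_t RM_s p_in_Hom gsets.range)
qed

text \<open>If every edge leaving \<open>A\<close> died, \<open>p A\<close> would be terminal and
  would kill itself.\<close>

lemma linked_live_edge:
  assumes "linked_to (p A)" "A \<in> gsets G"
  obtains e where "e \<in> edges G" "src G e \<in> A" "p (rng G e) \<notin> P"
proof (rule ccontr)
  assume "\<not> thesis"
  then have *: "p (rng G e) \<in> P" if "e \<in> edges G" "src G e \<in> A" for e
    using that \<open>\<And>e. e \<in> edges G \<Longrightarrow> src G e \<in> A \<Longrightarrow> p (rng G e) \<notin> P \<Longrightarrow> thesis\<close> by blast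
  have nP: "p A \<notin> P" using assms(1) by (simp add: linked_to_def)
  have "p A * s e \<in> P \<and> t e * p A \<in> P" if e: "e \<in> edges G" for e
  proof (cases "src G e \<in> A")
    case True
    then have "p (rng G e) \<in> P" using * e by blast
    then show ?thesis using s_P_iff t_P_iff e P_left P_right by blast
  next
    case False
    then show ?thesis using p_s_notin t_p_notin assms e by (auto simp: P_iff_cg)
  qed
  moreover have "p A * p A \<approx> p A" using p_p[of A A] assms by simp
  ultimately have "terminal (p A)" by (auto simp: terminal_def)
  then have "p A * p A * p A \<in> P" using linked_to_terminal assms LM_p RM_p by blast
  then show False using p_idem3[of A A] assms nP cg_P by blast
qed

text \<open>As all other edges at \<open>v\<close> die, \<open>p {v} - s e * t e\<close> is
  terminal, and compressing \<open>p {v}\<close> by it gives it back; so it lies in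
  \<open>P\<close>. This yields a Cuntz-Krieger relation at \<open>v\<close> even if
  \<open>v\<close> emits infinitely many edges.\<close>

lemma linked_unique_edge:
  assumes l: "linked_to (p {v})" and e: "e \<in> edges G" "src G e = v"
    and unique: "\<And>f. f \<in> edges G \<Longrightarrow> src G f = v \<Longrightarrow> p (rng G f) \<notin> P \<Longrightarrow> f = e"
  shows "p {v} \<approx> s e * t e"
proof -
  let ?q = "p {v} - s e * t e"
  have v: "{v} \<in> gsets G" using vertex_gset e by blast
  have se: "p {v} * s e \<approx> s e" and te: "t e * p {v} \<approx> t e"
    using e v p_s_in[of "{v}" e] t_p_in[of "{v}" e] by auto
  have qs: "?q * s f \<in> P" if f: "f \<in> edges G" for f
  proof -
    have "?q * s f = p {v} * s f - s e * (t e * s f)" by (simp add: left_diff_distrib mult.assoc)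
    moreover have "p {v} * s f \<in> P \<and> s e * (t e * s f) \<in> P" if "f \<noteq> e"
    proof
      have "t e * s f \<in> P" using t_s_diff[OF e(1) f] that by (auto simp: P_iff_cg)
      then show "s e * (t e * s f) \<in> P" by (rule P_left)
      show "p {v} * s f \<in> P"
      proof (cases "src G f = v")
        case True
        then have "s f \<in> P" using unique f that s_P_iff by blast
        then show ?thesis by (rule P_left)
      next
        case False
        then show ?thesis using p_s_notin[OF v f] by (auto simp: P_iff_cg)
      qed
    qed
    moreover have "p {v} * s e \<approx> s e * (t e * s e)"
      using cg_trans[OF se cg_sym[OF cg_trans[OF cg_left[OF t_s_same[OF e(1)]] s_rng[OF e(1)]]]] .
    then have "p {v} * s e - s e * (t e * s e) \<in> P" by (simp add: cg_def)
    ultimately show ?thesis using P_diff by (cases "f = e") auto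
  qed
  have tq: "t f * ?q \<in> P" if f: "f \<in> edges G" for f
  proof -
    have "t f * ?q = t f * p {v} - t f * s e * t e" by (simp add: right_diff_distrib mult.assoc)
    moreover have "t f * p {v} \<in> P \<and> t f * s e * t e \<in> P" if "f \<noteq> e"
    proof
      have "t f * s e \<in> P" using t_s_diff[OF f e(1)] that by (auto simp: P_iff_cg)
      then show "t f * s e * t e \<in> P" by (rule P_right)
      show "t f * p {v} \<in> P"
      proof (cases "src G f = v")
        case True
        then have "t f \<in> P" using unique f that t_P_iff by blast
        then show ?thesis by (rule P_right)
      next
        case False
        then show ?thesis using t_p_notin[OF v f] by (auto simp: P_iff_cg)
      qed
    qed
    moreover have "t e * p {v} \<approx> t e * s e * t e"
      using cg_trans[OF te cg_sym[OF cg_trans[OF cg_right[OF t_s_same[OF e(1)]] rng_t[OF e(1)]]]] .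
    then have "t e * p {v} - t e * s e * t e \<in> P" by (simp add: cg_def)
    ultimately show ?thesis using P_diff by (cases "f = e") auto
  qed
  have pq: "p {v} * ?q \<approx> ?q"
  proof -
    have "p {v} * ?q = p {v} * p {v} - p {v} * s e * t e" by (simp add: right_diff_distrib mult.assoc)
    also have "\<dots> \<approx> p ({v} \<inter> {v}) - s e * t e" by (intro cg_diff p_p v cg_right se)
    finally show ?thesis by simp
  qed
  have "?q * ?q = p {v} * ?q - s e * (t e * ?q)" by (simp only: left_diff_distrib mult.assoc)
  also have "\<dots> \<approx> ?q - 0"
    using P_left[OF tq[OF e(1)]] by (intro cg_diff pq) (simp add: P_iff_cg)
  finally have qq: "?q * ?q \<approx> ?q" by simp
  then have "terminal ?q" using qs tq by (simp add: terminal_def)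
  moreover have "?q \<in> LM 0" "?q \<in> RM 0"
    using e v by (auto intro!: LM_diff LM_p LM_st_prod RM_diff RM_p RM_st_prod)
  ultimately have "?q * p {v} * ?q \<in> P" using linked_to_terminal[OF l] by blast
  moreover have "?q * p {v} * ?q \<approx> ?q"
    using cg_trans[OF cg_left[OF pq] qq] by (simp add: mult.assoc)
  ultimately show ?thesis using cg_P by (simp add: cg_def)
qed

end

section \<open>The cycle of an inhomogeneous ideal\<close>

context leavitt_ideal
begin

lemma edge_path_edges: "edge_path G \<mu> \<Longrightarrow> set \<mu> \<subseteq> edges G"
  by (simp add: edge_path_def)

lemma edge_path_hd: "edge_path G \<mu> \<Longrightarrow> hd \<mu> \<in> edges G"
  and edge_path_last: "edge_path G \<mu> \<Longrightarrow> last \<mu> \<in> edges G"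
  by (auto simp: edge_path_def)

lemma edge_path_append:
  "\<mu> \<noteq> [] \<Longrightarrow> \<nu> \<noteq> [] \<Longrightarrow>
    edge_path G (\<mu> @ \<nu>) \<longleftrightarrow> edge_path G \<mu> \<and> edge_path G \<nu> \<and> src G (hd \<nu>) \<in> rng G (last \<mu>)"
proof (induction \<mu>)
  case (Cons e \<mu>)
  then show ?case by (cases "\<mu> = []") (auto simp: edge_path_Cons)
qed simp

lemma st_sp_p:
  assumes "sp \<alpha> \<notin> P" "set \<alpha> \<subseteq> edges G" "B \<in> gsets G"
  shows "\<exists>C\<in>gsets G. st \<alpha> * sp \<alpha> * p B \<approx> p C"
proof (cases "\<alpha> = []")
  case False
  have "edge_path G \<alpha>" using sp_edge_path assms False by blast
  have r: "rng G (last \<alpha>) \<in> gsets G" using assms False by (intro gsets.range) auto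
  have "st \<alpha> * sp \<alpha> * p B \<approx> p (rng G (last \<alpha>)) * p B"
    by (intro cg_right st_sp) fact
  also have "\<dots> \<approx> p (rng G (last \<alpha>) \<inter> B)" by (intro p_p r assms)
  finally show ?thesis using gsets.inter[OF r assms(3)] by blast
qed (use assms(3) in auto)

lemma p_st_sp:
  assumes "sp \<alpha> \<notin> P" "set \<alpha> \<subseteq> edges G" "B \<in> gsets G"
  shows "\<exists>C\<in>gsets G. p B * (st \<alpha> * sp \<alpha>) \<approx> p C"
proof (cases "\<alpha> = []")
  case False
  have "edge_path G \<alpha>" using sp_edge_path assms False by blast
  have r: "rng G (last \<alpha>) \<in> gsets G" using assms False by (intro gsets.range) auto
  have "p B * (st \<alpha> * sp \<alpha>) \<approx> p B * p (rng G (last \<alpha>))"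
    by (intro cg_left st_sp) fact
  also have "\<dots> \<approx> p (B \<inter> rng G (last \<alpha>))" by (intro p_p r assms)
  finally show ?thesis using gsets.inter[OF assms(3) r] by blast
qed (use assms(3) in auto)

text \<open>Survival forces both words, being no longer than \<open>\<mu>\<close>, to be initial
  segments of \<open>\<mu>\<close>; the two remainders then meet around a projection and must be
  comparable. Thus \<open>\<mu>\<close> overlaps with a shifted copy of itself.\<close>

lemma st_mono_sp:
  assumes nP: "st \<mu> * mono \<alpha> A \<beta> * sp \<mu> \<notin> P"
    and sets: "set \<mu> \<subseteq> edges G" "set \<alpha> \<subseteq> edges G" "set \<beta> \<subseteq> edges G" "A \<in> gsets G"
    and len: "length \<alpha> \<le> length \<mu>" "length \<beta> \<le> length \<mu>"
  obtains \<nu> \<nu>' \<gamma> where "\<mu> = \<alpha> @ \<nu>" "\<mu> = \<beta> @ \<nu>'" "\<nu>' = \<nu> @ \<gamma> \<or> \<nu> = \<nu>' @ \<gamma>"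
proof -
  have eq: "st \<mu> * mono \<alpha> A \<beta> * sp \<mu> = st \<mu> * sp \<alpha> * (p A * (st \<beta> * sp \<mu>))"
    by (simp add: mono_def mult.assoc)
  have 1: "st \<mu> * sp \<alpha> \<notin> P" using nP P_right unfolding eq by blast
  have 2: "st \<beta> * sp \<mu> \<notin> P" using nP P_left unfolding eq by blast
  obtain \<nu> where \<nu>: "\<mu> = \<alpha> @ \<nu>" using st_sp_comparable[OF 1] sets len by auto
  obtain \<nu>' where \<nu>': "\<mu> = \<beta> @ \<nu>'" using st_sp_comparable[OF 2] sets len by auto
  have "sp \<alpha> \<notin> P" using 1 P_left by blast
  then obtain B where B: "B \<in> gsets G" "st \<alpha> * sp \<alpha> * p A \<approx> p B"
    using st_sp_p sets by blast
  have "sp \<mu> \<notin> P" using 2 P_left by blast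
  then have "sp \<beta> \<notin> P" using P_right unfolding \<nu>' sp_append by blast
  then obtain C where C: "C \<in> gsets G" "p B * (st \<beta> * sp \<beta>) \<approx> p C"
    using p_st_sp sets B by blast
  have "st \<mu> * mono \<alpha> A \<beta> * sp \<mu> = st \<nu> * (st \<alpha> * sp \<alpha> * p A) * (st \<beta> * sp \<mu>)"
    unfolding \<nu> st_append mono_def by (simp add: mult.assoc)
  also have "\<dots> \<approx> st \<nu> * p B * (st \<beta> * sp \<mu>)" by (intro cg_right cg_left B)
  also have "\<dots> = st \<nu> * (p B * (st \<beta> * sp \<beta>)) * sp \<nu>'"
    unfolding \<nu>' sp_append by (simp add: mult.assoc)
  also have "\<dots> \<approx> st \<nu> * p C * sp \<nu>'" by (intro cg_right cg_left C)
  finally have "st \<nu> * p C * sp \<nu>' \<notin> P" using nP cg_P by blast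
  moreover have "set \<nu> \<subseteq> edges G" "set \<nu>' \<subseteq> edges G" using sets \<nu> \<nu>' by (metis le_sup_iff set_append)+
  ultimately obtain \<gamma> where "\<nu>' = \<nu> @ \<gamma> \<or> \<nu> = \<nu>' @ \<gamma>" using st_p_sp_comparable C by blast
  then show thesis using that \<nu> \<nu>' by blast
qed

text \<open>Compressing a component of degree \<open>n\<close> to a long path that survives modulo \<open>P\<close> shows that
  the path is eventually periodic with period \<open>\<bar>n\<bar>\<close>.\<close>

lemma linked_period:
  assumes l: "linked_to (p {w})" and w: "w \<in> verts G"
  obtains D n where "n > 0"
    "\<And>\<mu> k. edge_path G \<mu> \<Longrightarrow> src G (hd \<mu>) = w \<Longrightarrow> p (rng G (last \<mu>)) \<notin> P \<Longrightarrow> D \<le> k \<Longrightarrow>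
      k + n < length \<mu> \<Longrightarrow> \<mu> ! (k + n) = \<mu> ! k"
proof -
  obtain S y where S: "homogeneous_sum S y" "0 \<in> S" "S \<noteq> {0}" "y 0 = p {w}" "linked S y"
    using l unfolding linked_to_def by blast
  then obtain d where d: "d \<in> S" "d \<noteq> 0" by blast
  then have "y d \<in> Hom d" using S by (simp add: homogeneous_sum_def)
  then obtain N where N: "y d \<in> Sp (\<lambda>\<alpha> \<beta>. int (length \<alpha>) - int (length \<beta>) = d \<and> length \<alpha> \<le> N \<and> length \<beta> \<le> N)"
    using Sp_bounded unfolding Hom_def by blast
  define n where "n = nat \<bar>d\<bar>"
  have "\<mu> ! (k + n) = \<mu> ! k"
    if \<mu>: "edge_path G \<mu>" "src G (hd \<mu>) = w" "p (rng G (last \<mu>)) \<notin> P" and k: "N \<le> k" "k + n < length \<mu>"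
    for \<mu> k
  proof -
    have set\<mu>: "set \<mu> \<subseteq> edges G" using \<mu> edge_path_edges by blast
    obtain e \<mu>' where e: "\<mu> = e # \<mu>'" using \<mu> by (cases \<mu>) (auto simp: edge_path_def)
    have "p {w} * sp \<mu> \<approx> sp \<mu>"
      unfolding e using e set\<mu> \<mu> w by (intro p_sp_in gsets.vertex) auto
    then have "st \<mu> * (p {w} * sp \<mu>) \<approx> st \<mu> * sp \<mu>" by (rule cg_left)
    also have "\<dots> \<approx> p (rng G (last \<mu>))" by (intro st_sp \<mu>)
    \<comment> \<open>The path compresses \<open>p {w}\<close> to the surviving projection of its
      range; linkedness transfers the survival to the component of degree \<open>d\<close>.\<close>
    finally have "st \<mu> * y 0 * sp \<mu> \<notin> P" using \<mu> cg_P S(4) by (simp add: mult.assoc)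
    then have "st \<mu> * y d * sp \<mu> \<notin> P"
      using S(2,5) d LM_st[OF set\<mu>] RM_sp[OF set\<mu>] unfolding linked_def by blast
    then obtain A \<alpha> \<beta> where *: "A \<in> gsets G" "set \<alpha> \<subseteq> edges G" "set \<beta> \<subseteq> edges G"
      "int (length \<alpha>) - int (length \<beta>) = d \<and> length \<alpha> \<le> N \<and> length \<beta> \<le> N"
      "st \<mu> * mono \<alpha> A \<beta> * sp \<mu> \<notin> P"
      by (rule Sp_image_mono_notP[OF N]) (rule that)
    have "length \<alpha> \<le> length \<mu>" "length \<beta> \<le> length \<mu>" using * k by auto
    then obtain \<nu> \<nu>' \<gamma> where \<nu>: "\<mu> = \<alpha> @ \<nu>" "\<mu> = \<beta> @ \<nu>'" "\<nu>' = \<nu> @ \<gamma> \<or> \<nu> = \<nu>' @ \<gamma>"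
      using st_mono_sp[OF *(5) set\<mu> *(2,3,1)] by metis
    have nth: "\<mu> ! (length \<alpha> + j) = \<nu> ! j" "\<mu> ! (length \<beta> + j) = \<nu>' ! j" for j
      using \<nu>(1,2) by (metis nth_append_length_plus)+
    have lens: "length \<mu> = length \<alpha> + length \<nu>" "length \<mu> = length \<beta> + length \<nu>'"
      using \<nu>(1,2) by (metis length_append)+
    \<comment> \<open>The remainders of \<open>\<mu>\<close> after \<open>\<alpha>\<close> and after
      \<open>\<beta>\<close> start \<open>n\<close> positions apart and agree on their common
      length. The sign of \<open>d\<close> only decides which one starts later.\<close>
    show ?thesis
    proof (cases "d > 0")
      case True
      then have "int n = d" by (simp add: n_def)
      then have n: "length \<alpha> = length \<beta> + n" using * by linarith
      then have "\<nu>' = \<nu> @ \<gamma>" using \<nu>(3) lens by auto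
      moreover obtain j where j: "k = length \<beta> + j" using * k by (metis le_Suc_ex le_trans)
      moreover have "j < length \<nu>" using lens n j k by simp
      ultimately have "\<nu>' ! j = \<nu> ! j" by (simp add: nth_append)
      moreover have "k + n = length \<alpha> + j" using n j by simp
      ultimately show ?thesis using nth j by metis
    next
      case False
      then have "int n = - d" by (simp add: n_def)
      then have n: "length \<beta> = length \<alpha> + n" using * by linarith
      then have "\<nu> = \<nu>' @ \<gamma>" using \<nu>(3) lens by auto
      moreover obtain j where j: "k = length \<alpha> + j" using * k by (metis le_Suc_ex le_trans)
      moreover have "j < length \<nu>'" using lens n j k by simp
      ultimately have "\<nu> ! j = \<nu>' ! j" by (simp add: nth_append)
      moreover have "k + n = length \<beta> + j" using n j by simp
      ultimately show ?thesis using nth j by metis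
    qed
  qed
  moreover have "n > 0" using d by (simp add: n_def)
  ultimately show thesis using that by blast
qed

text \<open>Survival passes to earlier edges, since a set containing the source of a live edge is
  itself live.\<close>

lemma live_hd:
  "edge_path G \<mu> \<Longrightarrow> p (rng G (last \<mu>)) \<notin> P \<Longrightarrow> p (rng G (hd \<mu>)) \<notin> P"
proof (induction \<mu>)
  case (Cons e \<mu>)
  show ?case
  proof (cases "\<mu> = []")
    case False
    then have e: "e \<in> edges G" "src G (hd \<mu>) \<in> rng G e" "edge_path G \<mu>"
      using Cons.prems by (auto simp: edge_path_Cons)
    then have "p (rng G (hd \<mu>)) \<notin> P" using Cons.IH Cons.prems(2) False by simp
    then have "p (rng G e) \<notin> P"
      using p_src_P[OF edge_path_hd[OF e(3)] gsets.range[OF e(1)] e(2)] by blast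
    then show ?thesis by simp
  qed (use Cons.prems in simp)
qed (simp add: edge_path_def)

lemma live_append: "edge_path G (\<mu> @ \<nu>) \<Longrightarrow> \<mu> \<noteq> [] \<Longrightarrow> p (rng G (last (\<mu> @ \<nu>))) \<notin> P \<Longrightarrow> p (rng G (last \<mu>)) \<notin> P"
proof (cases "\<nu> = []")
  case False
  assume *: "edge_path G (\<mu> @ \<nu>)" "\<mu> \<noteq> []" "p (rng G (last (\<mu> @ \<nu>))) \<notin> P"
  then have \<nu>: "edge_path G \<nu>" "src G (hd \<nu>) \<in> rng G (last \<mu>)" "edge_path G \<mu>"
    using edge_path_append False by auto
  have "p (rng G (hd \<nu>)) \<notin> P" using live_hd[OF \<nu>(1)] * False by simp
  then show ?thesis
    using p_src_P[OF edge_path_hd[OF \<nu>(1)] gsets.range[OF edge_path_last[OF \<nu>(3)]] \<nu>(2)] by blast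
qed simp

lemma linked_along:
  "edge_path G \<mu> \<Longrightarrow> linked_to (p A) \<Longrightarrow> A \<in> gsets G \<Longrightarrow> src G (hd \<mu>) \<in> A \<Longrightarrow>
    p (rng G (last \<mu>)) \<notin> P \<Longrightarrow> linked_to (p (rng G (last \<mu>)))"
proof (induction \<mu> arbitrary: A)
  case (Cons e \<mu>)
  have e: "e \<in> edges G" using Cons.prems(1) by (simp add: edge_path_Cons)
  have "p (rng G e) \<notin> P" using live_hd[OF Cons.prems(1,5)] by simp
  then have "linked_to (p (rng G e))"
    using linked_edge[OF Cons.prems(2,3) e] Cons.prems(4) by simp
  then show ?case
    using Cons.IH[of "rng G e"] Cons.prems gsets.range[OF e]
    by (cases "\<mu> = []") (auto simp: edge_path_Cons)
qed (simp add: edge_path_def)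

lemma linked_extend:
  "linked_to (p A) \<Longrightarrow> A \<in> gsets G \<Longrightarrow>
    \<exists>\<mu>. length \<mu> = Suc L \<and> edge_path G \<mu> \<and> src G (hd \<mu>) \<in> A \<and> p (rng G (last \<mu>)) \<notin> P"
proof (induction L arbitrary: A)
  case 0
  obtain e where "e \<in> edges G" "src G e \<in> A" "p (rng G e) \<notin> P"
    using linked_live_edge[OF 0] by blast
  then show ?case by (intro exI[of _ "[e]"]) (simp add: edge_path_Cons)
next
  case (Suc L)
  obtain e where e: "e \<in> edges G" "src G e \<in> A" "p (rng G e) \<notin> P"
    using linked_live_edge[OF Suc.prems] by blast
  then have "linked_to (p (rng G e))" using linked_edge[OF Suc.prems] by blast
  then obtain \<mu> where "length \<mu> = Suc L" "edge_path G \<mu>" "src G (hd \<mu>) \<in> rng G e" "p (rng G (last \<mu>)) \<notin> P"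
    using Suc.IH[OF _ gsets.range[OF e(1)]] by blast
  moreover from this have "\<mu> \<noteq> []" by auto
  ultimately show ?case using e by (intro exI[of _ "e # \<mu>"]) (simp add: edge_path_Cons)
qed

text \<open>By the last clause the range of each edge of the cycle collapses modulo \<open>P\<close>
  to the next vertex: whatever avoids that vertex is dead.\<close>

definition live_cycle :: "'e list \<Rightarrow> bool" where
  "live_cycle c \<longleftrightarrow> cycle G c \<and>
    (\<forall>k. linked_to (p {cycle_graph.vx G c k}) \<and>
      (\<forall>e\<in>edges G. src G e = cycle_graph.vx G c k \<longrightarrow> p (rng G e) \<notin> P \<longrightarrow> e = cycle_graph.edg c k) \<and>
      (\<forall>B\<in>gsets G. B \<subseteq> rng G (cycle_graph.edg c k) \<longrightarrow> p B \<notin> P \<longrightarrow> cycle_graph.vx G c (Suc k) \<in> B))"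

text \<open>All live paths from \<open>v\<close> follow one sequence \<open>E\<close>, so a vertex
  on it determines everything after it. The cycle is cut at the first return to \<open>u 0\<close>,
  which may come before position \<open>n\<close>.\<close>

lemma live_cycle_of_sequence:
  fixes E :: "nat \<Rightarrow> 'e"
  assumes v: "linked_to (p {v})" "v \<in> verts G" and n: "n > 0" "E n = E 0"
    and E: "\<And>\<nu> i. edge_path G \<nu> \<Longrightarrow> src G (hd \<nu>) = v \<Longrightarrow> p (rng G (last \<nu>)) \<notin> P \<Longrightarrow>
      i < length \<nu> \<Longrightarrow> \<nu> ! i = E i"
  shows "\<exists>c. live_cycle c"
proof -
  define u where "u i = src G (E i)" for i
  have vg: "{v} \<in> gsets G" by (rule gsets.vertex[OF v(2)])
  have path: "edge_path G (map E [0..<Suc L]) \<and> u 0 = v \<and> p (rng G (E L)) \<notin> P" for L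
  proof -
    obtain \<mu> where \<mu>: "length \<mu> = Suc L" "edge_path G \<mu>" "src G (hd \<mu>) = v" "p (rng G (last \<mu>)) \<notin> P"
      using linked_extend[OF v(1) vg, of L] by blast
    have eq: "\<mu> = map E [0..<Suc L]"
      using E[OF \<mu>(2,3,4)] \<mu>(1) by (intro nth_equalityI) (auto simp del: upt_Suc)
    have "edge_path G (map E [0..<Suc L])" using \<mu>(2) unfolding eq .
    moreover have "hd \<mu> = E 0" unfolding eq by (simp add: hd_map del: upt_Suc)
    then have "u 0 = v" using \<mu>(3) by (simp add: u_def)
    moreover have "last \<mu> = E L" unfolding eq by simp
    then have "p (rng G (E L)) \<notin> P" using \<mu>(4) by simp
    ultimately show ?thesis by blast
  qed
  have E_in: "E i \<in> edges G" for i using path[of i] edge_path_edges by fastforce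
  have live: "p (rng G (E i)) \<notin> P" for i using path by blast
  have u_in: "u i \<in> verts G" for i using E_in src_in by (simp add: u_def)
  have u_Suc: "u (Suc i) \<in> rng G (E i)" for i
  proof -
    have "edge_path G (map E [0..<Suc i] @ [E (Suc i)])" using path[of "Suc i"] by simp
    then show ?thesis by (subst (asm) edge_path_append) (auto simp: u_def)
  qed
  have hd_seq: "src G (hd (map E [0..<Suc i] @ xs)) = v" for i xs
    using path[of 0] by (simp add: u_def hd_append hd_map del: upt_Suc)
  have linked_rng: "linked_to (p (rng G (E i)))" for i
    using linked_along[of "map E [0..<Suc i]" "{v}"] path[of i] v vg hd_seq[of i "[]"] by simp
  have u_nP: "p {u i} \<notin> P" for i
    using p_src_P[OF E_in gsets.vertex[OF u_in]] live by (auto simp: u_def)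
  have linked_u: "linked_to (p {u i})" for i
  proof (cases i)
    case 0
    then show ?thesis using v path by metis
  next
    case (Suc j)
    then show ?thesis
      using linked_subset[OF linked_rng gsets.range[OF E_in] gsets.vertex[OF u_in], of "Suc j" j] u_nP u_Suc
      by simp
  qed
  have uniq: "e = E i" if e: "e \<in> edges G" "src G e = u i" "p (rng G e) \<notin> P" for e i
  proof (cases i)
    case 0
    then show ?thesis using E[of "[e]" 0] e path[of 0] by (simp add: edge_path_Cons)
  next
    case (Suc j)
    have "edge_path G (map E [0..<Suc j] @ [e])"
      using path[of j] u_Suc[of j] e Suc by (subst edge_path_append) (auto simp: edge_path_Cons)
    from E[OF this hd_seq, of i] show ?thesis using e Suc by (simp add: nth_append del: upt_Suc)
  qed
  \<comment> \<open>A surviving piece of the range is linked, hence emits a live edge. This edge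
    continues a live path from \<open>v\<close>, so it is \<open>E (Suc i)\<close>.\<close>
  have dead: "u (Suc i) \<in> B" if B: "B \<in> gsets G" "B \<subseteq> rng G (E i)" "p B \<notin> P" for B i
  proof -
    have "linked_to (p B)" using linked_subset[OF linked_rng gsets.range[OF E_in] B(1,2,3)] .
    from linked_live_edge[OF this B(1)]
    obtain e where e: "e \<in> edges G" "src G e \<in> B" "p (rng G e) \<notin> P" by blast
    have "edge_path G (map E [0..<Suc i] @ [e])"
      using path[of i] e B by (subst edge_path_append) (auto simp: edge_path_Cons)
    from E[OF this hd_seq, of "Suc i"] have "e = E (Suc i)"
      using e by (simp add: nth_append del: upt_Suc)
    then show ?thesis using e by (simp add: u_def)
  qed
  have E_eq: "E i = E j" if "u i = u j" for i j
    using uniq[OF E_in, of j i] that live by (simp add: u_def)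
  have u_Suc_eq: "u (Suc i) = u (Suc j)" if "u i = u j" for i j
    using dead[OF gsets.vertex[OF u_in], of "Suc j" i] E_eq[OF that] u_Suc[of j] u_nP by simp
  have u_add_eq: "u (i + k) = u (j + k)" if "u i = u j" for i j k
  proof (induction k)
    case (Suc k)
    then show ?case using u_Suc_eq[of "i + k" "j + k"] by simp
  qed (use that in simp)
  define m where "m = (LEAST m. m > 0 \<and> u m = u 0)"
  have "n > 0 \<and> u n = u 0" using n by (simp add: u_def)
  then have m: "m > 0 \<and> u m = u 0" unfolding m_def by (rule LeastI)
  have m_least: "m \<le> k" if "k > 0" "u k = u 0" for k
    unfolding m_def using that by (intro Least_le) simp
  obtain L where L: "m = Suc L" using m gr0_implies_Suc by blast
  define c where "c = map E [0..<m]"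
  \<comment> \<open>Equal vertices at \<open>i < j < m\<close> would produce a return to
    \<open>u 0\<close> after only \<open>i + (m - j)\<close> steps.\<close>
  have neq: "u i \<noteq> u j" if "i < j" "j < m" for i j
  proof
    assume "u i = u j"
    then have "u (i + (m - j)) = u 0" using u_add_eq[of i j "m - j"] m that by simp
    then show False using m_least[of "i + (m - j)"] that by simp
  qed
  have "distinct (map (src G) c)"
    unfolding distinct_conv_nth
  proof (intro allI impI)
    fix i j assume ij: "i < length (map (src G) c)" "j < length (map (src G) c)" "i \<noteq> j"
    then have "map (src G) c ! i = u i" "map (src G) c ! j = u j" by (simp_all add: c_def u_def)
    then show "map (src G) c ! i \<noteq> map (src G) c ! j"
      using neq[of i j] neq[of j i] ij by (cases "i < j") (auto simp: c_def)
  qed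
  moreover have "closed_path G c"
    using path[of L] hd_seq[of L "[]"] u_Suc[of L] m L unfolding closed_path_def c_def by simp
  ultimately have "cycle G c" by (simp add: cycle_def)
  then interpret C: cycle_graph G c by unfold_locales
  have len: "length c = m" by (simp add: c_def)
  have "u (i + m * q) = u i" for i q
  proof (induction q)
    case (Suc q)
    have "u (m + (i + m * q)) = u (0 + (i + m * q))" using m by (intro u_add_eq) simp
    then show ?case using Suc by (simp add: algebra_simps)
  qed simp
  then have umod: "u (k mod m) = u k" for k by (metis mod_mult_div_eq)
  have edg: "C.edg k = E k" for k
  proof -
    have "C.edg k = E (k mod m)" using m by (simp add: C.edg_def len) (simp add: c_def)
    then show ?thesis using E_eq[OF umod] by simp
  qed
  have vx: "C.vx k = u k" for k by (simp add: C.vx_def edg u_def)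
  have "live_cycle c"
    unfolding live_cycle_def vx edg using \<open>cycle G c\<close> linked_u uniq dead by blast
  then show ?thesis by blast
qed

text \<open>Periodicity holds only from position \<open>D\<close> on, so a live path
  \<open>\<pi> @ \<gamma>\<close> is put in front, with \<open>\<pi>\<close> longer than
  \<open>D\<close> and \<open>\<gamma>\<close> one period long. Every live path continuing it must
  then repeat \<open>\<gamma>\<close>.\<close>

lemma linked_live_cycle:
  assumes "linked_to (p A)" "A \<in> gsets G"
  shows "\<exists>c. live_cycle c"
proof -
  obtain e where e: "e \<in> edges G" "src G e \<in> A" "p (rng G e) \<notin> P"
    using linked_live_edge[OF assms] by blast
  define w where "w = src G e"
  have w: "w \<in> verts G" "{w} \<in> gsets G" using e src_in vertex_gset by (auto simp: w_def)
  have "p {w} \<notin> P" using p_src_P[OF e(1) w(2)] e by (auto simp: w_def)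
  then have lw: "linked_to (p {w})"
    using linked_subset[OF assms w(2)] e by (simp add: w_def)
  obtain D n where n: "n > 0" and per: "\<And>\<mu> k. edge_path G \<mu> \<Longrightarrow> src G (hd \<mu>) = w \<Longrightarrow>
      p (rng G (last \<mu>)) \<notin> P \<Longrightarrow> D \<le> k \<Longrightarrow> k + n < length \<mu> \<Longrightarrow> \<mu> ! (k + n) = \<mu> ! k"
    using linked_period[OF lw w(1)] by metis
  obtain \<mu> where \<mu>: "length \<mu> = Suc (Suc D + n)" "edge_path G \<mu>" "src G (hd \<mu>) = w"
    "p (rng G (last \<mu>)) \<notin> P" using linked_extend[OF lw w(2), of "Suc D + n"] by blast
  define \<pi> where "\<pi> = take (Suc D) \<mu>"
  define \<gamma> where "\<gamma> = take n (drop (Suc D) \<mu>)"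
  \<comment> \<open>One edge beyond the period: it equals \<open>hd \<gamma>\<close>, which shows
    that \<open>\<gamma>\<close> closes up at its own source.\<close>
  define f where "f = \<mu> ! (Suc D + n)"
  have len: "length \<pi> = Suc D" "length \<gamma> = n" using \<mu> by (simp_all add: \<pi>_def \<gamma>_def)
  have ne: "\<pi> \<noteq> []" "\<gamma> \<noteq> []" using len n by auto
  have \<mu>_split: "\<mu> = (\<pi> @ \<gamma>) @ [f]"
  proof -
    have "\<mu> = take (Suc D + n) \<mu> @ [f]" unfolding f_def using \<mu>(1)
      by (metis lessI take_Suc_conv_app_nth take_all_iff le_refl)
    then show ?thesis unfolding \<pi>_def \<gamma>_def take_add by simp
  qed
  define v where "v = src G (hd \<gamma>)"
  have f_eq: "f = hd \<gamma>"
  proof -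
    have "\<mu> ! (Suc D + n) = \<mu> ! Suc D" using per[OF \<mu>(2,3,4), of "Suc D"] \<mu>(1) by simp
    moreover have "\<mu> ! Suc D = \<gamma> ! 0"
      unfolding \<mu>_split using len n by (simp add: nth_append)
    ultimately show ?thesis using ne by (simp add: f_def hd_conv_nth)
  qed
  have ep: "edge_path G (\<pi> @ \<gamma>)" "src G f \<in> rng G (last (\<pi> @ \<gamma>))"
    using \<mu>(2) ne unfolding \<mu>_split by (auto simp: edge_path_append)
  then have ep2: "edge_path G \<pi>" "edge_path G \<gamma>" "v \<in> rng G (last \<pi>)"
    using ne by (auto simp: edge_path_append v_def)
  have live: "p (rng G (last (\<pi> @ \<gamma>))) \<notin> P"
    using live_append[of "\<pi> @ \<gamma>" "[f]"] \<mu>(2,4) ne \<mu>_split by simp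
  have live\<pi>: "p (rng G (last \<pi>)) \<notin> P"
    using live_append[OF ep(1) ne(1) live] .
  have hd\<pi>: "src G (hd \<pi>) = w" using \<mu>(3) ne unfolding \<mu>_split by simp
  have hd\<gamma>: "hd \<gamma> \<in> edges G" by (rule edge_path_hd[OF ep2(2)])
  have v: "v \<in> verts G" "{v} \<in> gsets G" using hd\<gamma> src_in vertex_gset by (auto simp: v_def)
  have "p (rng G (hd \<gamma>)) \<notin> P" using live_hd[OF ep2(2)] live ne by simp
  then have "p {v} \<notin> P" using p_src_P[OF hd\<gamma> v(2)] by (auto simp: v_def)
  moreover have "linked_to (p (rng G (last \<pi>)))"
    using linked_along[OF ep2(1) lw w(2) _ live\<pi>] hd\<pi> by simp
  moreover have "rng G (last \<pi>) \<in> gsets G"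
    by (rule gsets.range[OF edge_path_last[OF ep2(1)]])
  ultimately have lv: "linked_to (p {v})"
    using linked_subset[of "rng G (last \<pi>)" "{v}"] v(2) ep2(3) by blast
  \<comment> \<open>Comparing positions \<open>n\<close> apart in
    \<open>\<pi> @ \<gamma> @ \<nu>\<close> gives \<open>\<nu> ! i = (\<gamma> @ \<nu>) ! i\<close>;
    hence \<open>\<nu>\<close> copies \<open>\<gamma>\<close> over and over.\<close>
  have follow: "\<nu> ! i = \<gamma> ! (i mod n)"
    if \<nu>: "edge_path G \<nu>" "src G (hd \<nu>) = v" "p (rng G (last \<nu>)) \<notin> P" "i < length \<nu>" for \<nu> i
    using \<nu>(4)
  proof (induction i rule: less_induct)
    case (less i)
    let ?\<mu> = "\<pi> @ \<gamma> @ \<nu>"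
    have ne\<nu>: "\<nu> \<noteq> []" using less by auto
    have "edge_path G ((\<pi> @ \<gamma>) @ \<nu>)"
      using ep \<nu> ne ne\<nu> f_eq v_def by (subst edge_path_append) auto
    then have "?\<mu> ! (Suc D + i + n) = ?\<mu> ! (Suc D + i)"
      using per[of ?\<mu> "Suc D + i"] hd\<pi> \<nu> ne ne\<nu> less.prems len by simp
    then have "(\<gamma> @ \<nu>) ! (i + n) = (\<gamma> @ \<nu>) ! i"
      using nth_append_length_plus[of \<pi> "\<gamma> @ \<nu>" "i + n"] nth_append_length_plus[of \<pi> "\<gamma> @ \<nu>" i] len
      by (simp add: add.assoc)
    then have *: "\<nu> ! i = (\<gamma> @ \<nu>) ! i"
      using nth_append_length_plus[of \<gamma> \<nu> i] len by (simp add: add.commute)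
    show ?case
    proof (cases "i < n")
      case True
      then show ?thesis using * len by (simp add: nth_append)
    next
      case False
      then have "\<nu> ! i = \<nu> ! (i - n)" using * len by (simp add: nth_append)
      also have "\<dots> = \<gamma> ! ((i - n) mod n)" using less False n by auto
      also have "(i - n) mod n = i mod n" using False by (simp add: le_mod_geq)
      finally show ?thesis .
    qed
  qed
  show ?thesis
    by (rule live_cycle_of_sequence[OF lv v(1) n, of "\<lambda>i. \<gamma> ! (i mod n)"]) (use follow in auto)
qed

text \<open>Survival spreads backwards: a vertex survives as soon as it emits an edge with surviving
  range.\<close>

lemma walk_notP: "walk G x es y \<Longrightarrow> p {y} \<notin> P \<Longrightarrow> x \<in> verts G \<Longrightarrow> p {x} \<notin> P"
proof (induction es arbitrary: x)
  case (Cons e es)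
  then obtain z where z: "e \<in> edges G" "src G e = x" "z \<in> rng G e" "walk G z es y" by auto
  then have "z \<in> verts G" using rng_sub by blast
  then have "p {z} \<notin> P" using Cons.IH[OF z(4)] Cons.prems(2) by blast
  then have "p (rng G e) \<notin> P"
    using p_P_subset[OF _ gsets.range[OF z(1)] gsets.vertex[OF \<open>z \<in> verts G\<close>]] z(3) by blast
  then show ?case using p_src_P[OF z(1) gsets.vertex[OF Cons.prems(3)]] z(2) by blast
qed simp

end


section \<open>Ideals with a distinguished cycle\<close>

lemma (in exclusive_cycle_graph) live_edges_vx:
  "{e \<in> edges G. src G e = vx k \<and> rng G e \<inter> M \<noteq> {}} = {edg k}"
proof -
  have "edg k \<in> edges G" "src G (edg k) = vx k" "rng G (edg k) \<inter> M \<noteq> {}"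
    using edg_in src_edg rng_Int_M by auto
  moreover have "e = edg k" if "e \<in> edges G" "src G e = vx k" "rng G e \<inter> M \<noteq> {}" for e
    using unique_return[OF that(1,2)] that(3) by blast
  ultimately show ?thesis by blast
qed

text \<open>The conditions are local to the cycle. They suffice to compute with its edges before
  anything is known about \<open>M\<close> and the remainder of \<open>P\<close>.\<close>

locale cycle_ideal = leavitt_ideal G K p s t P + cycle_graph G c
  for G :: "('v, 'e) ultragraph" and K :: "'k::field \<Rightarrow> 'a::ring_1" and p s t P c +
  assumes vx_notP: "p {vx k} \<notin> P"
    and unique_live_edge: "e \<in> edges G \<Longrightarrow> src G e = vx k \<Longrightarrow> p (rng G e) \<notin> P \<Longrightarrow> e = edg k"
    and live_in_rng: "B \<in> gsets G \<Longrightarrow> B \<subseteq> rng G (edg k) \<Longrightarrow> p B \<notin> P \<Longrightarrow> vx (Suc k) \<in> B"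
    and vx_ck: "p {vx k} \<approx> s (edg k) * t (edg k)"
begin

lemma vx_gset: "{vx k} \<in> gsets G"
  by (intro gsets.vertex vx_in)

lemma rng_edg_gset: "rng G (edg k) \<in> gsets G"
  by (intro gsets.range edg_in)

lemma p_rng_edg: "p (rng G (edg k)) \<approx> p {vx (Suc k)}"
proof -
  let ?R = "rng G (edg k)" and ?x = "vx (Suc k)"
  have "?R - {?x} \<in> gsets G" by (intro gsets.diff rng_edg_gset vx_gset)
  then have "p (?R - {?x}) \<in> P" using live_in_rng[of "?R - {?x}" k] by blast
  then have "p (?R \<inter> {?x}) + p (?R - {?x}) \<approx> p (?R \<inter> {?x}) + 0"
    by (intro cg_add cg_refl) (simp add: P_iff_cg)
  moreover have "?R \<inter> {?x} = {?x}" using vx_Suc_in_rng by blast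
  ultimately show ?thesis using cg_trans[OF p_split[OF rng_edg_gset vx_gset, of k "Suc k"]] by simp
qed

text \<open>Read from the right, each edge of \<open>\<beta>\<close> must be a live edge at the
  current vertex of the cycle, and the surviving part of its range is the next vertex.\<close>

lemma p_st_p_vx:
  assumes "p B * st \<beta> * p {vx k} \<notin> P" "set \<beta> \<subseteq> edges G" "B \<in> gsets G"
  shows "\<beta> = seg k (length \<beta>) \<and> vx (k + length \<beta>) \<in> B"
  using assms
proof (induction \<beta> arbitrary: k)
  case Nil
  then have "p (B \<inter> {vx k}) \<notin> P" using cg_P[OF p_p[OF Nil(3) vx_gset]] by simp
  from p_Int_singleton_notP[OF this] show ?case by simp
next
  case (Cons e \<beta>)
  have e: "e \<in> edges G" using Cons by simp
  have src: "src G e = vx k"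
  proof (rule ccontr)
    assume "src G e \<noteq> vx k"
    then have "st (e # \<beta>) * p {vx k} \<approx> 0" by (intro st_p_notin vx_gset e) simp
    then show False using Cons.prems(1) P_left P_iff_cg by (metis mult.assoc)
  qed
  have "st (e # \<beta>) * p {vx k} \<approx> st (e # \<beta>)" using src by (intro st_p_in vx_gset e) simp
  then have "p B * (st (e # \<beta>) * p {vx k}) \<approx> p B * st (e # \<beta>)" by (rule cg_left)
  also have "p B * st (e # \<beta>) = p B * st \<beta> * t e" by (simp add: mult.assoc)
  also have "\<dots> \<approx> p B * st \<beta> * (p (rng G e) * t e)" by (intro cg_left cg_sym[OF rng_t] e)
  finally have *: "p B * st \<beta> * p (rng G e) * t e \<notin> P" using Cons.prems(1) cg_P by (simp add: mult.assoc)
  then have "p B * st \<beta> * p (rng G e) \<notin> P" using P_right by blast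
  moreover from this have "p (rng G e) \<notin> P" using P_left by blast
  then have ek: "e = edg k" using unique_live_edge e src by blast
  ultimately have nP: "p B * st \<beta> * p {vx (Suc k)} \<notin> P"
    using cg_P[OF cg_left[OF p_rng_edg]] by blast
  have set: "set \<beta> \<subseteq> edges G" using Cons.prems(2) by simp
  have IH: "\<beta> = seg (Suc k) (length \<beta>)" "vx (Suc k + length \<beta>) \<in> B"
    using Cons.IH[OF nP set Cons.prems(3)] by blast+
  have "e # \<beta> = seg k (length (e # \<beta>))"
    unfolding length_Cons seg_Suc by (rule arg_cong2[where f = Cons, OF ek IH(1)])
  moreover have "vx (k + length (e # \<beta>)) \<in> B" using IH(2) by simp
  ultimately show ?case by (rule conjI)
qed

lemma p_vx_sp_p:
  assumes "p {vx k} * sp \<alpha> * p B \<notin> P" "set \<alpha> \<subseteq> edges G" "B \<in> gsets G"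
  shows "\<alpha> = seg k (length \<alpha>) \<and> vx (k + length \<alpha>) \<in> B"
  using assms
proof (induction \<alpha> arbitrary: k)
  case Nil
  then have "p ({vx k} \<inter> B) \<notin> P" using cg_P[OF p_p[OF vx_gset Nil(3)]] by simp
  then have "p (B \<inter> {vx k}) \<notin> P" unfolding Int_commute[of B] .
  from p_Int_singleton_notP[OF this] show ?case by simp
next
  case (Cons e \<alpha>)
  have e: "e \<in> edges G" using Cons by simp
  have src: "src G e = vx k"
  proof (rule ccontr)
    assume "src G e \<noteq> vx k"
    then have "p {vx k} * sp (e # \<alpha>) \<approx> 0" by (intro p_sp_notin vx_gset e) simp
    then show False using Cons.prems(1) P_right P_iff_cg by metis
  qed
  have "p {vx k} * sp (e # \<alpha>) \<approx> sp (e # \<alpha>)" using src by (intro p_sp_in vx_gset e) simp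
  then have "p {vx k} * sp (e # \<alpha>) * p B \<approx> sp (e # \<alpha>) * p B" by (rule cg_right)
  also have "sp (e # \<alpha>) * p B = s e * (sp \<alpha> * p B)" by (simp add: mult.assoc)
  also have "\<dots> \<approx> s e * p (rng G e) * (sp \<alpha> * p B)" by (intro cg_right cg_sym[OF s_rng] e)
  finally have *: "s e * (p (rng G e) * sp \<alpha> * p B) \<notin> P"
    using Cons.prems(1) cg_P by (simp add: mult.assoc)
  then have "p (rng G e) * (sp \<alpha> * p B) \<notin> P" using P_left by (metis mult.assoc)
  moreover from this have "p (rng G e) \<notin> P" using P_right by blast
  then have ek: "e = edg k" using unique_live_edge e src by blast
  ultimately have nP: "p {vx (Suc k)} * sp \<alpha> * p B \<notin> P"
    using cg_P[OF cg_right[OF p_rng_edg]] by (simp add: mult.assoc)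
  have set: "set \<alpha> \<subseteq> edges G" using Cons.prems(2) by simp
  have IH: "\<alpha> = seg (Suc k) (length \<alpha>)" "vx (Suc k + length \<alpha>) \<in> B"
    using Cons.IH[OF nP set Cons.prems(3)] by blast+
  have "e # \<alpha> = seg k (length (e # \<alpha>))"
    unfolding length_Cons seg_Suc by (rule arg_cong2[where f = Cons, OF ek IH(1)])
  moreover have "vx (k + length (e # \<alpha>)) \<in> B" using IH(2) by simp
  ultimately show ?case by (rule conjI)
qed

text \<open>The rest of \<open>B\<close> contributes nothing: survival would force the endpoint of
  the segment to lie in that rest.\<close>

lemma p_st_p_vx_cg:
  assumes "p B * st \<beta> * p {vx k} \<notin> P" "set \<beta> \<subseteq> edges G" "B \<in> gsets G"
  shows "p B * st \<beta> * p {vx k} \<approx> p {vx (k + length \<beta>)} * st \<beta> * p {vx k}"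
proof -
  let ?x = "vx (k + length \<beta>)" and ?z = "st \<beta> * p {vx k}"
  have x: "?x \<in> B" using p_st_p_vx assms by blast
  have "B - {?x} \<in> gsets G" by (intro gsets.diff assms vx_gset)
  then have "p (B - {?x}) * st \<beta> * p {vx k} \<in> P" using p_st_p_vx[of "B - {?x}" \<beta> k] assms by blast
  then have 0: "p (B - {?x}) * ?z \<approx> 0" by (simp add: P_iff_cg mult.assoc)
  have "p B * ?z \<approx> (p (B \<inter> {?x}) + p (B - {?x})) * ?z" by (intro cg_right p_split assms vx_gset)
  also have "\<dots> = p (B \<inter> {?x}) * ?z + p (B - {?x}) * ?z" by (rule distrib_right)
  also have "\<dots> \<approx> p (B \<inter> {?x}) * ?z + 0" by (intro cg_add cg_refl 0)
  also have "B \<inter> {?x} = {?x}" using x by blast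
  finally show ?thesis by (simp add: mult.assoc)
qed

lemma p_vx_sp_p_cg:
  assumes "p {vx k} * sp \<alpha> * p B \<notin> P" "set \<alpha> \<subseteq> edges G" "B \<in> gsets G"
  shows "p {vx k} * sp \<alpha> * p B \<approx> p {vx k} * sp \<alpha> * p {vx (k + length \<alpha>)}"
proof -
  let ?x = "vx (k + length \<alpha>)" and ?z = "p {vx k} * sp \<alpha>"
  have x: "?x \<in> B" using p_vx_sp_p assms by blast
  have "B - {?x} \<in> gsets G" by (intro gsets.diff assms vx_gset)
  then have "p {vx k} * sp \<alpha> * p (B - {?x}) \<in> P" using p_vx_sp_p[of k \<alpha> "B - {?x}"] assms by blast
  then have 0: "?z * p (B - {?x}) \<approx> 0" by (simp add: P_iff_cg)
  have "?z * p B \<approx> ?z * (p (B \<inter> {?x}) + p (B - {?x}))" by (intro cg_left p_split assms vx_gset)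
  also have "\<dots> = ?z * p (B \<inter> {?x}) + ?z * p (B - {?x})" by (rule distrib_left)
  also have "\<dots> \<approx> ?z * p (B \<inter> {?x}) + 0" by (intro cg_add cg_refl 0)
  also have "B \<inter> {?x} = {?x}" using x by blast
  finally show ?thesis by simp
qed

end

text \<open>What is kept of a non-graded prime: its dead sets and the Cuntz-Krieger relations at the
  vertices of \<open>M\<close> with finitely many live edges, regular and breaking ones alike. The
  ideal spanned by the expected generators qualifies as well.\<close>

locale nice_ideal = leavitt_ideal G K p s t P + exclusive_cycle_graph G c
  for G :: "('v, 'e) ultragraph" and K :: "'k::field \<Rightarrow> 'a::ring_1" and p s t P c +
  assumes p_P_iff: "A \<in> gsets G \<Longrightarrow> p A \<in> P \<longleftrightarrow> A \<inter> M = {}"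
    and ck_M: "w \<in> M \<Longrightarrow> finite {e \<in> edges G. src G e = w \<and> rng G e \<inter> M \<noteq> {}} \<Longrightarrow>
      p {w} - (\<Sum>e | e \<in> edges G \<and> src G e = w \<and> rng G e \<inter> M \<noteq> {}. s e * t e) \<in> P"
begin

sublocale cycle_ideal
proof
  fix k
  show "p {vx k} \<notin> P" using p_P_iff[OF gsets.vertex[OF vx_in]] vx_in_M by auto
  show "e = edg k" if "e \<in> edges G" "src G e = vx k" "p (rng G e) \<notin> P" for e
    using live_edges_vx that p_P_iff[OF gsets.range] by blast
  show "vx (Suc k) \<in> B" if "B \<in> gsets G" "B \<subseteq> rng G (edg k)" "p B \<notin> P" for B
  proof -
    have "B \<inter> M \<noteq> {}" using p_P_iff[OF that(1)] that(3) by blast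
    then obtain x where "x \<in> B" "x \<in> M" by blast
    moreover from this have "x \<in> rng G (edg k) \<inter> M" using \<open>B \<subseteq> rng G (edg k)\<close> by blast
    ultimately show ?thesis by (simp add: rng_Int_M)
  qed
  show "p {vx k} \<approx> s (edg k) * t (edg k)"
    using ck_M[OF vx_in_M, of k] unfolding live_edges_vx by (simp add: cg_def)
qed

end

text \<open>Primeness by elements, with a middle factor from the whole unital ring; the second axiom
  reduces that factor to a scalar plus an element of the algebra.\<close>

locale leavitt_prime = leavitt_ideal +
  assumes prime: "a \<in> Sp (\<lambda>_ _. True) \<Longrightarrow> b \<in> Sp (\<lambda>_ _. True) \<Longrightarrow> (\<And>z. a * z * b \<in> P) \<Longrightarrow> a \<in> P \<or> b \<in> P"
    and scalar_plus: "\<exists>k. z - K k \<in> Sp (\<lambda>_ _. True)"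
begin

text \<open>The middle factor can be taken from the algebra: \<open>p A\<close>, a left unit for
  \<open>b\<close>, already covers the scalars.\<close>

lemma prime_corner:
  assumes "a \<in> Sp (\<lambda>_ _. True)" "b \<in> Sp (\<lambda>_ _. True)" "a \<notin> P" "b \<notin> P" "A \<in> gsets G" "p A * b \<approx> b"
  obtains z where "z \<in> Sp (\<lambda>_ _. True)" "a * z * b \<notin> P"
proof (rule ccontr)
  assume "\<not> thesis"
  then have *: "a * z * b \<in> P" if "z \<in> Sp (\<lambda>_ _. True)" for z
    using that \<open>\<And>z. z \<in> Sp (\<lambda>_ _. True) \<Longrightarrow> a * z * b \<notin> P \<Longrightarrow> thesis\<close> by blast
  have "p A \<in> Sp (\<lambda>_ _. True)"
    using mono_in_Sp[of A "[]" "[]" "\<lambda>_ _. True"] assms by (simp add: mono_def)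
  then have "a * p A * b \<in> P" using * by blast
  then have ab: "a * b \<in> P" using cg_P[OF cg_left[OF assms(6), of a]] by (simp add: mult.assoc)
  have "a * z * b \<in> P" for z
  proof -
    obtain k where "z - K k \<in> Sp (\<lambda>_ _. True)" using scalar_plus by blast
    then have "a * (z - K k) * b + K k * (a * b) \<in> P"
      using P_add[OF * P_left[OF ab, of "K k"]] by blast
    moreover have "K k * (a * b) = a * K k * b" by (metis K_commute mult.assoc)
    ultimately show ?thesis by (simp add: algebra_simps)
  qed
  then show False using prime assms by blast
qed

text \<open>The vertices of \<open>d\<close> lead back to \<open>c\<close> and therefore survive, so
  \<open>d\<close> can only follow the unique live edges of \<open>c\<close>. The length of each
  cycle is a return time of the other, hence the lengths divide each other.\<close>

lemma live_cycle_exclusive: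
  assumes "live_cycle c"
  shows "exclusive_cycle G c"
proof -
  interpret C: cycle_graph G c using assms by unfold_locales (simp add: live_cycle_def)
  have live: "linked_to (p {C.vx k})"
    "\<And>e. e \<in> edges G \<Longrightarrow> src G e = C.vx k \<Longrightarrow> p (rng G e) \<notin> P \<Longrightarrow> e = C.edg k"
    "\<And>B. B \<in> gsets G \<Longrightarrow> B \<subseteq> rng G (C.edg k) \<Longrightarrow> p B \<notin> P \<Longrightarrow> C.vx (Suc k) \<in> B" for k
    using assms unfolding live_cycle_def by blast+
  have "\<exists>k. d = rotate k c" if d: "cycle G d" "base G d \<in> src G ` set c" for d
  proof -
    interpret D: cycle_graph G d using d by unfold_locales
    obtain k where k: "D.vx 0 = C.vx k" using d(2) D.base_eq C.vx_range by auto
    have nP: "p {D.vx i} \<notin> P" for i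
    proof -
      obtain j where "D.vx (i + j) = D.vx 0" using D.reach_vx by blast
      then have "walk G (D.vx i) (D.seg i j) (C.vx k)" using D.walk_seg[of i j] k by simp
      then show ?thesis using walk_notP live(1) D.vx_in linked_to_def by blast
    qed
    have vx_edg: "D.vx i = C.vx (k + i) \<and> D.edg i = C.edg (k + i)" for i
    proof (induction i)
      have edg: "D.edg i = C.edg (k + i)" if "D.vx i = C.vx (k + i)" for i
      proof -
        have "p (rng G (D.edg i)) \<notin> P"
          using p_src_P[OF D.edg_in gsets.vertex[OF D.vx_in], of "i" i] nP[of "Suc i"]
            p_P_subset[OF _ gsets.range[OF D.edg_in] gsets.vertex[OF D.vx_in], of i "Suc i"]
            D.vx_Suc_in_rng[of i] by blast
        then show ?thesis using live(2) D.edg_in D.src_edg that by metis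
      qed
      {
        case 0
        then show ?case using k edg[of 0] by simp
      next
        case (Suc i)
        have "C.vx (Suc (k + i)) \<in> {D.vx (Suc i)}"
          using Suc nP[of "Suc i"] D.vx_Suc_in_rng[of i]
          by (intro live(3) gsets.vertex D.vx_in) auto
        then show ?case using edg[of "Suc i"] by simp
      }
    qed
    have "C.vx (k + length d) = C.vx k" using vx_edg[of "length d"] D.vx_period(2)[of 0] k by simp
    then have "length c dvd length d"
      unfolding C.vx_eq_iff by (metis add_diff_cancel_left' mod_eq_dvd_iff_nat le_add1)
    moreover have "D.vx (length c) = D.vx 0" using vx_edg[of "length c"] C.vx_period(1)[of k] k by simp
    then have "length d dvd length c" unfolding D.vx_eq_iff by auto
    ultimately have len: "length d = length c" by (rule dvd_antisym[symmetric])
    have "d = D.seg 0 (length d)" by (simp add: D.seg_c)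
    also have "\<dots> = C.seg k (length c)"
      by (rule nth_equalityI) (simp_all add: len D.seg_nth C.seg_nth vx_edg)
    finally have "d = rotate k c" by (simp add: C.seg_m)
    then show ?thesis by blast
  qed
  then show ?thesis using C.is_cycle by (auto simp: exclusive_cycle_def)
qed

text \<open>Primeness connects every surviving element \<open>a\<close> to the cycle:
  \<open>a * sp \<alpha> * p {vx j}\<close> survives for some word \<open>\<alpha>\<close>. Applied
  to \<open>p A\<close> and to a Cuntz-Krieger defect, this gives the axioms of
  \<open>nice_ideal\<close>.\<close>

theorem live_cycle_nice:
  assumes lc: "live_cycle c"
  shows "nice_ideal G K p s t P c"
proof -
  interpret X: exclusive_cycle_graph G c
    using live_cycle_exclusive[OF lc] by unfold_locales (simp_all add: exclusive_cycle_def)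
  have live: "linked_to (p {X.vx k})"
    "\<And>e. e \<in> edges G \<Longrightarrow> src G e = X.vx k \<Longrightarrow> p (rng G e) \<notin> P \<Longrightarrow> e = X.edg k"
    "\<And>B. B \<in> gsets G \<Longrightarrow> B \<subseteq> rng G (X.edg k) \<Longrightarrow> p B \<notin> P \<Longrightarrow> X.vx (Suc k) \<in> B" for k
    using lc unfolding live_cycle_def by blast+
  interpret C: cycle_ideal G K p s t P c
  proof
    fix k
    show "p {X.vx k} \<notin> P" using live(1) linked_to_def by blast
    show "p {X.vx k} \<approx> s (X.edg k) * t (X.edg k)"
      using linked_unique_edge[OF live(1) X.edg_in X.src_edg] live(2) by blast
  qed (use live in blast)+
  let ?v = "X.vx 0"
  have pv: "p {?v} \<in> Sp (\<lambda>_ _. True)" "p {?v} * p {?v} \<approx> p {?v}"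
    using mono_in_Sp[OF C.vx_gset, of "[]" "[]" "\<lambda>_ _. True"] p_p[OF C.vx_gset C.vx_gset, of 0 0]
    by (auto simp: mono_def)
  have reach: "\<exists>\<alpha> j. set \<alpha> \<subseteq> edges G \<and> a * sp \<alpha> * p {X.vx j} \<notin> P"
    if a: "a \<in> Sp (\<lambda>_ _. True)" "a \<notin> P" for a
  proof -
    obtain z where z: "z \<in> Sp (\<lambda>_ _. True)" "a * z * p {?v} \<notin> P"
      using prime_corner[OF a(1) pv(1) a(2) C.vx_notP C.vx_gset pv(2)] by blast
    then obtain B \<alpha> \<beta> where *: "B \<in> gsets G" "set \<alpha> \<subseteq> edges G" "set \<beta> \<subseteq> edges G"
      "a * mono \<alpha> B \<beta> * p {?v} \<notin> P" using Sp_image_mono_notP[OF z] by metis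
    then have nP: "a * sp \<alpha> * (p B * st \<beta> * p {?v}) \<notin> P" by (simp add: mono_def mult.assoc)
    then have "p B * st \<beta> * p {?v} \<notin> P" using P_left by blast
    from C.p_st_p_vx_cg[OF this *(3,1)]
    have "a * sp \<alpha> * p {X.vx (0 + length \<beta>)} * (st \<beta> * p {?v}) \<notin> P"
      using nP cg_P[OF cg_left] by (metis mult.assoc)
    then show ?thesis using *(2) P_right by blast
  qed
  have iff: "p A \<in> P \<longleftrightarrow> A \<inter> X.M = {}" if A: "A \<in> gsets G" for A
  proof
    assume "p A \<in> P"
    show "A \<inter> X.M = {}"
    proof (rule ccontr)
      assume "A \<inter> X.M \<noteq> {}"
      then obtain x where x: "x \<in> A" "x \<in> X.M" by blast
      then obtain es where "walk G x es ?v" "x \<in> verts G" using X.M_iff by blast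
      then have "p {x} \<notin> P" using walk_notP C.vx_notP by blast
      then show False using p_P_subset[OF \<open>p A \<in> P\<close> A gsets.vertex] x \<open>x \<in> verts G\<close> by blast
    qed
  next
    assume disj: "A \<inter> X.M = {}"
    show "p A \<in> P"
    proof (rule ccontr)
      assume "p A \<notin> P"
      moreover have "p A \<in> Sp (\<lambda>_ _. True)"
        using mono_in_Sp[OF A, of "[]" "[]" "\<lambda>_ _. True"] by (simp add: mono_def)
      ultimately obtain \<alpha> j where *: "set \<alpha> \<subseteq> edges G" "p A * sp \<alpha> * p {X.vx j} \<notin> P"
        using reach by blast
      have "sp \<alpha> * p {X.vx j} \<notin> P" using *(2) P_left by (metis mult.assoc)
      then obtain u where u: "walk G u \<alpha> (X.vx j)" using sp_p_walk *(1) X.vx_in by blast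
      show False
      proof (cases \<alpha>)
        case Nil
        then have "p (A \<inter> {X.vx j}) \<notin> P" using *(2) cg_P[OF p_p[OF A C.vx_gset]] by simp
        from p_Int_singleton_notP[OF this] show ?thesis using X.vx_in_M disj by blast
      next
        case (Cons e \<alpha>')
        have "src G e \<in> A"
        proof (rule ccontr)
          assume "src G e \<notin> A"
          then have "p A * sp \<alpha> \<approx> 0" using Cons *(1) A unfolding Cons by (intro p_sp_notin) auto
          then show False using *(2) P_right P_iff_cg by blast
        qed
        moreover have "src G e \<in> X.M"
          using X.walk_into_M[OF u X.vx_in_M] u Cons src_in by auto
        ultimately show ?thesis using disj by blast
      qed
    qed
  qed
  have ck: "p {w} - (\<Sum>e | e \<in> edges G \<and> src G e = w \<and> rng G e \<inter> X.M \<noteq> {}. s e * t e) \<in> P"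
    if w: "w \<in> X.M" and fin: "finite {e \<in> edges G. src G e = w \<and> rng G e \<inter> X.M \<noteq> {}}" for w
  proof (rule ccontr)
    define \<Lambda> where "\<Lambda> = {e \<in> edges G. src G e = w \<and> rng G e \<inter> X.M \<noteq> {}}"
    let ?r = "p {w} - (\<Sum>e\<in>\<Lambda>. s e * t e)"
    assume "\<not> ?thesis"
    then have rP: "?r \<notin> P" by (simp add: \<Lambda>_def)
    have \<Lambda>: "finite \<Lambda>" "\<Lambda> \<subseteq> edges G" using fin by (auto simp: \<Lambda>_def)
    have wg: "{w} \<in> gsets G" "w \<in> verts G" using w X.M_verts gsets.vertex[of w G] by auto
    \<comment> \<open>Congruent to \<open>?r\<close>, in a form that visibly kills every
      \<open>s e\<close>. So the word supplied by \<open>reach\<close> is empty and \<open>w\<close>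
      lies on the cycle, where the relation is already known.\<close>
    define q where "q = p {w} * gap \<Lambda>"
    have "q = p {w} - (\<Sum>e\<in>\<Lambda>. p {w} * s e * t e)"
      by (simp add: q_def gap_def right_diff_distrib sum_distrib_left mult.assoc)
    also have "\<dots> \<approx> ?r"
      using wg \<Lambda> by (intro cg_diff cg_refl cg_sum cg_right p_s_in) (auto simp: \<Lambda>_def)
    finally have qr: "q \<approx> ?r" .
    then have qP: "q \<notin> P" using rP cg_P by blast
    have qs: "q * s e \<in> P" if e: "e \<in> edges G" for e
    proof (cases "e \<in> \<Lambda>")
      case True
      then show ?thesis using cg_left[OF gap_s[OF \<Lambda> e], of "p {w}"]
        by (simp add: P_iff_cg q_def mult.assoc)
    next
      case False
      have 1: "q * s e \<approx> p {w} * s e"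
        using cg_left[OF gap_s[OF \<Lambda> e], of "p {w}"] False by (simp add: q_def mult.assoc)
      have "p {w} * s e \<in> P"
      proof (cases "src G e = w")
        case True
        then have "p (rng G e) \<in> P" using False e iff[OF gsets.range] by (auto simp: \<Lambda>_def)
        then show ?thesis using s_P_iff e P_left by blast
      next
        case False
        then show ?thesis using p_s_notin[OF wg(1) e] by (auto simp: P_iff_cg)
      qed
      then show ?thesis using cg_P[OF 1] by blast
    qed
    have "q = p {w} - (\<Sum>e\<in>\<Lambda>. p {w} * (s e * t e))"
      by (simp add: q_def gap_def right_diff_distrib sum_distrib_left mult.assoc)
    moreover have "p {w} \<in> Sp (\<lambda>_ _. True)"
      using mono_in_Sp[OF wg(1), of "[]" "[]" "\<lambda>_ _. True"] by (simp add: mono_def)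
    moreover have "s e * t e \<in> Sp (\<lambda>_ _. True)" if "e \<in> edges G" for e
    proof -
      have "s e * p (rng G e) * t e \<in> Sp (\<lambda>_ _. True)"
        using mono_in_Sp[OF gsets.range[OF that], of "[e]" "[e]" "\<lambda>_ _. True"] that
        by (simp add: mono_def)
      then show ?thesis using Sp_cg[OF _ cg_right[OF s_rng[OF that]]] by blast
    qed
    ultimately have "q \<in> Sp (\<lambda>_ _. True)"
      using \<Lambda> wg by (auto intro!: Sp_diff Sp_sum p_Sp)
    then obtain \<alpha> j where *: "set \<alpha> \<subseteq> edges G" "q * sp \<alpha> * p {X.vx j} \<notin> P"
      using reach qP by blast
    have "\<alpha> = []"
    proof (rule ccontr)
      assume "\<alpha> \<noteq> []"
      then obtain e \<alpha>' where "\<alpha> = e # \<alpha>'" by (cases \<alpha>) auto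
      then have "q * s e * (sp \<alpha>' * p {X.vx j}) \<notin> P" "e \<in> edges G" using * by (auto simp: mult.assoc)
      then show False using qs P_right by blast
    qed
    then have qj: "q * p {X.vx j} \<notin> P" using * by simp
    have wj: "w = X.vx j"
    proof (rule ccontr)
      assume "w \<noteq> X.vx j"
      have "q * p {X.vx j} \<approx> ?r * p {X.vx j}" by (rule cg_right[OF qr])
      also have "\<dots> = p {w} * p {X.vx j} - (\<Sum>e\<in>\<Lambda>. s e * (t e * p {X.vx j}))"
        by (simp add: left_diff_distrib sum_distrib_right mult.assoc)
      also have "\<dots> \<approx> p ({w} \<inter> {X.vx j}) - (\<Sum>e\<in>\<Lambda>. s e * 0)"
        using \<open>w \<noteq> X.vx j\<close> \<Lambda> wg
        by (intro cg_diff cg_sum p_p cg_left t_p_notin C.vx_gset) (auto simp: \<Lambda>_def)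
      also have "{w} \<inter> {X.vx j} = {}" using \<open>w \<noteq> X.vx j\<close> by blast
      finally have "q * p {X.vx j} \<approx> p {}" by simp
      then show False using qj rel_empty cg_P by blast
    qed
    have "\<Lambda> = {X.edg j}"
      using X.live_edges_vx[of j] wj unfolding \<Lambda>_def by simp
    then have "?r \<in> P" using C.vx_ck[of j] wj by (simp add: cg_def)
    then show False using rP by blast
  qed
  show ?thesis by unfold_locales (use iff ck in auto)
qed

theorem exists_nice_cycle:
  assumes "homogeneous_sum S y" "n \<in> S" "y n \<notin> P"
  shows "\<exists>c. nice_ideal G K p s t P c \<and> linked_to (p {base G c})"
proof -
  obtain A where "A \<in> gsets G" "linked_to (p A)" by (rule linked_to_gset_exists[OF assms]) (rule that)
  then obtain c where c: "live_cycle c" using linked_live_cycle by blast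
  then have "nice_ideal G K p s t P c" by (rule live_cycle_nice)
  moreover interpret C: cycle_graph G c using c by unfold_locales (simp add: live_cycle_def)
  have "linked_to (p {base G c})" using c unfolding live_cycle_def C.base_eq by blast
  ultimately show ?thesis by blast
qed

end

section \<open>The corner at the cycle\<close>

lemma int_Suc_induct [case_names zero plus minus]:
  assumes "Q (0::int)" "\<And>i. Q i \<Longrightarrow> Q (i + 1)" "\<And>i. Q i \<Longrightarrow> Q (i - 1)"
  shows "Q i"
  by (rule int_induct[of Q 0]) (use assms in auto)

lemma poly_mapping_sum_single:
  "(g :: 'b \<Rightarrow>\<^sub>0 'c::comm_monoid_add) = (\<Sum>i\<in>Poly_Mapping.keys g. Poly_Mapping.single i (Poly_Mapping.lookup g i))"
proof (rule poly_mapping_eqI)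
  fix k
  have "Poly_Mapping.lookup (\<Sum>i\<in>Poly_Mapping.keys g. Poly_Mapping.single i (Poly_Mapping.lookup g i)) k =
    (\<Sum>i\<in>Poly_Mapping.keys g. if i = k then Poly_Mapping.lookup g k else 0)"
    unfolding lookup_sum by (rule sum.cong) (auto simp: lookup_single when_def)
  then show "Poly_Mapping.lookup g k =
    Poly_Mapping.lookup (\<Sum>i\<in>Poly_Mapping.keys g. Poly_Mapping.single i (Poly_Mapping.lookup g i)) k"
    by (simp add: in_keys_iff)
qed

context leavitt_ideal
begin

abbreviation Fin :: "'a set" where "Fin \<equiv> Sp (\<lambda>_ _. True)"

lemma Fin_p: "A \<in> gsets G \<Longrightarrow> p A \<in> Fin"
  using mono_in_Sp[of A "[]" "[]" "\<lambda>_ _. True"] by (simp add: mono_def)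

lemma Fin_s: "e \<in> edges G \<Longrightarrow> s e \<in> Fin"
  using mono_in_Sp[OF gsets.range, of e "[e]" "[]" "\<lambda>_ _. True"] Sp_cg[OF _ s_rng]
  by (auto simp: mono_def)

lemma Fin_t: "e \<in> edges G \<Longrightarrow> t e \<in> Fin"
  using mono_in_Sp[OF gsets.range, of e "[]" "[e]" "\<lambda>_ _. True"] Sp_cg[OF _ rng_t]
  by (auto simp: mono_def)

lemma s_Fin: "e \<in> edges G \<Longrightarrow> y \<in> Fin \<Longrightarrow> s e * y \<in> Fin"
  by (rule s_Sp) auto

lemma t_Fin: "e \<in> edges G \<Longrightarrow> y \<in> Fin \<Longrightarrow> t e * y \<in> Fin"
  by (rule t_Sp) auto

lemma sp_Fin: "set \<alpha> \<subseteq> edges G \<Longrightarrow> y \<in> Fin \<Longrightarrow> sp \<alpha> * y \<in> Fin"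
  by (induction \<alpha>) (auto simp: mult.assoc intro: s_Fin)

lemma st_Fin: "set \<alpha> \<subseteq> edges G \<Longrightarrow> y \<in> Fin \<Longrightarrow> st \<alpha> * y \<in> Fin"
proof (induction \<alpha> arbitrary: y)
  case (Cons e \<alpha>)
  then have "st \<alpha> * (t e * y) \<in> Fin" using t_Fin by auto
  then show ?case by (simp add: mult.assoc)
qed simp

lemma Fin_mult: "x \<in> Fin \<Longrightarrow> y \<in> Fin \<Longrightarrow> x * y \<in> Fin"
proof -
  assume x: "x \<in> Fin" and y: "y \<in> Fin"
  have "1 * x * y \<in> Fin" using x
  proof (rule Sp_image)
    fix A \<alpha> \<beta> assume *: "A \<in> gsets G" "set \<alpha> \<subseteq> edges G" "set \<beta> \<subseteq> edges G"
    have "sp \<alpha> * (p A * (st \<beta> * y)) \<in> Fin" by (intro sp_Fin p_Sp st_Fin * y)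
    then show "1 * mono \<alpha> A \<beta> * y \<in> Fin" by (simp add: mono_def mult.assoc)
  qed
  then show ?thesis by simp
qed

lemma t_gap_in: "finite E \<Longrightarrow> E \<subseteq> edges G \<Longrightarrow> e \<in> E \<Longrightarrow> t e * gap E \<in> P"
  using t_gap[of E e] by (auto simp: P_iff_cg)

end

context cycle_graph
begin

lemma seg_cong: "vx k = vx k' \<Longrightarrow> seg k n = seg k' n"
  unfolding vx_eq_iff by (metis seg_mod)

lemma vx_mult [simp]: "vx (k * m) = vx 0" "vx (m * k) = vx 0"
  by (simp_all add: vx_eq_iff)

lemma vx_mult_add [simp]: "vx (k * m + n) = vx n" "vx (n + k * m) = vx n"
  by (simp_all add: vx_eq_iff)

end

context cycle_ideal
begin

text \<open>A step along the cycle cut down to single vertices. The projection at the far end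
  replaces the range of the last edge, so that \<open>up\<close> and \<open>dn\<close> become
  mutually inverse between \<open>p {vx k}\<close> and \<open>p {vx (k + n)}\<close>.\<close>

definition up :: "nat \<Rightarrow> nat \<Rightarrow> 'a" where "up k n = sp (seg k n) * p {vx (k + n)}"

definition dn :: "nat \<Rightarrow> nat \<Rightarrow> 'a" where "dn k n = p {vx (k + n)} * st (seg k n)"

lemma p_vx_idem: "p {vx k} * p {vx k} \<approx> p {vx k}"
  using p_p[OF vx_gset vx_gset, of k k] by simp

lemma up_0: "up k 0 = p {vx k}" and dn_0: "dn k 0 = p {vx k}"
  by (simp_all add: up_def dn_def)

lemma up_cong: "vx k = vx k' \<Longrightarrow> up k n = up k' n"
  and dn_cong: "vx k = vx k' \<Longrightarrow> dn k n = dn k' n"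
  unfolding up_def dn_def using seg_cong vx_add_eq by metis+

lemma up_Fin: "up k n \<in> Fin"
  unfolding up_def by (intro sp_Fin set_seg Fin_p vx_gset)

lemma p_vx_st_seg: "st (seg k n) * p {vx k} \<approx> (if n = 0 then p {vx k} else st (seg k n))"
proof (cases n)
  case (Suc n')
  then show ?thesis unfolding Suc seg_Suc
    using st_p_in[OF vx_gset edg_in, of k k] src_edg by simp
qed simp

lemma p_sp_seg: "p {vx k} * sp (seg k n) \<approx> (if n = 0 then p {vx k} else sp (seg k n))"
proof (cases n)
  case (Suc n')
  then show ?thesis unfolding Suc seg_Suc
    using p_sp_in[OF vx_gset edg_in, of k k] src_edg by simp
qed simp

lemma p_up: "p {vx k} * up k n \<approx> up k n"
proof (cases "n = 0")
  case False
  then show ?thesis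
    using cg_right[OF p_sp_seg, of k n "p {vx (k + n)}"] by (simp add: up_def mult.assoc)
qed (simp add: up_0 p_vx_idem)

lemma dn_p: "dn k n * p {vx k} \<approx> dn k n"
proof (cases "n = 0")
  case False
  then show ?thesis
    using cg_left[OF p_vx_st_seg, of "p {vx (k + n)}" k n] by (simp add: dn_def mult.assoc)
qed (simp add: dn_0 p_vx_idem)

lemma up_p: "up k n * p {vx (k + n)} \<approx> up k n"
  unfolding up_def using cg_left[OF p_vx_idem] by (simp add: mult.assoc)

lemma p_dn: "p {vx (k + n)} * dn k n \<approx> dn k n"
  unfolding dn_def using cg_right[OF p_vx_idem] by (simp add: mult.assoc)

lemma up_append: "up k n * up (k + n) l \<approx> up k (n + l)"
proof -
  have "up k n * up (k + n) l = sp (seg k n) * (p {vx (k + n)} * up (k + n) l)"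
    by (simp add: up_def mult.assoc)
  also have "\<dots> \<approx> sp (seg k n) * up (k + n) l" by (intro cg_left p_up)
  also have "\<dots> = up k (n + l)" by (simp add: up_def seg_append sp_append mult.assoc add.assoc)
  finally show ?thesis .
qed

lemma dn_append: "dn (k + n) l * dn k n \<approx> dn k (n + l)"
proof -
  have "dn (k + n) l * dn k n = (dn (k + n) l * p {vx (k + n)}) * st (seg k n)"
    by (simp add: dn_def mult.assoc)
  also have "\<dots> \<approx> dn (k + n) l * st (seg k n)" by (intro cg_right dn_p)
  also have "\<dots> = dn k (n + l)" by (simp add: dn_def seg_append st_append mult.assoc add.assoc)
  finally show ?thesis .
qed

lemma edge_path_seg: "n > 0 \<Longrightarrow> edge_path G (seg k n)"
  using walk_seg[of k n] walk_iff_edge_path[of "seg k n" G] by (cases n) (auto simp: seg_Suc)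

lemma dn_up: "dn k n * up k n \<approx> p {vx (k + n)}"
proof (cases n)
  case 0
  then show ?thesis using p_vx_idem by (simp add: up_0 dn_0)
next
  case (Suc l)
  let ?x = "p {vx (k + n)}"
  have last: "last (seg k n) = edg (k + l)" unfolding Suc seg_Suc_right by simp
  have "dn k n * up k n = ?x * (st (seg k n) * sp (seg k n)) * ?x"
    by (simp add: up_def dn_def mult.assoc)
  also have "\<dots> \<approx> ?x * p (rng G (edg (k + l))) * ?x"
    unfolding last[symmetric] using Suc by (intro cg_right cg_left st_sp edge_path_seg) simp
  also have "\<dots> \<approx> ?x"
    using vx_Suc_in_rng[of "k + l"] Suc by (intro p_idem3 rng_edg_gset vx_gset) simp
  finally show ?thesis .
qed

lemma p_vx_t_edg: "p {vx (Suc k)} * t (edg k) \<approx> t (edg k)"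
  using cg_trans[OF cg_right[OF cg_sym[OF p_rng_edg]] rng_t[OF edg_in]] .

lemma up_Suc: "up k (Suc n) = s (edg k) * up (Suc k) n"
  and dn_Suc: "dn k (Suc n) = dn (Suc k) n * t (edg k)"
  by (simp_all add: up_def dn_def seg_Suc mult.assoc)

text \<open>Telescopes from the inside by \<open>vx_ck\<close>. This makes the cycle invertible in
  the corner, not merely an isometry.\<close>

lemma up_dn: "up k n * dn k n \<approx> p {vx k}"
proof (induction n arbitrary: k)
  case 0
  then show ?case using p_vx_idem by (simp add: up_0 dn_0)
next
  case (Suc n)
  have "up k (Suc n) * dn k (Suc n) = s (edg k) * (up (Suc k) n * dn (Suc k) n) * t (edg k)"
    by (simp add: up_Suc dn_Suc mult.assoc)
  also have "\<dots> \<approx> s (edg k) * p {vx (Suc k)} * t (edg k)" by (intro cg_right cg_left Suc)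
  also have "\<dots> = s (edg k) * (p {vx (Suc k)} * t (edg k))" by (simp add: mult.assoc)
  also have "\<dots> \<approx> s (edg k) * t (edg k)" by (intro cg_left p_vx_t_edg)
  also have "\<dots> \<approx> p {vx k}" by (rule cg_sym[OF vx_ck])
  finally show ?case .
qed

text \<open>The powers of the cycle inside the corner at \<open>vx 0\<close>, where
  \<open>p {vx 0}\<close> is a two-sided unit modulo \<open>P\<close>.\<close>

definition cp :: "int \<Rightarrow> 'a" where
  "cp i = (if 0 \<le> i then up 0 (nat i * m) else dn 0 (nat (- i) * m))"

lemma cp_0: "cp 0 = p {vx 0}"
  by (simp add: cp_def up_0)

lemma cp_of_nat: "cp (int n) = up 0 (n * m)"
  by (simp add: cp_def)

lemma cp_uminus_of_nat: "cp (- int n) = dn 0 (n * m)"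
  by (cases n) (simp_all add: cp_def up_0 dn_0 flip: of_nat_Suc)

lemma p_cp: "p {vx 0} * cp i \<approx> cp i"
  unfolding cp_def using p_up[of 0] p_dn[of 0 "nat (- i) * m"] by simp

lemma S_cp: "up 0 m * cp i \<approx> cp (i + 1)"
proof (cases "i \<ge> 0")
  case True
  then obtain n where n: "i = int n" using nonneg_int_cases by blast
  have "up m (n * m) = up 0 (n * m)" by (rule up_cong) (use vx_mult(1)[of 1] in simp)
  then have "up 0 m * up 0 (n * m) \<approx> up 0 (m + n * m)"
    using up_append[of 0 m "n * m"] by simp
  moreover have "cp (i + 1) = up 0 (m + n * m)" using cp_of_nat[of "Suc n"] n by (simp add: add.commute)
  ultimately show ?thesis using n by (simp add: cp_of_nat)
next
  case False
  then obtain n where n: "i = - int (Suc n)" using neg_int_cases[of i] by (metis not_le Suc_pred)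
  have "dn (n * m) m = dn 0 m" by (rule dn_cong) simp
  then have 1: "dn 0 m * dn 0 (n * m) \<approx> dn 0 (Suc n * m)"
    using dn_append[of 0 "n * m" m] by (simp add: add.commute)
  have "cp i = dn 0 (Suc n * m)" unfolding n by (rule cp_uminus_of_nat)
  then have "up 0 m * cp i \<approx> up 0 m * (dn 0 m * dn 0 (n * m))" using cg_left[OF cg_sym[OF 1]] by simp
  also have "\<dots> = up 0 m * dn 0 m * dn 0 (n * m)" by (simp add: mult.assoc)
  also have "\<dots> \<approx> p {vx 0} * dn 0 (n * m)" by (intro cg_right up_dn)
  also have "\<dots> \<approx> dn 0 (n * m)" using p_dn[of 0 "n * m"] by simp
  also have "dn 0 (n * m) = cp (i + 1)" using cp_uminus_of_nat[of n] n by simp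
  finally show ?thesis .
qed

lemma T_cp: "dn 0 m * cp i \<approx> cp (i - 1)"
proof -
  have "dn 0 m * cp i \<approx> dn 0 m * (up 0 m * cp (i - 1))"
    using cg_left[OF cg_sym[OF S_cp[of "i - 1"]]] by simp
  also have "\<dots> = dn 0 m * up 0 m * cp (i - 1)" by (simp add: mult.assoc)
  also have "\<dots> \<approx> p {vx (0 + m)} * cp (i - 1)" by (intro cg_right dn_up)
  also have "vx (0 + m) = vx 0" using vx_mult(1)[of 1] by simp
  also have "p {vx 0} * cp (i - 1) \<approx> cp (i - 1)" by (rule p_cp)
  finally show ?thesis .
qed

lemma cp_mult: "cp i * cp j \<approx> cp (i + j)"
proof (induction i rule: int_Suc_induct)
  case zero
  show ?case using p_cp[of j] by (simp add: cp_0)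
next
  case (plus i)
  have "cp (i + 1) * cp j \<approx> up 0 m * cp i * cp j" by (intro cg_right cg_sym[OF S_cp])
  also have "\<dots> = up 0 m * (cp i * cp j)" by (simp add: mult.assoc)
  also have "\<dots> \<approx> up 0 m * cp (i + j)" by (intro cg_left plus)
  also have "\<dots> \<approx> cp (i + j + 1)" by (rule S_cp)
  finally show ?case by (simp add: algebra_simps)
next
  case (minus i)
  have "cp (i - 1) * cp j \<approx> dn 0 m * cp i * cp j" by (intro cg_right cg_sym[OF T_cp])
  also have "\<dots> = dn 0 m * (cp i * cp j)" by (simp add: mult.assoc)
  also have "\<dots> \<approx> dn 0 m * cp (i + j)" by (intro cg_left minus)
  also have "\<dots> \<approx> cp (i + j - 1)" by (rule T_cp)
  finally show ?case by (simp add: algebra_simps)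
qed

definition ev :: "'k laurent \<Rightarrow> 'a" where
  "ev g = (\<Sum>i\<in>Poly_Mapping.keys g. K (Poly_Mapping.lookup g i) * cp i)"

lemma ev_superset: "finite I \<Longrightarrow> Poly_Mapping.keys g \<subseteq> I \<Longrightarrow> ev g = (\<Sum>i\<in>I. K (Poly_Mapping.lookup g i) * cp i)"
  unfolding ev_def by (rule sum.mono_neutral_left) (auto simp: in_keys_iff K_zero)

lemma ev_add: "ev (g + h) = ev g + ev h"
proof -
  let ?I = "Poly_Mapping.keys g \<union> Poly_Mapping.keys h"
  have "ev (g + h) = (\<Sum>i\<in>?I. K (Poly_Mapping.lookup (g + h) i) * cp i)"
    by (rule ev_superset) (simp_all add: keys_add)
  also have "\<dots> = (\<Sum>i\<in>?I. K (Poly_Mapping.lookup g i) * cp i) + (\<Sum>i\<in>?I. K (Poly_Mapping.lookup h i) * cp i)"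
    by (simp add: lookup_add K_add distrib_right sum.distrib)
  also have "\<dots> = ev g + ev h" using ev_superset[of ?I g] ev_superset[of ?I h] by simp
  finally show ?thesis .
qed

lemma ev_0: "ev 0 = 0" by (simp add: ev_def)

lemma ev_sum: "ev (sum f I) = (\<Sum>i\<in>I. ev (f i))"
  by (induction I rule: infinite_finite_induct) (auto simp: ev_0 ev_add)

lemma ev_single: "ev (Poly_Mapping.single i k) = K k * cp i"
  by (simp add: ev_def K_zero)

lemma ev_1: "ev 1 = p {vx 0}"
  using ev_single[of 0 1] by (simp add: K_one cp_0)

lemma K_mult_mult: "K (k * l) * (x * y) = (K k * x) * (K l * y)"
  unfolding K_mult mult.assoc by (simp only: K_left_commute[of x l y])

lemma ev_mult: "ev (g * h) \<approx> ev g * ev h"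
proof -
  let ?g = "\<lambda>i. Poly_Mapping.lookup g i" and ?h = "\<lambda>j. Poly_Mapping.lookup h j"
  let ?I = "Poly_Mapping.keys g" and ?J = "Poly_Mapping.keys h"
  have "g * h = (\<Sum>i\<in>?I. Poly_Mapping.single i (?g i)) * (\<Sum>j\<in>?J. Poly_Mapping.single j (?h j))"
    using poly_mapping_sum_single[of g] poly_mapping_sum_single[of h] by simp
  also have "\<dots> = (\<Sum>i\<in>?I. \<Sum>j\<in>?J. Poly_Mapping.single (i + j) (?g i * ?h j))"
    by (simp add: sum_product mult_single)
  finally have "ev (g * h) = (\<Sum>i\<in>?I. \<Sum>j\<in>?J. K (?g i * ?h j) * cp (i + j))"
    by (simp add: ev_sum ev_single)
  also have "\<dots> \<approx> (\<Sum>i\<in>?I. \<Sum>j\<in>?J. K (?g i * ?h j) * (cp i * cp j))"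
    by (intro cg_sum cg_left cg_sym[OF cp_mult])
  also have "\<dots> = (\<Sum>i\<in>?I. \<Sum>j\<in>?J. (K (?g i) * cp i) * (K (?h j) * cp j))"
    by (simp only: K_mult_mult)
  also have "\<dots> = ev g * ev h" by (simp add: ev_def sum_product)
  finally show ?thesis .
qed

lemma p_ev: "p {vx 0} * ev g \<approx> ev g"
  using cg_sym[OF ev_mult[of 1 g]] by (simp add: ev_1)

lemma ev_p: "ev g * p {vx 0} \<approx> ev g"
  using cg_sym[OF ev_mult[of g 1]] by (simp add: ev_1)

lemma dn_Fin: "dn k n \<in> Fin"
proof -
  have "p {vx (k + n)} * (st (seg k n) * p {vx k}) \<in> Fin"
    by (intro p_Sp st_Fin set_seg Fin_p vx_gset)
  then show ?thesis using Sp_cg[OF _ dn_p, of k n] by (simp add: dn_def mult.assoc)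
qed

lemma ev_Fin: "ev g \<in> Fin"
  unfolding ev_def cp_def using up_Fin dn_Fin by (auto intro!: Sp_sum Sp_K)

text \<open>Segments ending at the same vertex differ in length by a multiple of \<open>m\<close>.
  The shorter one cancels and full turns remain.\<close>

lemma up_dn_cp:
  assumes "vx a = vx b"
  shows "\<exists>i. up 0 a * dn 0 b \<approx> cp i \<and> int a - int b = i * int m"
proof (cases "b \<le> a")
  case True
  have "a mod m = b mod m" using assms vx_eq_iff by blast
  then obtain q where q: "a = q * m + b"
    using True by (metis add.commute mod_eq_nat1E mult.commute)
  have "up (q * m) b = up 0 b" by (rule up_cong) simp
  then have 1: "up 0 (q * m) * up 0 b \<approx> up 0 a" using up_append[of 0 "q * m" b] q by simp
  have "up 0 a * dn 0 b \<approx> up 0 (q * m) * up 0 b * dn 0 b" by (intro cg_right cg_sym[OF 1])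
  also have "\<dots> = up 0 (q * m) * (up 0 b * dn 0 b)" by (simp add: mult.assoc)
  also have "\<dots> \<approx> up 0 (q * m) * p {vx 0}" by (intro cg_left up_dn)
  also have "\<dots> \<approx> up 0 (q * m)" using up_p[of 0 "q * m"] by simp
  also have "\<dots> = cp (int q)" by (simp add: cp_of_nat)
  finally show ?thesis using q by (intro exI[of _ "int q"]) simp
next
  case False
  have "a mod m = b mod m" using assms vx_eq_iff by blast
  then obtain q where q: "b = q * m + a"
    using False by (metis add.commute mod_eq_nat1E mult.commute nat_le_linear)
  have "dn (q * m) a = dn 0 a" by (rule dn_cong) simp
  then have 1: "dn 0 a * dn 0 (q * m) \<approx> dn 0 b" using dn_append[of 0 "q * m" a] q by simp
  have "up 0 a * dn 0 b \<approx> up 0 a * (dn 0 a * dn 0 (q * m))" by (intro cg_left cg_sym[OF 1])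
  also have "\<dots> = up 0 a * dn 0 a * dn 0 (q * m)" by (simp add: mult.assoc)
  also have "\<dots> \<approx> p {vx 0} * dn 0 (q * m)" by (intro cg_right up_dn)
  also have "\<dots> \<approx> dn 0 (q * m)" using p_dn[of 0 "q * m"] by simp
  also have "\<dots> = cp (- int q)" by (simp add: cp_uminus_of_nat)
  finally show ?thesis using q by (intro exI[of _ "- int q"]) simp
qed

text \<open>Survival forces both words along the cycle, and the projection between them forces both
  to end at the same vertex.\<close>

lemma mono_corner:
  assumes nP: "p {vx 0} * mono \<alpha> B \<beta> * p {vx 0} \<notin> P"
    and *: "set \<alpha> \<subseteq> edges G" "set \<beta> \<subseteq> edges G" "B \<in> gsets G"
  shows "\<exists>i. p {vx 0} * mono \<alpha> B \<beta> * p {vx 0} \<approx> cp i \<and> int (length \<alpha>) - int (length \<beta>) = i * int m"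
proof -
  let ?e = "p {vx 0}" and ?a = "length \<alpha>" and ?b = "length \<beta>"
  have nP': "?e * sp \<alpha> * p B * (st \<beta> * ?e) \<notin> P" using nP by (simp add: mono_def mult.assoc)
  have 1: "?e * sp \<alpha> * p B \<notin> P" using nP' P_right by blast
  have "?e * sp \<alpha> * (p B * st \<beta> * ?e) \<notin> P" using nP' by (simp add: mult.assoc)
  then have 2: "p B * st \<beta> * ?e \<notin> P" using P_left by blast
  have \<alpha>: "\<alpha> = seg 0 ?a" using p_vx_sp_p[OF 1 *(1,3)] by (rule conjunct1)
  have \<beta>: "\<beta> = seg 0 ?b" using p_st_p_vx[OF 2 *(2,3)] by (rule conjunct1)
  have up: "?e * sp \<alpha> * p B \<approx> up 0 ?a"
  proof -
    have "?e * sp \<alpha> * p B \<approx> ?e * sp \<alpha> * p {vx (0 + ?a)}" by (rule p_vx_sp_p_cg[OF 1 *(1,3)])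
    also have "\<dots> = ?e * up 0 ?a" unfolding up_def using \<alpha> by (simp add: mult.assoc)
    also have "\<dots> \<approx> up 0 ?a" by (rule p_up)
    finally show ?thesis .
  qed
  have dn: "p B * st \<beta> * ?e \<approx> dn 0 ?b"
  proof -
    have "p B * st \<beta> * ?e \<approx> p {vx (0 + ?b)} * st \<beta> * ?e" by (rule p_st_p_vx_cg[OF 2 *(2,3)])
    also have "\<dots> = dn 0 ?b * ?e" unfolding dn_def using \<beta> by simp
    also have "\<dots> \<approx> dn 0 ?b" by (rule dn_p)
    finally show ?thesis .
  qed
  have pp: "p B * p B \<approx> p B" using p_p[OF *(3,3)] by simp
  have "?e * mono \<alpha> B \<beta> * ?e = ?e * sp \<alpha> * p B * (st \<beta> * ?e)" by (simp add: mono_def mult.assoc)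
  also have "\<dots> \<approx> ?e * sp \<alpha> * (p B * p B) * (st \<beta> * ?e)"
    by (intro cg_right cg_left cg_sym[OF pp])
  also have "\<dots> = (?e * sp \<alpha> * p B) * (p B * st \<beta> * ?e)" by (simp add: mult.assoc)
  also have "\<dots> \<approx> up 0 ?a * dn 0 ?b" by (intro cg_mult up dn)
  finally have eq: "?e * mono \<alpha> B \<beta> * ?e \<approx> up 0 ?a * dn 0 ?b" .
  have "up 0 ?a * dn 0 ?b = sp (seg 0 ?a) * (p {vx ?a} * p {vx ?b}) * st (seg 0 ?b)"
    by (simp add: up_def dn_def mult.assoc)
  also have "\<dots> \<approx> sp (seg 0 ?a) * p ({vx ?a} \<inter> {vx ?b}) * st (seg 0 ?b)"
    by (intro cg_right cg_left p_p vx_gset)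
  finally have "sp (seg 0 ?a) * p ({vx ?a} \<inter> {vx ?b}) * st (seg 0 ?b) \<notin> P"
    using nP eq cg_P by blast
  then have "p ({vx ?a} \<inter> {vx ?b}) \<notin> P" using P_left P_right by blast
  from p_Int_singleton_notP[OF this] have "vx ?a = vx ?b" by simp
  then obtain i where "up 0 ?a * dn 0 ?b \<approx> cp i" "int ?a - int ?b = i * int m"
    using up_dn_cp by blast
  then show ?thesis using cg_trans[OF eq] by blast
qed

text \<open>The clause on exponents records degrees: an element of degree \<open>n\<close>
  contributes only exponents \<open>i\<close> with \<open>i * m = n\<close>. It later keeps nonzero
  degrees away from the constant coefficient.\<close>

lemma corner:
  assumes "x \<in> Sp \<Phi>"
  shows "\<exists>g. p {vx 0} * x * p {vx 0} \<approx> ev g \<and>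
    (\<forall>i\<in>Poly_Mapping.keys g. \<exists>\<alpha> \<beta>. \<Phi> \<alpha> \<beta> \<and> int (length \<alpha>) - int (length \<beta>) = i * int m)"
  using assms
proof (induction x rule: Sp.induct)
  case (Sp_P x)
  then have "p {vx 0} * x * p {vx 0} \<approx> ev 0" unfolding ev_0 P_iff_cg[symmetric] by (intro P_left P_right)
  then show ?case by (intro exI[of _ 0]) simp
next
  case (Sp_mono x A \<alpha> \<beta> k)
  let ?e = "p {vx 0}"
  obtain g where g: "?e * x * ?e \<approx> ev g"
    "\<forall>i\<in>Poly_Mapping.keys g. \<exists>\<alpha> \<beta>. \<Phi> \<alpha> \<beta> \<and> int (length \<alpha>) - int (length \<beta>) = i * int m"
    using Sp_mono.IH by blast
  have eq: "?e * (x + K k * mono \<alpha> A \<beta>) * ?e = ?e * x * ?e + K k * (?e * mono \<alpha> A \<beta> * ?e)"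
    by (simp add: algebra_simps K_left_commute)
  show ?case
  proof (cases "?e * mono \<alpha> A \<beta> * ?e \<in> P")
    case True
    then have "K k * (?e * mono \<alpha> A \<beta> * ?e) \<approx> 0" using P_left by (simp add: P_iff_cg[symmetric])
    then have "?e * (x + K k * mono \<alpha> A \<beta>) * ?e \<approx> ev g"
      unfolding eq using cg_add[OF g(1)] by fastforce
    then show ?thesis using g(2) by blast
  next
    case False
    then obtain i where i: "?e * mono \<alpha> A \<beta> * ?e \<approx> cp i" "int (length \<alpha>) - int (length \<beta>) = i * int m"
      using mono_corner Sp_mono by blast
    have "?e * (x + K k * mono \<alpha> A \<beta>) * ?e \<approx> ev (g + Poly_Mapping.single i k)"
      unfolding eq ev_add ev_single by (intro cg_add g cg_left i)
    moreover have "\<exists>\<alpha> \<beta>. \<Phi> \<alpha> \<beta> \<and> int (length \<alpha>) - int (length \<beta>) = j * int m"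
      if "j \<in> Poly_Mapping.keys (g + Poly_Mapping.single i k)" for j
    proof -
      have "j \<in> Poly_Mapping.keys g \<or> j = i"
        using that keys_add[of g "Poly_Mapping.single i k"] by (auto split: if_splits)
      then show ?thesis
      proof
        assume "j \<in> Poly_Mapping.keys g"
        then show ?thesis using g(2) by (rule_tac bspec)
      next
        assume "j = i"
        then show ?thesis using i(2) Sp_mono.hyps(5) by metis
      qed
    qed
    ultimately show ?thesis by (intro exI[of _ "g + Poly_Mapping.single i k"] conjI ballI)
  qed
qed

text \<open>Rotating the cycle conjugates \<open>f(s\<^sub>c)\<close> by a path along the cycle.\<close>

lemma dn_cp_up:
  "dn 0 k * cp i * up 0 k \<approx> (if 0 \<le> i then up k (nat i * m) else dn k (nat (- i) * m))"
proof (cases "0 \<le> i")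
  case True
  let ?n = "nat i * m"
  have 1: "up 0 ?n * up 0 k \<approx> up 0 (k + ?n)"
    using up_append[of 0 ?n k] up_cong[of ?n 0 k] by (simp add: add.commute)
  have "dn 0 k * cp i * up 0 k = dn 0 k * (up 0 ?n * up 0 k)" using True by (simp add: cp_def mult.assoc)
  also have "\<dots> \<approx> dn 0 k * (up 0 k * up k ?n)"
    using cg_left[OF cg_trans[OF 1 cg_sym[OF up_append[of 0 k ?n]]]] by simp
  also have "\<dots> = dn 0 k * up 0 k * up k ?n" by (simp add: mult.assoc)
  also have "\<dots> \<approx> p {vx (0 + k)} * up k ?n" by (intro cg_right dn_up)
  also have "\<dots> \<approx> up k ?n" using p_up by simp
  finally show ?thesis using True by simp
next
  case False
  let ?n = "nat (- i) * m"
  have 1: "dn 0 k * dn 0 ?n \<approx> dn 0 (k + ?n)"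
    using dn_append[of 0 ?n k] dn_cong[of ?n 0 k] by (simp add: add.commute)
  have "dn 0 k * cp i * up 0 k = (dn 0 k * dn 0 ?n) * up 0 k" using False by (simp add: cp_def mult.assoc)
  also have "\<dots> \<approx> (dn k ?n * dn 0 k) * up 0 k"
    using cg_right[OF cg_trans[OF 1 cg_sym[OF dn_append[of 0 k ?n]]]] by simp
  also have "\<dots> = dn k ?n * (dn 0 k * up 0 k)" by (simp add: mult.assoc)
  also have "\<dots> \<approx> dn k ?n * p {vx (0 + k)}" by (intro cg_left dn_up)
  also have "\<dots> \<approx> dn k ?n" using dn_p by simp
  finally show ?thesis using False by simp
qed

end

section \<open>The corner at the cycle detects the ideal\<close>

context leavitt_ideal
begin

text \<open>The ranges of the words belong to \<open>F\<close> too, so an admissible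
  \<open>C\<close> lies inside or outside each of them; \<open>sp \<alpha> * p C\<close> can then
  survive only if \<open>\<alpha>\<close> leads to every vertex of \<open>C\<close>.\<close>

lemma path_combination_aux:
  "y \<in> Sp (\<lambda>\<alpha> \<beta>. \<beta> = []) \<Longrightarrow> \<exists>F B. finite F \<and> F \<subseteq> gsets G \<and> B \<in> gsets G \<and> y * p B \<approx> y \<and>
    (\<forall>C\<in>gsets G. (\<forall>A\<in>F. C \<subseteq> A \<or> C \<inter> A = {}) \<longrightarrow>
      (\<exists>\<Gamma> c. finite \<Gamma> \<and> (\<forall>\<alpha>\<in>\<Gamma>. set \<alpha> \<subseteq> edges G \<and> (\<alpha> \<noteq> [] \<longrightarrow> rng G (last \<alpha>) \<in> F)) \<and>
        y * p C \<approx> (\<Sum>\<alpha>\<in>\<Gamma>. K (c \<alpha>) * (sp \<alpha> * p C))))"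
proof (induction y rule: Sp.induct)
  case (Sp_P y)
  have 1: "y * p {} \<approx> y" unfolding cg_def by (intro P_diff P_right Sp_P)
  have 2: "\<forall>C\<in>gsets G. (\<forall>A\<in>{}. C \<subseteq> A \<or> C \<inter> A = {}) \<longrightarrow>
      (\<exists>\<Gamma> c. finite \<Gamma> \<and> (\<forall>\<alpha>\<in>\<Gamma>. set \<alpha> \<subseteq> edges G \<and> (\<alpha> \<noteq> [] \<longrightarrow> rng G (last \<alpha>) \<in> {})) \<and>
        y * p C \<approx> (\<Sum>\<alpha>\<in>\<Gamma>. K (c \<alpha>) * (sp \<alpha> * p C)))"
  proof (intro ballI impI)
    fix C
    have "y * p C \<approx> (\<Sum>\<alpha>\<in>{}. K (0 :: 'k) * (sp \<alpha> * p C))"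
      using P_right[OF Sp_P, of "p C"] by (simp add: P_iff_cg)
    then show "\<exists>\<Gamma> c. finite \<Gamma> \<and> (\<forall>\<alpha>\<in>\<Gamma>. set \<alpha> \<subseteq> edges G \<and> (\<alpha> \<noteq> [] \<longrightarrow> rng G (last \<alpha>) \<in> {})) \<and>
        y * p C \<approx> (\<Sum>\<alpha>\<in>\<Gamma>. K (c \<alpha>) * (sp \<alpha> * p C))"
      by (intro exI[of _ "{}"] exI[of _ "\<lambda>_. 0"] conjI) simp_all
  qed
  show ?case
    by (rule exI[of _ "{}"], rule exI[of _ "{}"], intro conjI)
      (rule finite.emptyI, rule empty_subsetI, rule gsets.empty, rule 1, rule 2)
next
  case (Sp_mono y A \<alpha> \<beta> k)
  from Sp_mono.IH obtain F B where *: "finite F" "F \<subseteq> gsets G" "B \<in> gsets G" "y * p B \<approx> y"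
    and comb: "\<forall>C\<in>gsets G. (\<forall>A\<in>F. C \<subseteq> A \<or> C \<inter> A = {}) \<longrightarrow>
      (\<exists>\<Gamma> c. finite \<Gamma> \<and> (\<forall>\<alpha>\<in>\<Gamma>. set \<alpha> \<subseteq> edges G \<and> (\<alpha> \<noteq> [] \<longrightarrow> rng G (last \<alpha>) \<in> F)) \<and>
        y * p C \<approx> (\<Sum>\<alpha>\<in>\<Gamma>. K (c \<alpha>) * (sp \<alpha> * p C)))"
    by (elim exE conjE) (rule that)
  have A: "A \<in> gsets G" and BA: "B \<union> A \<in> gsets G" using Sp_mono * gsets.union[of B G A] by auto
  have m: "mono \<alpha> A \<beta> = sp \<alpha> * p A" using Sp_mono by (simp add: mono_def)
  define F' where "F' = insert A ((if \<alpha> = [] then {} else {rng G (last \<alpha>)}) \<union> F)"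
  have "rng G (last \<alpha>) \<in> gsets G" if "\<alpha> \<noteq> []"
    using last_in_set[OF that] Sp_mono.hyps(3) by (intro gsets.range) blast
  then have F': "finite F'" "F' \<subseteq> gsets G" using *(1,2) A by (auto simp: F'_def)
  have "y * p (B \<union> A) \<approx> (y * p B) * p (B \<union> A)" by (intro cg_right cg_sym[OF *(4)])
  also have "\<dots> = y * (p B * p (B \<union> A))" by (simp add: mult.assoc)
  also have "\<dots> \<approx> y * p (B \<inter> (B \<union> A))" by (intro cg_left p_p BA *)
  also have "B \<inter> (B \<union> A) = B" by blast
  also have "y * p B \<approx> y" by fact
  finally have 1: "y * p (B \<union> A) \<approx> y" .
  have "sp \<alpha> * p A * p (B \<union> A) = sp \<alpha> * (p A * p (B \<union> A))" by (simp add: mult.assoc)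
  also have "\<dots> \<approx> sp \<alpha> * p (A \<inter> (B \<union> A))" by (intro cg_left p_p BA A)
  also have "A \<inter> (B \<union> A) = A" by blast
  finally have 2: "sp \<alpha> * p A * p (B \<union> A) \<approx> sp \<alpha> * p A" .
  have unit: "(y + K k * mono \<alpha> A \<beta>) * p (B \<union> A) \<approx> y + K k * mono \<alpha> A \<beta>"
    unfolding m distrib_right mult.assoc[of "K k"] using 1 2 by (intro cg_add cg_left)
  have comb': "\<forall>C\<in>gsets G. (\<forall>A\<in>F'. C \<subseteq> A \<or> C \<inter> A = {}) \<longrightarrow>
      (\<exists>\<Gamma> c. finite \<Gamma> \<and> (\<forall>\<alpha>\<in>\<Gamma>. set \<alpha> \<subseteq> edges G \<and> (\<alpha> \<noteq> [] \<longrightarrow> rng G (last \<alpha>) \<in> F')) \<and>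
        (y + K k * mono \<alpha> A \<beta>) * p C \<approx> (\<Sum>\<alpha>\<in>\<Gamma>. K (c \<alpha>) * (sp \<alpha> * p C)))"
  proof (intro ballI impI)
    fix C assume C: "C \<in> gsets G" "\<forall>A\<in>F'. C \<subseteq> A \<or> C \<inter> A = {}"
    then have "\<forall>A\<in>F. C \<subseteq> A \<or> C \<inter> A = {}" by (simp add: F'_def)
    then obtain \<Gamma> c where \<Gamma>: "finite \<Gamma>" "\<forall>\<alpha>\<in>\<Gamma>. set \<alpha> \<subseteq> edges G \<and> (\<alpha> \<noteq> [] \<longrightarrow> rng G (last \<alpha>) \<in> F)"
      "y * p C \<approx> (\<Sum>\<alpha>\<in>\<Gamma>. K (c \<alpha>) * (sp \<alpha> * p C))"
      using comb C(1) by meson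
    have "p A * p C \<approx> p (A \<inter> C)" by (intro p_p C A)
    moreover have "A \<inter> C = C \<or> A \<inter> C = {}" using C(2) by (auto simp: F'_def)
    ultimately have "p A * p C \<approx> K 1 * p C \<or> p A * p C \<approx> K 0 * p C"
      using cg_trans[OF _ p_empty] by (auto simp: K_one K_zero)
    then obtain l where l: "p A * p C \<approx> K l * p C" by blast
    have "\<exists>c'. (\<forall>f. c' f = (if f = \<alpha> then (if \<alpha> \<in> \<Gamma> then c \<alpha> else 0) + k * l else c f)) \<and>
        (\<Sum>f\<in>insert \<alpha> \<Gamma>. K (c' f) * (sp f * p C)) =
        (\<Sum>f\<in>\<Gamma>. K (c f) * (sp f * p C)) + K (k * l) * (sp \<alpha> * p C)"
      using \<Gamma>(1) by (rule sum_fun_upd_add) (simp add: K_add distrib_right)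
    then obtain c' where c': "(\<Sum>f\<in>insert \<alpha> \<Gamma>. K (c' f) * (sp f * p C)) =
        (\<Sum>f\<in>\<Gamma>. K (c f) * (sp f * p C)) + K (k * l) * (sp \<alpha> * p C)" by blast
    have "(y + K k * mono \<alpha> A \<beta>) * p C = y * p C + K k * (sp \<alpha> * (p A * p C))"
      by (simp add: m distrib_right mult.assoc)
    also have "\<dots> \<approx> (\<Sum>f\<in>\<Gamma>. K (c f) * (sp f * p C)) + K k * (sp \<alpha> * (K l * p C))"
      by (intro cg_add cg_left \<Gamma> l)
    also have "\<dots> = (\<Sum>f\<in>insert \<alpha> \<Gamma>. K (c' f) * (sp f * p C))"
      unfolding c' K_mult by (simp only: K_left_commute[of "sp \<alpha>" l] mult.assoc)
    finally have "(y + K k * mono \<alpha> A \<beta>) * p C \<approx> (\<Sum>f\<in>insert \<alpha> \<Gamma>. K (c' f) * (sp f * p C))" .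
    moreover have "\<forall>f\<in>insert \<alpha> \<Gamma>. set f \<subseteq> edges G \<and> (f \<noteq> [] \<longrightarrow> rng G (last f) \<in> F')"
      using \<Gamma>(2) Sp_mono.hyps(3) by (auto simp: F'_def)
    moreover have "finite (insert \<alpha> \<Gamma>)" using \<Gamma>(1) by simp
    ultimately show "\<exists>\<Gamma> c. finite \<Gamma> \<and> (\<forall>\<alpha>\<in>\<Gamma>. set \<alpha> \<subseteq> edges G \<and> (\<alpha> \<noteq> [] \<longrightarrow> rng G (last \<alpha>) \<in> F')) \<and>
        (y + K k * mono \<alpha> A \<beta>) * p C \<approx> (\<Sum>\<alpha>\<in>\<Gamma>. K (c \<alpha>) * (sp \<alpha> * p C))"
      by (rule_tac exI[of _ "insert \<alpha> \<Gamma>"], rule_tac exI[of _ c']) (intro conjI)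
  qed
  show ?case
    by (rule exI[of _ F'], rule exI[of _ "B \<union> A"], intro conjI)
      (rule F'(1), rule F'(2), rule BA, rule unit, rule comb')
qed

text \<open>After discarding the terms in \<open>P\<close>, any vertex of \<open>C\<close> can serve
  as common endpoint of all remaining words.\<close>

lemma path_combination:
  assumes "y \<in> Sp (\<lambda>\<alpha> \<beta>. \<beta> = [])"
  obtains F B where "finite F" "F \<subseteq> gsets G" "B \<in> gsets G" "y * p B \<approx> y"
    "\<forall>C\<in>gsets G. (\<forall>A\<in>F. C \<subseteq> A \<or> C \<inter> A = {}) \<longrightarrow>
      (\<exists>\<Gamma> c. finite \<Gamma> \<and> (\<forall>\<alpha>\<in>\<Gamma>. set \<alpha> \<subseteq> edges G \<and> c \<alpha> \<noteq> 0 \<and> (\<forall>w\<in>C. \<exists>u. walk G u \<alpha> w)) \<and>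
        y * p C \<approx> (\<Sum>\<alpha>\<in>\<Gamma>. K (c \<alpha>) * (sp \<alpha> * p C)))"
proof -
  from path_combination_aux[OF assms]
  obtain F B where *: "finite F" "F \<subseteq> gsets G" "B \<in> gsets G" "y * p B \<approx> y"
    and comb: "\<forall>C\<in>gsets G. (\<forall>A\<in>F. C \<subseteq> A \<or> C \<inter> A = {}) \<longrightarrow>
      (\<exists>\<Gamma> c. finite \<Gamma> \<and> (\<forall>\<alpha>\<in>\<Gamma>. set \<alpha> \<subseteq> edges G \<and> (\<alpha> \<noteq> [] \<longrightarrow> rng G (last \<alpha>) \<in> F)) \<and>
        y * p C \<approx> (\<Sum>\<alpha>\<in>\<Gamma>. K (c \<alpha>) * (sp \<alpha> * p C)))"
    by (elim exE conjE) (rule that)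
  show thesis
  proof (rule that[OF *], intro ballI impI)
    fix C assume C: "C \<in> gsets G" "\<forall>A\<in>F. C \<subseteq> A \<or> C \<inter> A = {}"
    then obtain \<Gamma> c where \<Gamma>: "finite \<Gamma>" "\<forall>\<alpha>\<in>\<Gamma>. set \<alpha> \<subseteq> edges G \<and> (\<alpha> \<noteq> [] \<longrightarrow> rng G (last \<alpha>) \<in> F)"
      "y * p C \<approx> (\<Sum>\<alpha>\<in>\<Gamma>. K (c \<alpha>) * (sp \<alpha> * p C))"
      using comb by meson
    define \<Gamma>' where "\<Gamma>' = {\<alpha>\<in>\<Gamma>. c \<alpha> \<noteq> 0 \<and> sp \<alpha> * p C \<notin> P}"
    have split: "(\<Sum>\<alpha>\<in>\<Gamma>. K (c \<alpha>) * (sp \<alpha> * p C)) =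
        (\<Sum>\<alpha>\<in>\<Gamma>'. K (c \<alpha>) * (sp \<alpha> * p C)) + (\<Sum>\<alpha>\<in>\<Gamma> - \<Gamma>'. K (c \<alpha>) * (sp \<alpha> * p C))"
      using \<Gamma>(1) by (subst sum.union_disjoint[symmetric]) (auto simp: \<Gamma>'_def intro: sum.cong)
    have "(\<Sum>\<alpha>\<in>\<Gamma> - \<Gamma>'. K (c \<alpha>) * (sp \<alpha> * p C)) \<in> P"
    proof (rule P_sum)
      fix \<alpha> assume "\<alpha> \<in> \<Gamma> - \<Gamma>'"
      then have "c \<alpha> = 0 \<or> sp \<alpha> * p C \<in> P" by (auto simp: \<Gamma>'_def)
      then show "K (c \<alpha>) * (sp \<alpha> * p C) \<in> P" using P_left[of "sp \<alpha> * p C"] by (auto simp: K_zero P_zero)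
    qed
    then have "(\<Sum>\<alpha>\<in>\<Gamma> - \<Gamma>'. K (c \<alpha>) * (sp \<alpha> * p C)) \<approx> 0" by (simp add: P_iff_cg)
    from cg_trans[OF \<Gamma>(3)[unfolded split] cg_add[OF cg_refl this]]
    have eq: "y * p C \<approx> (\<Sum>\<alpha>\<in>\<Gamma>'. K (c \<alpha>) * (sp \<alpha> * p C))" by simp
    have walk: "\<exists>u. walk G u \<alpha> w" if \<alpha>: "\<alpha> \<in> \<Gamma>'" and w: "w \<in> C" for \<alpha> w
    proof (cases "\<alpha> = []")
      case False
      have set: "set \<alpha> \<subseteq> edges G" and r: "rng G (last \<alpha>) \<in> F" using \<alpha> \<Gamma>(2) False by (auto simp: \<Gamma>'_def)
      have nP: "sp \<alpha> * p C \<notin> P" using \<alpha> by (simp add: \<Gamma>'_def)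
      have "sp \<alpha> \<notin> P" using nP P_right by blast
      then have ep: "edge_path G \<alpha>" using sp_edge_path False set by blast
      have rg: "rng G (last \<alpha>) \<in> gsets G" using r *(2) by blast
      have "sp \<alpha> * p C \<approx> sp \<alpha> * p (rng G (last \<alpha>)) * p C" by (intro cg_right cg_sym[OF sp_rng] False set)
      also have "\<dots> = sp \<alpha> * (p (rng G (last \<alpha>)) * p C)" by (simp add: mult.assoc)
      also have "\<dots> \<approx> sp \<alpha> * p (rng G (last \<alpha>) \<inter> C)" by (intro cg_left p_p rg C)
      finally have "p (rng G (last \<alpha>) \<inter> C) \<notin> P" using nP cg_P P_left by blast
      then have "rng G (last \<alpha>) \<inter> C \<noteq> {}" using rel_empty by metis
      then have "w \<in> rng G (last \<alpha>)" using bspec[OF C(2) r] w by blast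
      then have "walk G (src G (hd \<alpha>)) \<alpha> w" unfolding walk_iff_edge_path[OF False] using ep by simp
      then show ?thesis by blast
    qed auto
    show "\<exists>\<Gamma> c. finite \<Gamma> \<and> (\<forall>\<alpha>\<in>\<Gamma>. set \<alpha> \<subseteq> edges G \<and> c \<alpha> \<noteq> 0 \<and> (\<forall>w\<in>C. \<exists>u. walk G u \<alpha> w)) \<and>
        y * p C \<approx> (\<Sum>\<alpha>\<in>\<Gamma>. K (c \<alpha>) * (sp \<alpha> * p C))"
    proof (rule exI[of _ \<Gamma>'], rule exI[of _ c], intro conjI ballI eq)
      show "finite \<Gamma>'" using \<Gamma>(1) by (simp add: \<Gamma>'_def)
    qed (use \<Gamma>(2) walk in \<open>auto simp: \<Gamma>'_def\<close>)
  qed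
qed

end

section \<open>Faithfulness of the corner\<close>

context nice_ideal
begin

text \<open>Among paths of minimal length, compressing by \<open>\<alpha>\<mu>\<close> isolates one coefficient: a longer
  competitor would have to continue along the cycle, while \<open>\<mu>\<close> ends with an edge off the cycle.\<close>

lemma off_cycle_coefficients:
  assumes fin: "finite \<Gamma>"
    and \<Gamma>: "\<And>\<alpha>. \<alpha> \<in> \<Gamma> \<Longrightarrow> set \<alpha> \<subseteq> edges G \<and> c' \<alpha> \<noteq> 0 \<and> (\<exists>u. walk G u \<alpha> w)"
    and \<mu>: "\<mu> \<noteq> []" "walk G w \<mu> (vx k)" "src G ` set \<mu> \<inter> range vx = {}"
    and sum: "(\<Sum>\<alpha>\<in>\<Gamma>. K (c' \<alpha>) * (sp \<alpha> * sp \<mu> * p {vx k})) \<in> P"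
  shows "\<Gamma> = {}"
proof (rule ccontr)
  assume "\<Gamma> \<noteq> {}"
  then obtain \<alpha>0 where "is_arg_min length (\<lambda>\<alpha>. \<alpha> \<in> \<Gamma>) \<alpha>0"
    using ex_is_arg_min_if_finite[OF fin] by blast
  then have \<alpha>0: "\<alpha>0 \<in> \<Gamma>" "\<And>\<alpha>. \<alpha> \<in> \<Gamma> \<Longrightarrow> length \<alpha>0 \<le> length \<alpha>"
    unfolding is_arg_min_def by (auto simp: not_less)
  let ?e = "p {vx k}"
  define R where "R = ?e * st (\<alpha>0 @ \<mu>)"
  have set\<mu>: "set \<mu> \<subseteq> edges G" using walk_edges[OF \<mu>(2)] .
  have ep: "edge_path G (\<alpha> @ \<mu>) \<and> vx k \<in> rng G (last (\<alpha> @ \<mu>)) \<and> set (\<alpha> @ \<mu>) \<subseteq> edges G" if "\<alpha> \<in> \<Gamma>" for \<alpha>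
  proof -
    have "\<exists>u. walk G u \<alpha> w" using \<Gamma>[OF that] by blast
    then obtain u where "walk G u \<alpha> w" by blast
    then have "walk G u (\<alpha> @ \<mu>) (vx k)" unfolding walk_append using \<mu>(2) by blast
    then show ?thesis using walk_iff_edge_path[of "\<alpha> @ \<mu>" G u "vx k"] \<mu>(1) set\<mu> \<Gamma>[OF that] by auto
  qed
  have last: "last (\<alpha>0 @ \<mu>) = last \<mu>" using \<mu>(1) by simp
  have ep0: "edge_path G (\<alpha>0 @ \<mu>)" "vx k \<in> rng G (last \<mu>)" using ep[OF \<alpha>0(1)] last by auto
  have rg: "rng G (last \<mu>) \<in> gsets G" using gsets.range[OF edge_path_last[OF ep0(1)]] last by simp
  have zero: "R * (sp \<alpha> * sp \<mu> * ?e) \<in> P" if \<alpha>: "\<alpha> \<in> \<Gamma>" "\<alpha> \<noteq> \<alpha>0" for \<alpha>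
  proof (rule ccontr)
    assume "R * (sp \<alpha> * sp \<mu> * ?e) \<notin> P"
    then have nP: "?e * (st (\<alpha>0 @ \<mu>) * sp (\<alpha> @ \<mu>)) * ?e \<notin> P"
      by (simp add: R_def sp_append mult.assoc)
    then have "st (\<alpha>0 @ \<mu>) * sp (\<alpha> @ \<mu>) \<notin> P" using P_left P_right by blast
    then obtain \<gamma> where "\<alpha> @ \<mu> = (\<alpha>0 @ \<mu>) @ \<gamma> \<or> \<alpha>0 @ \<mu> = (\<alpha> @ \<mu>) @ \<gamma>"
      using st_sp_comparable ep[OF \<alpha>(1)] ep[OF \<alpha>0(1)] by blast
    then have \<gamma>: "\<alpha> @ \<mu> = (\<alpha>0 @ \<mu>) @ \<gamma>" "\<gamma> \<noteq> []"
    proof -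
      assume or: "\<alpha> @ \<mu> = (\<alpha>0 @ \<mu>) @ \<gamma> \<or> \<alpha>0 @ \<mu> = (\<alpha> @ \<mu>) @ \<gamma>"
      have "\<gamma> = [] \<Longrightarrow> False" using or \<alpha>(2) by auto
      moreover have "\<alpha>0 @ \<mu> = (\<alpha> @ \<mu>) @ \<gamma> \<Longrightarrow> \<gamma> = []"
        using \<alpha>0(2)[OF \<alpha>(1)] by (metis add_le_cancel_right append_Nil2 append_eq_append_conv
            le_antisym le_add1 length_append)
      ultimately show "\<alpha> @ \<mu> = (\<alpha>0 @ \<mu>) @ \<gamma>" "\<gamma> \<noteq> []" using or by auto
    qed
    have set\<gamma>: "set \<gamma> \<subseteq> edges G" using ep[OF \<alpha>(1)] unfolding \<gamma>(1) by simp
    have "?e * (st (\<alpha>0 @ \<mu>) * sp (\<alpha> @ \<mu>)) * ?e = ?e * (st (\<alpha>0 @ \<mu>) * sp (\<alpha>0 @ \<mu>)) * (sp \<gamma> * ?e)"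
      unfolding \<gamma>(1) sp_append[of "\<alpha>0 @ \<mu>"] by (simp add: mult.assoc)
    also have "\<dots> \<approx> ?e * p (rng G (last \<mu>)) * (sp \<gamma> * ?e)"
      using st_sp[OF ep0(1)] last by (intro cg_right cg_left) simp
    also have "\<dots> \<approx> p ({vx k} \<inter> rng G (last \<mu>)) * (sp \<gamma> * ?e)" by (intro cg_right p_p vx_gset rg)
    also have "{vx k} \<inter> rng G (last \<mu>) = {vx k}" using ep0(2) by blast
    finally have "?e * sp \<gamma> * ?e \<notin> P" using nP cg_P by (simp add: mult.assoc)
    then have seg: "\<gamma> = seg k (length \<gamma>)" using p_vx_sp_p[OF _ set\<gamma> vx_gset] by blast
    have "last \<mu> = last \<gamma>" using arg_cong[OF \<gamma>(1), of last] \<gamma>(2) \<mu>(1) by simp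
    moreover have "last \<gamma> \<in> set (seg k (length \<gamma>))" using seg \<gamma>(2) last_in_set by metis
    then have "src G (last \<gamma>) \<in> range vx" by (auto simp: seg_def src_edg)
    ultimately show False using \<mu>(3) last_in_set[OF \<mu>(1)] by (metis IntI empty_iff imageI)
  qed
  have "R * (\<Sum>\<alpha>\<in>\<Gamma>. K (c' \<alpha>) * (sp \<alpha> * sp \<mu> * ?e)) =
      (\<Sum>\<alpha>\<in>\<Gamma>. K (c' \<alpha>) * (R * (sp \<alpha> * sp \<mu> * ?e)))"
    by (simp add: sum_distrib_left K_left_commute)
  also have "\<dots> = K (c' \<alpha>0) * (R * (sp \<alpha>0 * sp \<mu> * ?e)) +
      (\<Sum>\<alpha>\<in>\<Gamma> - {\<alpha>0}. K (c' \<alpha>) * (R * (sp \<alpha> * sp \<mu> * ?e)))"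
    using fin \<alpha>0(1) by (rule sum.remove)
  finally have eq: "K (c' \<alpha>0) * (R * (sp \<alpha>0 * sp \<mu> * ?e)) =
      R * (\<Sum>\<alpha>\<in>\<Gamma>. K (c' \<alpha>) * (sp \<alpha> * sp \<mu> * ?e)) -
      (\<Sum>\<alpha>\<in>\<Gamma> - {\<alpha>0}. K (c' \<alpha>) * (R * (sp \<alpha> * sp \<mu> * ?e)))" by simp
  have "K (c' \<alpha>0) * (R * (sp \<alpha>0 * sp \<mu> * ?e)) \<in> P"
    unfolding eq by (intro P_diff P_left[OF sum] P_sum P_left[OF zero]) auto
  then have "R * (sp \<alpha>0 * sp \<mu> * ?e) \<in> P" using K_cancel \<Gamma>[OF \<alpha>0(1)] by blast
  then have "?e * (st (\<alpha>0 @ \<mu>) * sp (\<alpha>0 @ \<mu>)) * ?e \<in> P"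
    by (simp add: R_def sp_append mult.assoc)
  moreover have "?e * (st (\<alpha>0 @ \<mu>) * sp (\<alpha>0 @ \<mu>)) * ?e \<approx> ?e * p (rng G (last \<mu>)) * ?e"
    using st_sp[OF ep0(1)] last by (intro cg_right cg_left) simp
  moreover have "?e * p (rng G (last \<mu>)) * ?e \<approx> ?e"
    using ep0(2) by (intro p_idem3 rg vx_gset) simp
  ultimately show False using vx_notP[of k] cg_P[OF cg_trans] by blast
qed

lemma p_vx_gap: "finite E \<Longrightarrow> E \<subseteq> edges G \<Longrightarrow> edg k \<in> E \<Longrightarrow> p {vx k} * gap E \<in> P"
proof -
  assume *: "finite E" "E \<subseteq> edges G" "edg k \<in> E"
  have "p {vx k} * gap E \<approx> s (edg k) * t (edg k) * gap E" by (intro cg_right vx_ck)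
  moreover have "s (edg k) * (t (edg k) * gap E) \<in> P" by (intro P_left t_gap_in *)
  ultimately show ?thesis using cg_P by (simp add: mult.assoc)
qed

text \<open>A surviving piece contains a vertex \<open>w\<close> of \<open>M\<close>. Either some
  edge outside \<open>E\<close> leads from \<open>w\<close> to the cycle, and \<open>out\<close>
  applies along it, or all live edges at \<open>w\<close> lie in \<open>E\<close>, and
  \<open>gap E\<close> vanishes at \<open>w\<close>.\<close>

lemma right_stuck:
  assumes x: "x \<in> Sp (\<lambda>\<alpha> \<beta>. \<beta> = [])" and E: "finite E" "E \<subseteq> edges G"
    and out: "\<And>e z. e \<in> edges G \<Longrightarrow> e \<notin> E \<Longrightarrow> z \<in> Fin \<Longrightarrow> x * s e * z * p {vx 0} \<in> P"
  shows "x * gap E \<in> P"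
proof (rule ccontr)
  assume nP: "x * gap E \<notin> P"
  obtain F B where F: "finite F" "F \<subseteq> gsets G" "B \<in> gsets G" "x * p B \<approx> x"
    and comb: "\<forall>C\<in>gsets G. (\<forall>A\<in>F. C \<subseteq> A \<or> C \<inter> A = {}) \<longrightarrow>
      (\<exists>\<Gamma> c. finite \<Gamma> \<and> (\<forall>\<alpha>\<in>\<Gamma>. set \<alpha> \<subseteq> edges G \<and> c \<alpha> \<noteq> 0 \<and> (\<forall>w\<in>C. \<exists>u. walk G u \<alpha> w)) \<and>
        x * p C \<approx> (\<Sum>\<alpha>\<in>\<Gamma>. K (c \<alpha>) * (sp \<alpha> * p C)))"
    by (rule path_combination[OF x]) (rule that)
  \<comment> \<open>Singletons are added wherever the piece has to be a single vertex: the sources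
    of \<open>E\<close> and the vertices of the cycle.\<close>
  define F' where "F' = F \<union> (\<lambda>e. {src G e}) ` E \<union> (\<lambda>j. {vx j}) ` {..<m}"
  have F': "finite F'" "F' \<subseteq> gsets G"
    using F E vertex_gset vx_gset by (auto simp: F'_def)
  have "x * p B * gap E \<notin> P" using nP cg_P[OF cg_right[OF F(4)]] by blast
  then obtain C where C: "C \<in> gsets G" "x * p C * gap E \<notin> P" "\<And>A. A \<in> F' \<Longrightarrow> C \<subseteq> A \<or> C \<inter> A = {}"
    by (rule gset_refine[OF F' F(3)]) (rule that)
  have "p C \<notin> P" using C(2) P_left P_right by blast
  then obtain w where w: "w \<in> C" "w \<in> M" using p_P_iff[OF C(1)] by blast
  have single: "C = {w}" if "{w} \<in> F'" using C(3)[OF that] w by blast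
  have out': "x * s e * z \<in> P" if "e \<in> edges G" "e \<notin> E" "z \<in> Fin" "z * p {vx 0} \<approx> z" for e z
    using out[OF that(1-3)] cg_P[OF cg_left[OF that(4), of "x * s e"]] by (simp add: mult.assoc)
  show False
  proof (cases "w \<in> range vx")
    case True
    then obtain k where k: "w = vx k" by blast
    have "{vx (k mod m)} \<in> (\<lambda>j. {vx j}) ` {..<m}" by (rule imageI) (use m_pos in simp)
    then have "{w} \<in> F'" unfolding F'_def vx_mod k by blast
    then have Cw: "C = {vx k}" using single k by simp
    show False
    proof (cases "edg k \<in> E")
      case True
      then show False using P_left[OF p_vx_gap[OF E True], of x] C(2) Cw by (simp add: mult.assoc)
    next
      case False
      obtain n where n: "vx (Suc k + n) = vx 0" using reach_vx by blast
      have "up (Suc k) n * p {vx 0} \<approx> up (Suc k) n" using up_p[of "Suc k" n] n by simp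
      then have "x * s (edg k) * up (Suc k) n \<in> P" using out' edg_in False up_Fin by blast
      then have "x * s (edg k) * up (Suc k) n * (dn k (Suc n) * gap E) \<in> P" by (rule P_right)
      then have "x * (up k (Suc n) * dn k (Suc n)) * gap E \<in> P" by (simp add: up_Suc mult.assoc)
      moreover have "x * (up k (Suc n) * dn k (Suc n)) * gap E \<approx> x * p {vx k} * gap E"
        by (intro cg_right cg_left up_dn)
      ultimately show False using C(2) Cw cg_P by blast
    qed
  next
    case off: False
    show False
    proof (cases "\<exists>e\<in>edges G. e \<notin> E \<and> src G e = w \<and> rng G e \<inter> M \<noteq> {}")
      case True
      then obtain e where e: "e \<in> edges G" "e \<notin> E" "src G e = w" "rng G e \<inter> M \<noteq> {}" by blast
      then obtain y where "y \<in> rng G e" "y \<in> M" by blast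
      from edge_to_cycle[OF e(1) this] off e(3)
      obtain \<mu> k where \<mu>: "walk G w (e # \<mu>) (vx k)" "src G ` set (e # \<mu>) \<inter> range vx = {}" by blast
      have set\<mu>: "set \<mu> \<subseteq> edges G" using walk_edges[OF \<mu>(1)] by simp
      have "\<forall>A\<in>F. C \<subseteq> A \<or> C \<inter> A = {}" using C(3) by (simp add: F'_def)
      then obtain \<Gamma> c' where \<Gamma>: "finite \<Gamma>" "\<forall>\<alpha>\<in>\<Gamma>. set \<alpha> \<subseteq> edges G \<and> c' \<alpha> \<noteq> 0 \<and> (\<forall>w\<in>C. \<exists>u. walk G u \<alpha> w)"
        "x * p C \<approx> (\<Sum>\<alpha>\<in>\<Gamma>. K (c' \<alpha>) * (sp \<alpha> * p C))"
        using comb C(1) by meson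
      obtain n where n: "vx (k + n) = vx 0" using reach_vx by blast
      let ?z = "sp \<mu> * up k n"
      have "?z * p {vx 0} \<approx> ?z" using cg_left[OF up_p[of k n], of "sp \<mu>"] n by (simp add: mult.assoc)
      moreover have "?z \<in> Fin" by (intro sp_Fin set\<mu> up_Fin)
      ultimately have "x * s e * ?z \<in> P" using out' e(1,2) by blast
      then have "x * s e * ?z * dn k n \<in> P" by (rule P_right)
      then have 1: "x * s e * sp \<mu> * (up k n * dn k n) \<in> P" by (simp add: mult.assoc)
      have "x * s e * sp \<mu> * (up k n * dn k n) \<approx> x * s e * sp \<mu> * p {vx k}"
        by (intro cg_left up_dn)
      then have 2: "x * s e * sp \<mu> * p {vx k} \<in> P" using 1 cg_P by blast
      have pe: "p C * sp (e # \<mu>) \<approx> sp (e # \<mu>)" using C(1) e w by (intro p_sp_in) auto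
      have "(x * p C) * (sp (e # \<mu>) * p {vx k}) = x * (p C * sp (e # \<mu>)) * p {vx k}"
        by (simp add: mult.assoc)
      also have "\<dots> \<approx> x * sp (e # \<mu>) * p {vx k}" by (intro cg_right cg_left pe)
      finally have 3: "(x * p C) * (sp (e # \<mu>) * p {vx k}) \<in> P" using 2 cg_P by (simp add: mult.assoc)
      have "(x * p C) * (sp (e # \<mu>) * p {vx k}) \<approx>
          (\<Sum>\<alpha>\<in>\<Gamma>. K (c' \<alpha>) * (sp \<alpha> * p C)) * (sp (e # \<mu>) * p {vx k})" by (intro cg_right \<Gamma>)
      also have "\<dots> = (\<Sum>\<alpha>\<in>\<Gamma>. K (c' \<alpha>) * (sp \<alpha> * (p C * sp (e # \<mu>)) * p {vx k}))"
        by (simp add: sum_distrib_right mult.assoc)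
      also have "\<dots> \<approx> (\<Sum>\<alpha>\<in>\<Gamma>. K (c' \<alpha>) * (sp \<alpha> * sp (e # \<mu>) * p {vx k}))"
        by (intro cg_sum cg_left cg_right pe)
      finally have "(\<Sum>\<alpha>\<in>\<Gamma>. K (c' \<alpha>) * (sp \<alpha> * sp (e # \<mu>) * p {vx k})) \<in> P" using 3 cg_P by blast
      then have "\<Gamma> = {}"
        using off_cycle_coefficients[OF \<Gamma>(1) _ _ \<mu>] \<Gamma>(2) w(1) by blast
      then have "x * p C \<in> P" using \<Gamma>(3) by (simp add: P_iff_cg)
      then show False using C(2) P_right by blast
    next
      case False
      \<comment> \<open>All live edges at \<open>w\<close> are in \<open>E\<close>, and there is at
        least one; so \<open>{w}\<close> is among the refined sets and the relation at
        \<open>w\<close> is available.\<close>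
      define \<Lambda> where "\<Lambda> = {e \<in> edges G. src G e = w \<and> rng G e \<inter> M \<noteq> {}}"
      have \<Lambda>: "\<Lambda> \<subseteq> E" using False by (auto simp: \<Lambda>_def)
      then have fin: "finite \<Lambda>" using E(1) finite_subset by blast
      obtain e where "e \<in> \<Lambda>" using M_edge[OF w(2)] by (auto simp: \<Lambda>_def)
      then have "{w} \<in> F'" using \<Lambda> by (auto simp: F'_def \<Lambda>_def)
      then have Cw: "C = {w}" by (rule single)
      have summand: "p {w} * (s e * t e) \<approx> (if e \<in> \<Lambda> then s e * t e else 0)" if e: "e \<in> E" for e
      proof (cases "src G e = w")
        case True
        have "p {w} * s e * t e \<approx> s e * t e"
          using C(1) Cw True e E by (intro cg_right p_s_in) auto
        moreover have "s e * t e \<in> P" if "e \<notin> \<Lambda>"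
        proof -
          have "p (rng G e) \<in> P" using that True e E p_P_iff[OF gsets.range] by (auto simp: \<Lambda>_def)
          then show ?thesis using s_P_iff e E P_right by blast
        qed
        ultimately show ?thesis using cg_trans by (auto simp: P_iff_cg mult.assoc)
      next
        case False
        have "p {w} * s e * t e \<approx> 0 * t e"
          using C(1) Cw False e E by (intro cg_right p_s_notin) auto
        then show ?thesis using False by (auto simp: \<Lambda>_def mult.assoc)
      qed
      have "p {w} * gap E = p {w} - (\<Sum>e\<in>E. p {w} * (s e * t e))"
        by (simp add: gap_def right_diff_distrib sum_distrib_left)
      also have "\<dots> \<approx> p {w} - (\<Sum>e\<in>E. if e \<in> \<Lambda> then s e * t e else 0)"
        by (intro cg_diff cg_refl cg_sum summand)
      also have "(\<Sum>e\<in>E. if e \<in> \<Lambda> then s e * t e else 0) = (\<Sum>e\<in>\<Lambda>. s e * t e)"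
        using \<Lambda> E(1) by (simp add: sum.inter_restrict[symmetric] Int_absorb1)
      finally have "p {w} * gap E \<in> P"
        using ck_M[OF w(2)] fin cg_P by (auto simp: \<Lambda>_def)
      then have "x * (p {w} * gap E) \<in> P" by (rule P_left)
      then show False using C(2) Cw by (simp add: mult.assoc)
    qed
  qed
qed

text \<open>Induction on the length of the right words: \<open>x * s e\<close> inherits the
  hypothesis with shorter words, so \<open>x\<close> is stuck, and \<open>right_stuck\<close>
  disposes of what is left.\<close>

lemma corner_faithful_right:
  assumes "x \<in> Fin" "\<And>z. z \<in> Fin \<Longrightarrow> x * z * p {vx 0} \<in> P"
  shows "x \<in> P"
proof -
  obtain N where "x \<in> Sp (\<lambda>\<alpha> \<beta>. True \<and> length \<alpha> \<le> N \<and> length \<beta> \<le> N)"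
    using Sp_bounded[OF assms(1)] by blast
  then have "x \<in> Sp (\<lambda>\<alpha> \<beta>. length \<beta> \<le> N)" by (rule Sp_weaken) simp
  then show ?thesis using assms(2)
  proof (induction N arbitrary: x)
    case 0
    have "x \<in> Sp (\<lambda>\<alpha> \<beta>. \<beta> = [])" using 0(1) by (rule Sp_weaken) simp
    then have "x * gap {} \<in> P"
    proof (rule right_stuck)
      fix e z assume "e \<in> edges G" "z \<in> Fin"
      then have "x * (s e * z) * p {vx 0} \<in> P" by (intro 0(2) s_Fin)
      then show "x * s e * z * p {vx 0} \<in> P" by (simp add: mult.assoc)
    qed auto
    then show ?case by (simp add: gap_def)
  next
    case (Suc N)
    have stuck: "x * s e \<in> P" if e: "e \<in> edges G" for e
    proof (rule Suc.IH)
      show "x * s e \<in> Sp (\<lambda>\<alpha> \<beta>. length \<beta> \<le> N)" using Suc.prems(1) e by (rule Sp_s) auto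
      fix z assume "z \<in> Fin"
      then have "x * (s e * z) * p {vx 0} \<in> P" using e by (intro Suc.prems(2) s_Fin)
      then show "x * s e * z * p {vx 0} \<in> P" by (simp add: mult.assoc)
    qed
    obtain x0 E where E: "finite E" "E \<subseteq> edges G" and x0: "x0 \<in> Sp (\<lambda>\<alpha> \<beta>. \<beta> = [] \<and> length ([]::'e list) \<le> Suc N)"
      and x: "x \<approx> x0 * gap E"
      by (rule Sp_stuck_right[OF Suc.prems(1) stuck]) (assumption, rule that)
    have "x0 * gap E \<in> P"
    proof (rule right_stuck[OF _ E])
      show "x0 \<in> Sp (\<lambda>\<alpha> \<beta>. \<beta> = [])" using x0 by (rule Sp_weaken) simp
      fix e z assume e: "e \<in> edges G" "e \<notin> E"
      have "x * s e \<approx> x0 * gap E * s e" by (rule cg_right[OF x])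
      also have "\<dots> = x0 * (gap E * s e)" by (simp add: mult.assoc)
      also have "\<dots> \<approx> x0 * s e" using cg_left[OF gap_s[OF E e(1)], of x0] e(2) by simp
      finally have "x0 * s e \<in> P" using stuck[OF e(1)] cg_P by blast
      then show "x0 * s e * z * p {vx 0} \<in> P" by (rule P_right[OF P_right])
    qed
    then show ?case using cg_P[OF x] by blast
  qed
qed

text \<open>The projection onto the vertices of the cycle. Modulo \<open>P\<close> it is a left unit
  for every \<open>p A * st \<beta> * p {vx 0}\<close>, since a surviving \<open>\<beta>\<close>
  ends on the cycle.\<close>

definition vsum :: 'a where "vsum = (\<Sum>j<m. p {vx j})"

lemma vsum_p_vx: "vsum * p {vx k} \<approx> p {vx k}"
proof -
  have "vsum * p {vx k} = (\<Sum>j<m. p {vx j} * p {vx k})" by (simp add: vsum_def sum_distrib_right)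
  also have "\<dots> \<approx> (\<Sum>j<m. if j = k mod m then p {vx k} else 0)"
  proof (rule cg_sum)
    fix j assume j: "j \<in> {..<m}"
    have pp: "p {vx j} * p {vx k} \<approx> p ({vx j} \<inter> {vx k})" by (intro p_p vx_gset)
    show "p {vx j} * p {vx k} \<approx> (if j = k mod m then p {vx k} else 0)"
    proof (cases "j = k mod m")
      case True
      then have "vx j = vx k" by simp
      then show ?thesis using p_vx_idem[of k] True by simp
    next
      case False
      then have "vx j \<noteq> vx k" using j by (simp add: vx_eq_iff)
      then have "{vx j} \<inter> {vx k} = {}" by blast
      then show ?thesis using cg_trans[OF pp] p_empty False by simp
    qed
  qed
  also have "\<dots> = p {vx k}" using m_pos by simp
  finally show ?thesis .
qed

text \<open>The factor \<open>p {vx 0}\<close> already forces the right words onto the cycle. So an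
  element without left words is fixed by \<open>vsum\<close> once multiplied by
  \<open>p {vx 0}\<close>, and \<open>up\<close> and \<open>dn\<close> carry the hypothesis to each
  vertex of the cycle.\<close>

lemma corner_faithful_left:
  assumes "y \<in> Fin" "\<And>z. z \<in> Fin \<Longrightarrow> p {vx 0} * z * y * p {vx 0} \<in> P"
  shows "y * p {vx 0} \<in> P"
proof -
  let ?e = "p {vx 0}"
  have at_vx: "p {vx k} * y * ?e \<in> P" if "\<And>z. z \<in> Fin \<Longrightarrow> ?e * z * y * ?e \<in> P" for k y
  proof -
    have "dn 0 k * (?e * up 0 k * y * ?e) \<in> P" by (intro P_left that up_Fin)
    moreover have "dn 0 k * (?e * up 0 k * y * ?e) = dn 0 k * (?e * up 0 k) * (y * ?e)"
      by (simp add: mult.assoc)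
    moreover have "\<dots> \<approx> dn 0 k * up 0 k * (y * ?e)" by (intro cg_right cg_left p_up)
    moreover have "\<dots> \<approx> p {vx (0 + k)} * (y * ?e)" by (intro cg_right dn_up)
    ultimately show ?thesis using cg_P by (simp add: mult.assoc)
  qed
  have start: "(1 - vsum) * y0 * ?e \<in> P" if "y0 \<in> Sp (\<lambda>\<alpha> \<beta>. \<alpha> = [])" for y0
    using that
  proof (rule Sp_image_P)
    fix A \<alpha> \<beta> assume *: "A \<in> gsets G" "set \<alpha> \<subseteq> edges G" "set \<beta> \<subseteq> edges G" "\<alpha> = []"
    have eq: "mono \<alpha> A \<beta> * ?e = p A * st \<beta> * ?e" using * by (simp add: mono_def)
    show "(1 - vsum) * mono \<alpha> A \<beta> * ?e \<in> P"
    proof (cases "p A * st \<beta> * ?e \<in> P")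
      case True
      then show ?thesis unfolding mult.assoc[of "1 - vsum"] eq by (rule P_left)
    next
      case False
      let ?x = "p {vx (0 + length \<beta>)}"
      have cg: "p A * st \<beta> * ?e \<approx> ?x * st \<beta> * ?e" by (rule p_st_p_vx_cg[OF False *(3,1)])
      have "(1 - vsum) * ?x \<approx> 0"
        using cg_diff[OF cg_refl vsum_p_vx, of ?x "0 + length \<beta>"] by (simp add: left_diff_distrib)
      then have "(1 - vsum) * ?x * (st \<beta> * ?e) \<in> P" using P_right by (simp add: P_iff_cg[symmetric])
      moreover have "(1 - vsum) * mono \<alpha> A \<beta> * ?e \<approx> (1 - vsum) * (?x * st \<beta> * ?e)"
        unfolding mult.assoc[of "1 - vsum"] eq by (rule cg_left[OF cg])
      ultimately show ?thesis using cg_P by (simp add: mult.assoc)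
    qed
  qed
  obtain N where "y \<in> Sp (\<lambda>\<alpha> \<beta>. True \<and> length \<alpha> \<le> N \<and> length \<beta> \<le> N)"
    using Sp_bounded[OF assms(1)] by blast
  then have "y \<in> Sp (\<lambda>\<alpha> \<beta>. length \<alpha> \<le> N)" by (rule Sp_weaken) simp
  then show ?thesis using assms(2)
  proof (induction N arbitrary: y)
    case 0
    have "y \<in> Sp (\<lambda>\<alpha> \<beta>. \<alpha> = [])" using 0(1) by (rule Sp_weaken) simp
    then have 1: "(1 - vsum) * y * ?e \<in> P" by (rule start)
    have "vsum * y * ?e = (\<Sum>j<m. p {vx j} * y * ?e)" by (simp add: vsum_def sum_distrib_right)
    also have "\<dots> \<in> P" by (intro P_sum at_vx 0(2))
    finally have "(1 - vsum) * y * ?e + vsum * y * ?e \<in> P" using 1 P_add by blast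
    then show ?case by (simp add: algebra_simps)
  next
    case (Suc N)
    have stuck: "t e * y * ?e \<in> P" if e: "e \<in> edges G" for e
    proof (rule Suc.IH)
      show "t e * y \<in> Sp (\<lambda>\<alpha> \<beta>. length \<alpha> \<le> N)" using Suc.prems(1) e by (rule t_Sp) auto
      fix z assume z: "z \<in> Fin"
      have "?e * (z * t e) * y * ?e \<in> P" by (intro Suc.prems(2) Fin_mult z Fin_t e)
      then show "?e * z * (t e * y) * ?e \<in> P" by (simp add: mult.assoc)
    qed
    obtain y0 E u where E: "finite E" "E \<subseteq> edges G"
      and y0: "y0 \<in> Sp (\<lambda>\<alpha> \<beta>. \<alpha> = [] \<and> length ([]::'e list) \<le> Suc N)"
      and y: "y \<approx> y0 + (\<Sum>e\<in>E. s e * u e)"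
      by (rule Sp_decompose_left[OF Suc.prems(1)]) (rule that)
    have ue: "s e * u e * ?e \<approx> - (s e * t e * y0 * ?e)" if e: "e \<in> E" for e
    proof -
      have eE: "e \<in> edges G" using e E by blast
      have "t e * y \<approx> t e * y0 + t e * (\<Sum>e\<in>E. s e * u e)"
        using cg_left[OF y] by (simp add: distrib_left)
      also have "\<dots> \<approx> t e * y0 + p (rng G e) * u e"
        using cg_add[OF cg_refl t_sum_s[OF E eE, of u]] e by auto
      finally have "(t e * y0 + p (rng G e) * u e) * ?e \<in> P" using stuck[OF eE] cg_P[OF cg_right] by blast
      then have "s e * ((t e * y0 + p (rng G e) * u e) * ?e) \<in> P" by (rule P_left)
      then have "s e * p (rng G e) * u e * ?e \<approx> - (s e * t e * y0 * ?e)"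
        by (simp add: cg_def algebra_simps)
      moreover have "s e * u e * ?e \<approx> s e * p (rng G e) * u e * ?e"
        by (intro cg_right cg_sym[OF s_rng] eE)
      ultimately show ?thesis using cg_trans by blast
    qed
    have "y * ?e \<approx> y0 * ?e + (\<Sum>e\<in>E. s e * u e * ?e)"
      using cg_right[OF y, of ?e] by (simp add: distrib_right sum_distrib_right)
    also have "\<dots> \<approx> y0 * ?e + (\<Sum>e\<in>E. - (s e * t e * y0 * ?e))"
      by (intro cg_add cg_refl cg_sum ue)
    also have "\<dots> = gap E * (y0 * ?e)"
      by (simp add: gap_def left_diff_distrib sum_distrib_right sum_negf mult.assoc)
    finally have yg: "y * ?e \<approx> gap E * (y0 * ?e)" .
    have y0': "y0 \<in> Sp (\<lambda>\<alpha> \<beta>. \<alpha> = [])" using y0 by (rule Sp_weaken) simp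
    have "y0 * ?e \<approx> vsum * (y0 * ?e)"
      using start[OF y0'] by (simp add: cg_def algebra_simps)
    then have 1: "gap E * (y0 * ?e) \<approx> gap E * (vsum * (y0 * ?e))" by (rule cg_left)
    \<comment> \<open>With \<open>gap E\<close> moved past \<open>vsum\<close>, the product
      \<open>gap E * (y0 * ?e)\<close> can be replaced by \<open>y * ?e\<close> at each vertex of
      the cycle.\<close>
    have comm: "gap E * p {vx j} \<approx> p {vx j} * gap E" for j
    proof -
      have "s e * t e * p {vx j} \<approx> p {vx j} * (s e * t e)" if "e \<in> E" for e
      proof -
        have eE: "e \<in> edges G" using that E by blast
        show ?thesis
        proof (cases "src G e = vx j")
          case True
          have 1: "s e * (t e * p {vx j}) \<approx> s e * t e" using True by (intro cg_left t_p_in vx_gset eE) simp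
          have 2: "p {vx j} * s e * t e \<approx> s e * t e" using True by (intro cg_right p_s_in vx_gset eE) simp
          from cg_trans[OF 1 cg_sym[OF 2]] show ?thesis by (simp add: mult.assoc)
        next
          case False
          have 1: "s e * (t e * p {vx j}) \<approx> s e * 0" using False by (intro cg_left t_p_notin vx_gset eE) simp
          have 2: "p {vx j} * s e * t e \<approx> 0 * t e" using False by (intro cg_right p_s_notin vx_gset eE) simp
          from cg_trans[OF 1[unfolded mult_zero_right] cg_sym[OF 2[unfolded mult_zero_left]]]
          show ?thesis by (simp add: mult.assoc)
        qed
      qed
      then show ?thesis
        by (simp only: gap_def left_diff_distrib right_diff_distrib sum_distrib_left sum_distrib_right
            mult_1_left mult_1_right) (intro cg_diff cg_refl cg_sum)
    qed
    have "gap E * (vsum * (y0 * ?e)) = (\<Sum>j<m. gap E * p {vx j} * (y0 * ?e))"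
      by (simp add: vsum_def sum_distrib_left sum_distrib_right mult.assoc)
    also have "\<dots> \<approx> (\<Sum>j<m. p {vx j} * gap E * (y0 * ?e))" by (intro cg_sum cg_right comm)
    also have "\<dots> = (\<Sum>j<m. p {vx j} * (gap E * (y0 * ?e)))" by (simp add: mult.assoc)
    also have "\<dots> \<approx> (\<Sum>j<m. p {vx j} * (y * ?e))" by (intro cg_sum cg_left cg_sym[OF yg])
    finally have 2: "gap E * (vsum * (y0 * ?e)) \<approx> (\<Sum>j<m. p {vx j} * (y * ?e))" .
    have "p {vx j} * (y * ?e) \<in> P" for j
      using at_vx[of y j] Suc.prems(2) by (simp add: mult.assoc)
    then have "(\<Sum>j<m. p {vx j} * (y * ?e)) \<in> P" by (intro P_sum)
    then show ?case using cg_P[OF cg_trans[OF cg_trans[OF yg 1] 2]] by blast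
  qed
qed

lemma corner_faithful:
  assumes "x \<in> Fin" "\<And>z z'. z \<in> Fin \<Longrightarrow> z' \<in> Fin \<Longrightarrow> p {vx 0} * (z * x * z') * p {vx 0} \<in> P"
  shows "x \<in> P"
proof (rule corner_faithful_right[OF assms(1)])
  fix z' assume z': "z' \<in> Fin"
  show "x * z' * p {vx 0} \<in> P"
  proof (rule corner_faithful_left)
    show "x * z' \<in> Fin" using Fin_mult assms(1) z' by blast
    fix z assume "z \<in> Fin"
    then show "p {vx 0} * z * (x * z') * p {vx 0} \<in> P" using assms(2)[OF _ z'] by (simp add: mult.assoc)
  qed
qed

text \<open>If the corner of a larger ideal \<open>I\<close> contains only multiples of
  \<open>f\<close>, then \<open>I\<close> contains nothing new in \<open>Fin\<close>. In the
  application \<open>P\<close> is the ideal spanned by the expected generators and \<open>I\<close>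
  the given one.\<close>

theorem determined_by_polynomial:
  assumes I: "P \<subseteq> I" "\<And>a b. a \<in> I \<Longrightarrow> b \<in> I \<Longrightarrow> a - b \<in> I" "\<And>a b. a \<in> I \<Longrightarrow> b * a \<in> I" "\<And>a b. a \<in> I \<Longrightarrow> a * b \<in> I"
    and f: "ev f \<in> P" "\<And>g. ev g \<in> I \<Longrightarrow> f dvd g"
    and x: "x \<in> Fin" "x \<in> I"
  shows "x \<in> P"
proof (rule corner_faithful[OF x(1)])
  fix z z' assume z: "z \<in> Fin" "z' \<in> Fin"
  let ?w = "p {vx 0} * (z * x * z') * p {vx 0}"
  have "z * x * z' \<in> Fin" by (intro Fin_mult z x)
  then obtain g where g: "?w \<approx> ev g" using corner by blast
  have "?w \<in> I" by (intro I x)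
  moreover have "?w - ev g \<in> I" using g I(1) by (auto simp: cg_def)
  ultimately have "?w - (?w - ev g) \<in> I" by (rule I(2))
  then have "ev g \<in> I" by simp
  then obtain h where "g = f * h" using f(2) by (auto elim: dvdE)
  then have "ev g \<approx> ev f * ev h" using ev_mult by simp
  then have "ev g \<in> P" using cg_P P_right[OF f(1)] by blast
  then show "?w \<in> P" using cg_P[OF g] by blast
qed

end

section \<open>Rotation of the cycle\<close>

context exclusive_cycle_graph
begin

lemma exclusive_rotate: "exclusive_cycle_graph G (rotate k c)"
proof -
  have seg: "rotate k c = seg k m" by (simp add: seg_m)
  have "walk G (vx k) (rotate k c) (vx k)" unfolding seg using walk_seg[of k m] by simp
  then have "closed_path G (rotate k c)"
    unfolding closed_path_def using walk_iff_edge_path[of "rotate k c" G] c_nonempty by auto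
  moreover have "distinct (map (src G) (rotate k c))"
    using is_cycle by (simp add: cycle_def flip: rotate_map)
  ultimately have cyc: "cycle G (rotate k c)" by (simp add: cycle_def)
  have "\<exists>j. d = rotate j (rotate k c)" if d: "cycle G d" "base G d \<in> src G ` set (rotate k c)" for d
  proof -
    have "d \<in> cycle_class c" using exclusive d by (auto simp: exclusive_cycle_def cycle_class_def)
    then show ?thesis unfolding cycle_class_rotate[of k c, symmetric] by (simp add: cycle_class_def)
  qed
  then have "exclusive_cycle G (rotate k c)" using cyc by (auto simp: exclusive_cycle_def)
  then show ?thesis using cyc by unfold_locales
qed

end

context nice_ideal
begin

lemma nice_rotate: "nice_ideal G K p s t P (rotate k c)"
  and ev_rotate: "ev g \<in> P \<Longrightarrow> cycle_ideal.ev G K p s t (rotate k c) g \<in> P"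
proof -
  interpret X: exclusive_cycle_graph G "rotate k c" by (rule exclusive_rotate)
  have edg: "X.edg j = edg (k + j)" for j
    using m_pos by (simp add: X.edg_def edg_def nth_rotate mod_add_right_eq)
  have vx: "X.vx j = vx (k + j)" for j by (simp add: X.vx_def vx_def edg)
  have seg: "X.seg 0 n = seg k n" for n
    by (rule nth_equalityI) (simp_all add: X.seg_nth seg_nth edg)
  have M: "X.M = M" using X.M_iff[of _ 0] M_iff[of _ k] vx[of 0] by auto
  interpret R: nice_ideal G K p s t P "rotate k c"
    by unfold_locales (use p_P_iff ck_M in \<open>auto simp: M\<close>)
  show "nice_ideal G K p s t P (rotate k c)" by unfold_locales
  assume "ev g \<in> P"
  have cp: "R.cp i = (if 0 \<le> i then up k (nat i * m) else dn k (nat (- i) * m))" for i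
    by (simp add: R.cp_def R.up_def R.dn_def up_def dn_def seg vx)
  have "dn 0 k * ev g * up 0 k = (\<Sum>i\<in>Poly_Mapping.keys g. K (Poly_Mapping.lookup g i) * (dn 0 k * cp i * up 0 k))"
    by (simp add: ev_def sum_distrib_left sum_distrib_right mult.assoc K_left_commute[of "dn 0 k"])
  also have "\<dots> \<approx> (\<Sum>i\<in>Poly_Mapping.keys g. K (Poly_Mapping.lookup g i) * R.cp i)"
    unfolding cp by (intro cg_sum cg_left dn_cp_up)
  also have "\<dots> = R.ev g" by (simp add: R.ev_def)
  finally have "dn 0 k * ev g * up 0 k \<approx> R.ev g" .
  moreover have "dn 0 k * ev g * up 0 k \<in> P" using \<open>ev g \<in> P\<close> by (intro P_right P_left)
  ultimately show "R.ev g \<in> P" using cg_P by blast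
qed

text \<open>Compress the linked family to the corner. The component in degree \<open>0\<close>
  contributes \<open>1\<close> and the others have no constant term, so a nonzero polynomial
  results.\<close>

lemma linked_ev:
  assumes "linked_to (p {vx 0})"
  obtains g where "g \<noteq> 0" "ev g \<in> P"
proof -
  obtain S y where S: "finite S" "\<And>n. n \<in> S \<Longrightarrow> y n \<in> Hom n" "sum y S \<in> P" "0 \<in> S" "y 0 = p {vx 0}"
    using assms unfolding linked_to_def homogeneous_sum_def by blast
  let ?e = "p {vx 0}"
  have "\<forall>n\<in>S. \<exists>g. ?e * y n * ?e \<approx> ev g \<and> Poly_Mapping.lookup g 0 = (if n = 0 then 1 else 0)"
  proof
    fix n assume n: "n \<in> S"
    show "\<exists>g. ?e * y n * ?e \<approx> ev g \<and> Poly_Mapping.lookup g 0 = (if n = 0 then 1 else 0)"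
    proof (cases "n = 0")
      case True
      have "?e * ?e * ?e \<approx> ?e" by (intro p_idem3 vx_gset) simp
      then show ?thesis using True S(5) by (intro exI[of _ 1]) (simp add: ev_1)
    next
      case False
      from corner[OF S(2)[OF n, unfolded Hom_def]] obtain g where
        g: "?e * y n * ?e \<approx> ev g" "\<forall>i\<in>Poly_Mapping.keys g. n = i * int m" by auto
      have "0 \<notin> Poly_Mapping.keys g" using g(2) False by auto
      then show ?thesis using g(1) False by (auto simp: in_keys_iff)
    qed
  qed
  then obtain h where h: "\<And>n. n \<in> S \<Longrightarrow> ?e * y n * ?e \<approx> ev (h n)"
    "\<And>n. n \<in> S \<Longrightarrow> Poly_Mapping.lookup (h n) 0 = (if n = 0 then 1 else 0)" by metis
  have "?e * sum y S * ?e = (\<Sum>n\<in>S. ?e * y n * ?e)" by (simp add: sum_distrib_left sum_distrib_right)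
  also have "\<dots> \<approx> (\<Sum>n\<in>S. ev (h n))" by (intro cg_sum h)
  also have "\<dots> = ev (sum h S)" by (simp add: ev_sum)
  finally have "ev (sum h S) \<in> P" using cg_P P_left P_right S(3) by blast
  moreover have "Poly_Mapping.lookup (sum h S) 0 = 1"
    using S(1,4) h(2) by (simp add: lookup_sum)
  then have "sum h S \<noteq> 0" by auto
  ultimately show thesis using that by blast
qed

lemma one_notin: "ev 1 \<notin> P"
  using vx_notP[of 0] by (simp add: ev_1)

end

text \<open>In the corner the middle factor becomes a Laurent polynomial \<open>r\<close>, and
  commutativity turns \<open>g * r * h\<close> into \<open>r * (g * h)\<close>.\<close>

lemma (in leavitt_prime) ev_prime:
  assumes nice: "nice_ideal G K p s t P c" and gh: "cycle_ideal.ev G K p s t c (g * h) \<in> P"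
  shows "cycle_ideal.ev G K p s t c g \<in> P \<or> cycle_ideal.ev G K p s t c h \<in> P"
proof (rule ccontr)
  interpret N: nice_ideal G K p s t P c by (rule nice)
  assume "\<not> ?thesis"
  then have gh': "N.ev g \<notin> P" "N.ev h \<notin> P" by auto
  obtain z where z: "z \<in> Fin" "N.ev g * z * N.ev h \<notin> P"
    using prime_corner[OF N.ev_Fin N.ev_Fin gh' N.vx_gset N.p_ev] by blast
  obtain r where r: "p {N.vx 0} * z * p {N.vx 0} \<approx> N.ev r" using N.corner[OF z(1)] by blast
  have "N.ev g * z * N.ev h \<approx> (N.ev g * p {N.vx 0}) * z * (p {N.vx 0} * N.ev h)"
    by (intro cg_mult cg_refl cg_sym[OF N.ev_p] cg_sym[OF N.p_ev])
  also have "\<dots> = N.ev g * (p {N.vx 0} * z * p {N.vx 0}) * N.ev h" by (simp add: mult.assoc)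
  also have "\<dots> \<approx> N.ev g * N.ev r * N.ev h" by (intro cg_right cg_left r)
  also have "\<dots> \<approx> N.ev (g * r) * N.ev h" by (intro cg_right cg_sym[OF N.ev_mult])
  also have "\<dots> \<approx> N.ev (g * r * h)" by (rule cg_sym[OF N.ev_mult])
  also have "g * r * h = r * (g * h)" by (simp add: algebra_simps)
  also have "N.ev (r * (g * h)) \<approx> N.ev r * N.ev (g * h)" by (rule N.ev_mult)
  finally have "N.ev g * z * N.ev h \<approx> N.ev r * N.ev (g * h)" .
  then show False using z(2) cg_P P_left[OF gh] by blast
qed


section \<open>Laurent polynomials form a principal ideal domain\<close>

definition lpoly :: "'k::field poly \<Rightarrow> 'k laurent" where
  "lpoly q = (\<Sum>i\<le>Polynomial.degree q. Poly_Mapping.single (int i) (poly.coeff q i))"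

lemma lookup_lpoly: "Poly_Mapping.lookup (lpoly q) i = (if 0 \<le> i then poly.coeff q (nat i) else 0)"
proof -
  have "Poly_Mapping.lookup (lpoly q) i = (\<Sum>j\<le>Polynomial.degree q. if int j = i then poly.coeff q j else 0)"
    by (simp add: lpoly_def lookup_sum lookup_single when_def)
  also have "\<dots> = (if 0 \<le> i then poly.coeff q (nat i) else 0)"
  proof (cases "0 \<le> i")
    case True
    then obtain n where n: "i = int n" using nonneg_int_cases by blast
    then show ?thesis by (simp add: coeff_eq_0)
  qed (auto intro!: sum.neutral)
  finally show ?thesis .
qed

lemma lpoly_add: "lpoly (q + r) = lpoly q + lpoly r"
  by (rule poly_mapping_eqI) (simp add: lookup_lpoly lookup_add)

lemma lpoly_0 [simp]: "lpoly 0 = 0"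
  by (rule poly_mapping_eqI) (simp add: lookup_lpoly)

lemma lpoly_monom: "lpoly (Polynomial.monom a n) = Poly_Mapping.single (int n) a"
  by (rule poly_mapping_eqI) (auto simp: lookup_lpoly lookup_single when_def)

lemma lpoly_sum: "lpoly (sum f I) = (\<Sum>i\<in>I. lpoly (f i))"
  by (induction I rule: infinite_finite_induct) (auto simp: lpoly_add)

lemma poly_sum_monom: "(q :: 'k::field poly) = (\<Sum>i\<le>Polynomial.degree q. Polynomial.monom (poly.coeff q i) i)"
  by (rule poly_eqI) (simp add: coeff_sum coeff_eq_0)

lemma lpoly_mult: "lpoly (q * r) = lpoly q * lpoly r"
proof -
  let ?I = "{..Polynomial.degree q}" and ?J = "{..Polynomial.degree r}"
  have "q * r = (\<Sum>i\<in>?I. \<Sum>j\<in>?J. Polynomial.monom (poly.coeff q i) i * Polynomial.monom (poly.coeff r j) j)"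
    unfolding sum_product[symmetric] using poly_sum_monom[of q] poly_sum_monom[of r] by simp
  then have "lpoly (q * r) = (\<Sum>i\<in>?I. \<Sum>j\<in>?J. Poly_Mapping.single (int (i + j)) (poly.coeff q i * poly.coeff r j))"
    by (simp add: lpoly_sum lpoly_monom mult_monom)
  also have "\<dots> = lpoly q * lpoly r"
    by (simp add: lpoly_def sum_product mult_single)
  finally show ?thesis .
qed

lemma lpoly_shift:
  fixes g :: "'k::field laurent"
  obtains N q where "Poly_Mapping.single N 1 * g = lpoly q"
proof -
  obtain N where N: "\<And>i. i \<in> Poly_Mapping.keys g \<Longrightarrow> 0 \<le> i + N"
  proof -
    have "\<exists>N. \<forall>i\<in>Poly_Mapping.keys g. 0 \<le> i + N"
    proof (cases "Poly_Mapping.keys g = {}")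
      case False
      have "0 \<le> i + (- Min (Poly_Mapping.keys g))" if "i \<in> Poly_Mapping.keys g" for i
        using Min_le[OF finite_keys that] by linarith
      then show ?thesis by blast
    qed simp
    then show thesis using that by blast
  qed
  let ?g = "Poly_Mapping.lookup g"
  have "Poly_Mapping.single N 1 * g =
      Poly_Mapping.single N 1 * (\<Sum>i\<in>Poly_Mapping.keys g. Poly_Mapping.single i (?g i))"
    using poly_mapping_sum_single[of g] by simp
  also have "\<dots> = (\<Sum>i\<in>Poly_Mapping.keys g. Poly_Mapping.single (i + N) (?g i))"
    by (simp add: sum_distrib_left mult_single add.commute)
  also have "\<dots> = (\<Sum>i\<in>Poly_Mapping.keys g. lpoly (Polynomial.monom (?g i) (nat (i + N))))"
    using N by (intro sum.cong refl) (simp add: lpoly_monom)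
  also have "\<dots> = lpoly (\<Sum>i\<in>Poly_Mapping.keys g. Polynomial.monom (?g i) (nat (i + N)))"
    by (simp add: lpoly_sum)
  finally show thesis by (rule that)
qed

text \<open>Contract to ordinary polynomials, where a nonzero element of least degree generates.
  Powers of \<open>x\<close> are units, so clearing negative exponents loses nothing.\<close>

lemma laurent_principal:
  fixes Q :: "'k::field laurent set"
  assumes Q: "0 \<in> Q" "\<And>g h. g \<in> Q \<Longrightarrow> h \<in> Q \<Longrightarrow> g + h \<in> Q" "\<And>g h. g \<in> Q \<Longrightarrow> h * g \<in> Q"
  obtains f where "\<And>g. g \<in> Q \<longleftrightarrow> f dvd g"
proof -
  define Q' where "Q' = {q. lpoly q \<in> Q}"
  have "\<exists>d\<in>Q'. \<forall>q\<in>Q'. d dvd q"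
  proof (cases "Q' \<subseteq> {0}")
    case True
    then show ?thesis using Q(1) by (intro bexI[of _ 0]) (auto simp: Q'_def)
  next
    case False
    then obtain q0 where q0: "q0 \<in> Q' \<and> q0 \<noteq> 0" by blast
    define d where "d = arg_min Polynomial.degree (\<lambda>q. q \<in> Q' \<and> q \<noteq> 0)"
    have d: "d \<in> Q' \<and> d \<noteq> 0" unfolding d_def by (rule arg_min_natI[where P = "\<lambda>q. q \<in> Q' \<and> q \<noteq> 0", OF q0])
    have min: "Polynomial.degree d \<le> Polynomial.degree q" if "q \<in> Q'" "q \<noteq> 0" for q
      unfolding d_def using that by (intro arg_min_nat_le) simp
    have "d dvd q" if q: "q \<in> Q'" for q
    proof (rule ccontr)
      assume nd: "\<not> d dvd q"
      let ?r = "q mod d"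
      have "q = d * (q div d) + ?r" by simp
      then have "?r = q + (- (q div d)) * d" by (metis add_diff_cancel_left' diff_conv_add_uminus mult.commute mult_minus_left)
      then have "lpoly ?r = lpoly q + lpoly (- (q div d)) * lpoly d" by (simp only: lpoly_add lpoly_mult)
      then have "?r \<in> Q'" using Q(2,3) q d by (simp add: Q'_def)
      moreover have "?r \<noteq> 0" using nd by (simp add: mod_eq_0_iff_dvd)
      ultimately have "Polynomial.degree d \<le> Polynomial.degree ?r" by (rule min)
      moreover have "Polynomial.degree ?r < Polynomial.degree d"
        using degree_mod_less[of d q] d \<open>?r \<noteq> 0\<close> by auto
      ultimately show False by simp
    qed
    then show ?thesis using d by blast
  qed
  then obtain d where d: "d \<in> Q'" "\<And>q. q \<in> Q' \<Longrightarrow> d dvd q" by blast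
  have "g \<in> Q \<longleftrightarrow> lpoly d dvd g" for g
  proof
    assume g: "g \<in> Q"
    obtain N q where Nq: "Poly_Mapping.single N 1 * g = lpoly q" by (rule lpoly_shift)
    then have "q \<in> Q'" using Q(3)[OF g, of "Poly_Mapping.single N 1"] by (simp add: Q'_def)
    then obtain r where "q = d * r" using d(2) by (auto elim: dvdE)
    then have "Poly_Mapping.single N 1 * g = lpoly d * lpoly r" using Nq by (simp add: lpoly_mult)
    then have "Poly_Mapping.single (- N) 1 * (Poly_Mapping.single N 1 * g) =
        lpoly d * (Poly_Mapping.single (- N) 1 * lpoly r)" by (simp add: ac_simps)
    then have "g = lpoly d * (Poly_Mapping.single (- N) 1 * lpoly r)"
      by (simp add: mult_single flip: mult.assoc)
    then show "lpoly d dvd g" by (rule dvdI)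
  next
    assume "lpoly d dvd g"
    then obtain h where "g = lpoly d * h" by (rule dvdE)
    then show "g \<in> Q" using Q(3)[of "lpoly d" h] d(1) by (simp add: Q'_def mult.commute)
  qed
  then show thesis by (rule that)
qed

text \<open>In a factorization of the generator one factor is again a multiple of it; cancelling
  makes the other factor a unit.\<close>

lemma laurent_prime_generator:
  fixes Q :: "'k::field laurent set"
  assumes Q: "0 \<in> Q" "\<And>g h. g \<in> Q \<Longrightarrow> h \<in> Q \<Longrightarrow> g + h \<in> Q" "\<And>g h. g \<in> Q \<Longrightarrow> h * g \<in> Q"
    and ne: "g0 \<in> Q" "g0 \<noteq> 0" and one: "1 \<notin> Q"
    and prime: "\<And>g h. g * h \<in> Q \<Longrightarrow> g \<in> Q \<or> h \<in> Q"
  obtains f where "Factorial_Ring.irreducible f" "\<And>g. g \<in> Q \<longleftrightarrow> f dvd g"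
proof -
  obtain f where f: "\<And>g. g \<in> Q \<longleftrightarrow> f dvd g" by (rule laurent_principal[OF Q]) (assumption | rule that)+
  have f0: "f \<noteq> 0" using ne f by auto
  have "Factorial_Ring.irreducible f"
  proof (rule Factorial_Ring.irreducibleI)
    show "f \<noteq> 0" by fact
    show "\<not> f dvd 1" using one f by blast
    fix a b assume ab: "f = a * b"
    then have "a * b \<in> Q" using f by simp
    then have "f dvd a \<or> f dvd b" using prime f by blast
    then show "a dvd 1 \<or> b dvd 1"
    proof
      assume "f dvd a"
      then obtain r where "a = f * r" by (rule dvdE)
      then have "f * 1 = f * (r * b)" using ab by (metis mult.assoc mult.right_neutral)
      then have "1 = r * b" using f0 mult_left_cancel by blast
      then have "1 = b * r" by (simp add: mult.commute)
      then show ?thesis by (metis dvdI)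
    next
      assume "f dvd b"
      then obtain r where "b = f * r" by (rule dvdE)
      then have "f * 1 = f * (r * a)" using ab by (metis mult.assoc mult.commute mult.right_neutral)
      then have "1 = r * a" using f0 mult_left_cancel by blast
      then have "1 = a * r" by (simp add: mult.commute)
      then show ?thesis by (metis dvdI)
    qed
  qed
  then show thesis using that f by blast
qed

section \<open>Algebras and their ideals\<close>

locale plain_algebra =
  fixes A :: "('k::field, 'a) module" (structure)
  assumes abelian: "abelian_group A"
    and smult_uminus: "x \<in> carrier A \<Longrightarrow> (-1) \<odot> x = \<ominus> x"
    and smult_in: "x \<in> carrier A \<Longrightarrow> k \<odot> x \<in> carrier A"
    and mult_in: "x \<in> carrier A \<Longrightarrow> y \<in> carrier A \<Longrightarrow> x \<otimes> y \<in> carrier A"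
begin

text \<open>Closure under negation, which \<open>submodule\<close> demands, comes from the scalar
  \<open>-1\<close>.\<close>

lemma alg_ideal_iff:
  "alg_ideal A I \<longleftrightarrow> I \<subseteq> carrier A \<and> \<zero> \<in> I \<and> (\<forall>x\<in>I. \<forall>y\<in>I. x \<oplus> y \<in> I) \<and>
    (\<forall>k. \<forall>x\<in>I. k \<odot> x \<in> I) \<and> (\<forall>x\<in>carrier A. \<forall>a\<in>I. x \<otimes> a \<in> I \<and> a \<otimes> x \<in> I)"
  (is "?l \<longleftrightarrow> ?r")
proof
  assume ?l
  then show ?r
    unfolding alg_ideal_def submodule_def submodule_axioms_def subgroup_def
    by (auto simp: ring_of_type_algebra_def)
next
  assume r: ?r
  have "\<ominus> x \<in> I" if "x \<in> I" for x
    using r that smult_uminus by (metis subsetD)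
  then have "m_inv (add_monoid A) x \<in> I" if "x \<in> I" for x
    using that by (simp add: a_inv_def)
  then show ?l
    using r unfolding alg_ideal_def submodule_def submodule_axioms_def subgroup_def
    by (auto simp: ring_of_type_algebra_def)
qed

lemma carrier_ideal: "alg_ideal A (carrier A)"
proof -
  interpret abelian_group A by (rule abelian)
  show ?thesis unfolding alg_ideal_iff using smult_in mult_in by auto
qed

lemma alg_ideal_gen_ideal: "S \<subseteq> carrier A \<Longrightarrow> alg_ideal A (alg_ideal_gen A S)"
  and alg_ideal_gen_subset: "S \<subseteq> alg_ideal_gen A S"
  and alg_ideal_gen_least: "alg_ideal A I \<Longrightarrow> S \<subseteq> I \<Longrightarrow> alg_ideal_gen A S \<subseteq> I"
proof -
  show "S \<subseteq> alg_ideal_gen A S" by (auto simp: alg_ideal_gen_def)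
  show "alg_ideal_gen A S \<subseteq> I" if "alg_ideal A I" "S \<subseteq> I" for I using that by (auto simp: alg_ideal_gen_def)
  assume "S \<subseteq> carrier A"
  then have "alg_ideal_gen A S \<subseteq> carrier A"
    using carrier_ideal by (auto simp: alg_ideal_gen_def)
  then show "alg_ideal A (alg_ideal_gen A S)"
    unfolding alg_ideal_iff unfolding alg_ideal_gen_def using alg_ideal_iff by auto
qed

end


section \<open>The free algebra\<close>

definition fcar :: "'g set \<Rightarrow> ('g fword \<Rightarrow>\<^sub>0 'k::field) set" where
  "fcar T = {f. \<forall>w\<in>Poly_Mapping.keys f. letters w \<noteq> [] \<and> set (letters w) \<subseteq> T}"

text \<open>The words with a letter outside \<open>T\<close> span an ideal; it absorbs the part of the free unital
  algebra on all letters that is not seen by the free algebra on \<open>T\<close>.\<close>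

definition fbad :: "'g set \<Rightarrow> ('g fword \<Rightarrow>\<^sub>0 'k::field) set" where
  "fbad T = {f. \<forall>w\<in>Poly_Mapping.keys f. \<not> set (letters w) \<subseteq> T}"

definition fK :: "'k \<Rightarrow> ('g fword \<Rightarrow>\<^sub>0 'k::field)" where "fK k = Poly_Mapping.single 0 k"

lemma letters_zero [simp]: "letters 0 = []" and letters_plus [simp]: "letters (u + w) = letters u @ letters w"
  by (simp_all add: zero_fword_def plus_fword_def)

lemma free_algebra_simps [simp]:
  "carrier (free_algebra T) = fcar T" "ring.zero (free_algebra T) = 0" "ring.add (free_algebra T) = (+)"
  "monoid.mult (free_algebra T) = (*)" "module.smult (free_algebra T) k f = fK k * f"
  by (simp_all add: free_algebra_def fcar_def fK_def)

lemma keys_uminus: "Poly_Mapping.keys (- f) = Poly_Mapping.keys (f :: 'b \<Rightarrow>\<^sub>0 'c::ab_group_add)"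
  by (auto simp: in_keys_iff)

lemma fcar_0: "0 \<in> fcar T"
  and fcar_add: "x \<in> fcar T \<Longrightarrow> y \<in> fcar T \<Longrightarrow> x + y \<in> fcar T"
  and fcar_uminus: "x \<in> fcar T \<Longrightarrow> - x \<in> fcar T"
  using keys_add[of x y] by (auto simp: fcar_def keys_uminus)

lemma fcar_diff: "x \<in> fcar T \<Longrightarrow> y \<in> fcar T \<Longrightarrow> x - y \<in> fcar T"
  using fcar_add[of x T "- y"] fcar_uminus[of y T] by simp

lemma fcar_mult: "x \<in> fcar T \<Longrightarrow> y \<in> fcar T \<Longrightarrow> x * y \<in> fcar T"
  using keys_mult[of x y] by (fastforce simp: fcar_def)

lemma fcar_K: "x \<in> fcar T \<Longrightarrow> fK k * x \<in> fcar T"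
  using keys_mult[of "fK k" x] by (fastforce simp: fcar_def fK_def split: if_splits)

lemma fcar_sum: "(\<And>i. i \<in> I \<Longrightarrow> f i \<in> fcar T) \<Longrightarrow> sum f I \<in> fcar T"
  by (induction I rule: infinite_finite_induct) (auto intro: fcar_0 fcar_add)

lemma fbad_0: "0 \<in> fbad T"
  and fbad_add: "x \<in> fbad T \<Longrightarrow> y \<in> fbad T \<Longrightarrow> x + y \<in> fbad T"
  using keys_add[of x y] by (auto simp: fbad_def)

lemma fbad_left: "x \<in> fbad T \<Longrightarrow> y * x \<in> fbad T" and fbad_right: "x \<in> fbad T \<Longrightarrow> x * y \<in> fbad T"
  using keys_mult[of x y] keys_mult[of y x] by (fastforce simp: fbad_def)+

lemma fbad_sum: "(\<And>i. i \<in> I \<Longrightarrow> f i \<in> fbad T) \<Longrightarrow> sum f I \<in> fbad T"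
  by (induction I rule: infinite_finite_induct) (auto intro: fbad_0 fbad_add)

lemma fcar_fbad: "x \<in> fcar T \<Longrightarrow> x \<in> fbad T \<Longrightarrow> x = 0"
  by (metis (mono_tags, lifting) fbad_def fcar_def keys_eq_empty all_not_in_conv mem_Collect_eq)

lemma letter_fcar: "g \<in> T \<Longrightarrow> letter g \<in> fcar T"
  by (simp add: fcar_def letter_def)

lemma fK_add: "fK (k + l) = fK k + fK l"
  and fK_mult: "fK (k * l) = fK k * fK l"
  and fK_one: "fK 1 = 1"
  by (simp_all add: fK_def single_add mult_single)

lemma fK_commute: "fK k * x = x * fK k"
proof -
  let ?s = "\<Sum>w\<in>Poly_Mapping.keys x. Poly_Mapping.single w (Poly_Mapping.lookup x w)"
  have "fK k * ?s = ?s * fK k"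
    by (simp add: fK_def sum_distrib_left sum_distrib_right mult_single mult.commute)
  then show ?thesis using poly_mapping_sum_single[of x] by simp
qed

text \<open>Sorts the words of \<open>z\<close> into the empty one, the nonempty ones over
  \<open>T\<close>, and those with a foreign letter.\<close>

lemma free_split:
  fixes z :: "'g fword \<Rightarrow>\<^sub>0 'k::field"
  obtains k f b where "z = fK k + f + b" "f \<in> fcar T" "b \<in> fbad T"
proof -
  let ?s = "\<lambda>w. Poly_Mapping.single w (Poly_Mapping.lookup z w)"
  let ?A = "{w\<in>Poly_Mapping.keys z. w \<noteq> 0 \<and> set (letters w) \<subseteq> T}"
  let ?B = "{w\<in>Poly_Mapping.keys z. \<not> set (letters w) \<subseteq> T}"
  have "z = (\<Sum>w\<in>Poly_Mapping.keys z. ?s w)" by (rule poly_mapping_sum_single)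
  \<comment> \<open>The empty word is inserted so that its coefficient can be split off even when it
    is \<open>0\<close>.\<close>
  also have "\<dots> = (\<Sum>w\<in>insert 0 (Poly_Mapping.keys z). ?s w)"
    by (rule sum.mono_neutral_left) (auto simp: in_keys_iff)
  also have "insert 0 (Poly_Mapping.keys z) = insert 0 (?A \<union> ?B)" by auto
  also have "(\<Sum>w\<in>insert 0 (?A \<union> ?B). ?s w) = ?s 0 + sum ?s (?A \<union> ?B)"
    by (subst sum.insert) auto
  also have "sum ?s (?A \<union> ?B) = sum ?s ?A + sum ?s ?B"
    by (rule sum.union_disjoint) auto
  finally have "z = fK (Poly_Mapping.lookup z 0) + sum ?s ?A + sum ?s ?B"
    by (simp add: fK_def add.assoc)
  moreover have "letters w \<noteq> []" if "w \<noteq> 0" for w :: "'g fword"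
    using that by (cases w) (auto simp: zero_fword_def)
  then have "sum ?s ?A \<in> fcar T" by (intro fcar_sum) (auto simp: fcar_def split: if_splits)
  moreover have "?s w \<in> fbad T" if "w \<in> ?B" for w using that by (auto simp: fbad_def split: if_splits)
  then have "sum ?s ?B \<in> fbad T"
    by (intro fbad_sum)
  ultimately show thesis by (rule that)
qed

interpretation free: plain_algebra "free_algebra T :: ('k::field, 'g fword \<Rightarrow>\<^sub>0 'k) module" for T
proof -
  let ?A = "free_algebra T :: ('k::field, 'g fword \<Rightarrow>\<^sub>0 'k) module"
  have ab: "abelian_group ?A"
    by (rule abelian_groupI) (auto simp: add.assoc add.commute fcar_0 fcar_add intro!: bexI[of _ "- x" for x] fcar_uminus)
  have inv: "\<ominus>\<^bsub>?A\<^esub> x = - x" if "x \<in> fcar T" for x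
    by (rule abelian_group.minus_equality[OF ab]) (simp_all add: that fcar_uminus)
  have "fK (-1) * x = - x" for x :: "'g fword \<Rightarrow>\<^sub>0 'k"
    by (simp add: fK_def single_uminus)
  then show "plain_algebra ?A"
    by (intro plain_algebra.intro ab) (simp_all add: inv fcar_K fcar_mult)
qed


section \<open>The Leavitt path algebra as a quotient\<close>

context ultragraph
begin

abbreviation (input) F :: "(('v, 'e) gen fword \<Rightarrow>\<^sub>0 'k::field) set" where "F \<equiv> fcar (gens G)"

lemma fp_F: "A \<in> gsets G \<Longrightarrow> fp A \<in> F" and fs_F: "e \<in> edges G \<Longrightarrow> fs e \<in> F"
  and fstar_F: "e \<in> edges G \<Longrightarrow> fstar e \<in> F"
  by (auto intro!: letter_fcar simp: gens_def)

lemma relators_F: "relators G \<subseteq> F"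
proof
  fix x :: "('v, 'e) gen fword \<Rightarrow>\<^sub>0 'k::field" assume "x \<in> relators G"
  then show "x \<in> F"
  proof cases
    case (cuntz_krieger v)
    then show ?thesis
      by (auto simp: regular_def out_edges_def
          intro!: fcar_diff fcar_sum fcar_mult fp_F fs_F fstar_F gsets.vertex)
  qed (auto intro!: fcar_diff fcar_add fcar_mult fp_F fs_F fstar_F fcar_0 src_in
      gsets.empty gsets.inter gsets.union gsets.range gsets.vertex)
qed

abbreviation (input) N :: "(('v, 'e) gen fword \<Rightarrow>\<^sub>0 'k::field) set" where "N \<equiv> rel_ideal G"

lemma N_ideal: "alg_ideal (free_algebra (gens G)) N"
  unfolding rel_ideal_def by (rule free.alg_ideal_gen_ideal) (use relators_F in simp)

lemma N_relators: "relators G \<subseteq> N"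
  unfolding rel_ideal_def by (rule free.alg_ideal_gen_subset)

lemma N_facts: "N \<subseteq> F" "0 \<in> N" "x \<in> N \<Longrightarrow> y \<in> N \<Longrightarrow> x + y \<in> N" "x \<in> N \<Longrightarrow> fK k * x \<in> N"
  "x \<in> N \<Longrightarrow> a \<in> F \<Longrightarrow> a * x \<in> N" "x \<in> N \<Longrightarrow> a \<in> F \<Longrightarrow> x * a \<in> N"
  using N_ideal unfolding free.alg_ideal_iff by auto

lemma N_uminus: "x \<in> N \<Longrightarrow> - x \<in> N"
  using N_facts(4)[of x "-1"] by (simp add: fK_def single_uminus)

text \<open>Defined for every element of the unital algebra, so that sums and scalar multiples of
  cosets carry no membership conditions.\<close>

definition cos :: "(('v, 'e) gen fword \<Rightarrow>\<^sub>0 'k::field) \<Rightarrow> ('v, 'e, 'k) lpa" where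
  "cos x = {y. y - x \<in> N}"

lemma coset_eq: "rel_ideal G +>\<^bsub>free_algebra (gens G)\<^esub> x = cos x"
  unfolding cos_def a_r_coset_def r_coset_def by (auto simp: algebra_simps)

lemma cos_eq_iff: "cos x = cos y \<longleftrightarrow> x - y \<in> N"
proof
  assume "cos x = cos y"
  moreover have "x \<in> cos x" by (simp add: cos_def N_facts)
  ultimately show "x - y \<in> N" by (simp add: cos_def)
next
  assume xy: "x - y \<in> N"
  have "z - x \<in> N \<longleftrightarrow> z - y \<in> N" for z
  proof
    assume "z - x \<in> N"
    then have "(z - x) + (x - y) \<in> N" using xy by (rule N_facts)
    then show "z - y \<in> N" by simp
  next
    assume "z - y \<in> N"
    then have "(z - y) + - (x - y) \<in> N" using N_uminus[OF xy] by (rule N_facts)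
    then show "z - x \<in> N" by simp
  qed
  then show "cos x = cos y" by (simp add: cos_def)
qed

lemma mem_cos: "y \<in> cos x \<longleftrightarrow> cos y = cos x"
  unfolding cos_eq_iff by (simp add: cos_def)

lemma cos_self: "x \<in> cos x"
  by (simp add: mem_cos)

lemma N_cos: "N = cos 0"
  by (simp add: cos_def)

lemma lgen_cos: "lgen G g = cos (letter g)"
  by (simp add: lgen_def coset_eq)

lemma leavitt_carrier: "carrier (leavitt G) = cos ` F"
proof -
  have "carrier (leavitt G) = a_rcosets\<^bsub>free_algebra (gens G)\<^esub> (rel_ideal G)"
    by (simp add: leavitt_def alg_quotient_def ring.defs module.defs FactRing_def)
  also have "\<dots> = (\<Union>x\<in>F. {cos x})"
    unfolding A_RCOSETS_def RCOSETS_def coset_eq[unfolded a_r_coset_def] by simp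
  finally show ?thesis by blast
qed

lemma cos_F: "x \<in> F \<Longrightarrow> y \<in> cos x \<Longrightarrow> y \<in> F"
  using N_facts(1) fcar_add[of "y - x" _ x] by (auto simp: cos_def)

lemma leavitt_zero: "zero (leavitt G) = cos 0"
  by (simp add: leavitt_def alg_quotient_def ring.defs module.defs FactRing_def flip: N_cos)

lemma leavitt_mult:
  assumes "x \<in> F" "y \<in> F"
  shows "cos x \<otimes>\<^bsub>leavitt G\<^esub> cos y = cos (x * y)"
proof -
  have "cos (a * b) = cos (x * y)" if "a \<in> cos x" "b \<in> cos y" for a b
  proof -
    have "a - x \<in> N" "b - y \<in> N" "a \<in> F" using that assms cos_F by (auto simp: cos_def)
    then have "a * (b - y) + (a - x) * y \<in> N" using assms by (intro N_facts(3,5,6))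
    then show ?thesis unfolding cos_eq_iff by (simp add: algebra_simps)
  qed
  then have "(\<Union>a\<in>cos x. \<Union>b\<in>cos y. cos (a * b)) = cos (x * y)"
    using cos_self by blast
  then show ?thesis
    by (simp add: leavitt_def alg_quotient_def ring.defs module.defs FactRing_def rcoset_mult_def coset_eq)
qed

lemma leavitt_add:
  "cos x \<oplus>\<^bsub>leavitt G\<^esub> cos y = cos (x + y)"
proof -
  have "(\<Union>a\<in>cos x. \<Union>b\<in>cos y. {a + b}) = cos (x + y)"
  proof
    show "(\<Union>a\<in>cos x. \<Union>b\<in>cos y. {a + b}) \<subseteq> cos (x + y)"
    proof clarify
      fix a b assume "a \<in> cos x" "b \<in> cos y"
      then have "(a - x) + (b - y) \<in> N" by (intro N_facts) (auto simp: cos_def)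
      then show "a + b \<in> cos (x + y)" by (simp add: cos_def algebra_simps)
    qed
    show "cos (x + y) \<subseteq> (\<Union>a\<in>cos x. \<Union>b\<in>cos y. {a + b})"
    proof
      fix z assume "z \<in> cos (x + y)"
      then have "z - y \<in> cos x" by (simp add: cos_def algebra_simps)
      moreover have "z = (z - y) + y" by simp
      ultimately show "z \<in> (\<Union>a\<in>cos x. \<Union>b\<in>cos y. {a + b})" using cos_self[of y] by blast
    qed
  qed
  then show ?thesis
    by (simp add: leavitt_def alg_quotient_def ring.defs module.defs FactRing_def set_add_def set_mult_def)
qed

lemma leavitt_smult:
  "k \<odot>\<^bsub>leavitt G\<^esub> cos x = cos (fK k * x)"
proof -
  have "cos (fK k * y) = cos (fK k * x)" if "y \<in> cos x" for y
  proof -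
    have "fK k * (y - x) \<in> N" using that by (intro N_facts) (simp add: cos_def)
    then show ?thesis unfolding cos_eq_iff by (simp add: algebra_simps)
  qed
  then have "(\<Union>y\<in>cos x. cos (fK k * y)) = cos (fK k * x)" using cos_self by blast
  then show ?thesis
    by (simp add: leavitt_def alg_quotient_def ring.defs module.defs FactRing_def coset_eq)
qed

lemma leavitt_abelian: "abelian_group (leavitt G :: ('k::field, ('v, 'e, 'k) lpa) module)"
proof (rule abelian_groupI)
  fix Z :: "('v, 'e, 'k) lpa" assume "Z \<in> carrier (leavitt G)"
  then obtain x where x: "x \<in> F" "Z = cos x" by (auto simp: leavitt_carrier)
  then show "\<zero>\<^bsub>leavitt G\<^esub> \<oplus>\<^bsub>leavitt G\<^esub> Z = Z" by (simp add: leavitt_add leavitt_zero)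
  show "\<exists>W\<in>carrier (leavitt G). W \<oplus>\<^bsub>leavitt G\<^esub> Z = \<zero>\<^bsub>leavitt G\<^esub>"
    using x by (intro bexI[of _ "cos (- x)"])
      (simp_all add: leavitt_add leavitt_zero leavitt_carrier fcar_uminus)
qed (auto simp: leavitt_carrier leavitt_zero leavitt_add ac_simps fcar_0 fcar_add)

lemma leavitt_uminus: "x \<in> F \<Longrightarrow> \<ominus>\<^bsub>leavitt G\<^esub> cos x = cos (- x)"
  by (rule abelian_group.minus_equality[OF leavitt_abelian])
    (simp_all add: leavitt_add leavitt_zero leavitt_carrier fcar_uminus)

lemma leavitt_minus: "x \<in> F \<Longrightarrow> cos x \<ominus>\<^bsub>leavitt G\<^esub> cos y = cos (x - y)" if "y \<in> F"
  using that by (simp add: a_minus_def leavitt_uminus leavitt_add)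

sublocale leavitt: plain_algebra "leavitt G :: ('k::field, ('v, 'e, 'k) lpa) module"
proof (intro plain_algebra.intro leavitt_abelian)
  fix Z W :: "('v, 'e, 'k) lpa" and k :: 'k assume "Z \<in> carrier (leavitt G)"
  then obtain x where x: "x \<in> F" "Z = cos x" by (auto simp: leavitt_carrier)
  have "fK (-1) * x = - x" by (simp add: fK_def single_uminus)
  then show "(-1) \<odot>\<^bsub>leavitt G\<^esub> Z = \<ominus>\<^bsub>leavitt G\<^esub> Z"
    using x by (simp add: leavitt_smult leavitt_uminus)
  show "k \<odot>\<^bsub>leavitt G\<^esub> Z \<in> carrier (leavitt G)"
    using x by (simp add: leavitt_smult leavitt_carrier fcar_K)
  assume "W \<in> carrier (leavitt G)"
  then obtain y where "y \<in> F" "W = cos y" by (auto simp: leavitt_carrier)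
  then show "Z \<otimes>\<^bsub>leavitt G\<^esub> W \<in> carrier (leavitt G)"
    using x by (simp add: leavitt_mult leavitt_carrier fcar_mult)
qed

lemma leavitt_finsum:
  assumes "\<And>i. i \<in> S \<Longrightarrow> f i \<in> F"
  shows "(\<Oplus>\<^bsub>leavitt G\<^esub>i\<in>S. cos (f i)) = cos (sum f S)"
proof -
  interpret abelian_group "leavitt G :: ('k::field, ('v, 'e, 'k) lpa) module" by (rule leavitt_abelian)
  show ?thesis using assms
  proof (induction S rule: infinite_finite_induct)
    case (infinite S)
    then show ?case by (simp add: leavitt_zero finsum_infinite)
  next
    case (insert i S)
    have "(\<lambda>i. cos (f i)) \<in> S \<rightarrow> carrier (leavitt G)" "cos (f i) \<in> carrier (leavitt G)"
      using insert.prems by (auto simp: leavitt_carrier)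
    then show ?case using insert by (simp add: leavitt_add)
  qed (simp add: leavitt_zero)
qed

lemma leavitt_nprod:
  assumes "xs \<noteq> []" "\<And>x. x \<in> set xs \<Longrightarrow> f x \<in> F"
  shows "nprod (leavitt G) (map (\<lambda>x. cos (f x)) xs) = cos (prod_list (map f xs)) \<and> prod_list (map f xs) \<in> F"
  using assms
proof (induction xs rule: induct_list012)
  case (3 x y zs)
  then show ?case by (auto simp: leavitt_mult fcar_mult)
qed auto

text \<open>Adding \<open>fbad\<close> turns the preimage of an ideal into an ideal of the free unital algebra on all
  letters.\<close>

definition pre :: "('v, 'e, 'k::field) lpa set \<Rightarrow> (('v, 'e) gen fword \<Rightarrow>\<^sub>0 'k) set" where
  "pre P = {x. \<exists>y\<in>F. cos y \<in> P \<and> x - y \<in> fbad (gens G)}"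

lemma pre_iff: "x \<in> F \<Longrightarrow> x \<in> pre P \<longleftrightarrow> cos x \<in> P"
proof
  assume x: "x \<in> F"
  {
    assume "x \<in> pre P"
    then obtain y where y: "y \<in> F" "cos y \<in> P" "x - y \<in> fbad (gens G)" unfolding pre_def by blast
    then have "x - y = 0" using x by (intro fcar_fbad fcar_diff)
    then show "cos x \<in> P" using y by simp
  }
  assume "cos x \<in> P"
  moreover have "x - x \<in> fbad (gens G)" by (simp add: fbad_0)
  ultimately show "x \<in> pre P" unfolding pre_def using x by blast
qed

text \<open>A factor \<open>a\<close> splits into a scalar, an element of the algebra and a part in
  \<open>fbad\<close>. The ideal \<open>P\<close> absorbs the products with the first two,
  \<open>fbad\<close> those with the third.\<close>

lemma leavitt_ideal_pre:
  fixes P :: "('v, 'e, 'k::field) lpa set"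
  assumes P: "alg_ideal (leavitt G) P"
  shows "leavitt_ideal G fK (\<lambda>A. fp A) (\<lambda>e. fs e) (\<lambda>e. fstar e) (pre P)"
proof -
  have PL: "P \<subseteq> carrier (leavitt G)" "cos 0 \<in> P" "\<And>Z W. Z \<in> P \<Longrightarrow> W \<in> P \<Longrightarrow> Z \<oplus>\<^bsub>leavitt G\<^esub> W \<in> P"
    "\<And>k Z. Z \<in> P \<Longrightarrow> k \<odot>\<^bsub>leavitt G\<^esub> Z \<in> P"
    "\<And>Z A. Z \<in> P \<Longrightarrow> A \<in> carrier (leavitt G) \<Longrightarrow> A \<otimes>\<^bsub>leavitt G\<^esub> Z \<in> P"
    "\<And>Z A. Z \<in> P \<Longrightarrow> A \<in> carrier (leavitt G) \<Longrightarrow> Z \<otimes>\<^bsub>leavitt G\<^esub> A \<in> P"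
    using P unfolding leavitt.alg_ideal_iff by (auto simp: leavitt_zero)
  have N: "x \<in> pre P" if "x \<in> N" for x
    using that N_facts(1) PL(2) cos_eq_iff[of x 0] pre_iff[of x P] by auto
  have rel: "x \<in> pre P" if "x \<in> relators G" for x using that N N_relators by blast
  show ?thesis
  proof unfold_locales
    show "0 \<in> pre P" using N N_facts by blast
    show "x + y \<in> pre P" if xy: "x \<in> pre P" "y \<in> pre P" for x y
    proof -
      obtain x' y' where *: "x' \<in> F" "cos x' \<in> P" "x - x' \<in> fbad (gens G)"
        "y' \<in> F" "cos y' \<in> P" "y - y' \<in> fbad (gens G)" using xy unfolding pre_def by blast
      have "cos (x' + y') \<in> P" using PL(3)[OF *(2,5)] by (simp add: leavitt_add)
      moreover have "x + y - (x' + y') \<in> fbad (gens G)"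
        using fbad_add[OF *(3,6)] by (simp add: algebra_simps)
      ultimately show ?thesis unfolding pre_def using fcar_add[OF *(1,4)] by blast
    qed
    fix x a :: "('v, 'e) gen fword \<Rightarrow>\<^sub>0 'k" assume "x \<in> pre P"
    then obtain y where y: "y \<in> F" "cos y \<in> P" "x - y \<in> fbad (gens G)" unfolding pre_def by blast
    obtain k f b where a: "a = fK k + f + b" "f \<in> F" "b \<in> fbad (gens G)" by (rule free_split)
    show "a * x \<in> pre P"
    proof -
      have "cos (fK k * y + f * y) \<in> P"
        using PL(3)[OF PL(4)[OF y(2), of k] PL(5)[OF y(2), of "cos f"]] a y
        by (simp add: leavitt_add leavitt_smult leavitt_mult leavitt_carrier)
      moreover have "a * (x - y) + b * y \<in> fbad (gens G)"
        by (intro fbad_add fbad_left[OF y(3)] fbad_right a)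
      moreover have "a * (x - y) + b * y = a * x - (fK k * y + f * y)"
        using a(1) by (simp add: algebra_simps)
      ultimately show ?thesis unfolding pre_def using fcar_add[OF fcar_K fcar_mult] a y
        by (metis (mono_tags, lifting) mem_Collect_eq)
    qed
    show "x * a \<in> pre P"
    proof -
      have "cos (fK k * y + y * f) \<in> P"
        using PL(3)[OF PL(4)[OF y(2), of k] PL(6)[OF y(2), of "cos f"]] a y
        by (simp add: leavitt_add leavitt_smult leavitt_mult leavitt_carrier)
      moreover have "(x - y) * a + y * b \<in> fbad (gens G)"
        by (intro fbad_add fbad_right[OF y(3)] fbad_left a)
      moreover have "(x - y) * a + y * b = x * a - (fK k * y + y * f)"
        using a(1) by (simp add: algebra_simps fK_commute[of k y])
      ultimately show ?thesis unfolding pre_def using fcar_add[OF fcar_K fcar_mult] a y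
        by (metis (mono_tags, lifting) mem_Collect_eq)
    qed
  qed (intro fK_add fK_mult fK_one fK_commute; fail | intro rel relators.intros; assumption)+
qed

end

section \<open>The powers of the cycle as they occur in f(s_c)\<close>

context cycle_ideal
begin

lemma s_edg_p: "s (edg k) * p {vx (Suc k)} \<approx> s (edg k)"
  using cg_trans[OF cg_left[OF cg_sym[OF p_rng_edg]] s_rng[OF edg_in]] .

lemma up_sp: "n > 0 \<Longrightarrow> up 0 n \<approx> sp (seg 0 n)"
proof (cases n)
  case (Suc l)
  then show ?thesis
    using cg_left[OF s_edg_p[of l], of "sp (seg 0 l)"]
    by (simp add: up_def seg_Suc_right sp_append mult.assoc)
qed simp

lemma dn_st: "n > 0 \<Longrightarrow> dn 0 n \<approx> st (seg 0 n)"
proof (cases n)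
  case (Suc l)
  then show ?thesis
    using cg_right[OF p_vx_t_edg[of l], of "st (seg 0 l)"]
    by (simp add: dn_def seg_Suc_right st_append mult.assoc)
qed simp

lemma sp_seg_mult: "sp (seg 0 (n * m)) = sp c ^ n" and st_seg_mult: "st (seg 0 (n * m)) = st c ^ n"
proof (induction n)
  case (Suc n)
  have eq: "seg 0 (Suc n * m) = c @ seg 0 (n * m)"
    using seg_append[of 0 m "n * m"] seg_cong[of m 0 "n * m"] vx_mult(1)[of 1] seg_c by simp
  {
    case 1
    then show ?case using Suc by (simp only: eq sp_append power_Suc)
  next
    case 2
    then show ?case using Suc by (simp only: eq st_append power_Suc power_commutes)
  }
qed simp_all

definition cpow :: "int \<Rightarrow> 'a" where
  "cpow i = (if i = 0 then p {vx 0} else if i > 0 then sp c ^ nat i else st c ^ nat (- i))"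

text \<open>The projection built into \<open>cp\<close> is absorbed modulo \<open>P\<close>, where
  the range of the last edge has shrunk to the next vertex.\<close>

lemma cp_cpow: "cp i \<approx> cpow i"
  using up_sp[of "nat i * m"] dn_st[of "nat (- i) * m"] m_pos
  by (auto simp: cp_def cpow_def up_0 sp_seg_mult st_seg_mult)

lemma ev_cpow: "ev g \<approx> (\<Sum>i\<in>Poly_Mapping.keys g. K (Poly_Mapping.lookup g i) * cpow i)"
  unfolding ev_def by (intro cg_sum cg_left cp_cpow)

end


section \<open>Ideals of the Leavitt path algebra\<close>

lemma (in leavitt_ideal) LM_sp: "set \<alpha> \<subseteq> edges G \<Longrightarrow> sp \<alpha> \<in> LM (int (length \<alpha>))"
proof (induction \<alpha>)
  case (Cons e \<alpha>)
  then show ?case using LM_mult[OF LM_s, of e "sp \<alpha>" "int (length \<alpha>)"] by simp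
qed (simp add: LM_one)

lemma (in leavitt_ideal) RM_st: "set \<alpha> \<subseteq> edges G \<Longrightarrow> st \<alpha> \<in> RM (- int (length \<alpha>))"
proof (induction \<alpha>)
  case (Cons e \<alpha>)
  then show ?case using RM_mult[OF _ RM_t, of "st \<alpha>" "- int (length \<alpha>)" e]
    by (simp add: algebra_simps)
qed (simp add: RM_one)

lemma (in leavitt_ideal) st_edge_path: "st \<alpha> \<notin> P \<Longrightarrow> \<alpha> \<noteq> [] \<Longrightarrow> set \<alpha> \<subseteq> edges G \<Longrightarrow> edge_path G \<alpha>"
proof (induction \<alpha>)
  case (Cons e \<alpha>)
  show ?case
  proof (cases \<alpha>)
    case (Cons f \<beta>)
    have e: "e \<in> edges G" "f \<in> edges G" using Cons.prems Cons by auto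
    have nP: "st \<alpha> * t e \<notin> P" using Cons.prems by simp
    then have "st \<alpha> \<notin> P" using P_right by blast
    then have 1: "edge_path G \<alpha>" using Cons.IH Cons.prems Cons by auto
    have "st \<alpha> * (p (rng G e) * t e) \<approx> st \<alpha> * t e" by (intro cg_left rng_t e)
    then have "st \<alpha> * p (rng G e) * t e \<notin> P" using nP cg_P by (simp add: mult.assoc)
    then have "\<not> st \<alpha> * p (rng G e) \<approx> 0" using P_right P_iff_cg by blast
    then have "src G f \<in> rng G e" using st_p_notin[OF gsets.range[OF e(1)] e(2), of \<beta>] Cons by blast
    then show ?thesis using 1 e Cons by (auto simp: edge_path_Cons)
  qed (use Cons.prems in \<open>auto simp: edge_path_Cons\<close>)
qed simp

locale quotient_ideal = ultragraph G for G :: "('v, 'e) ultragraph" +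
  fixes P :: "('v, 'e, 'k::field) lpa set"
  assumes is_ideal: "alg_ideal (leavitt G) P"
begin

sublocale leavitt_ideal G "fK :: 'k \<Rightarrow> _" "\<lambda>A. fp A" "\<lambda>e. fs e" "\<lambda>e. fstar e" "pre P"
  by (rule leavitt_ideal_pre[OF is_ideal])

notation cg (infix \<open>\<approx>\<close> 50)

lemma zero_in: "cos 0 \<in> P"
  using P_zero pre_iff[OF fcar_0] by blast

lemma fbad_pre: "b \<in> fbad (gens G) \<Longrightarrow> b \<in> pre P"
  unfolding pre_def using zero_in fcar_0 by force

lemma letter_Fin: "g \<in> gens G \<Longrightarrow> letter g \<in> Fin"
  unfolding gens_def using Fin_p Fin_s Fin_t by auto

lemma word_Fin: "gs \<noteq> [] \<Longrightarrow> set gs \<subseteq> gens G \<Longrightarrow> Poly_Mapping.single (FWord gs) (1::'k) \<in> Fin"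
proof (induction gs)
  case (Cons g gs)
  show ?case
  proof (cases "gs = []")
    case True
    then show ?thesis using letter_Fin[of g] Cons.prems by (simp add: letter_def)
  next
    case False
    have "letter g * Poly_Mapping.single (FWord gs) (1::'k) \<in> Fin"
      using Cons False by (intro Fin_mult letter_Fin) auto
    then show ?thesis by (simp add: letter_def mult_single plus_fword_def)
  qed
qed simp

lemma F_Fin: "x \<in> F \<Longrightarrow> x \<in> Fin"
proof -
  assume x: "x \<in> F"
  have "Poly_Mapping.single w (Poly_Mapping.lookup x w) \<in> Fin" if w: "w \<in> Poly_Mapping.keys x" for w
  proof -
    have "Poly_Mapping.single w (1::'k) \<in> Fin"
      using x w word_Fin[of "letters w"] by (simp add: fcar_def)
    then have "fK (Poly_Mapping.lookup x w) * Poly_Mapping.single w 1 \<in> Fin" by (rule Sp_K)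
    then show ?thesis by (simp add: fK_def mult_single)
  qed
  then have "(\<Sum>w\<in>Poly_Mapping.keys x. Poly_Mapping.single w (Poly_Mapping.lookup x w)) \<in> Fin"
    by (rule Sp_sum)
  then show ?thesis using poly_mapping_sum_single[of x] by simp
qed

lemma sp_F: "set \<alpha> \<subseteq> edges G \<Longrightarrow> y \<in> F \<Longrightarrow> sp \<alpha> * y \<in> F"
  by (induction \<alpha>) (auto simp: mult.assoc intro!: fcar_mult fs_F)

lemma F_st: "set \<alpha> \<subseteq> edges G \<Longrightarrow> y \<in> F \<Longrightarrow> y * st \<alpha> \<in> F"
proof (induction \<alpha> arbitrary: y)
  case (Cons e \<alpha>)
  have "y * st \<alpha> * fstar e \<in> F" using Cons by (intro fcar_mult[of "y * st \<alpha>"] fstar_F) auto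
  then show ?case by (simp add: mult.assoc)
qed simp

lemma mono_F: "A \<in> gsets G \<Longrightarrow> set \<alpha> \<subseteq> edges G \<Longrightarrow> set \<beta> \<subseteq> edges G \<Longrightarrow> mono \<alpha> A \<beta> \<in> F"
  unfolding mono_def by (intro F_st sp_F fp_F)

text \<open>An element of \<open>Fin\<close> may involve foreign letters or scalars through its part
  in \<open>P\<close>; up to congruence it comes from the algebra.\<close>

lemma Fin_F: "a \<in> Fin \<Longrightarrow> \<exists>a'\<in>F. a \<approx> a'"
proof (induction a rule: Sp.induct)
  case (Sp_P x)
  then show ?case using fcar_0 by (intro bexI[of _ 0]) (auto simp: P_iff_cg)
next
  case (Sp_mono x A \<alpha> \<beta> k)
  then obtain a' where "a' \<in> F" "x \<approx> a'" by blast
  then show ?case using mono_F Sp_mono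
    by (intro bexI[of _ "a' + fK k * mono \<alpha> A \<beta>"] cg_add cg_refl fcar_add fcar_K)
qed

lemma in_P: "Z \<in> P \<Longrightarrow> \<exists>x\<in>F. Z = cos x \<and> x \<in> pre P"
proof -
  assume Z: "Z \<in> P"
  then have "Z \<in> carrier (leavitt G)" using is_ideal unfolding leavitt.alg_ideal_iff by blast
  then show ?thesis using Z pre_iff by (auto simp: leavitt_carrier)
qed

lemma P_subset: "quotient_ideal G P' \<Longrightarrow> (\<And>x. x \<in> F \<Longrightarrow> x \<in> pre P \<Longrightarrow> x \<in> pre P') \<Longrightarrow> P \<subseteq> P'"
  using in_P pre_iff by blast

lemma image_ideal:
  fixes I :: "(('v, 'e) gen fword \<Rightarrow>\<^sub>0 'k) set"
  assumes I: "I \<subseteq> F" "0 \<in> I" "\<And>x y. x \<in> I \<Longrightarrow> y \<in> I \<Longrightarrow> x + y \<in> I" "\<And>k x. x \<in> I \<Longrightarrow> fK k * x \<in> I"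
    "\<And>x a. x \<in> I \<Longrightarrow> a \<in> F \<Longrightarrow> a * x \<in> I" "\<And>x a. x \<in> I \<Longrightarrow> a \<in> F \<Longrightarrow> x * a \<in> I"
  shows "alg_ideal (leavitt G) (cos ` I)"
  unfolding leavitt.alg_ideal_iff
proof (intro conjI ballI allI)
  show "cos ` I \<subseteq> carrier (leavitt G)" using I(1) by (auto simp: leavitt_carrier)
  show "\<zero>\<^bsub>leavitt G\<^esub> \<in> cos ` I" using I(2) by (simp add: leavitt_zero)
  fix Z W assume "Z \<in> cos ` I"
  then obtain x where x: "x \<in> I" "Z = cos x" by blast
  show "k \<odot>\<^bsub>leavitt G\<^esub> Z \<in> cos ` I" for k using I(4) x by (simp add: leavitt_smult)
  show "Z \<oplus>\<^bsub>leavitt G\<^esub> W \<in> cos ` I" if "W \<in> cos ` I" using that I(3) x by (auto simp: leavitt_add)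
next
  fix Z W :: "('v, 'e, 'k) lpa" assume "Z \<in> carrier (leavitt G)" "W \<in> cos ` I"
  then obtain a x where "a \<in> F" "Z = cos a" "x \<in> I" "W = cos x" by (auto simp: leavitt_carrier)
  moreover from this have "x \<in> F" using I(1) by blast
  ultimately show "Z \<otimes>\<^bsub>leavitt G\<^esub> W \<in> cos ` I" "W \<otimes>\<^bsub>leavitt G\<^esub> Z \<in> cos ` I"
    using I(5,6) by (simp_all add: leavitt_mult)
qed

text \<open>From ideals to elements: \<open>I\<close> consists of the \<open>x\<close> with all
  \<open>x * z * b'\<close> in \<open>pre P\<close>, and \<open>J\<close> collects what
  \<open>I\<close> annihilates in turn. With annihilators instead of generated ideals, the ideal
  laws as well as \<open>a' \<in> I\<close> and \<open>b' \<in> J\<close> hold almost by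
  construction.\<close>

lemma prime_locale:
  assumes prime: "alg_prime_ideal (leavitt G) P"
  shows "leavitt_prime G (fK :: 'k \<Rightarrow> _) (\<lambda>A. fp A) (\<lambda>e. fs e) (\<lambda>e. fstar e) (pre P)"
proof unfold_locales
  fix z :: "('v, 'e) gen fword \<Rightarrow>\<^sub>0 'k"
  obtain k f b where z: "z = fK k + f + b" "f \<in> F" "b \<in> fbad (gens G)" by (rule free_split)
  then have "f + b \<in> Fin" using F_Fin fbad_pre by (intro Sp_add) (auto intro: Sp_P)
  then show "\<exists>k. z - fK k \<in> Fin" using z(1) by (intro exI[of _ k]) (simp add: add.assoc)
next
  fix a b assume ab: "a \<in> Fin" "b \<in> Fin" and *: "\<And>z. a * z * b \<in> pre P"
  obtain a' b' where a': "a' \<in> F" "a \<approx> a'" "b' \<in> F" "b \<approx> b'" using Fin_F ab by blast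
  have **: "a' * z * b' \<in> pre P" for z
    using * cg_P[OF cg_mult[OF cg_right[OF a'(2), of z] a'(4)]] by blast
  define I where "I = {x\<in>F. \<forall>z. x * z * b' \<in> pre P}"
  define J where "J = {y\<in>F. \<forall>x\<in>I. \<forall>z. x * z * y \<in> pre P}"
  have I: "alg_ideal (leavitt G) (cos ` I)"
  proof (rule image_ideal)
    show "fK k * x \<in> I" if "x \<in> I" for k x
      using that P_left by (auto simp: I_def fcar_K mult.assoc)
    show "a * x \<in> I" if "x \<in> I" "a \<in> F" for x a
      using that P_left by (auto simp: I_def fcar_mult mult.assoc)
    show "x * a \<in> I" if "x \<in> I" "a \<in> F" for x a
    proof -
      have "x * (a * z) * b' \<in> pre P" for z using that by (simp add: I_def)
      then show ?thesis using that by (simp add: I_def fcar_mult mult.assoc)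
    qed
  qed (auto simp: I_def fcar_0 fcar_add P_zero P_add distrib_right)
  have J: "alg_ideal (leavitt G) (cos ` J)"
  proof (rule image_ideal)
    show "fK k * x \<in> J" if "x \<in> J" for k x
    proof -
      have "y * (z * fK k) * x \<in> pre P" if "y \<in> I" for y z using that \<open>x \<in> J\<close> by (simp add: J_def)
      then show ?thesis using that by (simp add: J_def fcar_K mult.assoc)
    qed
    show "a * x \<in> J" if "x \<in> J" "a \<in> F" for x a
    proof -
      have "y * (z * a) * x \<in> pre P" if "y \<in> I" for y z using that \<open>x \<in> J\<close> by (simp add: J_def)
      then show ?thesis using that by (simp add: J_def fcar_mult mult.assoc)
    qed
    show "x * a \<in> J" if "x \<in> J" "a \<in> F" for x a
    proof -
      have "y * z * x * a \<in> pre P" if "y \<in> I" for y z using that \<open>x \<in> J\<close> by (intro P_right[of "y * z * x"]) (simp add: J_def)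
      then show ?thesis using that by (simp add: J_def fcar_mult mult.assoc)
    qed
  qed (auto simp: J_def fcar_0 fcar_add P_zero P_add distrib_left)
  have "\<forall>Z\<in>cos ` I. \<forall>W\<in>cos ` J. Z \<otimes>\<^bsub>leavitt G\<^esub> W \<in> P"
  proof (intro ballI)
    fix Z W assume "Z \<in> cos ` I" "W \<in> cos ` J"
    then obtain x y where xy: "x \<in> I" "y \<in> J" "Z = cos x" "W = cos y" by blast
    have "\<forall>z. x * z * y \<in> pre P" using xy(1,2) by (simp add: J_def)
    from this[rule_format, of 1] have "x * y \<in> pre P" by simp
    then show "Z \<otimes>\<^bsub>leavitt G\<^esub> W \<in> P"
      using xy pre_iff[of "x * y" P] by (simp add: leavitt_mult I_def J_def fcar_mult)
  qed
  then have "cos ` I \<subseteq> P \<or> cos ` J \<subseteq> P" using prime I J unfolding alg_prime_ideal_def by blast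
  moreover have "a' \<in> I" using a' ** by (simp add: I_def)
  moreover have "b' \<in> J" using a' by (auto simp: J_def I_def)
  ultimately have "a' \<in> pre P \<or> b' \<in> pre P" using pre_iff a' by blast
  then show "a \<in> pre P \<or> b \<in> pre P" using cg_P a' by blast
qed

lemma s_path_cos: "edge_path G es \<Longrightarrow> s_path G (PEdges es) = cos (sp es) \<and> sp es \<in> F"
  and s_path_star_cos: "edge_path G es \<Longrightarrow> s_path_star G (PEdges es) = cos (st es) \<and> st es \<in> F"
  using leavitt_nprod[of es "\<lambda>e. fs e"] leavitt_nprod[of "rev es" "\<lambda>e. fstar e"]
  by (auto simp: edge_path_def sp_def st_def lgen_cos fs_F fstar_F subset_iff)

lemma homogeneous_cos:
  assumes "Z \<in> homogeneous G n"
  shows "\<exists>x\<in>F. Z = cos x \<and> x \<in> Hom n"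
  using assms unfolding homogeneous_def
proof (induction Z rule: alg_span.induct)
  case zero
  then show ?case using fcar_0 by (intro bexI[of _ 0]) (auto simp: leavitt_zero Hom_def Sp_zero)
next
  case (add_smult Z W k)
  then obtain x where x: "x \<in> F" "Z = cos x" "x \<in> Hom n" by blast
  obtain \<alpha> A \<beta> where W: "W = s_path G \<alpha> \<otimes>\<^bsub>leavitt G\<^esub> lp G A \<otimes>\<^bsub>leavitt G\<^esub> s_path_star G \<beta>"
    "is_path G \<alpha>" "is_path G \<beta>" "A \<in> gsets G" "int (plength \<alpha>) - int (plength \<beta>) = n"
    using add_smult by blast
  have 1: "\<exists>a\<in>F. s_path G \<alpha> = cos a \<and> a \<in> LM (int (plength \<alpha>))"
  proof (cases \<alpha>)
    case (PSet B)
    then show ?thesis using W(2) by (auto simp: lgen_cos intro!: bexI[of _ "fp B"] fp_F LM_p)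
  next
    case (PEdges es)
    then have "edge_path G es" using W(2) by simp
    then show ?thesis using s_path_cos LM_sp edge_path_edges PEdges by (intro bexI[of _ "sp es"]) auto
  qed
  have 2: "\<exists>b\<in>F. s_path_star G \<beta> = cos b \<and> b \<in> RM (- int (plength \<beta>))"
  proof (cases \<beta>)
    case (PSet B)
    then show ?thesis using W(3) by (auto simp: lgen_cos intro!: bexI[of _ "fp B"] fp_F RM_p)
  next
    case (PEdges es)
    then have "edge_path G es" using W(3) by simp
    then show ?thesis using s_path_star_cos RM_st edge_path_edges PEdges by (intro bexI[of _ "st es"]) auto
  qed
  obtain a b where ab: "a \<in> F" "s_path G \<alpha> = cos a" "a \<in> LM (int (plength \<alpha>))"
    "b \<in> F" "s_path_star G \<beta> = cos b" "b \<in> RM (- int (plength \<beta>))" using 1 2 by blast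
  have "a * fp A * b \<in> Hom (0 + int (plength \<alpha>) + - int (plength \<beta>))"
    using W(4) ab by (intro HomRD HomLD p_in_Hom)
  then have "a * fp A * b \<in> Hom n" using W(5) by simp
  then have "x + fK k * (a * fp A * b) \<in> Hom n" using x unfolding Hom_def by (intro Sp_add Sp_K)
  moreover have "Z \<oplus>\<^bsub>leavitt G\<^esub> (k \<odot>\<^bsub>leavitt G\<^esub> W) = cos (x + fK k * (a * fp A * b))"
    using W(4) by (simp add: W(1) x(2) ab lgen_cos leavitt_mult fcar_mult fp_F leavitt_smult leavitt_add)
  moreover have "x + fK k * (a * fp A * b) \<in> F"
    using x ab W(4) by (intro fcar_add fcar_K fcar_mult fp_F)
  ultimately show ?case by blast
qed

text \<open>Translates monomials into the paths used by the grading. An empty word becomes the path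
  \<open>A\<close> of length \<open>0\<close>, whose projection is absorbed by idempotence; survival
  guarantees that nonempty words are paths.\<close>

lemma homogeneous_generator:
  assumes "A \<in> gsets G" "set \<alpha> \<subseteq> edges G" "set \<beta> \<subseteq> edges G" "mono \<alpha> A \<beta> \<notin> pre P"
  shows "\<exists>\<alpha>' \<beta>'. is_path G \<alpha>' \<and> is_path G \<beta>' \<and> plength \<alpha>' = length \<alpha> \<and> plength \<beta>' = length \<beta> \<and>
    (\<exists>a\<in>F. \<exists>b\<in>F. s_path G \<alpha>' = cos a \<and> s_path_star G \<beta>' = cos b \<and> a * fp A * b \<approx> mono \<alpha> A \<beta>)"
proof -
  have nP: "sp \<alpha> * fp A * st \<beta> \<notin> pre P" using assms(4) by (simp add: mono_def)
  have \<alpha>: "\<alpha> = [] \<or> edge_path G \<alpha>"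
  proof -
    have "sp \<alpha> \<notin> pre P" using nP P_right by blast
    then show ?thesis using sp_edge_path assms(2) by blast
  qed
  have \<beta>: "\<beta> = [] \<or> edge_path G \<beta>"
  proof -
    have "st \<beta> \<notin> pre P" using nP P_left by blast
    then show ?thesis using st_edge_path assms(3) by blast
  qed
  have AA: "fp A * fp A \<approx> fp A" using p_p[OF assms(1,1)] by simp
  define \<alpha>' where "\<alpha>' = (if \<alpha> = [] then PSet A else PEdges \<alpha> :: ('v, 'e) upath)"
  define \<beta>' where "\<beta>' = (if \<beta> = [] then PSet A else PEdges \<beta> :: ('v, 'e) upath)"
  define a where "a = (if \<alpha> = [] then fp A else sp \<alpha>)"
  define b where "b = (if \<beta> = [] then fp A else st \<beta>)"
  have aA: "a * fp A \<approx> sp \<alpha> * fp A" using AA by (simp add: a_def)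
  have Ab: "fp A * b \<approx> fp A * st \<beta>" using AA by (simp add: b_def)
  have "a * fp A * b \<approx> sp \<alpha> * fp A * b" by (intro cg_right aA)
  also have "\<dots> = sp \<alpha> * (fp A * b)" by (simp add: mult.assoc)
  also have "\<dots> \<approx> sp \<alpha> * (fp A * st \<beta>)" by (intro cg_left Ab)
  finally have cg: "a * fp A * b \<approx> mono \<alpha> A \<beta>" by (simp add: mono_def mult.assoc)
  have s: "s_path G \<alpha>' = cos a \<and> a \<in> F" "s_path_star G \<beta>' = cos b \<and> b \<in> F"
    using \<alpha> \<beta> s_path_cos s_path_star_cos assms(1)
    by (auto simp: \<alpha>'_def \<beta>'_def a_def b_def lgen_cos fp_F edge_path_def simp del: s_path.simps(2) s_path_star.simps(2))
  have "is_path G \<alpha>'" "is_path G \<beta>'" "plength \<alpha>' = length \<alpha>" "plength \<beta>' = length \<beta>"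
    using \<alpha> \<beta> assms(1) by (auto simp: \<alpha>'_def \<beta>'_def)
  then show ?thesis using s cg by blast
qed

end

section \<open>Homogeneous decomposition in the Leavitt path algebra\<close>

context ultragraph
begin

text \<open>Makes the algebra itself an instance of the calculus: for elements of the free algebra,
  congruence modulo the zero ideal is equality in \<open>leavitt G\<close>.\<close>

lemma zero_ideal: "quotient_ideal G ({cos 0} :: ('v, 'e, 'k::field) lpa set)"
proof
  show "alg_ideal (leavitt G) ({cos 0} :: ('v, 'e, 'k) lpa set)"
    unfolding leavitt.alg_ideal_iff
    by (auto simp: leavitt_carrier leavitt_zero leavitt_add leavitt_smult leavitt_mult fcar_0)
qed

lemma homogeneous_decomposition:
  fixes x :: "('v, 'e) gen fword \<Rightarrow>\<^sub>0 'k::field"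
  assumes "x \<in> F"
  obtains S y where "finite S" "\<And>n. y n \<in> F" "\<And>n. cos (y n) \<in> homogeneous G n" "cos x = cos (sum y S)"
proof -
  interpret Z: quotient_ideal G "{cos 0} :: ('v, 'e, 'k) lpa set" by (rule zero_ideal)
  have zero: "cos 0 \<in> homogeneous G n" for n
    unfolding homogeneous_def leavitt_zero[symmetric] by (rule alg_span.zero)
  have *: "\<exists>S y. finite S \<and> (\<forall>n. y n \<in> F \<and> cos (y n) \<in> homogeneous G n) \<and> x - sum y S \<in> pre {cos 0}"
    if "x \<in> Z.Fin" for x
    using that
  proof (induction x rule: Z.Sp.induct)
    case (Sp_P x)
    then show ?case using zero fcar_0
      by (intro exI[of _ "{}"] exI[of _ "\<lambda>_. 0"]) auto
  next
    case (Sp_mono x A \<alpha> \<beta> k)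
    then obtain S y where Sy: "finite S" "\<And>n. y n \<in> F" "\<And>n. cos (y n) \<in> homogeneous G n"
      "x - sum y S \<in> pre {cos 0}" by blast
    show ?case
    proof (cases "Z.mono \<alpha> A \<beta> \<in> pre {cos 0}")
      case True
      then have "(x - sum y S) + fK k * Z.mono \<alpha> A \<beta> \<in> pre {cos 0}"
        by (intro Z.P_add Sy(4) Z.P_left)
      then have "x + fK k * Z.mono \<alpha> A \<beta> - sum y S \<in> pre {cos 0}" by (simp add: algebra_simps)
      then show ?thesis using Sy(1-3) by blast
    next
      case False
      obtain \<alpha>' \<beta>' a b where ab: "is_path G \<alpha>'" "is_path G \<beta>'" "plength \<alpha>' = length \<alpha>" "plength \<beta>' = length \<beta>"
        "a \<in> F" "b \<in> F" "s_path G \<alpha>' = cos a" "s_path_star G \<beta>' = cos b"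
        "Z.cg (a * fp A * b) (Z.mono \<alpha> A \<beta>)"
        using Z.homogeneous_generator[OF Sp_mono(2-4) False] by blast
      define n where "n = int (length \<alpha>) - int (length \<beta>)"
      define w where "w = a * fp A * b"
      have w: "w \<in> F" unfolding w_def by (intro fcar_mult ab fp_F Sp_mono)
      have W: "cos w = s_path G \<alpha>' \<otimes>\<^bsub>leavitt G\<^esub> lp G A \<otimes>\<^bsub>leavitt G\<^esub> s_path_star G \<beta>'"
        using ab Sp_mono(2) by (simp add: w_def lgen_cos leavitt_mult fcar_mult fp_F)
      obtain y' where y': "\<And>f. y' f = (if f = n then (if n \<in> S then y n else 0) + fK k * w else y f)"
        "sum y' (insert n S) = sum y S + fK k * w"
        using sum_fun_upd_add[of S "\<lambda>_ z. z" n y "fK k * w"] Sy(1) by auto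
      have "cos (z + fK k * w) \<in> homogeneous G n" if "cos z \<in> homogeneous G n" for z
      proof -
        have "\<exists>\<alpha> A \<beta>. cos w = s_path G \<alpha> \<otimes>\<^bsub>leavitt G\<^esub> lp G A \<otimes>\<^bsub>leavitt G\<^esub> s_path_star G \<beta> \<and>
          is_path G \<alpha> \<and> is_path G \<beta> \<and> A \<in> gsets G \<and> int (plength \<alpha>) - int (plength \<beta>) = n"
          using W Sp_mono(2) ab(1-4) unfolding n_def by metis
        then have "cos z \<oplus>\<^bsub>leavitt G\<^esub> (k \<odot>\<^bsub>leavitt G\<^esub> cos w) \<in> homogeneous G n"
          using that unfolding homogeneous_def by (intro alg_span.add_smult CollectI)
        then show ?thesis by (simp add: leavitt_add leavitt_smult)
      qed
      from this[of 0] this[of "y n"] have 1: "cos (y' f) \<in> homogeneous G f" for f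
        using Sy(3) zero by (auto simp: y'(1))
      have 2: "y' f \<in> F" for f using Sy(2) w by (auto simp: y'(1) intro!: fcar_add fcar_K fcar_0)
      have "fK k * (w - Z.mono \<alpha> A \<beta>) \<in> pre {cos 0}"
        using ab(9) unfolding Z.cg_def w_def by (rule Z.P_left)
      then have "(x - sum y S) - fK k * (w - Z.mono \<alpha> A \<beta>) \<in> pre {cos 0}" by (rule Z.P_diff[OF Sy(4)])
      then have "x + fK k * Z.mono \<alpha> A \<beta> - sum y' (insert n S) \<in> pre {cos 0}"
        by (simp add: y'(2) algebra_simps)
      moreover have "finite (insert n S)" using Sy(1) by simp
      ultimately show ?thesis using 1 2 by blast
    qed
  qed
  obtain S y where Sy: "finite S" "\<And>n. y n \<in> F" "\<And>n. cos (y n) \<in> homogeneous G n" "x - sum y S \<in> pre {cos 0}"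
    using *[OF Z.F_Fin[OF assms]] by blast
  have "x - sum y S \<in> F" using assms Sy(2) by (intro fcar_diff fcar_sum)
  then have "cos (x - sum y S) = cos 0" using Sy(4) pre_iff by blast
  then have "cos x = cos (sum y S)" by (simp add: cos_eq_iff)
  then show thesis by (rule that[OF Sy(1-3)])
qed

lemma pre_mono: "P \<subseteq> P' \<Longrightarrow> pre P \<subseteq> pre P'"
  by (auto simp: pre_def)

end

text \<open>Every element of \<open>P\<close> is a sum of homogeneous ones; if the components of all
  such sums were in \<open>P\<close>, the ideal would be graded.\<close>

lemma (in quotient_ideal) not_graded_homogeneous_sum:
  assumes "\<not> graded_ideal G P"
  obtains S y n where "homogeneous_sum S y" "n \<in> S" "y n \<notin> pre P"
proof (rule ccontr)
  assume neg: "\<not> thesis"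
  have *: "y n \<in> pre P" if "homogeneous_sum S y" "n \<in> S" for S y n
    by (rule ccontr) (use neg \<open>\<And>n y S. \<lbrakk>homogeneous_sum S y; n \<in> S; y n \<notin> pre P\<rbrakk> \<Longrightarrow> thesis\<close> that in blast)
  have "graded_ideal G P" unfolding graded_ideal_def
  proof (intro conjI is_ideal ballI)
    fix Z assume "Z \<in> P"
    then obtain x where x: "x \<in> F" "Z = cos x" "x \<in> pre P" using in_P by blast
    obtain S y where y: "finite S" "\<And>n. y n \<in> F" "\<And>n. cos (y n) \<in> homogeneous G n" "cos x = cos (sum y S)"
      by (rule homogeneous_decomposition[OF x(1)]) (rule that)
    have "\<forall>n. \<exists>x\<in>F. cos (y n) = cos x \<and> x \<in> Hom n" using homogeneous_cos y(3) by blast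
    then obtain y' where y': "\<And>n. y' n \<in> F" "\<And>n. cos (y n) = cos (y' n)" "\<And>n. y' n \<in> Hom n" by metis
    have Z: "Z = cos (sum y' S)"
      using leavitt_finsum[of S y] leavitt_finsum[of S y'] y y' x(2) by simp
    moreover have "sum y' S \<in> F" by (intro fcar_sum y')
    ultimately have "sum y' S \<in> pre P" using \<open>Z \<in> P\<close> pre_iff by blast
    then have "homogeneous_sum S y'" using y(1) y'(3) by (simp add: homogeneous_sum_def)
    then have "cos (y' n) \<in> P" if "n \<in> S" for n using *[of S y' n] that pre_iff[OF y'(1)] by simp
    moreover have "cos (y' n) \<in> homogeneous G n" for n using y(3)[of n] y'(2)[of n] by simp
    moreover have "Z = (\<Oplus>\<^bsub>leavitt G\<^esub>n\<in>S. cos (y' n))" using Z leavitt_finsum[of S y', OF y'(1)] by simp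
    ultimately have "finite S \<and> (\<forall>n\<in>S. cos (y' n) \<in> P \<inter> homogeneous G n) \<and> Z = (\<Oplus>\<^bsub>leavitt G\<^esub>n\<in>S. cos (y' n))"
      using y(1) by simp
    then show "\<exists>N y. finite N \<and> (\<forall>n\<in>N. y n \<in> P \<inter> homogeneous G n) \<and> Z = (\<Oplus>\<^bsub>leavitt G\<^esub>n\<in>N. y n)"
      by (intro exI[of _ S] exI[of _ "\<lambda>n. cos (y' n)"])
  qed
  then show False using assms by blast
qed

section \<open>Generators of an ideal with a distinguished cycle\<close>

locale nice_quotient = quotient_ideal G P +
  nice_ideal G fK "\<lambda>A. fp A" "\<lambda>e. fs e" "\<lambda>e. fstar e" "ultragraph.pre G P" c
  for G :: "('v, 'e) ultragraph" and P :: "('v, 'e, 'k::field) lpa set" and c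
begin

definition dead :: "'v set set" where "dead = {A \<in> gsets G. A \<inter> M = {}}"

lemma lp_in_iff: "A \<in> gsets G \<Longrightarrow> lp G A \<in> P \<longleftrightarrow> A \<inter> M = {}"
  using p_P_iff[of A] by (simp add: lgen_cos pre_iff fp_F)

lemma H_of_eq: "H_of G P = dead"
  using lp_in_iff by (auto simp: H_of_def dead_def)

lemma verts_minus_dead: "verts G - \<Union>dead = M"
proof -
  have "w \<in> \<Union>dead" if "w \<in> verts G" "w \<notin> M" for w
    using gsets.vertex[OF that(1)] that(2) by (auto simp: dead_def)
  then show ?thesis using M_verts by (auto simp: dead_def)
qed

abbreviation "live_edges w \<equiv> {e \<in> edges G. src G e = w \<and> rng G e \<inter> M \<noteq> {}}"

lemma live_edges_eq: "{e \<in> out_edges G w. rng G e \<notin> dead} = live_edges w"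
  using gsets.range[of _ G] by (auto simp: dead_def out_edges_def)

definition ck :: "'v \<Rightarrow> ('v, 'e) gen fword \<Rightarrow>\<^sub>0 'k" where
  "ck w = fp {w} - (\<Sum>e\<in>live_edges w. fs e * fstar e)"

lemma ck_F: "w \<in> verts G \<Longrightarrow> ck w \<in> F"
  unfolding ck_def by (intro fcar_diff fp_F gsets.vertex fcar_sum fcar_mult fs_F fstar_F) auto

lemma lp_breaking_cos: "w \<in> verts G \<Longrightarrow> lp_breaking G dead w = cos (ck w)"
proof -
  assume w: "w \<in> verts G"
  have st: "fs e * fstar e \<in> F" if "e \<in> live_edges w" for e
    using that by (intro fcar_mult fs_F fstar_F) auto
  have sF: "(\<Sum>e\<in>live_edges w. fs e * fstar e :: ('v, 'e) gen fword \<Rightarrow>\<^sub>0 'k) \<in> F"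
    by (intro fcar_sum st)
  have "(\<Oplus>\<^bsub>leavitt G\<^esub>e\<in>live_edges w. ls G e \<otimes>\<^bsub>leavitt G\<^esub> lstar G e) =
    (\<Oplus>\<^bsub>leavitt G\<^esub>e\<in>live_edges w. cos (fs e * fstar e :: ('v, 'e) gen fword \<Rightarrow>\<^sub>0 'k))"
    by (intro abelian_monoid.finsum_cong'[OF abelian_group.axioms(1)[OF leavitt_abelian]])
      (auto simp: lgen_cos leavitt_mult fs_F fstar_F leavitt_carrier st)
  also have "\<dots> = cos (\<Sum>e\<in>live_edges w. fs e * fstar e)" by (intro leavitt_finsum st)
  finally have eq: "(\<Oplus>\<^bsub>leavitt G\<^esub>e\<in>live_edges w. ls G e \<otimes>\<^bsub>leavitt G\<^esub> lstar G e) =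
    cos (\<Sum>e\<in>live_edges w. fs e * fstar e :: ('v, 'e) gen fword \<Rightarrow>\<^sub>0 'k)" .
  show ?thesis
    unfolding lp_breaking_def live_edges_eq eq unfolding lgen_cos ck_def
    by (rule leavitt_minus[OF sF fp_F[OF gsets.vertex[OF w]]])
qed

text \<open>Having a live edge is the same as lying in \<open>M\<close>, so the breaking vertices
  are exactly the infinite emitters to which \<open>ck_M\<close> applies.\<close>

lemma breaking_dead: "w \<in> breaking G dead \<longleftrightarrow> w \<in> M \<and> infinite (out_edges G w) \<and> finite (live_edges w)"
proof -
  have "live_edges w \<noteq> {} \<longleftrightarrow> w \<in> M"
  proof
    assume "live_edges w \<noteq> {}"
    then show "w \<in> M" using src_in_M by blast
  next
    assume "w \<in> M"
    then show "live_edges w \<noteq> {}" using M_edge by blast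
  qed
  then show ?thesis unfolding breaking_def live_edges_eq using M_verts by blast
qed

definition cycle_element :: "'k laurent \<Rightarrow> ('v, 'e) gen fword \<Rightarrow>\<^sub>0 'k" where
  "cycle_element f = (\<Sum>i\<in>Poly_Mapping.keys f. fK (Poly_Mapping.lookup f i) * cpow i)"

lemma cycle_power_cos: "cycle_power G c i = cos (cpow i) \<and> cpow i \<in> F"
proof -
  have c: "edge_path G c" using is_cycle by (simp add: cycle_def closed_path_def)
  show ?thesis
    using leavitt_nprod[of "replicate (nat i) c" sp] leavitt_nprod[of "replicate (nat (- i)) c" st]
      s_path_cos[OF c] s_path_star_cos[OF c]
    by (simp add: cycle_power_def cpow_def base_eq lgen_cos fp_F vx_gset del: s_path.simps s_path_star.simps)
qed

lemma cycle_element_F: "cycle_element f \<in> F"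
  unfolding cycle_element_def by (intro fcar_sum fcar_K) (simp add: cycle_power_cos)

lemma laurent_at_cycle_cos: "laurent_at_cycle G f c = cos (cycle_element f)"
  unfolding laurent_at_cycle_def cycle_element_def
  using leavitt_finsum[of "Poly_Mapping.keys f" "\<lambda>i. fK (Poly_Mapping.lookup f i) * cpow i"]
  by (simp add: cycle_power_cos leavitt_smult fcar_K)

lemma laurent_at_cycle_in: "laurent_at_cycle G f c \<in> P \<longleftrightarrow> ev f \<in> pre P"
proof -
  have "ev f \<approx> cycle_element f" using ev_cpow unfolding cycle_element_def .
  then show ?thesis
    using cg_P pre_iff[OF cycle_element_F] by (simp add: laurent_at_cycle_cos)
qed

definition generators :: "'k laurent \<Rightarrow> ('v, 'e, 'k) lpa set" where
  "generators f = lp G ` dead \<union> lp_breaking G dead ` breaking G dead \<union> {laurent_at_cycle G f c}"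

lemma generators_in: "ev f \<in> pre P \<Longrightarrow> generators f \<subseteq> P"
proof -
  assume f: "ev f \<in> pre P"
  have "lp_breaking G dead w \<in> P" if "w \<in> breaking G dead" for w
  proof -
    have w: "w \<in> M" "finite (live_edges w)" "w \<in> verts G" using that breaking_dead M_verts by auto
    then have "ck w \<in> pre P" using ck_M by (simp add: ck_def)
    then show ?thesis using pre_iff[OF ck_F] w by (simp add: lp_breaking_cos)
  qed
  then show ?thesis
    using f laurent_at_cycle_in lp_in_iff by (auto simp: generators_def dead_def)
qed

text \<open>The ideal spanned by the generators is nice for the same cycle and contains
  \<open>f\<close> in its corner, so \<open>determined_by_polynomial\<close> leaves no room for a
  larger \<open>P\<close>.\<close>

theorem generated:
  assumes f: "ev f \<in> pre P" "\<And>g. ev g \<in> pre P \<Longrightarrow> f dvd g"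
  shows "P = alg_ideal_gen (leavitt G) (generators f)"
proof
  let ?J = "alg_ideal_gen (leavitt G) (generators f)"
  have sub: "generators f \<subseteq> P" by (rule generators_in[OF f(1)])
  show JP: "?J \<subseteq> P" by (rule leavitt.alg_ideal_gen_least[OF is_ideal sub])
  have "P \<subseteq> carrier (leavitt G)" using is_ideal unfolding leavitt.alg_ideal_iff by blast
  then have "alg_ideal (leavitt G) ?J" by (intro leavitt.alg_ideal_gen_ideal) (use sub in blast)
  then interpret J: quotient_ideal G ?J by unfold_locales
  have gJ: "generators f \<subseteq> ?J" by (rule leavitt.alg_ideal_gen_subset)
  have J_dead: "fp A \<in> pre ?J" if "A \<in> gsets G" "A \<inter> M = {}" for A
  proof -
    have "lp G A \<in> ?J" using that gJ by (auto simp: generators_def dead_def)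
    then show ?thesis using that(1) by (simp add: lgen_cos pre_iff fp_F)
  qed
  interpret J: nice_quotient G ?J c
  proof unfold_locales
    show "fp A \<in> pre ?J \<longleftrightarrow> A \<inter> M = {}" if "A \<in> gsets G" for A
      using J_dead[OF that] p_P_iff[OF that] pre_mono[OF JP] by blast
    fix w assume w: "w \<in> M" "finite (live_edges w)"
    then have wv: "w \<in> verts G" using M_verts by blast
    \<comment> \<open>At an infinite emitter this is one of the generators; at a regular vertex it
      is the defining relation up to the edges with dead range.\<close>
    show "fp {w} - (\<Sum>e\<in>live_edges w. fs e * fstar e) \<in> pre ?J"
    proof (cases "finite (out_edges G w)")
      case False
      then have "lp_breaking G dead w \<in> ?J" using w gJ by (auto simp: generators_def breaking_dead)
      then show ?thesis using pre_iff[OF ck_F[OF wv]] wv by (simp add: lp_breaking_cos ck_def)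
    next
      case True
      have "out_edges G w \<noteq> {}" using M_edge[OF w(1)] by (auto simp: out_edges_def)
      then have "fp {w} - (\<Sum>e\<in>out_edges G w. fs e * fstar e) \<in> pre ?J"
        using True wv by (intro J.rel_ck) (simp add: regular_def)
      moreover have "(\<Sum>e\<in>out_edges G w - live_edges w. fs e * fstar e) \<in> pre ?J"
      proof (intro J.P_sum)
        fix e assume "e \<in> out_edges G w - live_edges w"
        then have "e \<in> edges G" "rng G e \<inter> M = {}" by (auto simp: out_edges_def)
        then have "fs e \<in> pre ?J" using J.s_P_iff J_dead gsets.range[of e G] by blast
        then show "fs e * fstar e \<in> pre ?J" by (rule J.P_right)
      qed
      ultimately have "fp {w} - (\<Sum>e\<in>out_edges G w. fs e * fstar e) +
        (\<Sum>e\<in>out_edges G w - live_edges w. fs e * fstar e) \<in> pre ?J" by (rule J.P_add)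
      moreover have "live_edges w \<subseteq> out_edges G w" by (auto simp: out_edges_def)
      then have "(\<Sum>e\<in>out_edges G w. fs e * fstar e :: ('v, 'e) gen fword \<Rightarrow>\<^sub>0 'k) =
        (\<Sum>e\<in>out_edges G w - live_edges w. fs e * fstar e) + (\<Sum>e\<in>live_edges w. fs e * fstar e)"
        using True by (rule sum.subset_diff)
      ultimately show ?thesis by (simp add: algebra_simps)
    qed
  qed
  have fJ: "ev f \<in> pre ?J"
    using gJ J.laurent_at_cycle_in[of f] by (simp add: generators_def)
  show "P \<subseteq> ?J"
  proof (rule P_subset)
    show "quotient_ideal G ?J" by unfold_locales
    fix x assume x: "x \<in> F" "x \<in> pre P"
    show "x \<in> pre ?J"
      by (rule J.determined_by_polynomial[OF pre_mono[OF JP] _ _ _ fJ f(2) J.F_Fin[OF x(1)] x(2)])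
        (auto intro: P_diff P_left P_right)
  qed
qed

end

section \<open>Representations on infinite paths\<close>

definition cat :: "'e list \<Rightarrow> (nat \<Rightarrow> 'e) \<Rightarrow> nat \<Rightarrow> 'e" where
  "cat \<alpha> q i = (if i < length \<alpha> then \<alpha> ! i else q (i - length \<alpha>))"

lemma cat_Nil [simp]: "cat [] q = q"
  by (simp add: cat_def fun_eq_iff)

lemma cat_Cons: "cat (e # \<alpha>) q = case_nat e (cat \<alpha> q)"
  by (auto simp: cat_def fun_eq_iff split: nat.splits)

lemma cat_map_upt: "cat (map q [0..<n]) (\<lambda>i. q (n + i)) = q"
  by (auto simp: cat_def fun_eq_iff)

lemma case_nat_Suc_comp [simp]: "case_nat e q \<circ> Suc = q" "case_nat (q 0) (q \<circ> Suc) = q"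
  by (auto simp: fun_eq_iff split: nat.splits)

abbreviation x_pow :: "int \<Rightarrow> 'k::field laurent" where "x_pow i \<equiv> Poly_Mapping.single i 1"

lemma x_pow_mult: "x_pow i * x_pow j = x_pow (i + j)" and x_pow_0: "x_pow 0 = 1"
  by (simp_all add: mult_single)

context exclusive_cycle_graph
begin

text \<open>The infinite paths with the tail \<open>c\<^sup>\<infinity>\<close>, which is the function \<open>edg\<close>.\<close>

definition tails :: "(nat \<Rightarrow> 'b) set" where
  "tails = {q. (\<forall>i. q i \<in> edges G \<and> src G (q (Suc i)) \<in> rng G (q i)) \<and> (\<exists>n k. \<forall>i. q (n + i) = edg (k + i))}"

lemma tails_edge: "q \<in> tails \<Longrightarrow> q i \<in> edges G" and tails_rng: "q \<in> tails \<Longrightarrow> src G (q (Suc i)) \<in> rng G (q i)"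
  by (auto simp: tails_def)

lemma tails_tl: "q \<in> tails \<Longrightarrow> q \<circ> Suc \<in> tails"
proof -
  assume q: "q \<in> tails"
  then obtain n k where nk: "\<And>i. q (n + i) = edg (k + i)" unfolding tails_def by blast
  have "(q \<circ> Suc) (n + i) = edg (Suc k + i)" for i using nk[of "Suc i"] by simp
  then have "\<exists>n k. \<forall>i. (q \<circ> Suc) (n + i) = edg (k + i)" by blast
  then show ?thesis using q unfolding tails_def by auto
qed

lemma tails_cons_iff: "case_nat e q \<in> tails \<longleftrightarrow> q \<in> tails \<and> e \<in> edges G \<and> src G (q 0) \<in> rng G e"
proof
  assume *: "case_nat e q \<in> tails"
  then show "q \<in> tails \<and> e \<in> edges G \<and> src G (q 0) \<in> rng G e"
    using tails_tl[OF *] tails_edge[OF *, of 0] tails_rng[OF *, of 0] by simp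
next
  assume *: "q \<in> tails \<and> e \<in> edges G \<and> src G (q 0) \<in> rng G e"
  then obtain n k where nk: "\<And>i. q (n + i) = edg (k + i)" unfolding tails_def by blast
  have "\<forall>i. case_nat e q (Suc n + i) = edg (k + i)" using nk by simp
  then have "\<exists>n k. \<forall>i. case_nat e q (n + i) = edg (k + i)" by blast
  moreover have "case_nat e q i \<in> edges G \<and> src G (case_nat e q (Suc i)) \<in> rng G (case_nat e q i)" for i
    using * by (cases i) (auto simp: tails_def)
  ultimately show "case_nat e q \<in> tails" unfolding tails_def by blast
qed

lemma tails_edg: "edg \<in> tails"
  using edg_in vx_Suc_in_rng by (auto simp: tails_def src_edg intro!: exI[of _ 0])

lemma tails_in_M: "q \<in> tails \<Longrightarrow> src G (q i) \<in> M"
proof -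
  assume q: "q \<in> tails"
  then obtain n k where nk: "\<And>i. q (n + i) = edg (k + i)" unfolding tails_def by blast
  have "src G (q (n + i)) \<in> M" for i using nk vx_in_M by (simp add: src_edg)
  moreover have "src G (q i) \<in> M" if "src G (q (n + i)) \<in> M" for n i using that
  proof (induction n)
    case (Suc n)
    then have "src G (q (n + i)) \<in> M"
      using src_in_M[OF tails_edge[OF q] tails_rng[OF q], of "n + i"] by simp
    then show ?case by (rule Suc.IH)
  qed simp
  ultimately show ?thesis by blast
qed

text \<open>A path with this tail stays in \<open>M\<close>, and inside \<open>M\<close> the cycle
  cannot be left.\<close>

lemma tails_from_base: "q \<in> tails \<Longrightarrow> src G (q 0) = vx 0 \<Longrightarrow> q = edg"
proof -
  assume q: "q \<in> tails" "src G (q 0) = vx 0"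
  have "src G (q i) = vx i \<and> q i = edg i" for i
  proof (induction i)
    case 0
    then show ?case using unique_return[OF tails_edge[OF q(1)] q(2) tails_rng[OF q(1)] tails_in_M[OF q(1)]] q(2) by blast
  next
    case (Suc i)
    then have *: "src G (q (Suc i)) = vx (Suc i)"
      using unique_return[OF tails_edge[OF q(1)] _ tails_rng[OF q(1)] tails_in_M[OF q(1)]] by blast
    then show ?case using unique_return[OF tails_edge[OF q(1)] * tails_rng[OF q(1)] tails_in_M[OF q(1)]] by blast
  qed
  then show ?thesis by blast
qed

text \<open>Continuing the periodic part until it reaches the base brings it in phase with
  \<open>edg\<close>.\<close>

lemma tails_tail: "q \<in> tails \<Longrightarrow> \<exists>\<alpha>. set \<alpha> \<subseteq> edges G \<and> q = cat \<alpha> edg"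
proof -
  assume q: "q \<in> tails"
  then obtain n k where nk: "\<And>i. q (n + i) = edg (k + i)" unfolding tails_def by blast
  obtain l where l: "vx (k + l) = vx 0" using reach_vx by blast
  have "q (n + l + i) = edg i" for i
    using nk[of "l + i"] edg_eq[OF vx_add_eq[OF l, of i]] by (simp add: add.assoc)
  then have "q = cat (map q [0..<n + l]) edg" using cat_map_upt[of q "n + l"] by simp
  moreover have "set (map q [0..<n + l]) \<subseteq> edges G" using tails_edge[OF q] by auto
  ultimately show ?thesis by blast
qed

lemma tails_from: "w \<in> M \<Longrightarrow> \<exists>q\<in>tails. src G (q 0) = w"
proof -
  assume "w \<in> M"
  then obtain es where "walk G w es (vx 0)" using M_iff by blast
  then show ?thesis
  proof (induction es arbitrary: w)
    case Nil
    then show ?case using tails_edg by (intro bexI[of _ edg]) (simp_all add: src_edg)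
  next
    case (Cons e es)
    then obtain y where y: "e \<in> edges G" "src G e = w" "y \<in> rng G e" "walk G y es (vx 0)" by auto
    then obtain q where "q \<in> tails" "src G (q 0) = y" using Cons.IH by blast
    then show ?case using y by (intro bexI[of _ "case_nat e q"]) (simp_all add: tails_cons_iff)
  qed
qed

text \<open>The exponent of \<open>x\<close> attached to an edge; a full turn meets the first edge
  of \<open>c\<close> exactly once, whatever its starting point.\<close>

definition weight :: "'b \<Rightarrow> int" where "weight e = (if e = hd c then 1 else 0)"

text \<open>A generator sends \<open>\<phi>\<close> to the function with value
  \<open>coef g q * \<phi> (move g q)\<close> at \<open>q\<close>. The coefficient vanishes unless
  \<open>q\<close> and \<open>move g q\<close> are both in \<open>tails\<close>.\<close>

fun coef :: "('a, 'b) gen \<Rightarrow> (nat \<Rightarrow> 'b) \<Rightarrow> 'k::field laurent" where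
  "coef (GenP A) q = (if q \<in> tails \<and> src G (q 0) \<in> A then 1 else 0)"
| "coef (GenS e) q = (if q \<in> tails \<and> q 0 = e then x_pow (weight e) else 0)"
| "coef (GenStar e) q = (if case_nat e q \<in> tails then x_pow (- weight e) else 0)"

fun move :: "('a, 'b) gen \<Rightarrow> (nat \<Rightarrow> 'b) \<Rightarrow> nat \<Rightarrow> 'b" where
  "move (GenP A) q = q"
| "move (GenS e) q = q \<circ> Suc"
| "move (GenStar e) q = case_nat e q"

text \<open>The first letter of a word is the outermost operator, so it is the first to move the
  point \<open>q\<close>.\<close>

fun wcoef :: "('a, 'b) gen list \<Rightarrow> (nat \<Rightarrow> 'b) \<Rightarrow> 'k::field laurent" where
  "wcoef [] q = 1"
| "wcoef (g # gs) q = coef g q * wcoef gs (move g q)"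

fun wmove :: "('a, 'b) gen list \<Rightarrow> (nat \<Rightarrow> 'b) \<Rightarrow> nat \<Rightarrow> 'b" where
  "wmove [] q = q"
| "wmove (g # gs) q = wmove gs (move g q)"

lemma wmove_append: "wmove (gs @ hs) q = wmove hs (wmove gs q)"
  and wcoef_append: "wcoef (gs @ hs) q = wcoef gs q * wcoef hs (wmove gs q)"
  by (induction gs arbitrary: q) (simp_all add: mult.assoc)

definition act :: "(('a, 'b) gen fword \<Rightarrow>\<^sub>0 'k::field) \<Rightarrow> ((nat \<Rightarrow> 'b) \<Rightarrow> 'k laurent) \<Rightarrow> (nat \<Rightarrow> 'b) \<Rightarrow> 'k laurent" where
  "act a \<phi> q = (\<Sum>w\<in>Poly_Mapping.keys a. Poly_Mapping.single 0 (Poly_Mapping.lookup a w) *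
     (wcoef (letters w) q * \<phi> (wmove (letters w) q)))"

lemma act_superset: "finite W \<Longrightarrow> Poly_Mapping.keys a \<subseteq> W \<Longrightarrow>
  act a \<phi> q = (\<Sum>w\<in>W. Poly_Mapping.single 0 (Poly_Mapping.lookup a w) *
     (wcoef (letters w) q * \<phi> (wmove (letters w) q)))"
  unfolding act_def by (rule sum.mono_neutral_left) (auto simp: in_keys_iff)

lemma act_add: "act (a + b) \<phi> q = act a \<phi> q + act b \<phi> q"
proof -
  let ?W = "Poly_Mapping.keys a \<union> Poly_Mapping.keys b"
  have "act (a + b) \<phi> q = (\<Sum>w\<in>?W. Poly_Mapping.single 0 (Poly_Mapping.lookup (a + b) w) *
     (wcoef (letters w) q * \<phi> (wmove (letters w) q)))"
    by (rule act_superset) (simp_all add: keys_add)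
  also have "\<dots> = act a \<phi> q + act b \<phi> q"
    by (simp add: act_superset[of ?W a] act_superset[of ?W b] lookup_add single_add distrib_right sum.distrib)
  finally show ?thesis .
qed

lemma act_0: "act 0 \<phi> q = 0"
  by (simp add: act_def)

lemma act_uminus: "act (- a) \<phi> q = - act a \<phi> q"
  using act_add[of a "- a" \<phi> q] by (simp add: act_0 eq_neg_iff_add_eq_0 add.commute)

lemma act_diff: "act (a - b) \<phi> q = act a \<phi> q - act b \<phi> q"
  using act_add[of a "- b" \<phi> q] by (simp add: act_uminus)

lemma act_sum: "act (sum f I) \<phi> q = (\<Sum>i\<in>I. act (f i) \<phi> q)"
  by (induction I rule: infinite_finite_induct) (simp_all add: act_0 act_add)

lemma act_single: "act (Poly_Mapping.single w k) \<phi> q =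
  Poly_Mapping.single 0 k * (wcoef (letters w) q * \<phi> (wmove (letters w) q))"
  by (simp add: act_def)

lemma act_letter: "act (letter g) \<phi> q = coef g q * \<phi> (move g q)"
  by (simp add: letter_def act_single)

lemma act_one: "act 1 \<phi> q = \<phi> q"
  using act_single[of 0 1 \<phi> q] by simp

lemma act_mult: "act (a * b) \<phi> = act a (act b \<phi>)"
proof
  fix q
  have 1: "act (Poly_Mapping.single u k * b) \<phi> q = act (Poly_Mapping.single u k) (act b \<phi>) q" for u k
  proof -
    have "Poly_Mapping.single u k * b =
      (\<Sum>w\<in>Poly_Mapping.keys b. Poly_Mapping.single (u + w) (k * Poly_Mapping.lookup b w))"
      by (subst poly_mapping_sum_single[of b]) (simp add: sum_distrib_left mult_single)
    then have "act (Poly_Mapping.single u k * b) \<phi> q =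
      (\<Sum>w\<in>Poly_Mapping.keys b. Poly_Mapping.single 0 k * Poly_Mapping.single 0 (Poly_Mapping.lookup b w) *
        ((wcoef (letters u) q * wcoef (letters w) (wmove (letters u) q)) *
          \<phi> (wmove (letters w) (wmove (letters u) q))))"
      by (simp add: act_sum act_single wcoef_append wmove_append mult_single)
    also have "\<dots> = act (Poly_Mapping.single u k) (act b \<phi>) q"
      unfolding act_single by (simp add: act_def[of b] sum_distrib_left mult_ac)
    finally show ?thesis .
  qed
  have "act (a * b) \<phi> q = act ((\<Sum>u\<in>Poly_Mapping.keys a. Poly_Mapping.single u (Poly_Mapping.lookup a u)) * b) \<phi> q"
    by (subst poly_mapping_sum_single[of a]) (rule refl)
  also have "\<dots> = (\<Sum>u\<in>Poly_Mapping.keys a. act (Poly_Mapping.single u (Poly_Mapping.lookup a u)) (act b \<phi>) q)"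
    by (simp add: sum_distrib_right act_sum 1)
  also have "\<dots> = act a (act b \<phi>) q"
    by (simp add: act_sum[symmetric] poly_mapping_sum_single[symmetric])
  finally show "act (a * b) \<phi> q = act a (act b \<phi>) q" .
qed

lemma act_fK: "act (fK k) \<phi> q = Poly_Mapping.single 0 k * \<phi> q"
  by (simp add: fK_def act_single)

lemma act_linear: "act a (\<lambda>q. r * \<phi> q) q = r * act a \<phi> q"
  by (simp add: act_def sum_distrib_left mult_ac)

text \<open>Each word moves a path to one path, so that the action is given by row-finite matrices.\<close>

lemma act_matrix: "act a \<phi> q = (\<Sum>q'\<in>(\<lambda>w. wmove (letters w) q) ` Poly_Mapping.keys a.
    \<phi> q' * act a (\<lambda>r. if r = q' then 1 else 0) q)" (is "_ = (\<Sum>q'\<in>?D. _)")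
proof -
  have "(\<Sum>q'\<in>?D. \<phi> q' * act a (\<lambda>r. if r = q' then 1 else 0) q) =
    (\<Sum>q'\<in>?D. \<Sum>w\<in>Poly_Mapping.keys a. if wmove (letters w) q = q' then
      Poly_Mapping.single 0 (Poly_Mapping.lookup a w) * (wcoef (letters w) q * \<phi> q') else 0)"
    by (auto simp: act_def sum_distrib_left mult_ac intro!: sum.cong)
  also have "\<dots> = (\<Sum>w\<in>Poly_Mapping.keys a. \<Sum>q'\<in>?D. if wmove (letters w) q = q' then
      Poly_Mapping.single 0 (Poly_Mapping.lookup a w) * (wcoef (letters w) q * \<phi> q') else 0)"
    by (rule sum.swap)
  also have "\<dots> = act a \<phi> q"
    unfolding act_def by (intro sum.cong refl) (subst sum.delta', auto)
  finally show ?thesis by simp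
qed

lemma act_fp: "act (fp A) \<phi> q = (if q \<in> tails \<and> src G (q 0) \<in> A then \<phi> q else 0)"
  and act_fs: "act (fs e) \<phi> q = (if q \<in> tails \<and> q 0 = e then x_pow (weight e) * \<phi> (q \<circ> Suc) else 0)"
  and act_fstar: "act (fstar e) \<phi> q = (if case_nat e q \<in> tails then x_pow (- weight e) * \<phi> (case_nat e q) else 0)"
  by (simp_all add: act_letter)

lemma act_fs_fstar: "act (fs e * fstar e) \<phi> q = (if q \<in> tails \<and> q 0 = e then \<phi> q else 0)"
  by (auto simp: act_mult act_fs act_fstar mult.assoc[symmetric] x_pow_mult x_pow_0)

text \<open>The summands project onto the possible first edges of a path from \<open>w\<close>. The
  set \<open>E\<close> is left open to serve both the defining relation and the relation over live
  edges.\<close>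

lemma act_ck:
  assumes "finite E" "\<And>e. e \<in> E \<Longrightarrow> src G e = w" "\<And>q. q \<in> tails \<Longrightarrow> src G (q 0) = w \<Longrightarrow> q 0 \<in> E"
  shows "act (fp {w} - (\<Sum>e\<in>E. fs e * fstar e)) \<phi> q = 0"
proof -
  have "act (\<Sum>e\<in>E. fs e * fstar e) \<phi> q = (\<Sum>e\<in>E. if q 0 = e then (if q \<in> tails then \<phi> q else 0) else 0)"
    unfolding act_sum act_fs_fstar by (intro sum.cong) auto
  also have "\<dots> = (if q 0 \<in> E then (if q \<in> tails then \<phi> q else 0) else 0)"
    by (rule sum.delta'[OF assms(1)])
  also have "\<dots> = act (fp {w}) \<phi> q"
    using assms(2,3) by (auto simp: act_fp)
  finally show ?thesis by (simp add: act_diff)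
qed

lemma act_relators: "r \<in> relators G \<Longrightarrow> act r \<phi> q = 0"
proof (induction r rule: relators.induct)
  case p_empty
  then show ?case by (simp add: act_fp)
next
  case (p_inter A B)
  then show ?case by (simp add: act_diff act_mult act_fp)
next
  case (p_union A B)
  then show ?case by (auto simp: act_diff act_add act_fp)
next
  case (src_s e)
  then show ?case by (auto simp: act_diff act_mult act_fp act_fs)
next
  case (s_rng e)
  then show ?case using tails_rng[of q 0] tails_tl[of q] by (auto simp: act_diff act_mult act_fp act_fs)
next
  case (rng_star e)
  then show ?case by (auto simp: act_diff act_mult act_fp act_fstar tails_cons_iff)
next
  case (star_src e)
  then show ?case by (auto simp: act_diff act_mult act_fp act_fstar)
next
  case (star_s e f)
  then show ?case
    by (auto simp: act_diff act_mult act_fp act_fs act_fstar tails_cons_iff act_0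
        mult.assoc[symmetric] x_pow_mult x_pow_0)
next
  case (cuntz_krieger w)
  then show ?case
    by (intro act_ck) (auto simp: regular_def out_edges_def tails_edge)
qed

lemma act_rel_ideal:
  fixes x :: "('a, 'b) gen fword \<Rightarrow>\<^sub>0 'k::field"
  assumes "x \<in> rel_ideal G"
  shows "act x \<phi> q = 0"
proof -
  let ?I = "{a \<in> F. \<forall>\<phi> q. act a \<phi> q = 0} :: (('a, 'b) gen fword \<Rightarrow>\<^sub>0 'k) set"
  have 0: "act a \<psi> q = 0" if "\<And>q. \<psi> q = 0" for a :: "('a, 'b) gen fword \<Rightarrow>\<^sub>0 'k" and \<psi> q
    by (simp add: act_def that)
  have "alg_ideal (free_algebra (gens G)) ?I"
    unfolding free.alg_ideal_iff
    by (auto simp: act_0 act_add act_mult act_fK 0 fcar_0 fcar_add fcar_K fcar_mult)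
  then have "rel_ideal G \<subseteq> ?I"
    unfolding rel_ideal_def
    by (rule free.alg_ideal_gen_least) (use relators_F act_relators in blast)
  then show ?thesis using assms by blast
qed

lemma act_cos: "cos x = cos y \<Longrightarrow> act x \<phi> q = act y \<phi> q"
  using act_rel_ideal[of "x - y" \<phi> q] by (simp add: cos_eq_iff act_diff)

text \<open>Words of an element of the algebra are nonempty, and already one letter forces both ends
  of a nonzero entry into \<open>tails\<close>; the unit \<open>1\<close> would not.\<close>

lemma act_tails:
  fixes a :: "('a, 'b) gen fword \<Rightarrow>\<^sub>0 'k::field"
  assumes a: "a \<in> F" and nz: "act a (\<lambda>r. if r = q' then 1 else 0) q \<noteq> 0"
  shows "q \<in> tails \<and> q' \<in> tails"
proof (rule ccontr)
  assume neg: "\<not> ?thesis"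
  have *: "q \<in> tails \<and> move g q \<in> tails" if "coef g q \<noteq> (0 :: 'k laurent)" for g q
    using that tails_tl by (cases g) (auto simp: tails_cons_iff split: if_splits)
  have w: "q \<in> tails \<and> wmove gs q \<in> tails" if "gs \<noteq> []" "wcoef gs q \<noteq> (0 :: 'k laurent)" for gs q
    using that
  proof (induction gs arbitrary: q)
    case (Cons g gs)
    then show ?case using *[of g q] by (cases "gs = []") auto
  qed simp
  have "wcoef (letters u) q * (if wmove (letters u) q = q' then 1 else 0) = (0 :: 'k laurent)"
    if "u \<in> Poly_Mapping.keys a" for u
  proof -
    have "letters u \<noteq> []" using a that by (simp add: fcar_def)
    then show ?thesis using w[of "letters u" q] neg by auto
  qed
  then have "act a (\<lambda>r. if r = q' then 1 else 0) q = 0"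
    unfolding act_def by (intro sum.neutral ballI) simp
  then show False using nz by blast
qed

definition word_weight :: "'b list \<Rightarrow> int" where "word_weight \<alpha> = sum_list (map weight \<alpha>)"

lemma word_weight_simps [simp]: "word_weight [] = 0" "word_weight (e # \<alpha>) = weight e + word_weight \<alpha>"
  by (simp_all add: word_weight_def)

lemma word_weight_period: "word_weight (seg t m) = 1"
proof -
  have "distinct c" using is_cycle by (simp add: cycle_def distinct_map)
  then have "word_weight (seg t m) = sum weight (set c)"
    unfolding word_weight_def seg_m by (simp add: sum_list_distinct_conv_sum_set)
  also have "\<dots> = 1" using c_nonempty by (simp add: weight_def)
  finally show ?thesis .
qed

lemma word_weight_append: "word_weight (\<alpha> @ \<beta>) = word_weight \<alpha> + word_weight \<beta>"
  by (simp add: word_weight_def)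

lemma word_weight_mult: "word_weight (seg t (k * m)) = int k"
  by (induction k arbitrary: t) (simp_all add: seg_append word_weight_append word_weight_period)

text \<open>Segments from the base ending at the same vertex differ by full turns, each of weight
  \<open>1\<close> and length \<open>m\<close>.\<close>

lemma word_weight_diff:
  assumes "vx a = vx b"
  shows "int a - int b = (word_weight (seg 0 a) - word_weight (seg 0 b)) * int m"
proof -
  have *: "int a - int b = (word_weight (seg 0 a) - word_weight (seg 0 b)) * int m"
    if "vx a = vx b" "b \<le> a" for a b
  proof -
    have "m dvd a - b" using that by (metis vx_eq_iff mod_eq_dvd_iff_nat)
    then obtain k where "a - b = m * k" by (rule dvdE)
    then have a: "a = b + k * m" using that(2) by (simp add: algebra_simps)
    then have "word_weight (seg 0 a) = word_weight (seg 0 b) + int k"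
      by (simp add: seg_append word_weight_append word_weight_mult)
    then show ?thesis using a by simp
  qed
  show ?thesis
  proof (cases "b \<le> a")
    case False
    then show ?thesis using *[of b a] assms by (simp add: algebra_simps)
  qed (use * assms in blast)
qed

lemma cat_edg: "cat \<alpha> q = edg \<Longrightarrow> \<alpha> = seg 0 (length \<alpha>) \<and> (\<forall>i. q i = edg (length \<alpha> + i))"
proof -
  assume *: "cat \<alpha> q = edg"
  have "\<alpha> ! i = edg i" if "i < length \<alpha>" for i using fun_cong[OF *, of i] that by (simp add: cat_def)
  then have "\<alpha> = seg 0 (length \<alpha>)" by (intro nth_equalityI) (simp_all add: seg_nth)
  moreover have "q i = edg (length \<alpha> + i)" for i
    using fun_cong[OF *, of "length \<alpha> + i"] by (simp add: cat_def)
  ultimately show ?thesis by blast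
qed

lemma cat_c: "cat c edg = edg"
proof
  fix i
  show "cat c edg i = edg i"
    by (cases "i < m") (simp_all add: cat_def edg_def mod_if[of i])
qed

end

section \<open>The ideal of elements with all matrix entries in Q\<close>

locale cycle_representation = exclusive_cycle_graph G c
  for G :: "('v, 'e) ultragraph" and c +
  fixes Q :: "'k::field laurent set"
  assumes Q_zero: "0 \<in> Q" and Q_add: "g \<in> Q \<Longrightarrow> h \<in> Q \<Longrightarrow> g + h \<in> Q"
    and Q_mult: "g \<in> Q \<Longrightarrow> h * g \<in> Q" and Q_one: "1 \<notin> Q"
    and Q_prime: "g * h \<in> Q \<Longrightarrow> g \<in> Q \<or> h \<in> Q"
begin

lemma Q_sum: "(\<And>i. i \<in> I \<Longrightarrow> f i \<in> Q) \<Longrightarrow> sum f I \<in> Q"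
  by (induction I rule: infinite_finite_induct) (auto intro: Q_zero Q_add)

lemma Q_x_pow: "x_pow i * g \<in> Q \<Longrightarrow> g \<in> Q"
  using Q_mult[of "x_pow i * g" "x_pow (- i)"] by (simp add: mult.assoc[symmetric] x_pow_mult x_pow_0)

definition Ann :: "(('v, 'e) gen fword \<Rightarrow>\<^sub>0 'k) set" where
  "Ann = {a \<in> F. \<forall>\<phi> q. act a \<phi> q \<in> Q}"

definition R :: "('v, 'e, 'k) lpa set" where "R = cos ` Ann"

lemma act_Q: "(\<And>q. \<phi> q \<in> Q) \<Longrightarrow> act a \<phi> q \<in> Q"
  unfolding act_def by (intro Q_sum Q_mult) blast

lemma cos_R: "a \<in> F \<Longrightarrow> cos a \<in> R \<longleftrightarrow> (\<forall>\<phi> q. act a \<phi> q \<in> Q)"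
proof
  assume "cos a \<in> R"
  then obtain b where b: "b \<in> Ann" "cos a = cos b" by (auto simp: R_def)
  then show "\<forall>\<phi> q. act a \<phi> q \<in> Q" using act_cos[OF b(2)] by (simp add: Ann_def)
next
  assume "a \<in> F" "\<forall>\<phi> q. act a \<phi> q \<in> Q"
  then show "cos a \<in> R" by (simp add: R_def Ann_def)
qed

sublocale quotient_ideal G R
proof
  show "alg_ideal (leavitt G) R" unfolding R_def
    by (rule quotient_ideal.image_ideal[OF zero_ideal])
      (auto simp: Ann_def act_0 act_add act_mult act_fK fcar_0 fcar_add fcar_K fcar_mult
        intro: Q_zero Q_add Q_mult act_Q)
qed

lemma pre_R: "a \<in> F \<Longrightarrow> a \<in> pre R \<longleftrightarrow> (\<forall>\<phi> q. act a \<phi> q \<in> Q)"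
  using pre_iff cos_R by blast

sublocale nice_quotient G R c
proof
  fix A assume A: "A \<in> gsets G"
  show "fp A \<in> pre R \<longleftrightarrow> A \<inter> M = {}"
  proof
    assume "A \<inter> M = {}"
    then have "act (fp A) \<phi> q = 0" for \<phi> :: "_ \<Rightarrow> 'k laurent" and q using tails_in_M[of q 0] by (auto simp: act_fp)
    then show "fp A \<in> pre R" using pre_R[OF fp_F[OF A]] Q_zero by simp
  next
    assume p: "fp A \<in> pre R"
    show "A \<inter> M = {}"
    proof (rule ccontr)
      assume "A \<inter> M \<noteq> {}"
      then obtain q where q: "q \<in> tails" "src G (q 0) \<in> A" using tails_from by blast
      have "act (fp A) (\<lambda>_. 1) q \<in> Q" using p pre_R[OF fp_F[OF A]] by blast
      then show False using q Q_one by (simp add: act_fp)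
    qed
  qed
next
  fix w let ?E = "{e \<in> edges G. src G e = w \<and> rng G e \<inter> M \<noteq> {}}"
  assume w: "w \<in> M" "finite ?E"
  let ?a = "fp {w} - (\<Sum>e\<in>?E. fs e * fstar e) :: ('v, 'e) gen fword \<Rightarrow>\<^sub>0 'k"
  have "?a \<in> F" using M_verts w
    by (intro fcar_diff fp_F gsets.vertex fcar_sum fcar_mult fs_F fstar_F) auto
  moreover have "act ?a \<phi> q = 0" for \<phi> :: "_ \<Rightarrow> 'k laurent" and q
  proof (rule act_ck[OF w(2)])
    fix r assume r: "r \<in> tails" "src G (r 0) = w"
    have "src G (r (Suc 0)) \<in> rng G (r 0) \<inter> M" using tails_rng tails_in_M r by blast
    then show "r 0 \<in> ?E" using tails_edge[OF r(1)] r(2) by blast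
  qed simp
  ultimately show "?a \<in> pre R" using pre_R Q_zero by simp
qed

lemma act_sp: "cat \<alpha> q \<in> tails \<Longrightarrow> act (sp \<alpha>) \<phi> (cat \<alpha> q) = x_pow (word_weight \<alpha>) * (\<phi> q :: 'k laurent)"
proof (induction \<alpha>)
  case (Cons e \<alpha>)
  then have "cat \<alpha> q \<in> tails" by (simp add: cat_Cons tails_cons_iff)
  then show ?case using Cons
    by (simp add: act_mult act_fs) (simp add: cat_Cons mult.assoc[symmetric] x_pow_mult)
qed (simp add: act_one x_pow_0)

lemma act_sp_nonzero: "act (sp \<alpha>) \<phi> q \<noteq> (0 :: 'k laurent) \<Longrightarrow>
  \<exists>q'. q = cat \<alpha> q' \<and> act (sp \<alpha>) \<phi> q = x_pow (word_weight \<alpha>) * \<phi> q'"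
proof (induction \<alpha> arbitrary: q)
  case Nil
  then show ?case by (simp add: act_one x_pow_0)
next
  case (Cons e \<alpha>)
  then have q: "q 0 = e" and eq: "act (sp (e # \<alpha>)) \<phi> q = x_pow (weight e) * act (sp \<alpha>) \<phi> (q \<circ> Suc)"
    by (auto simp: act_mult act_fs split: if_splits)
  then have "act (sp \<alpha>) \<phi> (q \<circ> Suc) \<noteq> 0" using Cons.prems by auto
  then obtain q' where q': "q \<circ> Suc = cat \<alpha> q'" "act (sp \<alpha>) \<phi> (q \<circ> Suc) = x_pow (word_weight \<alpha>) * \<phi> q'"
    using Cons.IH by blast
  have "q = case_nat e (q \<circ> Suc)" using q by auto
  then have "q = cat (e # \<alpha>) q'" using q'(1) by (simp add: cat_Cons)
  moreover have "act (sp (e # \<alpha>)) \<phi> q = x_pow (word_weight (e # \<alpha>)) * \<phi> q'"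
    unfolding eq q'(2) by (simp add: mult.assoc[symmetric] x_pow_mult)
  ultimately show ?case by blast
qed

lemma act_st: "cat \<alpha> q \<in> tails \<Longrightarrow> act (st \<alpha>) \<phi> q = x_pow (- word_weight \<alpha>) * (\<phi> (cat \<alpha> q) :: 'k laurent)"
proof (induction \<alpha> arbitrary: \<phi>)
  case (Cons e \<alpha>)
  then have "cat \<alpha> q \<in> tails" by (simp add: cat_Cons tails_cons_iff)
  then have "act (st (e # \<alpha>)) \<phi> q = x_pow (- word_weight \<alpha>) * act (fstar e) \<phi> (cat \<alpha> q)"
    using Cons.IH by (simp add: act_mult)
  also have "\<dots> = x_pow (- word_weight \<alpha>) * (x_pow (- weight e) * \<phi> (cat (e # \<alpha>) q))"
    using Cons.prems by (simp add: act_fstar cat_Cons)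
  finally show ?case by (simp add: mult.assoc[symmetric] x_pow_mult add.commute)
qed (simp add: act_one x_pow_0)

lemma act_st_nonzero: "act (st \<alpha>) \<phi> q \<noteq> (0 :: 'k laurent) \<Longrightarrow> q \<in> tails \<Longrightarrow> cat \<alpha> q \<in> tails"
proof (induction \<alpha> arbitrary: \<phi>)
  case (Cons e \<alpha>)
  then have nz: "act (st \<alpha>) (act (fstar e) \<phi>) q \<noteq> 0" by (simp add: act_mult[symmetric])
  then have "cat \<alpha> q \<in> tails" using Cons by blast
  then have "act (fstar e) \<phi> (cat \<alpha> q) \<noteq> 0" using nz act_st[of \<alpha> q "act (fstar e) \<phi>"] by auto
  then show ?case by (auto simp: act_fstar cat_Cons split: if_splits)
qed simp

text \<open>A matrix unit times a power of \<open>x\<close>: by \<open>tails_from_base\<close> the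
  projection \<open>p {vx 0}\<close> leaves only the coordinate \<open>edg\<close>, and the words
  move it to \<open>cat \<alpha> edg\<close> and \<open>cat \<beta> edg\<close>.\<close>

lemma act_mono:
  assumes "cat \<alpha> edg \<in> tails" "cat \<beta> edg \<in> tails"
  shows "act (mono \<alpha> {vx 0} \<beta>) \<phi> q =
    (if q = cat \<alpha> edg then x_pow (word_weight \<alpha> - word_weight \<beta>) * \<phi> (cat \<beta> edg) else (0 :: 'k laurent))"
proof -
  let ?\<psi> = "act (fp {vx 0}) (act (st \<beta>) \<phi>)"
  have \<psi>: "?\<psi> r = (if r = edg then x_pow (- word_weight \<beta>) * \<phi> (cat \<beta> edg) else 0)" for r
  proof (cases "r = edg")
    case True
    then show ?thesis using tails_edg by (simp add: act_fp src_edg act_st[OF assms(2)])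
  next
    case False
    then have *: "\<not> (r \<in> tails \<and> src G (r 0) \<in> {vx 0})" using tails_from_base by blast
    show ?thesis unfolding act_fp if_not_P[OF *] using False by simp
  qed
  have eq: "act (mono \<alpha> {vx 0} \<beta>) \<phi> q = act (sp \<alpha>) ?\<psi> q" by (simp add: mono_def act_mult mult.assoc)
  show ?thesis
  proof (cases "q = cat \<alpha> edg")
    case True
    have "act (sp \<alpha>) ?\<psi> (cat \<alpha> edg) = x_pow (word_weight \<alpha>) * (x_pow (- word_weight \<beta>) * \<phi> (cat \<beta> edg))"
      unfolding act_sp[OF assms(1)] \<psi> by simp
    then show ?thesis unfolding eq using True by (simp add: mult.assoc[symmetric] x_pow_mult)
  next
    case False
    have "act (sp \<alpha>) ?\<psi> q = 0"
    proof (rule ccontr)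
      assume nz: "\<not> ?thesis"
      then obtain q' where q': "q = cat \<alpha> q'" "act (sp \<alpha>) ?\<psi> q = x_pow (word_weight \<alpha>) * ?\<psi> q'"
        using act_sp_nonzero[OF nz] by blast
      have "q' \<noteq> edg" using False q'(1) by blast
      then have "?\<psi> q' = 0" unfolding \<psi> by simp
      then have "act (sp \<alpha>) ?\<psi> q = 0" by (simp only: q'(2) mult_zero_right)
      then show False using nz by blast
    qed
    then show ?thesis using False eq by simp
  qed
qed

text \<open>An ideal not contained in \<open>R\<close> has an element with a matrix entry outside
  \<open>Q\<close>. A matrix unit placed between two such elements yields the product of the two
  entries up to a power of \<open>x\<close>, and \<open>Q\<close> is prime.\<close>

lemma R_prime: "alg_prime_ideal (leavitt G) R"
  unfolding alg_prime_ideal_def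
proof (intro conjI allI impI is_ideal)
  have "cos (fp {vx 0}) \<notin> R" using p_P_iff[OF vx_gset] vx_in_M pre_iff[OF fp_F[OF vx_gset]] by auto
  moreover have "cos (fp {vx 0}) \<in> carrier (leavitt G)"
    unfolding leavitt_carrier by (intro imageI fp_F vx_gset)
  ultimately show "R \<noteq> carrier (leavitt G)" by blast
next
  fix I J :: "('v, 'e, 'k) lpa set"
  assume "alg_ideal (leavitt G) I \<and> alg_ideal (leavitt G) J \<and> (\<forall>a\<in>I. \<forall>b\<in>J. a \<otimes>\<^bsub>leavitt G\<^esub> b \<in> R)"
  then have IJ: "alg_ideal (leavitt G) I" "alg_ideal (leavitt G) J"
    "\<And>a b. a \<in> I \<Longrightarrow> b \<in> J \<Longrightarrow> a \<otimes>\<^bsub>leavitt G\<^esub> b \<in> R" by auto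
  have entry: "\<exists>a\<in>F. cos a \<in> I \<and> (\<exists>q q'. act a (\<lambda>r. if r = q' then 1 else 0) q \<notin> Q)"
    if I: "alg_ideal (leavitt G) I" "\<not> I \<subseteq> R" for I
  proof -
    obtain Z where Z: "Z \<in> I" "Z \<notin> R" using I(2) by blast
    then obtain a where a: "a \<in> F" "Z = cos a"
      using I(1) unfolding leavitt.alg_ideal_iff leavitt_carrier by blast
    then obtain \<phi> q where "act a \<phi> q \<notin> Q" using Z(2) cos_R by blast
    then have "\<exists>q'. act a (\<lambda>r. if r = q' then 1 else 0) q \<notin> Q"
      unfolding act_matrix[of a \<phi> q] using Q_sum Q_mult by meson
    then show ?thesis using Z a by blast
  qed
  show "I \<subseteq> R \<or> J \<subseteq> R"
  proof (rule ccontr)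
    assume "\<not> ?thesis"
    then obtain a b q1 q2 q3 q4 where a: "a \<in> F" "cos a \<in> I" "act a (\<lambda>r. if r = q2 then 1 else 0) q1 \<notin> Q"
      and b: "b \<in> F" "cos b \<in> J" "act b (\<lambda>r. if r = q4 then 1 else 0) q3 \<notin> Q"
      using entry IJ(1,2) by meson
    then have "q2 \<in> tails" "q3 \<in> tails"
      using act_tails[OF a(1)] act_tails[OF b(1)] Q_zero by metis+
    then obtain \<alpha> \<beta> where \<alpha>: "set \<alpha> \<subseteq> edges G" "q2 = cat \<alpha> edg" and \<beta>: "set \<beta> \<subseteq> edges G" "q3 = cat \<beta> edg"
      using tails_tail by meson
    define z where "z = mono \<alpha> {vx 0} \<beta>"
    have z: "z \<in> F" unfolding z_def by (rule mono_F[OF vx_gset \<alpha>(1) \<beta>(1)])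
    define u where "u = word_weight \<alpha> - word_weight \<beta>"
    let ?\<psi> = "act b (\<lambda>r. if r = q4 then 1 else 0)"
    have "act (z * b) (\<lambda>r. if r = q4 then 1 else 0) = (\<lambda>q. (x_pow u * ?\<psi> q3) * (if q = q2 then 1 else 0))"
      using act_mono[of \<alpha> \<beta> ?\<psi>] \<open>q2 \<in> tails\<close> \<open>q3 \<in> tails\<close> unfolding \<alpha>(2) \<beta>(2) z_def u_def
      by (simp add: fun_eq_iff act_mult)
    then have eq: "act (a * (z * b)) (\<lambda>r. if r = q4 then 1 else 0) q1 =
      x_pow u * (?\<psi> q3 * act a (\<lambda>q. if q = q2 then 1 else 0) q1)"
      unfolding act_mult[of a] by (simp only: act_linear mult.assoc)
    have "cos z \<otimes>\<^bsub>leavitt G\<^esub> cos b \<in> J"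
      using IJ(2) b(2) z unfolding leavitt.alg_ideal_iff leavitt_carrier by blast
    then have "cos a \<otimes>\<^bsub>leavitt G\<^esub> (cos z \<otimes>\<^bsub>leavitt G\<^esub> cos b) \<in> R" by (rule IJ(3)[OF a(2)])
    then have "cos (a * (z * b)) \<in> R" using a(1) b(1) z by (simp add: leavitt_mult fcar_mult)
    then have "act (a * (z * b)) (\<lambda>r. if r = q4 then 1 else 0) q1 \<in> Q"
      using cos_R[of "a * (z * b)"] a(1) b(1) z by (simp add: fcar_mult)
    then have "?\<psi> q3 * act a (\<lambda>q. if q = q2 then 1 else 0) q1 \<in> Q" unfolding eq by (rule Q_x_pow)
    then show False using Q_prime a(3) b(3) by blast
  qed
qed

end

section \<open>Laurent polynomials in the cycle, and the grading\<close>

context cycle_representation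
begin

lemma tails_hd: "q \<in> tails \<Longrightarrow> q 0 = hd c \<Longrightarrow> q = edg"
  using tails_from_base[of q] base_eq by (simp add: base_def)

lemma act_sp_c: "act (sp c) \<phi> q = (if q = edg then x_pow 1 * \<phi> edg else (0 :: 'k laurent))"
proof (cases "q = edg")
  case True
  have "word_weight c = 1" using word_weight_period[of 0] by (simp add: seg_c)
  then show ?thesis using True act_sp[of c edg \<phi>] tails_edg by (simp add: cat_c)
next
  case False
  have n: "\<not> (q \<in> tails \<and> q 0 = hd c)" using tails_hd[of q] False by blast
  have "sp c = fs (hd c) * sp (tl c)" using sp_simps(2)[of "hd c" "tl c"] c_nonempty by simp
  then have "act (sp c) \<phi> q = act (fs (hd c)) (act (sp (tl c)) \<phi>) q" by (simp only: act_mult)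
  then show ?thesis using False by (simp only: act_fs if_not_P[OF n] if_False)
qed

text \<open>A path in front of which \<open>c\<close> can be put is \<open>edg\<close>, because the
  prolonged path starts at the base.\<close>

lemma act_st_c: "act (st c) \<phi> q = (if q = edg then x_pow (- 1) * \<phi> edg else (0 :: 'k laurent))"
proof (cases "q = edg")
  case True
  have "word_weight c = 1" using word_weight_period[of 0] by (simp add: seg_c)
  then show ?thesis using True act_st[of c edg \<phi>] tails_edg by (simp add: cat_c)
next
  case False
  have "act (st c) \<phi> q = 0"
  proof (rule ccontr)
    assume nz: "\<not> ?thesis"
    have "st c = fstar (last c) * st (butlast c)"
      using c_nonempty st_append[of "butlast c" "[last c]"] by simp
    then have "q \<in> tails" using nz by (auto simp: act_mult act_fstar tails_cons_iff split: if_splits)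
    then have ct: "cat c q \<in> tails" using act_st_nonzero nz by blast
    have "cat c q 0 = hd c" using c_nonempty by (simp add: cat_def hd_conv_nth)
    then have "cat c q = edg" by (rule tails_hd[OF ct])
    then have "q i = edg (m + i)" for i using cat_edg by blast
    then show False using False by (auto simp: fun_eq_iff)
  qed
  then show ?thesis using False by simp
qed

lemma act_power:
  assumes "\<And>\<phi> q. act a \<phi> q = (if q = edg then x_pow i * \<phi> edg else (0 :: 'k laurent))" "n > 0"
  shows "act (a ^ n) \<phi> q = (if q = edg then x_pow (int n * i) * \<phi> edg else (0 :: 'k laurent))"
  using assms(2)
proof (induction n arbitrary: q)
  case (Suc n)
  show ?case
  proof (cases "n = 0")
    case False
    then have "act (a ^ Suc n) \<phi> q = (if q = edg then x_pow i * (x_pow (int n * i) * \<phi> edg) else 0)"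
      using Suc.IH by (simp add: act_mult assms(1))
    then show ?thesis by (simp add: mult.assoc[symmetric] x_pow_mult algebra_simps)
  qed (simp add: assms(1))
qed simp

lemma act_cpow: "act (cpow i) \<phi> q = (if q = edg then x_pow i * \<phi> edg else (0 :: 'k laurent))"
proof -
  consider "i = 0" | "i > 0" | "i < 0" by linarith
  then show ?thesis
  proof cases
    case 1
    then show ?thesis
      using tails_from_base[of q] tails_edg by (cases "q = edg") (auto simp: cpow_def act_fp src_edg x_pow_0)
  next
    case 2
    then show ?thesis using act_power[OF act_sp_c, of "nat i" \<phi> q] by (simp add: cpow_def)
  next
    case 3
    then show ?thesis using act_power[OF act_st_c, of "nat (- i)" \<phi> q] by (simp add: cpow_def)
  qed
qed

lemma act_cycle_element: "act (cycle_element g) \<phi> q = (if q = edg then g * \<phi> edg else 0)"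
proof (cases "q = edg")
  case True
  have "act (cycle_element g) \<phi> q =
    (\<Sum>i\<in>Poly_Mapping.keys g. Poly_Mapping.single i (Poly_Mapping.lookup g i)) * \<phi> edg"
    unfolding cycle_element_def
    by (simp add: act_sum act_mult act_fK act_cpow True sum_distrib_right mult.assoc[symmetric] mult_single)
  then show ?thesis using True by (simp add: poly_mapping_sum_single[symmetric])
qed (simp add: cycle_element_def act_sum act_mult act_fK act_cpow)

lemma ev_R_iff: "ev g \<in> pre R \<longleftrightarrow> g \<in> Q"
proof -
  have "ev g \<in> pre R \<longleftrightarrow> (\<forall>\<phi> q. act (cycle_element g) \<phi> q \<in> Q)"
    using laurent_at_cycle_in cos_R[OF cycle_element_F] by (simp add: laurent_at_cycle_cos)
  also have "\<dots> \<longleftrightarrow> g \<in> Q"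
  proof
    assume "\<forall>\<phi> q. act (cycle_element g) \<phi> q \<in> Q"
    then have "act (cycle_element g) (\<lambda>_. 1) edg \<in> Q" by blast
    then show "g \<in> Q" by (simp add: act_cycle_element)
  next
    assume "g \<in> Q"
    then have "g * \<phi> edg \<in> Q" for \<phi> :: "_ \<Rightarrow> 'k laurent"
      using Q_mult[of g "\<phi> edg"] by (simp add: mult.commute)
    then show "\<forall>\<phi> q. act (cycle_element g) \<phi> q \<in> Q"
      using Q_zero by (simp add: act_cycle_element)
  qed
  finally show ?thesis .
qed

abbreviation \<delta> :: "(nat \<Rightarrow> 'e) \<Rightarrow> 'k laurent" where "\<delta> \<equiv> \<lambda>r. if r = edg then 1 else 0"

text \<open>A nonzero value at \<open>edg\<close> forces the edges to be a segment of the cycle, so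
  the entry depends on the length alone and is controlled by the degree.\<close>

lemma s_path_entry:
  assumes "is_path G \<alpha>"
  shows "\<exists>a\<in>F. s_path G \<alpha> = cos a \<and> (\<forall>\<psi> :: _ \<Rightarrow> 'k laurent. act a \<psi> edg = 0 \<or>
    act a \<psi> edg = x_pow (word_weight (seg 0 (plength \<alpha>))) * \<psi> (\<lambda>i. edg (plength \<alpha> + i)))"
proof (cases \<alpha>)
  case (PSet B)
  then have "B \<in> gsets G" using assms by simp
  then show ?thesis using PSet
    by (intro bexI[of _ "fp B"]) (auto simp: lgen_cos act_fp x_pow_0 fp_F)
next
  case (PEdges es)
  then have es: "edge_path G es" using assms by simp
  have "act (sp es) \<psi> edg = 0 \<or> act (sp es) \<psi> edg = x_pow (word_weight (seg 0 (length es))) * \<psi> (\<lambda>i. edg (length es + i))"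
    for \<psi> :: "_ \<Rightarrow> 'k laurent"
  proof (cases "act (sp es) \<psi> edg = 0")
    case False
    then obtain q' where q': "edg = cat es q'" "act (sp es) \<psi> edg = x_pow (word_weight es) * \<psi> q'"
      using act_sp_nonzero by blast
    have "es = seg 0 (length es)" "\<And>i. q' i = edg (length es + i)" using cat_edg[OF q'(1)[symmetric]] by auto
    then show ?thesis using q'(2) by (metis ext)
  qed simp
  then show ?thesis using s_path_cos[OF es] PEdges by (intro bexI[of _ "sp es"]) auto
qed

lemma s_path_star_entry:
  assumes "is_path G \<beta>"
  shows "\<exists>b\<in>F. s_path_star G \<beta> = cos b \<and> (\<forall>q\<in>tails. act b \<delta> q = 0 \<or>
    q = (\<lambda>i. edg (plength \<beta> + i)) \<and> act b \<delta> q = x_pow (- word_weight (seg 0 (plength \<beta>))))"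
proof (cases \<beta>)
  case (PSet B)
  then have "B \<in> gsets G" using assms by simp
  then show ?thesis using PSet
    by (intro bexI[of _ "fp B"]) (auto simp: lgen_cos act_fp x_pow_0 fp_F)
next
  case (PEdges es)
  then have es: "edge_path G es" using assms by simp
  have "act (st es) \<delta> q = 0 \<or>
    q = (\<lambda>i. edg (length es + i)) \<and> act (st es) \<delta> q = x_pow (- word_weight (seg 0 (length es)))"
    if q: "q \<in> tails" for q
  proof (cases "act (st es) \<delta> q = 0")
    case False
    then have "cat es q \<in> tails" using act_st_nonzero q by blast
    then have eq: "act (st es) \<delta> q = x_pow (- word_weight es) * \<delta> (cat es q)" by (rule act_st)
    then have "\<delta> (cat es q) \<noteq> 0" using False by auto
    then have ce: "cat es q = edg" by presburger
    then have "es = seg 0 (length es)" "\<And>i. q i = edg (length es + i)" using cat_edg by auto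
    then show ?thesis using eq ce by (auto simp: fun_eq_iff)
  qed simp
  then show ?thesis using s_path_star_cos[OF es] PEdges by (intro bexI[of _ "st es"]) auto
qed

text \<open>A nonzero diagonal entry at \<open>edg\<close> comes from words whose lengths differ by
  full turns, and their number is the exponent. If \<open>n\<close> is no multiple of
  \<open>m\<close>, the entry is \<open>0\<close> and the exponent \<open>n div int m\<close> is
  arbitrary.\<close>

lemma homogeneous_entry:
  assumes "Z \<in> homogeneous G n"
  shows "\<exists>z\<in>F. Z = cos z \<and> (\<exists>k. act z \<delta> edg = Poly_Mapping.single (n div int m) k)"
  using assms unfolding homogeneous_def
proof (induction Z rule: alg_span.induct)
  case zero
  then show ?case using fcar_0
    by (intro bexI[of _ 0]) (auto simp: leavitt_zero act_0 intro!: exI[of _ 0])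
next
  case (add_smult Z W k)
  then obtain z k0 where z: "z \<in> F" "Z = cos z" "act z \<delta> edg = Poly_Mapping.single (n div int m) k0" by blast
  obtain \<alpha> A \<beta> where W: "W = s_path G \<alpha> \<otimes>\<^bsub>leavitt G\<^esub> lp G A \<otimes>\<^bsub>leavitt G\<^esub> s_path_star G \<beta>"
    "is_path G \<alpha>" "is_path G \<beta>" "A \<in> gsets G" "int (plength \<alpha>) - int (plength \<beta>) = n"
    using add_smult by blast
  obtain a where a: "a \<in> F" "s_path G \<alpha> = cos a" "\<And>\<psi> :: _ \<Rightarrow> 'k laurent. act a \<psi> edg = 0 \<or>
    act a \<psi> edg = x_pow (word_weight (seg 0 (plength \<alpha>))) * \<psi> (\<lambda>i. edg (plength \<alpha> + i))"
    using s_path_entry[OF W(2)] by blast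
  obtain b where b: "b \<in> F" "s_path_star G \<beta> = cos b" "\<And>q. q \<in> tails \<Longrightarrow> act b \<delta> q = 0 \<or>
    q = (\<lambda>i. edg (plength \<beta> + i)) \<and> act b \<delta> q = x_pow (- word_weight (seg 0 (plength \<beta>)))"
    using s_path_star_entry[OF W(3)] by blast
  let ?w = "a * fp A * b" and ?r = "\<lambda>i. edg (plength \<alpha> + i)"
  have "act ?w \<delta> edg = 0 \<or> act ?w \<delta> edg = x_pow (n div int m)"
  proof (rule disjCI)
    let ?\<psi> = "act (fp A) (act b \<delta>)"
    assume ne: "act ?w \<delta> edg \<noteq> x_pow (n div int m)"
    show "act ?w \<delta> edg = 0"
    proof (rule ccontr)
      assume nz: "act ?w \<delta> edg \<noteq> 0"
      have w: "act ?w \<delta> edg = act a ?\<psi> edg" by (simp add: act_mult)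
      then have eq: "act ?w \<delta> edg = x_pow (word_weight (seg 0 (plength \<alpha>))) * ?\<psi> ?r"
        using a(3)[of ?\<psi>] nz by auto
      then have "?\<psi> ?r \<noteq> 0" using nz by auto
      then have r: "?r \<in> tails" "?\<psi> ?r = act b \<delta> ?r" "act b \<delta> ?r \<noteq> 0" by (auto simp: act_fp split: if_splits)
      then have b': "?r = (\<lambda>i. edg (plength \<beta> + i))"
        "act b \<delta> ?r = x_pow (- word_weight (seg 0 (plength \<beta>)))" using b(3)[OF r(1)] by auto
      have "edg (plength \<alpha>) = edg (plength \<beta>)" using fun_cong[OF b'(1), of 0] by simp
      then have "vx (plength \<alpha>) = vx (plength \<beta>)" by (simp add: vx_def)
      then have "n = (word_weight (seg 0 (plength \<alpha>)) - word_weight (seg 0 (plength \<beta>))) * int m"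
        using word_weight_diff W(5) by metis
      then have "n div int m = word_weight (seg 0 (plength \<alpha>)) - word_weight (seg 0 (plength \<beta>))"
        using m_pos by simp
      then have "act ?w \<delta> edg = x_pow (n div int m)"
        unfolding eq r(2) b'(2) by (simp add: x_pow_mult)
      then show False using ne by blast
    qed
  qed
  then have "\<exists>k'. act (z + fK k * ?w) \<delta> edg = Poly_Mapping.single (n div int m) k'"
    using z(3) by (auto simp: act_add act_mult act_fK mult_single single_add[symmetric])
  moreover have "Z \<oplus>\<^bsub>leavitt G\<^esub> (k \<odot>\<^bsub>leavitt G\<^esub> W) = cos (z + fK k * ?w)"
    using W(4) by (simp add: W(1) z(2) a b lgen_cos leavitt_mult fcar_mult fp_F leavitt_smult leavitt_add)
  moreover have "z + fK k * ?w \<in> F"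
    using z a b W(4) by (intro fcar_add fcar_K fcar_mult fp_F)
  ultimately show ?case by blast
qed

text \<open>Entries of homogeneous elements at \<open>c\<^sup>\<infinity>\<close> are monomials, hence those in \<open>Q\<close> vanish.\<close>

lemma R_not_graded:
  assumes "f \<in> Q" "f \<noteq> 0"
  shows "\<not> graded_ideal G R"
proof
  assume gr: "graded_ideal G R"
  have "cos (cycle_element f) \<in> R"
    using ev_R_iff assms(1) laurent_at_cycle_in by (simp add: laurent_at_cycle_cos)
  then obtain S y where y: "finite S" "\<And>n. n \<in> S \<Longrightarrow> y n \<in> R \<inter> homogeneous G n"
    "cos (cycle_element f) = (\<Oplus>\<^bsub>leavitt G\<^esub>n\<in>S. y n)"
    using gr unfolding graded_ideal_def by meson
  have "\<exists>z k. z \<in> F \<and> (n \<in> S \<longrightarrow> y n = cos z \<and> act z \<delta> edg = Poly_Mapping.single (n div int m) k)" for n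
    using homogeneous_entry[of "y n" n] y(2)[of n] fcar_0 by (cases "n \<in> S") blast+
  then obtain z k where z: "\<And>n. z n \<in> F"
    "\<And>n. n \<in> S \<Longrightarrow> y n = cos (z n)" "\<And>n. n \<in> S \<Longrightarrow> act (z n) \<delta> edg = Poly_Mapping.single (n div int m) (k n)"
    by metis
  have "act (z n) \<delta> edg = 0" if n: "n \<in> S" for n
  proof (rule ccontr)
    assume "act (z n) \<delta> edg \<noteq> 0"
    then have k: "k n \<noteq> 0" using z(3)[OF n] by auto
    have "cos (z n) \<in> R" using y(2)[OF n] z(2)[OF n] by simp
    then have "act (z n) \<delta> edg \<in> Q" using cos_R[OF z(1)] by blast
    \<comment> \<open>A nonzero monomial is a unit, which the proper ideal \<open>Q\<close> cannot
      contain.\<close>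
    then have "Poly_Mapping.single (- (n div int m)) (inverse (k n)) * Poly_Mapping.single (n div int m) (k n) \<in> Q"
      unfolding z(3)[OF n] by (rule Q_mult)
    then show False using k Q_one by (simp add: mult_single)
  qed
  then have "act (sum z S) \<delta> edg = 0" by (simp add: act_sum)
  moreover have "(\<Oplus>\<^bsub>leavitt G\<^esub>n\<in>S. y n) = (\<Oplus>\<^bsub>leavitt G\<^esub>n\<in>S. cos (z n))"
    by (intro abelian_monoid.finsum_cong'[OF abelian_group.axioms(1)[OF leavitt_abelian]])
      (auto simp: z leavitt_carrier)
  then have "cos (cycle_element f) = cos (sum z S)"
    unfolding y(3) using leavitt_finsum[of S z, OF z(1)] by simp
  then have "act (cycle_element f) \<delta> edg = act (sum z S) \<delta> edg" by (rule act_cos)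
  ultimately show False using assms(2) by (simp add: act_cycle_element)
qed

end


section \<open>The correspondence\<close>

lemma laurent_ring_simps [simp]: "carrier laurent_ring = UNIV" "monoid.mult laurent_ring = (*)"
  "ring.add laurent_ring = (+)" "ring.zero laurent_ring = 0" "monoid.one laurent_ring = 1"
  by (simp_all add: laurent_ring_def ring_of_type_algebra_def fun_eq_iff)

lemma PIdl_laurent: "PIdl\<^bsub>laurent_ring\<^esub> f = {g. f dvd g}"
  by (auto simp: cgenideal_def dvd_def mult.commute)

lemma Spec_laurent:
  "Q \<in> Spec (laurent_ring :: 'k::field laurent ring) \<longleftrightarrow> 0 \<in> Q \<and> (\<forall>g\<in>Q. \<forall>h\<in>Q. g + h \<in> Q) \<and>
    (\<forall>g\<in>Q. \<forall>h. h * g \<in> Q) \<and> 1 \<notin> Q \<and> (\<forall>g h. g * h \<in> Q \<longrightarrow> g \<in> Q \<or> h \<in> Q)" (is "_ \<longleftrightarrow> ?r")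
proof
  assume "Q \<in> Spec (laurent_ring :: 'k laurent ring)"
  then interpret primeideal Q "laurent_ring :: 'k laurent ring" by (simp add: Spec_def)
  show ?r
    using additive_subgroup.zero_closed[OF is_additive_subgroup] additive_subgroup.a_closed[OF is_additive_subgroup]
      I_l_closed one_imp_carrier I_notcarr I_prime by auto
next
  assume r: ?r
  interpret cring "laurent_ring :: 'k laurent ring" unfolding laurent_ring_def by (rule cring_from_type_algebra)
  have minus: "\<ominus>\<^bsub>laurent_ring\<^esub> g = - g" for g :: "'k laurent"
    by (rule minus_equality) simp_all
  have "- g \<in> Q" if "g \<in> Q" for g
    using r that mult_minus1[of g] by metis
  then have "m_inv (add_monoid laurent_ring) g \<in> Q" if "g \<in> Q" for g
    using that minus[of g] by (simp only: a_inv_def)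
  then have sub: "subgroup Q (add_monoid laurent_ring)"
    using r by (intro subgroup.intro) auto
  have "primeideal Q (laurent_ring :: 'k laurent ring)"
  proof (rule primeidealI)
    show "ideal Q (laurent_ring :: 'k laurent ring)"
      using r sub by (intro idealI ring_axioms) (auto simp: mult.commute)
  qed (use r in \<open>auto intro: is_cring\<close>)
  then show "Q \<in> Spec (laurent_ring :: 'k laurent ring)" by (simp add: Spec_def)
qed

context nice_quotient
begin

lemma nice_quotient_rotate: "nice_quotient G P (rotate k c)"
  by (intro nice_quotient.intro quotient_ideal_axioms nice_rotate)

definition cycle_ideal_of :: "'k laurent set" where "cycle_ideal_of = {g. ev g \<in> pre P}"

lemma ev_iff_dvd: "cycle_ideal_of = {g. f dvd g} \<Longrightarrow> ev g \<in> pre P \<longleftrightarrow> f dvd g"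
proof -
  assume "cycle_ideal_of = {g. f dvd g}"
  then have "g \<in> cycle_ideal_of \<longleftrightarrow> g \<in> {g. f dvd g}" by (rule arg_cong)
  then show ?thesis unfolding cycle_ideal_of_def mem_Collect_eq .
qed

lemma cycle_ideal_of_rotate: "nice_quotient.cycle_ideal_of G P (rotate k c) = cycle_ideal_of"
proof -
  interpret N: nice_quotient G P "rotate k c" by (rule nice_quotient_rotate)
  \<comment> \<open>The rotation leading back to \<open>c\<close>; it supplies the converse
    inclusion.\<close>
  obtain k' where k': "rotate k' (rotate k c) = c"
    using cycle_class_rotate[of k c] unfolding cycle_class_def
    by (smt (verit) mem_Collect_eq rotate0 id_apply)
  have "ev g \<in> pre P" if "N.ev g \<in> pre P" for g
    using N.ev_rotate[OF that, of k'] by (simp only: k')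
  then show ?thesis
    using ev_rotate[of _ k] unfolding cycle_ideal_of_def N.cycle_ideal_of_def by blast
qed

lemma cycle_ideal_of_prime:
  assumes "alg_prime_ideal (leavitt G) P" "cycle_ideal_of \<noteq> {0}"
  shows "cycle_ideal_of \<in> Spec laurent_ring"
    and "\<exists>f. Factorial_Ring.irreducible f \<and> cycle_ideal_of = {g. f dvd g}"
proof -
  interpret L: leavitt_prime G "fK :: 'k \<Rightarrow> _" "\<lambda>A. fp A" "\<lambda>e. fs e" "\<lambda>e. fstar e" "pre P"
    by (rule prime_locale[OF assms(1)])
  have 0: "0 \<in> cycle_ideal_of" by (simp add: cycle_ideal_of_def ev_0 P_zero)
  have add: "g + h \<in> cycle_ideal_of" if "g \<in> cycle_ideal_of" "h \<in> cycle_ideal_of" for g h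
    using that by (simp add: cycle_ideal_of_def ev_add P_add)
  have mult: "h * g \<in> cycle_ideal_of" if "g \<in> cycle_ideal_of" for g h
    using that cg_P[OF ev_mult[of h g]] P_left by (simp add: cycle_ideal_of_def)
  have one: "1 \<notin> cycle_ideal_of" using one_notin by (simp add: cycle_ideal_of_def)
  have prime: "g \<in> cycle_ideal_of \<or> h \<in> cycle_ideal_of" if "g * h \<in> cycle_ideal_of" for g h
    using that L.ev_prime[OF nice_ideal_axioms] by (simp add: cycle_ideal_of_def)
  show "cycle_ideal_of \<in> Spec laurent_ring" unfolding Spec_laurent using 0 add mult one prime by blast
  obtain g0 where "g0 \<in> cycle_ideal_of" "g0 \<noteq> 0" using assms(2) 0 by blast
  then obtain f where "Factorial_Ring.irreducible f" "\<And>g. g \<in> cycle_ideal_of \<longleftrightarrow> f dvd g"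
    using laurent_prime_generator[OF 0 add mult _ _ one prime] by blast
  then show "\<exists>f. Factorial_Ring.irreducible f \<and> cycle_ideal_of = {g. f dvd g}" by blast
qed

text \<open>Existence is \<open>generated\<close>. For uniqueness, \<open>M\<close> determines the
  cycle up to rotation, and a competing \<open>h\<close> is a multiple of \<open>f\<close>; being
  irreducible it is an associate, so both generate the same ideal.\<close>

lemma pair_of_iff:
  assumes P: "alg_prime_ideal (leavitt G) P" "cycle_ideal_of \<noteq> {0}"
  shows "pair_of G P y \<longleftrightarrow> y = (cycle_class c, cycle_ideal_of)"
proof
  obtain f where f: "Factorial_Ring.irreducible f" "cycle_ideal_of = {g. f dvd g}"
    using cycle_ideal_of_prime(2)[OF P] by blast
  have "ev f \<in> pre P" "\<And>g. ev g \<in> pre P \<Longrightarrow> f dvd g" by (simp_all add: ev_iff_dvd[OF f(2)])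
  then have "P = alg_ideal_gen (leavitt G) (generators f)" by (rule generated)
  then have "cycle_polynomial_of G P c f"
    using exclusive f(1) verts_minus_dead unfolding cycle_polynomial_of_def H_of_eq generators_def M_def by blast
  then show "y = (cycle_class c, cycle_ideal_of) \<Longrightarrow> pair_of G P y"
    unfolding pair_of_def PIdl_laurent f(2) by blast
next
  assume "pair_of G P y"
  then obtain d h where d: "exclusive_cycle G d" "verts G - \<Union>(H_of G P) = M_set G (base G d)"
    and h: "Factorial_Ring.irreducible h" and y: "y = (cycle_class d, {g. h dvd g})"
    and gen: "P = alg_ideal_gen (leavitt G)
           (lp G ` H_of G P \<union> lp_breaking G (H_of G P) ` breaking G (H_of G P) \<union> {laurent_at_cycle G h d})"
    unfolding pair_of_def cycle_polynomial_of_def PIdl_laurent by blast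
  have "M_set G (base G c) = M_set G (base G d)"
    using d(2) verts_minus_dead unfolding H_of_eq M_def by simp
  then obtain k where k: "d = rotate k c"
    by (rule exclusive_same_M_set[OF ultragraph_axioms exclusive d(1)]) (rule that)
  interpret N: nice_quotient G P d unfolding k by (rule nice_quotient_rotate)
  have "laurent_at_cycle G h d \<in> P"
    by (subst gen, rule subsetD[OF leavitt.alg_ideal_gen_subset]) simp
  then have hN: "h \<in> N.cycle_ideal_of" by (simp add: N.laurent_at_cycle_in N.cycle_ideal_of_def)
  have N: "N.cycle_ideal_of = cycle_ideal_of" unfolding k by (rule cycle_ideal_of_rotate)
  obtain f where f: "Factorial_Ring.irreducible f" "cycle_ideal_of = {g. f dvd g}"
    using cycle_ideal_of_prime(2)[OF P] by blast
  then have "f dvd h" using hN N by simp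
  then obtain r where r: "h = f * r" by (rule dvdE)
  then have "r dvd 1" using irreducibleD[OF h r] irreducible_not_unit[OF f(1)] by blast
  then obtain r' where r': "1 = r * r'" by (rule dvdE)
  have "f = f * (r * r')" by (simp flip: r')
  then have "f = h * r'" unfolding r by (simp only: mult.assoc)
  then have "h dvd f" by (rule dvdI)
  then have "{g. h dvd g} = cycle_ideal_of" using f(2) \<open>f dvd h\<close> dvd_trans by blast
  then show "y = (cycle_class c, cycle_ideal_of)"
    using y by (simp add: k cycle_class_rotate)
qed

end

context ultragraph
begin

text \<open>The condition on \<open>cycle_ideal_of\<close> is the form in which non-gradedness is
  used from here on: some nonzero polynomial evaluates into the ideal.\<close>

lemma nongraded_prime_nice:
  fixes P :: "('v, 'e, 'k::field) lpa set"
  assumes "P \<in> nongraded_primes G"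
  shows "\<exists>c. nice_quotient G P c \<and> nice_quotient.cycle_ideal_of G P c \<noteq> {0}"
proof -
  have P: "alg_prime_ideal (leavitt G) P" "\<not> graded_ideal G P" using assms by (auto simp: nongraded_primes_def)
  interpret quotient_ideal G P using P(1) by unfold_locales (simp add: alg_prime_ideal_def)
  interpret L: leavitt_prime G "fK :: 'k \<Rightarrow> _" "\<lambda>A. fp A" "\<lambda>e. fs e" "\<lambda>e. fstar e" "pre P"
    by (rule prime_locale[OF P(1)])
  obtain S y n where y: "homogeneous_sum S y" "n \<in> S" "y n \<notin> pre P"
    by (rule not_graded_homogeneous_sum[OF P(2)]) (rule that)
  obtain c where c: "nice_ideal G (fK :: 'k \<Rightarrow> _) (\<lambda>A. fp A) (\<lambda>e. fs e) (\<lambda>e. fstar e) (pre P) c"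
    "linked_to (fp {base G c})"
    using L.exists_nice_cycle[OF y] by blast
  interpret N: nice_quotient G P c by (intro nice_quotient.intro quotient_ideal_axioms c(1))
  obtain g where "g \<noteq> 0" "N.ev g \<in> pre P"
    by (rule N.linked_ev) (use c(2) N.base_eq in \<open>auto intro: that\<close>)
  then have "N.cycle_ideal_of \<noteq> {0}" by (auto simp: N.cycle_ideal_of_def)
  then show ?thesis using N.nice_quotient_axioms by blast
qed

end

theorem corollary3p9:
  fixes G :: "('v, 'e) ultragraph"
  assumes "ultragraph G"
  shows "(\<forall>P \<in> (nongraded_primes G :: ('v, 'e, 'k::field) lpa set set). \<exists>!y. pair_of G P y) \<and>
    bij_betw (\<lambda>P. THE y. pair_of G P y)
      (nongraded_primes G :: ('v, 'e, 'k) lpa set set)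
      (exclusive_cycle_classes G \<times> (Spec (laurent_ring :: 'k laurent ring) - {{0}}))"
proof -
  interpret ultragraph G by (rule assms)
  let ?NP = "nongraded_primes G :: ('v, 'e, 'k) lpa set set"
  have pair: "pair_of G P y \<longleftrightarrow> y = (cycle_class c, nice_quotient.cycle_ideal_of G P c)"
    if "P \<in> ?NP" "nice_quotient G P c" "nice_quotient.cycle_ideal_of G P c \<noteq> {0}" for P c y
    using nice_quotient.pair_of_iff[OF that(2) _ that(3)] that(1) by (simp add: nongraded_primes_def)
  have the_pair: "(THE y. pair_of G P y) = (cycle_class c, nice_quotient.cycle_ideal_of G P c)"
    if "P \<in> ?NP" "nice_quotient G P c" "nice_quotient.cycle_ideal_of G P c \<noteq> {0}" for P c
    unfolding pair[OF that] by simp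
  have "\<exists>!y. pair_of G P y" if "P \<in> ?NP" for P
    using nongraded_prime_nice[OF that] pair[OF that] by metis
  moreover have "inj_on (\<lambda>P. THE y. pair_of G P y) ?NP"
  proof (rule inj_onI)
    fix P P' assume P: "P \<in> ?NP" "P' \<in> ?NP" and eq: "(THE y. pair_of G P y) = (THE y. pair_of G P' y)"
    obtain c where c: "nice_quotient G P c" "nice_quotient.cycle_ideal_of G P c \<noteq> {0}"
      using nongraded_prime_nice[OF P(1)] by blast
    obtain d where d: "nice_quotient G P' d" "nice_quotient.cycle_ideal_of G P' d \<noteq> {0}"
      using nongraded_prime_nice[OF P(2)] by blast
    have cd: "cycle_class c = cycle_class d"
      "nice_quotient.cycle_ideal_of G P c = nice_quotient.cycle_ideal_of G P' d"
      using eq the_pair[OF P(1) c] the_pair[OF P(2) d] by simp_all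
    have "d = rotate 0 d" by simp
    then have "d \<in> cycle_class d" unfolding cycle_class_def by blast
    then obtain k where k: "d = rotate k c" using cd(1) unfolding cycle_class_def by blast
    \<comment> \<open>Both ideals are now referred to the same representative of the class.\<close>
    interpret N: nice_quotient G P d
      unfolding k by (rule nice_quotient.nice_quotient_rotate[OF c(1)])
    interpret N': nice_quotient G P' d by (rule d(1))
    have I: "N.cycle_ideal_of = N'.cycle_ideal_of"
      using cd(2) nice_quotient.cycle_ideal_of_rotate[OF c(1), of k] by (simp add: k)
    have "alg_prime_ideal (leavitt G) P'" using P(2) by (simp add: nongraded_primes_def)
    then obtain f where f: "N'.cycle_ideal_of = {g. f dvd g}"
      using N'.cycle_ideal_of_prime(2) d(2) by blast
    \<comment> \<open>The set \<open>generators f\<close> depends on the cycle and \<open>f\<close>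
      but not on the ideal, so both ideals are generated by the same set.\<close>
    have "P = alg_ideal_gen (leavitt G) (N.generators f)"
      by (rule N.generated) (simp_all add: N.ev_iff_dvd[OF I[unfolded f]])
    moreover have "P' = alg_ideal_gen (leavitt G) (N'.generators f)"
      by (rule N'.generated) (simp_all add: N'.ev_iff_dvd[OF f])
    ultimately show "P = P'" by simp
  qed
  moreover have "(\<lambda>P. THE y. pair_of G P y) ` ?NP =
    exclusive_cycle_classes G \<times> (Spec (laurent_ring :: 'k laurent ring) - {{0}})"
  proof (intro equalityI subsetI)
    fix y assume "y \<in> (\<lambda>P. THE y. pair_of G P y) ` ?NP"
    then obtain P where P: "P \<in> ?NP" "y = (THE y. pair_of G P y)" by blast
    obtain c where c: "nice_quotient G P c" "nice_quotient.cycle_ideal_of G P c \<noteq> {0}"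
      using nongraded_prime_nice[OF P(1)] by blast
    interpret N: nice_quotient G P c by (rule c(1))
    have "N.cycle_ideal_of \<in> Spec laurent_ring"
      using N.cycle_ideal_of_prime(1) P(1) c(2) by (simp add: nongraded_primes_def)
    then show "y \<in> exclusive_cycle_classes G \<times> (Spec (laurent_ring :: 'k laurent ring) - {{0}})"
      using the_pair[OF P(1) c] P(2) c(2) N.exclusive by (auto simp: exclusive_cycle_classes_def)
  next
    fix y assume "y \<in> exclusive_cycle_classes G \<times> (Spec (laurent_ring :: 'k laurent ring) - {{0}})"
    then obtain c and Q :: "'k laurent set" where y: "y = (cycle_class c, Q)" "exclusive_cycle G c"
      "Q \<in> Spec laurent_ring" "Q \<noteq> {0}" by (auto simp: exclusive_cycle_classes_def)
    have Q: "0 \<in> Q" "\<And>g h. g \<in> Q \<Longrightarrow> h \<in> Q \<Longrightarrow> g + h \<in> Q" "\<And>g h. g \<in> Q \<Longrightarrow> h * g \<in> Q" "1 \<notin> Q"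
      "\<And>g h. g * h \<in> Q \<Longrightarrow> g \<in> Q \<or> h \<in> Q" using y(3) unfolding Spec_laurent by blast+
    interpret C: cycle_representation G c Q
      using y(2) Q by unfold_locales (auto simp: exclusive_cycle_def)
    obtain f where "f \<in> Q" "f \<noteq> 0" using Q(1) y(4) by blast
    then have R: "C.R \<in> ?NP" using C.R_prime C.R_not_graded by (simp add: nongraded_primes_def)
    have "C.cycle_ideal_of = Q" by (simp add: C.cycle_ideal_of_def C.ev_R_iff)
    then have "(THE y. pair_of G C.R y) = y"
      using the_pair[OF R C.nice_quotient_axioms] y(1,4) by simp
    then show "y \<in> (\<lambda>P. THE y. pair_of G P y) ` ?NP" using R by (metis imageI)
  qed
  ultimately show ?thesis by (simp add: bij_betw_def)
qed

end
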